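(* Let $V$ be a MOSVA and $W$ a $V$-bimodule, both satisfying the pole-order condition, and let $m,n\in\mathbb Z_+$. (1) Let $u_1,u_2\in V$ and $f\in\widetilde W_{z_3,\dots,z_{n+2}}$ be such that $Y_W^L(u_1,z_1)Y_W^{s(R)}(u_2,z_2)f(z_3,\dots,z_{n+2})$ converges absolutely to a $\overline W$-valued rational function for every $(z_1,\dots,z_{n+2})\in F_{n+2}\mathbb C$ with $|z_1|>|z_2|>|z_i|$, $i=3,\dots,n+2$. Then the series $Y_W^{s(R)}(u_2,z_2)Y_W^L(u_1,z_1)f(z_3,\dots,z_{n+2})$ also converges absolutely to the same $\overline W$-valued rational function for every $(z_1,\dots,z_{n+2})\in F_{n+2}\mathbb C$ with $|z_2|>|z_1|>|z_i|$, $i=3,\dots,n+2$. Moreover $$E(Y_W^L(u_1,z_1)Y_W^{s(R)}(u_2,z_2)f(z_3,\dots,z_{n+2}))=E(Y_W^{s(R)}(u_2,z_2)Y_W^L(u_1,z_1)f(z_3,\dots,z_{n+2}))$$ in $\widetilde W_{z_1,\dots,z_{n+2}}$. (2) Let $u_1,\dots,u_m\in V$ and $f\in\widetilde W_{z_{m+1},\dots,z_{m+n}}$ be such that $Y_W^L(u_1,z_1)\cdots Y_W^L(u_m,z_m)f(z_{m+1},\dots,z_{m+n})$ converges absolutely to a $\overline W$-valued rational function for every $(z_1,\dots,z_{m+n})\in F_{m+n}\mathbb C$ with $|z_1|>\cdots>|z_m|>|z_i|$, $i=m+1,\dots,m+n$. Then the series $Y_W^L(Y_V(u_1,z_1-\zeta)\cdots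 Y_V(u_m,z_m-\zeta)\mathbf 1,\zeta)f(z_{m+1},\dots,z_{m+n})$ also converges absolutely to the same $\overline W$-valued rational function whenever $(z_1,\dots,z_{m+n})\in F_{m+n}\mathbb C$, $|\zeta|>|z_1-\zeta|+|z_i|$ for $i=m+1,\dots,m+n$, and $|z_1-\zeta|>\cdots>|z_m-\zeta|$. Moreover $$E(Y_W^L(u_1,z_1)\cdots Y_W^L(u_m,z_m)f(z_{m+1},\dots,z_{m+n}))=E(Y_W^L(Y_V(u_1,z_1-\zeta)\cdots Y_V(u_m,z_m-\zeta)\mathbf 1,\zeta)f(z_{m+1},\dots,z_{m+n}))$$ in $\widetilde W_{z_1,\dots,z_{m+n}}$. (3) Let $u_1,\dots,u_m\in V$ and $f\in\widetilde W_{z_{m+1},\dots,z_{m+n}}$ be such that $Y_W^{s(R)}(u_m,z_m)\cdots Y_W^{s(R)}(u_1,z_1)f(z_{m+1},\dots,z_{m+n})$ converges absolutely to a $\overline W$-valued rational function for every $(z_1,\dots,z_{m+n})\in F_{m+n}\mathbb C$ with $|z_m|>\cdots>|z_1|>|z_i|$, $i=m+1,\dots,m+n$. Then the series $Y_W^{s(R)}(Y_V(u_1,z_1-\zeta)\cdots Y_V(u_m,z_m-\zeta)\mathbf 1,\zeta)f(z_{m+1},\dots,z_{m+n})$ also converges absolutely to the same $\overline W$-valued rational function whenever $(z_1,\dots,z_{m+n})\in F_{m+n}\mathbb C$, $|\zeta|>|z_1-\zeta|+|z_i|$ for $i=m+1,\dots,m+n$, and $|z_1-\zeta|>\cdots>|z_m-\zeta|$.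 Moreover $$E(Y_W^{s(R)}(u_m,z_m)\cdots Y_W^{s(R)}(u_1,z_1)f(z_{m+1},\dots,z_{m+n}))=E(Y_W^{s(R)}(Y_V(u_1,z_1-\zeta)\cdots Y_V(u_m,z_m-\zeta)\mathbf 1,\zeta)f(z_{m+1},\dots,z_{m+n}))$$ in $\widetilde W_{z_1,\dots,z_{m+n}}$.
   Context: All vector spaces are over $\mathbb{C}$; $\mathbb{Z}_+=\{1,2,\dots\}$. **MOSVA.** A meromorphic open-string vertex algebra (MOSVA) is a $\mathbb{Z}$-graded space $V=\coprod_{n\in\mathbb Z}V_{(n)}$, $V_{(n)}=0$ for $n$ sufficiently negative, with a linear map $Y_V:V\otimes V\to V[[x,x^{-1}]]$, $Y_V(u,x)v=\sum_{k\in\mathbb Z}(Y_V)_k(u)v\,x^{-k-1}$, and $\mathbf 1\in V$ such that, with $\mathbf d_Vv=nv$ for $v\in V_{(n)}$, $D_Vv=\lim_{x\to0}\frac{d}{dx}Y_V(v,x)\mathbf 1$ and $V'=\coprod V_{(n)}^*$: (i) $[\mathbf d_V,Y_V(v,x)]=x\frac{d}{dx}Y_V(v,x)+Y_V(\mathbf d_Vv,x)$; (ii) $Y_V(\mathbf 1,x)=1_V$, $Y_V(u,x)\mathbf 1\in V[[x]]$ with constant term $u$; (iii) $\frac{d}{dx}Y_V(v,x)=Y_V(D_Vv,x)=[D_V,Y_V(v,x)]$; (iv) $\langle v',Y_V(u_1,z_1)\cdots Y_V(u_n,z_n)v\rangle$ converges absolutely for $|z_1|>\cdots>|z_n|>0$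 to a rational function with only possible poles $z_i=0$, $z_i=z_j$, and $\langle v',Y_V(Y_V(u_1,z_1-z_2)u_2,z_2)v\rangle$ converges absolutely for $|z_2|>|z_1-z_2|>0$ to a rational function with only possible poles $z_1=0,z_2=0,z_1=z_2$; (v) $\langle v',Y_V(u_1,z_1)Y_V(u_2,z_2)v\rangle=\langle v',Y_V(Y_V(u_1,z_1-z_2)u_2,z_2)v\rangle$ for $|z_1|>|z_2|>|z_1-z_2|>0$. **Bimodules.** A $V$-bimodule is a $\mathbb C$-graded space $W=\coprod_{m\in\mathbb C}W_{[m]}$, $W_{[m]}=0$ for $\mathrm{Re}\,m$ sufficiently negative, with $\mathbf d_Ww=mw$ for $w\in W_{[m]}$, an operator $D_W$ of weight $1$, and linear maps $Y_W^L:V\otimes W\to W[[x,x^{-1}]]$, $Y_W^R:W\otimes V\to W[[x,x^{-1}]]$ such that, with $W'=\coprod W_{[m]}^*$: Left module axioms: $[\mathbf d_W,Y_W^L(u,x)]=Y_W^L(\mathbf d_Vu,x)+x\frac{d}{dx}Y_W^L(u,x)$; $Y_W^L(\mathbf 1,x)=1_W$; $\frac{d}{dx}Y_W^L(u,x)=Y_W^L(D_Vu,x)=[D_W,Y_W^L(u,x)]$; the analogues of (iv), (v) for $\langle w',Y^L_W(u_1,z_1)\cdots Y^L_W(u_n,z_n)w\rangle$ and $\langle w',Y_W^L(Y_V(u_1,z_1-z_2)u_2,z_2)w\rangle$. Right module axioms: $\mathbf d_WY_W^R(w,x)-Y_W^R(w,x)\mathbf d_V=Y_W^R(\mathbf d_Ww,x)+x\frac{d}{dx}Y_W^R(w,x)$;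 $Y_W^R(w,x)\mathbf 1\in W[[x]]$ with constant term $w$; $\frac{d}{dx}Y_W^R(w,x)=Y_W^R(D_Ww,x)=D_WY_W^R(w,x)-Y_W^R(w,x)D_V$; the analogues of (iv), (v) for $\langle w',Y_W^R(w,z_1)Y_V(u_1,z_2)\cdots Y_V(u_{n-1},z_n)u_n\rangle$ and $\langle w',Y_W^R(Y_W^R(w,z_1-z_2)u_1,z_2)u_2\rangle$. Compatibility: $\langle w',Y_W^L(u_1,z_1)\cdots Y_W^L(u_n,z_n)Y_W^R(w,z_{n+1})Y_V(u_{n+1},z_{n+2})\cdots Y_V(u_{n+m-1},z_{n+m})u_{n+m}\rangle$ converges absolutely for $|z_1|>\cdots>|z_{n+m}|>0$ to a rational function; and $\langle w',Y_W^L(u,z_1)Y_W^R(w,z_2)v\rangle$ (for $|z_1|>|z_2|>0$) and $\langle w',Y_W^R(Y_W^L(u,z_1-z_2)w,z_2)v\rangle$ (for $|z_2|>|z_1-z_2|>0$) converge absolutely to a common rational function with only possible poles $z_1=0,z_2=0,z_1=z_2$. Put $Y_W^{s(R)}(v,x)w=e^{xD_W}Y_W^R(w,-x)v$. Write $Y_W^L(v,x)=\sum_k(Y_W^L)_k(v)x^{-k-1}$ and similarly for $Y_W^{s(R)}$. **Pole-order condition.** $V$ satisfies it if for all $u_1,v\in V$ there is $C$ such that for all $v'\in V',u_2\in V$ the pole $z_1=0$ of the rational function of $\langle v',Y_V(u_1,z_1)Y_V(u_2,z_2)v\rangle$ has order $<C$. $W$ satisfies it if the order of the pole $z_1=0$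 is bounded for the rational functions of: $\langle w',Y_W^L(u_1,z_1)Y_W^L(u_2,z_2)w\rangle$ (bound depending only on $u_1,w$); $\langle w',Y_W^R(w,z_1)Y_V(u_1,z_2)u_2\rangle$ (only on $u_2,w$); $\langle w',Y_W^L(u_1,z_1)Y_W^R(w,z_2)u_2\rangle$ (only on $u_1,u_2$). **$\overline W$-valued rational functions.** $\overline W=\prod_mW_{[m]}$, paired with $W'$; finite sums of homogeneous operators on $W$ (such as $(Y_W^L)_k(v)$, $(Y_W^{s(R)})_k(v)$) act on $\overline W$ componentwise. $F_n\mathbb C=\{(z_1,\dots,z_n)\in\mathbb C^n:z_i\ne z_j\ (i\neq j)\}$. $\widetilde W_{z_1,\dots,z_n}$ is the space of $\overline W$-valued rational functions, i.e. maps $f:F_n\mathbb C\to\overline W$ such that (1) for each $w'\in W'$, $\langle w',f(z_1,\dots,z_n)\rangle$ is a rational function with only possible poles $z_i=z_j$; (2) there are integers $p_{ij}$ and $g\in W[[x_1,\dots,x_n]]$ with $\prod_{i<j}(z_i-z_j)^{p_{ij}}\langle w',f(z_1,\dots,z_n)\rangle=\langle w',g(z_1,\dots,z_n)\rangle$ as polynomial functions, for all $w'$. **Series.** Expressions such as $Y_W^L(u_1,z_1)Y_W^{s(R)}(u_2,z_2)f(\cdots)$ denote the multiple series $\sum_{k_1,k_2}(Y_W^L)_{k_1}(u_1)(Y_W^{s(R)})_{k_2}(u_2)f(\cdots)z_1^{-k_1-1}z_2^{-k_2-1}$ of elements of $\overline W$; similarly $Y_W^L(Y_V(u_1,z_1-\zeta)\cdots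 Y_V(u_m,z_m-\zeta)\mathbf 1,\zeta)f(\cdots)$ is the multiple series in powers of $z_1-\zeta,\dots,z_m-\zeta,\zeta$ with coefficients $(Y_W^L)_{k}((Y_V)_{k_1}(u_1)\cdots(Y_V)_{k_m}(u_m)\mathbf 1)f(\cdots)$. Such a series converges absolutely if it does so after pairing with every $w'\in W'$. If its sum extends to a $\overline W$-valued rational function, $E(\cdot)$ denotes that function. *)

theory Defs
  imports "HOL-Analysis.Analysis"
begin

section \<open>Rational functions and Laurent series in several variables\<close>

text \<open>
  A point of \<open>\<complex>\<^sup>n\<close> is a list of length \<open>n\<close>; the variable written \<open>z\<^sub>i\<close> on paper is
  \<open>z ! (i - 1)\<close>. Multi-indices are lists as well.
\<close>

definition polynomial_fun :: "nat \<Rightarrow> (complex list \<Rightarrow> complex) \<Rightarrow> bool" where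
  "polynomial_fun n P \<longleftrightarrow> (\<exists>S c. finite S \<and> S \<subseteq> {a :: nat list. length a = n} \<and>
     (\<forall>z. length z = n \<longrightarrow> P z = (\<Sum>a\<in>S. c a * prod_list (map2 (^) z a))))"

definition config :: "nat \<Rightarrow> complex list set" where
  "config n = {z. length z = n \<and> distinct z}"

definition diag_prod :: "nat \<Rightarrow> (nat \<Rightarrow> nat \<Rightarrow> int) \<Rightarrow> complex list \<Rightarrow> complex" where
  "diag_prod n p z = (\<Prod>(i, j)\<in>{(i, j). i < j \<and> j < n}. (z ! i - z ! j) powi p i j)"

definition rational_diag :: "nat \<Rightarrow> (complex list \<Rightarrow> complex) \<Rightarrow> bool" where
  "rational_diag n R \<longleftrightarrow> (\<exists>P p. polynomial_fun n P \<and>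
     (\<forall>z\<in>config n. R z = P z / diag_prod n p z))"

text \<open>Possible poles at \<open>z\<^sub>i = 0\<close> and at \<open>z\<^sub>i = z\<^sub>j\<close>.\<close>

definition rational_diag0 :: "nat \<Rightarrow> (complex list \<Rightarrow> complex) \<Rightarrow> bool" where
  "rational_diag0 n R \<longleftrightarrow> (\<exists>P p (q :: nat \<Rightarrow> int). polynomial_fun n P \<and>
     (\<forall>z\<in>config n. 0 \<notin> set z \<longrightarrow>
        R z = P z / ((\<Prod>i<n. (z ! i) powi q i) * diag_prod n p z)))"

definition rational_on :: "nat \<Rightarrow> complex list set \<Rightarrow> (complex list \<Rightarrow> complex) \<Rightarrow> bool" where
  "rational_on n D R \<longleftrightarrow> (\<exists>P Q. polynomial_fun n P \<and> polynomial_fun n Q \<and>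
     (\<forall>z\<in>D. Q z \<noteq> 0 \<and> R z = P z / Q z))"

text \<open>
  Order of the pole \<open>z\<^sub>1 = 0\<close> of a rational function of two variables with possible poles
  \<open>z\<^sub>1 = 0\<close>, \<open>z\<^sub>2 = 0\<close>, \<open>z\<^sub>1 = z\<^sub>2\<close>; it is \<open>0\<close> if there is no pole.
\<close>

definition pole_order :: "(complex list \<Rightarrow> complex) \<Rightarrow> nat" where
  "pole_order R = (LEAST a. \<exists>P b c. polynomial_fun 2 P \<and>
     (\<forall>z1 z2. z1 \<noteq> 0 \<and> z2 \<noteq> 0 \<and> z1 \<noteq> z2 \<longrightarrow>
        R [z1, z2] = P [z1, z2] / (z1 ^ a * z2 ^ b * (z1 - z2) ^ c)))"

text \<open>
  Absolute convergence, with sum \<open>s\<close>, of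
  \<open>\<Sum> a [k\<^sub>1, \<dots>, k\<^sub>n] * x\<^sub>1 powi (- k\<^sub>1 - 1) * \<dots> * x\<^sub>n powi (- k\<^sub>n - 1)\<close>
  over all integers \<open>k\<^sub>1, \<dots>, k\<^sub>n\<close>, where \<open>n\<close> is the length of \<open>x\<close>.
\<close>

definition laurent_sums :: "(int list \<Rightarrow> complex) \<Rightarrow> complex list \<Rightarrow> complex \<Rightarrow> bool" where
  "laurent_sums a x s \<longleftrightarrow>
     (let t = (\<lambda>k. a k * prod_list (map2 (\<lambda>y l. y powi (- l - 1)) x k));
          I = {k. length k = length x}
      in (\<lambda>k. cmod (t k)) summable_on I \<and> (t has_sum s) I)"

text \<open>The region \<open>|z\<^sub>1| > \<dots> > |z\<^sub>n| > 0\<close>.\<close>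

definition radial :: "nat \<Rightarrow> complex list set" where
  "radial n = {z. length z = n \<and> sorted_wrt (>) (map cmod z @ [0])}"

definition prod_expands :: "nat \<Rightarrow> (int list \<Rightarrow> complex) \<Rightarrow> (complex list \<Rightarrow> complex) \<Rightarrow> bool" where
  "prod_expands n a R \<longleftrightarrow> (\<forall>z\<in>radial n. laurent_sums a z (R z))"

text \<open>For iterates, \<open>b\<close> is a family of coefficients of a series in powers of \<open>z\<^sub>1 - z\<^sub>2\<close> and \<open>z\<^sub>2\<close>.\<close>

definition iter_expands :: "(int list \<Rightarrow> complex) \<Rightarrow> (complex list \<Rightarrow> complex) \<Rightarrow> bool" where
  "iter_expands b R \<longleftrightarrow> (\<forall>z1 z2. cmod z2 > cmod (z1 - z2) \<and> cmod (z1 - z2) > 0 \<longrightarrow>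
     laurent_sums b [z1 - z2, z2] (R [z1, z2]))"

definition prod_rational :: "nat \<Rightarrow> (int list \<Rightarrow> complex) \<Rightarrow> bool" where
  "prod_rational n a \<longleftrightarrow> (\<exists>R. rational_diag0 n R \<and> prod_expands n a R)"

definition iter_rational :: "(int list \<Rightarrow> complex) \<Rightarrow> bool" where
  "iter_rational b \<longleftrightarrow> (\<exists>R. rational_diag0 2 R \<and> iter_expands b R)"

definition prod_eq_iter :: "(int list \<Rightarrow> complex) \<Rightarrow> (int list \<Rightarrow> complex) \<Rightarrow> bool" where
  "prod_eq_iter a b \<longleftrightarrow>
     (\<forall>z1 z2. cmod z1 > cmod z2 \<and> cmod z2 > cmod (z1 - z2) \<and> cmod (z1 - z2) > 0 \<longrightarrow>
        (\<exists>s. laurent_sums a [z1, z2] s \<and> laurent_sums b [z1 - z2, z2] s))"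

definition pole_order_bounded :: "nat \<Rightarrow> (int list \<Rightarrow> complex) \<Rightarrow> bool" where
  "pole_order_bounded C a \<longleftrightarrow>
     (\<forall>R. rational_diag0 2 R \<and> prod_expands 2 a R \<longrightarrow> pole_order R < C)"


section \<open>Graded vector spaces\<close>

definition is_decomp :: "('i \<Rightarrow> 'a set) \<Rightarrow> 'a::ab_group_add \<Rightarrow> ('i \<Rightarrow> 'a) \<Rightarrow> bool" where
  "is_decomp G x c \<longleftrightarrow>
     (\<forall>i. c i \<in> G i) \<and> finite {i. c i \<noteq> 0} \<and> x = (\<Sum>i | c i \<noteq> 0. c i)"

locale graded_space = vector_space scale
  for scale :: "complex \<Rightarrow> 'a::ab_group_add \<Rightarrow> 'a" +
  fixes G :: "'i \<Rightarrow> 'a set"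
  assumes subspace_G: "subspace (G i)"
    and direct_sum: "\<exists>!c. is_decomp G x c"

definition component :: "('i \<Rightarrow> 'a set) \<Rightarrow> 'i \<Rightarrow> 'a::ab_group_add \<Rightarrow> 'a" where
  "component G i x = (THE c. is_decomp G x c) i"

text \<open>The operator acting on \<open>G i\<close> as multiplication by \<open>wt i\<close>.\<close>

definition grading_op ::
  "(complex \<Rightarrow> 'a \<Rightarrow> 'a) \<Rightarrow> ('i \<Rightarrow> 'a set) \<Rightarrow> ('i \<Rightarrow> complex) \<Rightarrow> 'a::ab_group_add \<Rightarrow> 'a" where
  "grading_op s G wt x = (\<Sum>i | component G i x \<noteq> 0. s (wt i) (component G i x))"

text \<open>
  The coproduct of the duals of the \<open>G i\<close>, realised as the linear functionals on the whole space
  that vanish on all but finitely many \<open>G i\<close>.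
\<close>

definition graded_dual ::
  "(complex \<Rightarrow> 'a \<Rightarrow> 'a) \<Rightarrow> ('i \<Rightarrow> 'a set) \<Rightarrow> ('a::ab_group_add \<Rightarrow> complex) set" where
  "graded_dual s G = {\<phi>. Vector_Spaces.linear s (*) \<phi> \<and> finite {i. \<exists>x\<in>G i. \<phi> x \<noteq> 0}}"

definition completion :: "('i \<Rightarrow> 'a set) \<Rightarrow> ('i \<Rightarrow> 'a) set" where
  "completion G = {w. \<forall>i. w i \<in> G i}"

definition pairing ::
  "('i \<Rightarrow> 'a set) \<Rightarrow> ('a \<Rightarrow> complex) \<Rightarrow> ('i \<Rightarrow> 'a) \<Rightarrow> complex" where
  "pairing G \<phi> w = (\<Sum>i | \<exists>x\<in>G i. \<phi> x \<noteq> 0. \<phi> (w i))"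

text \<open>
  Componentwise action on the completion of a finite sum of homogeneous operators; for such \<open>T\<close>
  only finitely many \<open>w j\<close> contribute to the component of index \<open>i\<close>.
\<close>

definition hat :: "('i \<Rightarrow> 'a set) \<Rightarrow> ('a::ab_group_add \<Rightarrow> 'a) \<Rightarrow> ('i \<Rightarrow> 'a) \<Rightarrow> 'i \<Rightarrow> 'a" where
  "hat G T w i = (\<Sum>j | component G i (T (w j)) \<noteq> 0. component G i (T (w j)))"


section \<open>Meromorphic open-string vertex algebras and bimodules\<close>

text \<open>
  A vertex operator map is given by its modes: \<open>Y u k v\<close> is the coefficient of \<open>x powi (- k - 1)\<close>
  in \<open>Y(u, x) v\<close>. Identities of formal series are stated coefficientwise; thus the coefficient of
  \<open>x powi (- k - 1)\<close> in \<open>d/dx Y(u, x)\<close> is \<open>- k\<close> times the mode \<open>k - 1\<close>, and in \<open>x d/dx Y(u, x)\<close> it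
  is \<open>- k - 1\<close> times the mode \<open>k\<close>.

  \<open>modes Y [u\<^sub>1, \<dots>, u\<^sub>n] [k\<^sub>1, \<dots>, k\<^sub>n] x = Y u\<^sub>1 k\<^sub>1 (\<dots> (Y u\<^sub>n k\<^sub>n x))\<close>.
\<close>

definition modes :: "('u \<Rightarrow> int \<Rightarrow> 'a \<Rightarrow> 'a) \<Rightarrow> 'u list \<Rightarrow> int list \<Rightarrow> 'a \<Rightarrow> 'a" where
  "modes Y us k x = foldr (\<lambda>(u, l). Y u l) (zip us k) x"

text \<open>\<open>D\<^sub>V v\<close>: the constant term of \<open>d/dx Y\<^sub>V(v, x) \<one>\<close> is the coefficient of \<open>x\<close> in \<open>Y\<^sub>V(v, x) \<one>\<close>.\<close>

definition D_op :: "('v \<Rightarrow> int \<Rightarrow> 'v \<Rightarrow> 'v) \<Rightarrow> 'v \<Rightarrow> 'v \<Rightarrow> 'v" where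
  "D_op Y vac v = Y v (- 2) vac"

locale mosva = V: graded_space sV VG
  for sV :: "complex \<Rightarrow> 'v::ab_group_add \<Rightarrow> 'v" and VG :: "int \<Rightarrow> 'v set" +
  fixes YV :: "'v \<Rightarrow> int \<Rightarrow> 'v \<Rightarrow> 'v" and vac :: 'v
  assumes V_lower_bounded: "\<exists>N. \<forall>n<N. VG n = {0}"
    and YV_linear_right: "Vector_Spaces.linear sV sV (YV u k)"
    and YV_linear_left: "Vector_Spaces.linear sV sV (\<lambda>u. YV u k v)"
    and YV_d_commutator:
      "grading_op sV VG of_int (YV u k v) - YV u k (grading_op sV VG of_int v) =
         sV (of_int (- k - 1)) (YV u k v) + YV (grading_op sV VG of_int u) k v"
    and YV_identity: "YV vac k v = (if k = - 1 then v else 0)"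
    and YV_creation: "k \<ge> 0 \<Longrightarrow> YV u k vac = 0" "YV u (- 1) vac = u"
    and YV_D_derivative: "YV (D_op YV vac u) k v = sV (of_int (- k)) (YV u (k - 1) v)"
    and YV_D_commutator:
      "D_op YV vac (YV u k v) - YV u k (D_op YV vac v) = sV (of_int (- k)) (YV u (k - 1) v)"
    and YV_rationality_product:
      "\<phi> \<in> graded_dual sV VG \<Longrightarrow> prod_rational (length us) (\<lambda>k. \<phi> (modes YV us k v))"
    and YV_rationality_iterate:
      "\<phi> \<in> graded_dual sV VG \<Longrightarrow> iter_rational (\<lambda>k. \<phi> (YV (YV u1 (k ! 0) u2) (k ! 1) v))"
    and YV_associativity:
      "\<phi> \<in> graded_dual sV VG \<Longrightarrow>
         prod_eq_iter (\<lambda>k. \<phi> (modes YV [u1, u2] k v)) (\<lambda>k. \<phi> (YV (YV u1 (k ! 0) u2) (k ! 1) v))"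

locale mosva_bimodule = mosva sV VG YV vac + W: graded_space sW WG
  for sV :: "complex \<Rightarrow> 'v::ab_group_add \<Rightarrow> 'v" and VG :: "int \<Rightarrow> 'v set"
    and YV :: "'v \<Rightarrow> int \<Rightarrow> 'v \<Rightarrow> 'v" and vac :: 'v
    and sW :: "complex \<Rightarrow> 'w::ab_group_add \<Rightarrow> 'w" and WG :: "complex \<Rightarrow> 'w set" +
  fixes DW :: "'w \<Rightarrow> 'w"
    and YL :: "'v \<Rightarrow> int \<Rightarrow> 'w \<Rightarrow> 'w"
    and YR :: "'w \<Rightarrow> int \<Rightarrow> 'v \<Rightarrow> 'w"
  assumes W_lower_bounded: "\<exists>N. \<forall>m. Re m < N \<longrightarrow> WG m = {0}"
    and DW_linear: "Vector_Spaces.linear sW sW DW"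
    and DW_weight: "w \<in> WG m \<Longrightarrow> DW w \<in> WG (m + 1)"
    and YL_linear_right: "Vector_Spaces.linear sW sW (YL u k)"
    and YL_linear_left: "Vector_Spaces.linear sV sW (\<lambda>u. YL u k w)"
    and YR_linear_right: "Vector_Spaces.linear sV sW (YR w k)"
    and YR_linear_left: "Vector_Spaces.linear sW sW (\<lambda>w. YR w k v)"
    \<comment> \<open>left module\<close>
    and YL_d_commutator:
      "grading_op sW WG (\<lambda>m. m) (YL u k w) - YL u k (grading_op sW WG (\<lambda>m. m) w) =
         YL (grading_op sV VG of_int u) k w + sW (of_int (- k - 1)) (YL u k w)"
    and YL_identity: "YL vac k w = (if k = - 1 then w else 0)"
    and YL_D_derivative: "YL (D_op YV vac u) k w = sW (of_int (- k)) (YL u (k - 1) w)"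
    and YL_D_commutator: "DW (YL u k w) - YL u k (DW w) = sW (of_int (- k)) (YL u (k - 1) w)"
    and YL_rationality_product:
      "\<psi> \<in> graded_dual sW WG \<Longrightarrow> prod_rational (length us) (\<lambda>k. \<psi> (modes YL us k w))"
    and YL_rationality_iterate:
      "\<psi> \<in> graded_dual sW WG \<Longrightarrow> iter_rational (\<lambda>k. \<psi> (YL (YV u1 (k ! 0) u2) (k ! 1) w))"
    and YL_associativity:
      "\<psi> \<in> graded_dual sW WG \<Longrightarrow>
         prod_eq_iter (\<lambda>k. \<psi> (modes YL [u1, u2] k w)) (\<lambda>k. \<psi> (YL (YV u1 (k ! 0) u2) (k ! 1) w))"
    \<comment> \<open>right module\<close>
    and YR_d_commutator:
      "grading_op sW WG (\<lambda>m. m) (YR w k v) - YR w k (grading_op sV VG of_int v) =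
         YR (grading_op sW WG (\<lambda>m. m) w) k v + sW (of_int (- k - 1)) (YR w k v)"
    and YR_creation: "k \<ge> 0 \<Longrightarrow> YR w k vac = 0" "YR w (- 1) vac = w"
    and YR_D_derivative: "YR (DW w) k v = sW (of_int (- k)) (YR w (k - 1) v)"
    and YR_D_commutator:
      "DW (YR w k v) - YR w k (D_op YV vac v) = sW (of_int (- k)) (YR w (k - 1) v)"
    and YR_rationality_product:
      "\<psi> \<in> graded_dual sW WG \<Longrightarrow>
         prod_rational (1 + length us) (\<lambda>k. \<psi> (YR w (hd k) (modes YV us (tl k) v)))"
    and YR_rationality_iterate:
      "\<psi> \<in> graded_dual sW WG \<Longrightarrow> iter_rational (\<lambda>k. \<psi> (YR (YR w (k ! 0) u1) (k ! 1) u2))"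
    and YR_associativity:
      "\<psi> \<in> graded_dual sW WG \<Longrightarrow>
         prod_eq_iter (\<lambda>k. \<psi> (YR w (k ! 0) (YV u1 (k ! 1) u2)))
           (\<lambda>k. \<psi> (YR (YR w (k ! 0) u1) (k ! 1) u2))"
    \<comment> \<open>compatibility\<close>
    and LR_rationality_product:
      "\<psi> \<in> graded_dual sW WG \<Longrightarrow> n = length us \<Longrightarrow> l = n + 1 + length vs \<Longrightarrow>
         \<exists>R. rational_on l (radial l) R \<and>
           prod_expands l (\<lambda>k. \<psi> (modes YL us (take n k)
             (YR w (k ! n) (modes YV vs (drop (n + 1) k) v)))) R"
    and LR_compatibility:
      "\<psi> \<in> graded_dual sW WG \<Longrightarrow>
         \<exists>R. rational_diag0 2 R \<and>
           prod_expands 2 (\<lambda>k. \<psi> (YL u (k ! 0) (YR w (k ! 1) v))) R \<and>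
           iter_expands (\<lambda>k. \<psi> (YR (YL u (k ! 0) w) (k ! 1) v)) R"

text \<open>
  Modes of \<open>Y\<^sup>s\<^sup>(\<^sup>R\<^sup>)(v, x) w = exp(x D\<^sub>W) Y\<^sup>R(w, - x) v\<close>; the sum is finite because
  \<open>YR w l v = 0\<close> for large \<open>l\<close>.
\<close>

definition skew ::
  "(complex \<Rightarrow> 'w \<Rightarrow> 'w) \<Rightarrow> ('w \<Rightarrow> 'w) \<Rightarrow> ('w \<Rightarrow> int \<Rightarrow> 'v \<Rightarrow> 'w) \<Rightarrow>
     'v \<Rightarrow> int \<Rightarrow> 'w::ab_group_add \<Rightarrow> 'w" where
  "skew s D Y v k w = (\<Sum>i | Y w (k + int i) v \<noteq> 0.
     s ((- 1) powi (- (k + int i) - 1) / fact i) ((D ^^ i) (Y w (k + int i) v)))"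

definition mosva_pole_order_condition ::
  "(complex \<Rightarrow> 'v \<Rightarrow> 'v) \<Rightarrow> (int \<Rightarrow> 'v set) \<Rightarrow> ('v::ab_group_add \<Rightarrow> int \<Rightarrow> 'v \<Rightarrow> 'v) \<Rightarrow> bool" where
  "mosva_pole_order_condition sV VG YV \<longleftrightarrow>
     (\<forall>u1 v. \<exists>C. \<forall>\<phi>\<in>graded_dual sV VG. \<forall>u2.
        pole_order_bounded C (\<lambda>k. \<phi> (YV u1 (k ! 0) (YV u2 (k ! 1) v))))"

definition bimodule_pole_order_condition ::
  "('v \<Rightarrow> int \<Rightarrow> 'v \<Rightarrow> 'v) \<Rightarrow> (complex \<Rightarrow> 'w \<Rightarrow> 'w) \<Rightarrow> (complex \<Rightarrow> 'w set) \<Rightarrow>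
     ('v \<Rightarrow> int \<Rightarrow> 'w \<Rightarrow> 'w) \<Rightarrow> ('w::ab_group_add \<Rightarrow> int \<Rightarrow> 'v \<Rightarrow> 'w) \<Rightarrow> bool" where
  "bimodule_pole_order_condition YV sW WG YL YR \<longleftrightarrow>
     (\<forall>u1 w. \<exists>C. \<forall>\<psi>\<in>graded_dual sW WG. \<forall>u2.
        pole_order_bounded C (\<lambda>k. \<psi> (YL u1 (k ! 0) (YL u2 (k ! 1) w)))) \<and>
     (\<forall>u2 w. \<exists>C. \<forall>\<psi>\<in>graded_dual sW WG. \<forall>u1.
        pole_order_bounded C (\<lambda>k. \<psi> (YR w (k ! 0) (YV u1 (k ! 1) u2)))) \<and>
     (\<forall>u1 u2. \<exists>C. \<forall>\<psi>\<in>graded_dual sW WG. \<forall>w.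
        pole_order_bounded C (\<lambda>k. \<psi> (YL u1 (k ! 0) (YR w (k ! 1) u2))))"


section \<open>Rational functions and series with values in the completion\<close>

text \<open>
  \<open>g\<close> is a formal power series with coefficients in \<open>W\<close> whose pairing with each \<open>\<psi>\<close> has only finitely
  many nonzero coefficients. Functions are extensional, so that two of them are equal as soon as
  they agree on the configuration space.
\<close>

definition wtilde ::
  "(complex \<Rightarrow> 'w \<Rightarrow> 'w) \<Rightarrow> ('i \<Rightarrow> 'w::ab_group_add set) \<Rightarrow> nat \<Rightarrow> (complex list \<Rightarrow> 'i \<Rightarrow> 'w) set"
where
  "wtilde s G n = {f \<in> config n \<rightarrow>\<^sub>E completion G.
     (\<forall>\<psi>\<in>graded_dual s G. rational_diag n (\<lambda>z. pairing G \<psi> (f z))) \<and>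
     (\<exists>p (g :: nat list \<Rightarrow> 'w). \<forall>\<psi>\<in>graded_dual s G.
        finite {a. length a = n \<and> \<psi> (g a) \<noteq> 0} \<and>
        (\<forall>z\<in>config n. diag_prod n p z * pairing G \<psi> (f z) =
           (\<Sum>a | length a = n \<and> \<psi> (g a) \<noteq> 0. \<psi> (g a) * prod_list (map2 (^) z a))))}"

text \<open>
  A series with values in the completion is encoded by the set of its instances
  \<open>(z, x, c)\<close>, one for each choice of parameters in the region under consideration: \<open>z\<close> is the point
  of the configuration space, \<open>x\<close> lists the values of the expansion variables, and \<open>c k\<close> is the
  coefficient of the product of the \<open>x\<^sub>i powi (- k\<^sub>i - 1)\<close>.
\<close>

type_synonym ('i, 'w) wseries = "(complex list \<times> complex list \<times> (int list \<Rightarrow> 'i \<Rightarrow> 'w)) set"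

definition converges_to_rational ::
  "(complex \<Rightarrow> 'w \<Rightarrow> 'w) \<Rightarrow> ('i \<Rightarrow> 'w::ab_group_add set) \<Rightarrow> nat \<Rightarrow> ('i, 'w) wseries \<Rightarrow>
     (complex list \<Rightarrow> 'i \<Rightarrow> 'w) \<Rightarrow> bool" where
  "converges_to_rational s G n S F \<longleftrightarrow> F \<in> wtilde s G n \<and>
     (\<forall>(z, x, c)\<in>S. \<forall>\<psi>\<in>graded_dual s G.
        laurent_sums (\<lambda>k. pairing G \<psi> (c k)) x (pairing G \<psi> (F z)))"

definition E ::
  "(complex \<Rightarrow> 'w \<Rightarrow> 'w) \<Rightarrow> ('i \<Rightarrow> 'w::ab_group_add set) \<Rightarrow> nat \<Rightarrow> ('i, 'w) wseries \<Rightarrow>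
     complex list \<Rightarrow> 'i \<Rightarrow> 'w" where
  "E s G n S = (THE F. converges_to_rational s G n S F)"

text \<open>
  The series \<open>A\<^sub>1(x\<^sub>1) \<dots> A\<^sub>m(x\<^sub>m) f(y\<^sub>1, \<dots>, y\<^sub>n)\<close> in the region \<open>|x\<^sub>1| > \<dots> > |x\<^sub>m| > |y\<^sub>i|\<close>. The
  variables of the resulting function are \<open>x\<close> reordered by \<open>ord\<close> (\<open>\<lambda>x. x\<close> or \<open>rev\<close>), followed
  by \<open>y\<close>.
\<close>

definition product_series ::
  "('i \<Rightarrow> 'w::ab_group_add set) \<Rightarrow> nat \<Rightarrow> (complex list \<Rightarrow> complex list) \<Rightarrow>
     (int \<Rightarrow> 'w \<Rightarrow> 'w) list \<Rightarrow> (complex list \<Rightarrow> 'i \<Rightarrow> 'w) \<Rightarrow> ('i, 'w) wseries" where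
  "product_series G n ord As f =
     {(ord x @ y, x, \<lambda>k. modes (\<lambda>A l. hat G (A l)) As k (f y)) | x y.
        length x = length As \<and> length y = n \<and> distinct (x @ y) \<and>
        (\<forall>t\<in>set y. sorted_wrt (>) (map cmod (x @ [t])))}"

text \<open>
  The series \<open>Y\<^sub>W(Y\<^sub>V(u\<^sub>1, x\<^sub>1 - \<zeta>) \<dots> Y\<^sub>V(u\<^sub>m, x\<^sub>m - \<zeta>) \<one>, \<zeta>) f(y\<^sub>1, \<dots>, y\<^sub>n)\<close> in the region
  \<open>|\<zeta>| > |x\<^sub>1 - \<zeta>| + |y\<^sub>i|\<close>, \<open>|x\<^sub>1 - \<zeta>| > \<dots> > |x\<^sub>m - \<zeta>|\<close>.
\<close>

definition iterate_series ::
  "('i \<Rightarrow> 'w::ab_group_add set) \<Rightarrow> nat \<Rightarrow> ('v \<Rightarrow> int \<Rightarrow> 'v \<Rightarrow> 'v) \<Rightarrow> 'v \<Rightarrow>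
     ('v \<Rightarrow> int \<Rightarrow> 'w \<Rightarrow> 'w) \<Rightarrow> 'v list \<Rightarrow> (complex list \<Rightarrow> 'i \<Rightarrow> 'w) \<Rightarrow> ('i, 'w) wseries" where
  "iterate_series G n YV vac YW us f =
     {(x @ y, map (\<lambda>t. t - \<zeta>) x @ [\<zeta>],
       \<lambda>k. hat G (YW (modes YV us (butlast k) vac) (last k)) (f y)) | x y \<zeta>.
        length x = length us \<and> length y = n \<and> distinct (x @ y) \<and>
        (\<forall>t\<in>set y. cmod \<zeta> > cmod (hd x - \<zeta>) + cmod t) \<and>
        sorted_wrt (>) (map (\<lambda>t. cmod (t - \<zeta>)) x)}"

end

(* Fix a functional and the variables of f. The product series converges to F, so multiplying its
   coefficients by the factors z_i - z_j and z_i - y_l of the denominator of F yields, by uniqueness of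
   Laurent coefficients on a torus, the coefficients of a polynomial. Coefficients of a fixed total
   degree involve only finitely many homogeneous components of f. On a line of such coefficients the
   two-fold associativity (or commutativity) of vertex operators says that the two expansions agree
   after multiplication by a power of the linear factors. This relation is preserved by
   multiplication by polynomials, and it determines the second expansion from the first as soon as the
   first is a polynomial. Hence the variables z_m, ..., z_1 can be replaced one at a time by
   zeta + t_i, and the coefficients of the iterate multiplied by the same factors are those of the
   same polynomial. In the region of the theorem every factor has a dominant term, so it can be
   inverted by a Neumann series in a weighted l^1 norm, which gives absolute convergence to F.
   The opposite operators Y^{s(R)} satisfy the same associativity because exp(x D) acts on the graded
   dual by polynomials in x. *)

theory Submission
  imports Defs "HOL-Computational_Algebra.Polynomial"
begin

section \<open>Polynomials as operators, and the transport of linear relations along them\<close>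

section \<open>Polynomial expressions acting on coefficient families\<close>

text \<open>The power of the linear factors relating two expansions depends on the functional and on
  the component of f, and no bound uniform in the total degree is available. Hence no single
  multiple of the product family can be compared with a multiple of the iterate. What restores
  uniformity is that the denominator of F is fixed: after multiplication by it the first family is
  polynomial on every line, and the unknown power then cancels, because polynomials act injectively
  on families with modes bounded above. That bound comes from the lower truncation of the gradings.
  Polynomials are kept as expressions because one denominator has to act in many ways: on points, on
  product families, on iterates where a variable means \<zeta> + t_i, and on families altered by
  translations and signs. A relation compatible with linear combinations and with the variables
  passes to all of them. In the region of the theorem z_m - \<zeta> may be zero. The creation
  property leaves only nonnegative powers of it, and this has to be carried along whenever a series
  is evaluated.\<close>

datatype pexp = Var nat | Con complex | Add pexp pexp | Mul pexp pexp

primrec peval :: "(nat \<Rightarrow> complex) \<Rightarrow> pexp \<Rightarrow> complex" where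
  "peval x (Var i) = x i"
| "peval x (Con c) = c"
| "peval x (Add p q) = peval x p + peval x q"
| "peval x (Mul p q) = peval x p * peval x q"

text \<open>\<open>Mul\<close> becomes composition, and no commutation between the operators
  \<open>v i\<close> is presupposed.\<close>

primrec opr :: "(nat \<Rightarrow> ('k \<Rightarrow> complex) \<Rightarrow> 'k \<Rightarrow> complex) \<Rightarrow> pexp \<Rightarrow> ('k \<Rightarrow> complex) \<Rightarrow> 'k \<Rightarrow> complex" where
  "opr v (Var i) = v i"
| "opr v (Con c) = (\<lambda>A k. c * A k)"
| "opr v (Add p q) = (\<lambda>A k. opr v p A k + opr v q A k)"
| "opr v (Mul p q) = (\<lambda>A. opr v p (opr v q A))"

definition Sub :: "pexp \<Rightarrow> pexp \<Rightarrow> pexp" where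
  "Sub p q = Add p (Mul (Con (-1)) q)"

primrec ppow :: "pexp \<Rightarrow> nat \<Rightarrow> pexp" where
  "ppow p 0 = Con 1"
| "ppow p (Suc n) = Mul p (ppow p n)"

lemma peval_Sub [simp]: "peval x (Sub p q) = peval x p - peval x q"
  by (simp add: Sub_def)

lemma opr_Sub [simp]: "opr v (Sub p q) A = (\<lambda>k. opr v p A k - opr v q A k)"
  by (simp add: Sub_def fun_eq_iff)

lemma peval_ppow [simp]: "peval x (ppow p n) = peval x p ^ n"
  by (induction n) auto

lemma opr_ppow [simp]: "opr v (ppow p n) = (opr v p ^^ n)"
  proof (induction n)
  case (Suc n)
  then show ?case by (simp add: o_def)
qed (simp add: fun_eq_iff)

text \<open>Reduces every claim that something survives multiplication by a polynomial to the case
  of one variable. Its instances range over convergence at a point, equality on lists of one length,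
  intertwining by a map, and the pair relations between expansions.\<close>

lemma opr_rel:
  assumes add: "\<And>A B A' B'. R A B \<Longrightarrow> R A' B' \<Longrightarrow> R (\<lambda>k. A k + A' k) (\<lambda>k. B k + B' k)"
    and scal: "\<And>c A B. R A B \<Longrightarrow> R (\<lambda>k. c * A k) (\<lambda>k. c * B k)"
    and var: "\<And>i A B. R A B \<Longrightarrow> R (v i A) (w i B)"
    and "R A B"
  shows "R (opr v e A) (opr w e B)"
  using assms(4) by (induction e arbitrary: A B) (auto intro: add scal var)

lemma opr_pred:
  assumes "\<And>A A'. R A \<Longrightarrow> R A' \<Longrightarrow> R (\<lambda>k. A k + A' k)"
    and "\<And>c A. R A \<Longrightarrow> R (\<lambda>k. c * A k)"
    and "\<And>i A. R A \<Longrightarrow> R (v i A)"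
    and "R A"
  shows "R (opr v e A)"
  using opr_rel[of "\<lambda>A _. R A" v v A undefined e] assms by blast

lemma opr_add:
  assumes "\<And>i A B. v i (\<lambda>k. A k + B k) = (\<lambda>k. v i A k + v i B k)"
  shows "opr v e (\<lambda>k. A k + B k) = (\<lambda>k. opr v e A k + opr v e B k)"
proof (induction e arbitrary: A B)
  case (Mul p q)
  show ?case unfolding opr.simps by (simp only: Mul)
qed (auto simp: assms algebra_simps)

lemma opr_scale:
  assumes "\<And>i c A. v i (\<lambda>k. c * A k) = (\<lambda>k. c * v i A k)"
  shows "opr v e (\<lambda>k. c * A k) = (\<lambda>k. c * opr v e A k)"
proof (induction e arbitrary: A)
  case (Mul p q)
  show ?case unfolding opr.simps by (simp only: Mul)
qed (auto simp: assms algebra_simps)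

lemma opr_sum:
  assumes "\<And>i A B. v i (\<lambda>k. A k + B k) = (\<lambda>k. v i A k + v i B k)"
    and "\<And>i c A. v i (\<lambda>k. c * A k) = (\<lambda>k. c * v i A k)"
  shows "opr v e (\<lambda>k. \<Sum>i\<in>I. A i k) = (\<lambda>k. \<Sum>i\<in>I. opr v e (A i) k)"
proof (induction I rule: infinite_finite_induct)
  case (insert x F)
  then show ?case using opr_add[of v, OF assms(1)] by simp
qed (use opr_scale[of v, OF assms(2), of e 0 undefined] in auto)

lemma opr_comm:
  assumes "\<And>A B. O' (\<lambda>k. A k + B k) = (\<lambda>k. O' A k + O' B k)"
    and "\<And>c A. O' (\<lambda>k. c * A k) = (\<lambda>k. c * O' A k)"
    and "\<And>i A. v i (O' A) = O' (v i A)"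
  shows "opr v e (O' A) = O' (opr v e A)"
  using opr_rel[of "\<lambda>A B. B = O' A" v v A "O' A" e] assms by auto


section \<open>Multiplication by polynomials in one variable, and the comparison of two
  expansions\<close>

section \<open>Laurent families in one variable\<close>

text \<open>With \<alpha> read as the series \<Sum> \<alpha> k x^(-k-1), this is multiplication by
  \<open>p\<close>: a factor x^i moves the mode \<open>k + i\<close> to the mode
  \<open>k\<close>.\<close>

definition act :: "complex poly \<Rightarrow> (int \<Rightarrow> complex) \<Rightarrow> int \<Rightarrow> complex" where
  "act p \<alpha> k = (\<Sum>i\<le>degree p. coeff p i * \<alpha> (k + int i))"

text \<open>The polynomial \<open>L\<close> itself as such a series: x^j is the mode
  \<open>- j - 1\<close>, so nonnegative modes vanish.\<close>

definition iota :: "complex poly \<Rightarrow> int \<Rightarrow> complex" where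
  "iota L k = (if k < 0 then coeff L (nat (- k - 1)) else 0)"

lemma act_bound:
  assumes "degree p \<le> n"
  shows "act p \<alpha> k = (\<Sum>i\<le>n. coeff p i * \<alpha> (k + int i))"
  unfolding act_def using assms
  by (intro sum.mono_neutral_left) (auto simp: coeff_eq_0)

lemma act_pCons: "act (pCons a p) \<alpha> k = a * \<alpha> k + act p \<alpha> (k + 1)"
proof -
  have "act (pCons a p) \<alpha> k = (\<Sum>i\<le>Suc (degree p). coeff (pCons a p) i * \<alpha> (k + int i))"
    by (rule act_bound) (rule degree_pCons_le)
  then show ?thesis
    by (simp only: sum.atMost_Suc_shift) (simp add: act_def algebra_simps)
qed

lemma act_0 [simp]: "act 0 \<alpha> = (\<lambda>_. 0)"
  by (simp add: act_def fun_eq_iff)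

lemma act_add_left: "act (p + q) \<alpha> = (\<lambda>k. act p \<alpha> k + act q \<alpha> k)"
proof
  fix k
  let ?n = "max (degree p) (degree q)"
  show "act (p + q) \<alpha> k = act p \<alpha> k + act q \<alpha> k"
    by (simp add: act_bound[of _ ?n] degree_add_le_max algebra_simps sum.distrib)
qed

lemma act_add: "act p (\<lambda>k. \<alpha> k + \<beta> k) = (\<lambda>k. act p \<alpha> k + act p \<beta> k)"
  by (simp add: act_def fun_eq_iff algebra_simps sum.distrib)

lemma act_diff: "act p (\<lambda>k. \<alpha> k - \<beta> k) = (\<lambda>k. act p \<alpha> k - act p \<beta> k)"
  by (simp add: act_def fun_eq_iff algebra_simps sum_subtractf)

lemma act_smult: "act (smult c p) \<alpha> = (\<lambda>k. c * act p \<alpha> k)"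
  by (rule ext, subst act_bound[of _ "degree p"])
    (auto simp: act_def algebra_simps sum_distrib_left)

lemma act_mult: "act (p * q) \<alpha> = act p (act q \<alpha>)"
proof (induction p)
  case (pCons a p)
  show ?case
    by (rule ext) (simp add: act_add_left act_smult act_pCons pCons.IH)
qed auto

lemma act_1 [simp]: "act 1 \<alpha> = \<alpha>"
  by (simp add: act_def fun_eq_iff)

lemma act_linear: "act [:c, d:] \<alpha> = (\<lambda>k. c * \<alpha> k + d * \<alpha> (k + 1))"
  by (rule ext) (simp add: act_pCons)

lemma iota_pCons: "iota (pCons a p) k = a * iota 1 k + iota p (k + 1)"
proof (cases "k < -1")
  case True
  then have "nat (- k - 1) = Suc (nat (- (k + 1) - 1))" by simp
  then show ?thesis using True by (simp add: iota_def)
qed (auto simp: iota_def)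

lemma iota_add: "iota (p + q) = (\<lambda>k. iota p k + iota q k)"
  by (simp add: iota_def fun_eq_iff)

lemma iota_smult: "iota (smult c p) = (\<lambda>k. c * iota p k)"
  by (simp add: iota_def fun_eq_iff)

lemma act_iota: "act p (iota q) = iota (p * q)"
proof (induction p)
  case 0
  then show ?case by (simp add: iota_def fun_eq_iff)
next
  case (pCons a p)
  show ?case
    by (rule ext) (auto simp: act_pCons pCons.IH iota_add iota_smult iota_pCons[of 0 "p * q"])
qed

lemma iota_inj: "iota p = iota q \<Longrightarrow> p = q"
proof (rule poly_eqI)
  fix n assume "iota p = iota q"
  then have "iota p (- int n - 1) = iota q (- int n - 1)" by simp
  then show "coeff p n = coeff q n" by (simp add: iota_def)
qed

lemma iota_nonneg: "k \<ge> 0 \<Longrightarrow> iota p k = 0"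
  by (simp add: iota_def)

text \<open>Modes bounded above mean finitely many negative powers of x, and then the lowest term of
  \<open>p\<close> times the lowest term of the series cannot cancel. The bound is essential: \<Sum>
  x^n over all integers is killed by x - 1.\<close>

lemma act_inj:
  assumes "act p \<gamma> = (\<lambda>_. 0)" "p \<noteq> 0" "\<And>k. k \<ge> n0 \<Longrightarrow> \<gamma> k = 0"
  shows "\<gamma> k = 0"
proof (rule ccontr)
  assume "\<gamma> k \<noteq> 0"
  \<comment> \<open>The largest nonvanishing mode, found as the least distance below the bound
    \<open>n0\<close>.\<close>
  define K where "K = n0 - int (LEAST n. \<gamma> (n0 - int n) \<noteq> 0)"
  have ex: "\<exists>n. \<gamma> (n0 - int n) \<noteq> 0"
    using \<open>\<gamma> k \<noteq> 0\<close> assms(3)[of k] by (intro exI[of _ "nat (n0 - k)"]) force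
  then have K: "\<gamma> K \<noteq> 0" unfolding K_def by (rule LeastI_ex)
  have above: "\<gamma> l = 0" if "l > K" for l
  proof (cases "l \<ge> n0")
    case False
    then have "nat (n0 - l) < (LEAST n. \<gamma> (n0 - int n) \<noteq> 0)" using that unfolding K_def by linarith
    from not_less_Least[OF this] show ?thesis using False by simp
  qed (use assms(3) in auto)
  define i where "i = (LEAST i. coeff p i \<noteq> 0)"
  have i: "coeff p i \<noteq> 0"
    unfolding i_def by (rule LeastI_ex) (use assms(2) in \<open>auto simp: poly_eq_iff\<close>)
  have below: "coeff p j = 0" if "j < i" for j
    using not_less_Least[of j "\<lambda>i. coeff p i \<noteq> 0"] that unfolding i_def by auto
  have "act p \<gamma> (K - int i) = (\<Sum>j\<le>degree p. if j = i then coeff p i * \<gamma> K else 0)"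
    unfolding act_def
  proof (rule sum.cong)
    fix j assume "j \<in> {..degree p}"
    show "coeff p j * \<gamma> (K - int i + int j) = (if j = i then coeff p i * \<gamma> K else 0)"
      using below[of j] above[of "K - int i + int j"] by (cases i j rule: linorder_cases) auto
  qed simp
  also have "\<dots> = coeff p i * \<gamma> K"
    using le_degree[OF i] by (simp add: sum.delta)
  finally show False using assms(1) i K by simp
qed

definition bounded_modes :: "(int \<Rightarrow> complex) \<Rightarrow> bool" where
  "bounded_modes \<alpha> \<longleftrightarrow> (\<exists>n. \<forall>k\<ge>n. \<alpha> k = 0)"

lemma bounded_modesI: "(\<And>k. k \<ge> n \<Longrightarrow> \<alpha> k = 0) \<Longrightarrow> bounded_modes \<alpha>"
  unfolding bounded_modes_def by blast

lemma bounded_modes_add: "bounded_modes \<alpha> \<Longrightarrow> bounded_modes \<beta> \<Longrightarrow> bounded_modes (\<lambda>k. \<alpha> k + \<beta> k)"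
  unfolding bounded_modes_def
proof (elim exE)
  fix n m assume "\<forall>k\<ge>n. \<alpha> k = 0" "\<forall>k\<ge>m. \<beta> k = 0"
  then show "\<exists>n. \<forall>k\<ge>n. \<alpha> k + \<beta> k = 0" by (intro exI[of _ "max n m"]) auto
qed

lemma bounded_modes_act: "bounded_modes \<alpha> \<Longrightarrow> bounded_modes (act p \<alpha>)"
  unfolding bounded_modes_def act_def
proof (elim exE)
  fix n assume "\<forall>k\<ge>n. \<alpha> k = 0"
  then show "\<exists>n. \<forall>k\<ge>n. (\<Sum>i\<le>degree p. coeff p i * \<alpha> (k + int i)) = 0"
    by (intro exI[of _ n]) auto
qed

lemma bounded_modes_iota: "bounded_modes (iota p)"
  by (rule bounded_modesI[of 0]) (simp add: iota_nonneg)

lemma act_eq_imp_eq: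
  assumes "act p \<alpha> = act p \<beta>" "p \<noteq> 0" "bounded_modes \<alpha>" "bounded_modes \<beta>"
  shows "\<alpha> = \<beta>"
proof
  fix k
  from assms(3,4) obtain n m where nm: "\<forall>k\<ge>n. \<alpha> k = 0" "\<forall>k\<ge>m. \<beta> k = 0"
    unfolding bounded_modes_def by blast
  have "(\<lambda>k. \<alpha> k - \<beta> k) k = 0"
    by (rule act_inj[of p _ "max n m"]) (use assms nm in \<open>auto simp: act_diff\<close>)
  then show "\<alpha> k = \<beta> k" by simp
qed

text \<open>
  \<open>\<alpha>\<close> and \<open>\<beta>\<close> are expansions, in powers of \<open>x\<close> and of \<open>t = x - 1\<close>, of one rational function with
  possible poles at \<open>x = 0\<close> and \<open>x = 1\<close>.
\<close>

definition assoc_pair :: "(int \<Rightarrow> complex) \<Rightarrow> (int \<Rightarrow> complex) \<Rightarrow> bool" where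
  "assoc_pair \<alpha> \<beta> \<longleftrightarrow> bounded_modes \<beta> \<and>
     (\<exists>a c L. act ([:0, 1:] ^ a * [:-1, 1:] ^ c) \<alpha> = iota L \<and>
        act ([:1, 1:] ^ a * [:0, 1:] ^ c) \<beta> = iota (L \<circ>\<^sub>p [:1, 1:]))"

text \<open>The pole-free case, in which re-expansion under x = 1 + t is a substitution.\<close>

definition poly_pair :: "(int \<Rightarrow> complex) \<Rightarrow> (int \<Rightarrow> complex) \<Rightarrow> bool" where
  "poly_pair \<alpha> \<beta> \<longleftrightarrow> (\<exists>L. \<alpha> = iota L \<and> \<beta> = iota (L \<circ>\<^sub>p [:1, 1:]))"

text \<open>Weak commutativity in a dehomogenised variable: on families of fixed total degree x
  stands for z_1 / z_2, hence x - 1 for z_1 - z_2.\<close>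

definition comm_pair :: "(int \<Rightarrow> complex) \<Rightarrow> (int \<Rightarrow> complex) \<Rightarrow> bool" where
  "comm_pair \<alpha> \<beta> \<longleftrightarrow> bounded_modes \<beta> \<and> (\<exists>M. act ([:-1, 1:] ^ M) \<alpha> = act ([:-1, 1:] ^ M) \<beta>)"

lemma pcompose_power: "(p ^ n) \<circ>\<^sub>p q = (p \<circ>\<^sub>p q) ^ n" for p :: "complex poly"
  by (induction n) (auto simp: pcompose_mult pcompose_1)

lemma pcompose_denominator:
  "([:0, 1:] ^ a * [:-1, 1:] ^ c) \<circ>\<^sub>p [:1, 1:] = [:1, 1:] ^ a * [:0, 1::complex:] ^ c"
  by (simp add: pcompose_mult pcompose_power pcompose_pCons)

text \<open>Expansions with different pole orders can be added only over a common denominator;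
  enlarging the exponents multiplies \<open>L\<close> by the missing factors
  \<open>D\<close>.\<close>

lemma assoc_pair_raise:
  assumes "act ([:0, 1:] ^ a * [:-1, 1:] ^ c) \<alpha> = iota L"
    and "act ([:1, 1:] ^ a * [:0, 1:] ^ c) \<beta> = iota (L \<circ>\<^sub>p [:1, 1:])"
    and "a \<le> a'" "c \<le> c'"
  shows "\<exists>L'. act ([:0, 1:] ^ a' * [:-1, 1:] ^ c') \<alpha> = iota L' \<and>
           act ([:1, 1:] ^ a' * [:0, 1:] ^ c') \<beta> = iota (L' \<circ>\<^sub>p [:1, 1:])"
proof -
  define D where "D = [:0, 1::complex:] ^ (a' - a) * [:-1, 1:] ^ (c' - c)"
  have 1: "[:0, 1::complex:] ^ a' * [:-1, 1:] ^ c' = D * ([:0, 1:] ^ a * [:-1, 1:] ^ c)"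
  proof -
    have "a' = (a' - a) + a" "c' = (c' - c) + c" using assms(3,4) by auto
    then have "[:0, 1::complex:] ^ a' * [:-1, 1:] ^ c' = [:0, 1::complex:] ^ ((a' - a) + a) * [:-1, 1:] ^ ((c' - c) + c)"
      by simp
    then show ?thesis by (simp only: D_def power_add mult_ac)
  qed
  have 2: "[:1, 1::complex:] ^ a' * [:0, 1:] ^ c' = (D \<circ>\<^sub>p [:1, 1:]) * ([:1, 1:] ^ a * [:0, 1:] ^ c)"
    unfolding pcompose_denominator[symmetric] 1 pcompose_mult by simp
  show ?thesis
    unfolding 1 2 act_mult[of D] act_mult[of "D \<circ>\<^sub>p [:1, 1:]"] assms(1,2) act_iota
    by (intro exI[of _ "D * L"]) (simp add: pcompose_mult)
qed

lemma assoc_pair_add: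
  assumes "assoc_pair \<alpha> \<beta>" "assoc_pair \<alpha>' \<beta>'"
  shows "assoc_pair (\<lambda>k. \<alpha> k + \<alpha>' k) (\<lambda>k. \<beta> k + \<beta>' k)"
proof -
  from assms(1) obtain a c L where 1: "act ([:0, 1:] ^ a * [:-1, 1:] ^ c) \<alpha> = iota L"
    "act ([:1, 1:] ^ a * [:0, 1:] ^ c) \<beta> = iota (L \<circ>\<^sub>p [:1, 1:])" unfolding assoc_pair_def by blast
  from assms(2) obtain a' c' L' where 2: "act ([:0, 1:] ^ a' * [:-1, 1:] ^ c') \<alpha>' = iota L'"
    "act ([:1, 1:] ^ a' * [:0, 1:] ^ c') \<beta>' = iota (L' \<circ>\<^sub>p [:1, 1:])" unfolding assoc_pair_def by blast
  let ?a = "max a a'" and ?c = "max c c'"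
  from assoc_pair_raise[OF 1, of ?a ?c] obtain K where
    K: "act ([:0, 1:] ^ ?a * [:-1, 1:] ^ ?c) \<alpha> = iota K"
      "act ([:1, 1:] ^ ?a * [:0, 1:] ^ ?c) \<beta> = iota (K \<circ>\<^sub>p [:1, 1:])" by auto
  from assoc_pair_raise[OF 2, of ?a ?c] obtain K' where
    K': "act ([:0, 1:] ^ ?a * [:-1, 1:] ^ ?c) \<alpha>' = iota K'"
      "act ([:1, 1:] ^ ?a * [:0, 1:] ^ ?c) \<beta>' = iota (K' \<circ>\<^sub>p [:1, 1:])" by auto
  show ?thesis unfolding assoc_pair_def
  proof (intro conjI exI)
    show "bounded_modes (\<lambda>k. \<beta> k + \<beta>' k)"
      using assms unfolding assoc_pair_def by (blast intro: bounded_modes_add)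
    show "act ([:0, 1:] ^ ?a * [:-1, 1:] ^ ?c) (\<lambda>k. \<alpha> k + \<alpha>' k) = iota (K + K')"
      by (simp only: act_add K K' iota_add)
    show "act ([:1, 1:] ^ ?a * [:0, 1:] ^ ?c) (\<lambda>k. \<beta> k + \<beta>' k) = iota ((K + K') \<circ>\<^sub>p [:1, 1:])"
      by (simp only: act_add K K' iota_add pcompose_add)
  qed
qed

lemma assoc_pair_act:
  assumes "assoc_pair \<alpha> \<beta>"
  shows "assoc_pair (act p \<alpha>) (act (p \<circ>\<^sub>p [:1, 1:]) \<beta>)"
proof -
  from assms obtain a c L where 1: "act ([:0, 1:] ^ a * [:-1, 1:] ^ c) \<alpha> = iota L"
    "act ([:1, 1:] ^ a * [:0, 1:] ^ c) \<beta> = iota (L \<circ>\<^sub>p [:1, 1:])" unfolding assoc_pair_def by blast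
  show ?thesis unfolding assoc_pair_def
  proof (intro conjI exI)
    show "bounded_modes (act (p \<circ>\<^sub>p [:1, 1:]) \<beta>)"
      using assms unfolding assoc_pair_def by (blast intro: bounded_modes_act)
    show "act ([:0, 1:] ^ a * [:-1, 1:] ^ c) (act p \<alpha>) = iota (p * L)"
      unfolding act_iota[symmetric] 1(1)[symmetric] act_mult[symmetric] by (simp only: mult.commute)
    show "act ([:1, 1:] ^ a * [:0, 1:] ^ c) (act (p \<circ>\<^sub>p [:1, 1:]) \<beta>) = iota ((p * L) \<circ>\<^sub>p [:1, 1:])"
      unfolding pcompose_mult act_iota[symmetric] 1(2)[symmetric] act_mult[symmetric]
      by (simp only: mult.commute)
  qed
qed

lemma assoc_pair_scale: "assoc_pair \<alpha> \<beta> \<Longrightarrow> assoc_pair (\<lambda>k. c * \<alpha> k) (\<lambda>k. c * \<beta> k)"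
  using assoc_pair_act[of \<alpha> \<beta> "[:c:]"] by (simp add: pcompose_pCons act_pCons[abs_def])

lemma assoc_pair_x:
  "assoc_pair \<alpha> \<beta> \<Longrightarrow> assoc_pair (\<lambda>k. \<alpha> (k + 1)) (\<lambda>k. \<beta> k + \<beta> (k + 1))"
  using assoc_pair_act[of \<alpha> \<beta> "[:0, 1:]"] by (simp add: pcompose_pCons act_linear)

lemma assoc_pair_zero: "assoc_pair (\<lambda>_. 0) (\<lambda>_. 0)"
  unfolding assoc_pair_def
  by (intro conjI bounded_modesI exI[of _ 0]) (auto simp: iota_def fun_eq_iff)

lemma assoc_pair_sum:
  "(\<And>j. j \<in> J \<Longrightarrow> assoc_pair (\<alpha> j) (\<beta> j)) \<Longrightarrow> assoc_pair (\<lambda>k. \<Sum>j\<in>J. \<alpha> j k) (\<lambda>k. \<Sum>j\<in>J. \<beta> j k)"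
  by (induction J rule: infinite_finite_induct) (auto intro: assoc_pair_add assoc_pair_zero)

lemma poly_pair_add: "poly_pair \<alpha> \<beta> \<Longrightarrow> poly_pair \<alpha>' \<beta>' \<Longrightarrow> poly_pair (\<lambda>k. \<alpha> k + \<alpha>' k) (\<lambda>k. \<beta> k + \<beta>' k)"
  unfolding poly_pair_def
proof (elim exE conjE)
  fix L L'
  assume "\<alpha> = iota L" "\<beta> = iota (L \<circ>\<^sub>p [:1, 1:])" "\<alpha>' = iota L'" "\<beta>' = iota (L' \<circ>\<^sub>p [:1, 1:])"
  then show "\<exists>L. (\<lambda>k. \<alpha> k + \<alpha>' k) = iota L \<and> (\<lambda>k. \<beta> k + \<beta>' k) = iota (L \<circ>\<^sub>p [:1, 1:])"
    by (intro exI[of _ "L + L'"]) (simp add: iota_add pcompose_add)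
qed

lemma poly_pair_act: "poly_pair \<alpha> \<beta> \<Longrightarrow> poly_pair (act p \<alpha>) (act (p \<circ>\<^sub>p [:1, 1:]) \<beta>)"
  unfolding poly_pair_def
proof (elim exE conjE)
  fix L assume "\<alpha> = iota L" "\<beta> = iota (L \<circ>\<^sub>p [:1, 1:])"
  then show "\<exists>L. act p \<alpha> = iota L \<and> act (p \<circ>\<^sub>p [:1, 1:]) \<beta> = iota (L \<circ>\<^sub>p [:1, 1:])"
    by (intro exI[of _ "p * L"]) (simp add: act_iota pcompose_mult)
qed

lemma poly_pair_scale: "poly_pair \<alpha> \<beta> \<Longrightarrow> poly_pair (\<lambda>k. c * \<alpha> k) (\<lambda>k. c * \<beta> k)"
  using poly_pair_act[of \<alpha> \<beta> "[:c:]"] by (simp add: pcompose_pCons act_pCons[abs_def])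

lemma poly_pair_x:
  "poly_pair \<alpha> \<beta> \<Longrightarrow> poly_pair (\<lambda>k. \<alpha> (k + 1)) (\<lambda>k. \<beta> k + \<beta> (k + 1))"
  using poly_pair_act[of \<alpha> \<beta> "[:0, 1:]"] by (simp add: pcompose_pCons act_linear)

lemma poly_pair_const: "poly_pair (\<lambda>k. c * iota 1 k) (\<lambda>k. c * iota 1 k)"
  by (rule poly_pair_scale) (auto simp: poly_pair_def pcompose_1 intro!: exI[of _ 1])

text \<open>If \<alpha> is a polynomial \<open>Q\<close>, then injectivity of \<open>iota\<close>
  forces \<open>L\<close> to be the denominator times \<open>Q\<close>. So \<beta> and \<beta>'
  agree after multiplication by (1 + t)^a t^c, which cancels because both have bounded
  modes.\<close>

lemma assoc_pair_unique:
  assumes "assoc_pair \<alpha> \<beta>" "poly_pair \<alpha> \<beta>'"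
  shows "\<beta> = \<beta>'"
proof -
  from assms(1) obtain a c L where 1: "act ([:0, 1:] ^ a * [:-1, 1:] ^ c) \<alpha> = iota L"
    "act ([:1, 1:] ^ a * [:0, 1:] ^ c) \<beta> = iota (L \<circ>\<^sub>p [:1, 1:])" unfolding assoc_pair_def by blast
  from assms(2) obtain Q where Q: "\<alpha> = iota Q" "\<beta>' = iota (Q \<circ>\<^sub>p [:1, 1:])" unfolding poly_pair_def by blast
  have "L = [:0, 1:] ^ a * [:-1, 1:] ^ c * Q"
    using 1(1) unfolding Q act_iota by (rule iota_inj[symmetric])
  then have "act ([:1, 1:] ^ a * [:0, 1:] ^ c) \<beta> = act ([:1, 1:] ^ a * [:0, 1:] ^ c) \<beta>'"
    unfolding 1(2) unfolding Q act_iota pcompose_denominator[symmetric] by (simp add: pcompose_mult)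
  then show ?thesis
    by (rule act_eq_imp_eq) (use assms(1) in \<open>auto simp: assoc_pair_def Q bounded_modes_iota\<close>)
qed

lemma comm_pair_raise:
  "act ([:-1, 1:] ^ M) \<alpha> = act ([:-1, 1:] ^ M) \<beta> \<Longrightarrow> M \<le> N \<Longrightarrow>
     act ([:-1, 1:] ^ N) \<alpha> = act ([:-1, 1:] ^ N) \<beta>"
proof -
  assume 1: "act ([:-1, 1:] ^ M) \<alpha> = act ([:-1, 1:] ^ M) \<beta>" and "M \<le> N"
  then have "[:-1, 1::complex:] ^ N = [:-1, 1:] ^ (N - M) * [:-1, 1:] ^ M" by (simp flip: power_add)
  then show ?thesis by (simp only: act_mult 1)
qed

lemma comm_pair_add:
  assumes "comm_pair \<alpha> \<beta>" "comm_pair \<alpha>' \<beta>'"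
  shows "comm_pair (\<lambda>k. \<alpha> k + \<alpha>' k) (\<lambda>k. \<beta> k + \<beta>' k)"
proof -
  from assms obtain M M' where M: "act ([:-1, 1:] ^ M) \<alpha> = act ([:-1, 1:] ^ M) \<beta>"
    "act ([:-1, 1:] ^ M') \<alpha>' = act ([:-1, 1:] ^ M') \<beta>'" unfolding comm_pair_def by blast
  have "act ([:-1, 1:] ^ max M M') (\<lambda>k. \<alpha> k + \<alpha>' k) = act ([:-1, 1:] ^ max M M') (\<lambda>k. \<beta> k + \<beta>' k)"
    using comm_pair_raise[OF M(1), of "max M M'"] comm_pair_raise[OF M(2), of "max M M'"]
    by (simp add: act_add)
  then show ?thesis using assms unfolding comm_pair_def by (blast intro: bounded_modes_add)
qed

lemma comm_pair_act: "comm_pair \<alpha> \<beta> \<Longrightarrow> comm_pair (act p \<alpha>) (act p \<beta>)"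
  unfolding comm_pair_def
proof (elim conjE exE, intro conjI exI)
  fix M assume M: "act ([:-1, 1:] ^ M) \<alpha> = act ([:-1, 1:] ^ M) \<beta>"
  show "act ([:-1, 1:] ^ M) (act p \<alpha>) = act ([:-1, 1:] ^ M) (act p \<beta>)"
    by (simp only: act_mult[symmetric] mult.commute[of _ p]) (simp only: act_mult M)
qed (rule bounded_modes_act)

lemma comm_pair_scale: "comm_pair \<alpha> \<beta> \<Longrightarrow> comm_pair (\<lambda>k. c * \<alpha> k) (\<lambda>k. c * \<beta> k)"
  using comm_pair_act[of \<alpha> \<beta> "[:c:]"] by (simp add: act_pCons[abs_def])

lemma comm_pair_zero: "comm_pair (\<lambda>_. 0) (\<lambda>_. 0)"
  unfolding comm_pair_def by (auto simp: bounded_modes_def)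

lemma comm_pair_sum:
  "(\<And>j. j \<in> J \<Longrightarrow> comm_pair (\<alpha> j) (\<beta> j)) \<Longrightarrow> comm_pair (\<lambda>k. \<Sum>j\<in>J. \<alpha> j k) (\<lambda>k. \<Sum>j\<in>J. \<beta> j k)"
  by (induction J rule: infinite_finite_induct) (auto intro: comm_pair_add comm_pair_zero)

text \<open>Expansions of one function in two regions differ precisely because only one of them has
  bounded modes; once both are bounded, the power of x - 1 can be cancelled.\<close>

lemma comm_pair_unique:
  assumes "comm_pair \<alpha> \<beta>" "bounded_modes \<alpha>"
  shows "\<alpha> = \<beta>"
proof -
  from assms obtain M where "act ([:-1, 1:] ^ M) \<alpha> = act ([:-1, 1:] ^ M) \<beta>" unfolding comm_pair_def by blast
  then show ?thesis by (rule act_eq_imp_eq) (use assms in \<open>auto simp: comm_pair_def\<close>)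
qed

section \<open>Absolutely convergent series and the formal identities they imply\<close>

section \<open>Absolutely convergent Laurent series in several variables\<close>

definition mon :: "complex list \<Rightarrow> int list \<Rightarrow> complex" where
  "mon x k = prod_list (map2 (\<lambda>y l. y powi (- l - 1)) x k)"

text \<open>In the complex numbers unconditional summability already gives absolute summability, so
  one \<open>has_sum\<close> statement carries all the information.\<close>

lemma laurent_sums_iff:
  "laurent_sums a x s \<longleftrightarrow> ((\<lambda>k. a k * mon x k) has_sum s) {k. length k = length x}"
  unfolding laurent_sums_def mon_def[symmetric] Let_def
  using summable_on_iff_abs_summable_on_complex[of "\<lambda>k. a k * mon x k"]
    has_sum_imp_summable[of "\<lambda>k. a k * mon x k"] by blast

lemma mon_nth: "length k = length x \<Longrightarrow> mon x k = (\<Prod>i<length x. (x ! i) powi (- (k ! i) - 1))"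
  unfolding mon_def by (simp add: prod.list_conv_set_nth atLeast0LessThan)

lemma mon_Cons [simp]: "mon (y # x) (l # k) = y powi (- l - 1) * mon x k"
  by (simp add: mon_def)

lemma mon_Nil [simp]: "mon [] k = 1" "mon x [] = 1"
  by (simp_all add: mon_def)

text \<open>The second alternative admits the value zero. It excludes \<open>l = - 1\<close>, where
  the left side is 0 to the power 0, which is 1, while the right side is 0.\<close>

lemma powi_shift: "x \<noteq> 0 \<or> l + 1 < 0 \<Longrightarrow> x powi (- l - 1) = x * x powi (- (l + 1) - 1)" for x :: complex
proof -
  assume "x \<noteq> 0 \<or> l + 1 < 0"
  moreover have "x powi (- l - 1) = x * x powi (- (l + 1) - 1)" if "x \<noteq> 0"
  proof -
    have "- l - 1 = 1 + (- (l + 1) - 1)" by simp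
    then have "x powi (- l - 1) = x powi (1 + (- (l + 1) - 1))" by (rule arg_cong)
    also have "\<dots> = x powi 1 * x powi (- (l + 1) - 1)" by (rule power_int_add) (simp add: that)
    finally show ?thesis by simp
  qed
  moreover have "x powi (- l - 1) = 0" if "x = 0" "l + 1 < 0"
    using that by (simp add: power_int_0_left_if)
  ultimately show ?thesis by fastforce
qed

lemma mon_shift:
  assumes "i < length x" "length k = length x" "x ! i \<noteq> 0 \<or> k ! i + 1 < 0"
  shows "mon x k = x ! i * mon x (k[i := k ! i + 1])"
proof -
  have "mon x k = (x ! i) powi (- (k ! i) - 1) * (\<Prod>j\<in>{..<length x} - {i}. (x ! j) powi (- (k ! j) - 1))"
    using assms by (simp add: mon_nth prod.remove)
  moreover have "mon x (k[i := k ! i + 1]) = (x ! i) powi (- (k ! i + 1) - 1) *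
      (\<Prod>j\<in>{..<length x} - {i}. (x ! j) powi (- (k ! j) - 1))"
    using assms by (simp add: mon_nth prod.remove nth_list_update)
  ultimately show ?thesis using powi_shift[OF assms(3)] by simp
qed

definition shift :: "nat \<Rightarrow> (int list \<Rightarrow> complex) \<Rightarrow> int list \<Rightarrow> complex" where
  "shift i A k = A (k[i := k ! i + 1])"

definition lvar :: "nat \<Rightarrow> nat \<Rightarrow> (int list \<Rightarrow> complex) \<Rightarrow> int list \<Rightarrow> complex" where
  "lvar N i A = (if i < N then shift i A else (\<lambda>_. 0))"

definition ev :: "complex list \<Rightarrow> nat \<Rightarrow> complex" where
  "ev x i = (if i < length x then x ! i else 0)"

lemma ev_nth [simp]: "i < length x \<Longrightarrow> ev x i = x ! i"
  by (simp add: ev_def)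

lemma bij_shift: "i < N \<Longrightarrow> bij_betw (\<lambda>k. k[i := k ! i + c]) {k. length k = N} {k :: int list. length k = N}"
  by (rule bij_betwI[where g = "\<lambda>k. k[i := k ! i - c]"]) auto

lemma laurent_sums_unique: "laurent_sums a x s \<Longrightarrow> laurent_sums a x t \<Longrightarrow> s = t"
  unfolding laurent_sums_iff by (rule has_sum_unique)

lemma laurent_sums_cong:
  "(\<And>k. length k = length x \<Longrightarrow> a k = b k) \<Longrightarrow> laurent_sums a x s \<longleftrightarrow> laurent_sums b x s"
  unfolding laurent_sums_iff by (intro has_sum_cong) auto

lemma laurent_sums_add:
  "laurent_sums a x s \<Longrightarrow> laurent_sums b x t \<Longrightarrow> laurent_sums (\<lambda>k. a k + b k) x (s + t)"
  unfolding laurent_sums_iff by (drule (1) has_sum_add) (simp add: algebra_simps)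

lemma laurent_sums_scale: "laurent_sums a x s \<Longrightarrow> laurent_sums (\<lambda>k. c * a k) x (c * s)"
  unfolding laurent_sums_iff by (drule has_sum_cmult_right[where c = c]) (simp add: algebra_simps)

lemma laurent_sums_0: "laurent_sums (\<lambda>_. 0) x 0"
  unfolding laurent_sums_iff by simp

lemma laurent_sums_shift:
  assumes "laurent_sums A x s" "i < length x"
    and "x ! i \<noteq> 0 \<or> (\<forall>k. length k = length x \<longrightarrow> A k \<noteq> 0 \<longrightarrow> k ! i < 0)"
  shows "laurent_sums (shift i A) x (x ! i * s)"
proof -
  let ?g = "\<lambda>k. k[i := k ! i + (1 :: int)]"
  have "((\<lambda>k. (\<lambda>k. x ! i * (A k * mon x k)) (?g k)) has_sum x ! i * s) {k. length k = length x}"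
    by (subst has_sum_reindex_bij_betw[OF bij_shift[OF assms(2)]])
      (use assms(1) in \<open>auto simp: laurent_sums_iff intro: has_sum_cmult_right\<close>)
  also have "?this \<longleftrightarrow> ((\<lambda>k. shift i A k * mon x k) has_sum x ! i * s) {k. length k = length x}"
  proof (intro has_sum_cong)
    fix k assume "k \<in> {k :: int list. length k = length x}"
    then have k: "length k = length x" by simp
    show "x ! i * (A (?g k) * mon x (?g k)) = shift i A k * mon x k"
    proof (cases "A (?g k) = 0")
      case False
      then have "x ! i \<noteq> 0 \<or> k ! i + 1 < 0" using assms(2,3) k by (auto dest!: spec[of _ "?g k"])
      from mon_shift[OF assms(2) k this] show ?thesis by (simp add: shift_def)
    qed (simp add: shift_def)
  qed
  finally show ?thesis unfolding laurent_sums_iff .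
qed

text \<open>Only nonnegative powers of coordinates that are zero. An integer power of 0 with
  negative exponent evaluates to 0, so without this condition multiplying coefficients by a variable
  would not multiply the sum by its value. It matters for the coordinate z_m - \<zeta>.\<close>

definition vanishing_at :: "complex list \<Rightarrow> (int list \<Rightarrow> complex) \<Rightarrow> bool" where
  "vanishing_at x A \<longleftrightarrow> (\<forall>k i. length k = length x \<longrightarrow> i < length x \<longrightarrow> x ! i = 0 \<longrightarrow> A k \<noteq> 0 \<longrightarrow> k ! i < 0)"

lemma vanishing_at_shift:
  assumes "vanishing_at x A" shows "vanishing_at x (shift p A)"
  unfolding vanishing_at_def
proof (intro allI impI)
  fix k :: "int list" and i
  assume k: "length k = length x" "i < length x" "x ! i = 0" "shift p A k \<noteq> 0"
  then have "k[p := k ! p + 1] ! i < 0"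
    using assms unfolding vanishing_at_def shift_def by (metis length_list_update)
  then show "k ! i < 0" using k by (cases "p = i") auto
qed

lemma vanishing_at_add: "vanishing_at x A \<Longrightarrow> vanishing_at x B \<Longrightarrow> vanishing_at x (\<lambda>k. A k + B k)"
  unfolding vanishing_at_def by fastforce

lemma vanishing_at_scale: "vanishing_at x A \<Longrightarrow> vanishing_at x (\<lambda>k. c * A k)"
  unfolding vanishing_at_def by simp

lemma laurent_sums_opr:
  assumes v: "\<And>i A s. laurent_sums A x s \<Longrightarrow> vanishing_at x A \<Longrightarrow>
      laurent_sums (v i A) x (\<mu> i * s) \<and> vanishing_at x (v i A)"
    and "laurent_sums A x s" "vanishing_at x A"
  shows "laurent_sums (opr v e A) x (peval \<mu> e * s)"
proof -
  \<comment> \<open>Scalars are viewed as families over a one-point index type, so that evaluation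
    at \<mu> is itself an instance of \<open>opr\<close> and the transport lemma applies.\<close>
  have "opr (\<lambda>i S (u::unit). \<mu> i * S u) e (\<lambda>_. s) = (\<lambda>_. peval \<mu> e * s)" for s
  proof (induction e arbitrary: s)
    case (Mul p q)
    show ?case by (simp only: opr.simps Mul peval.simps mult.assoc)
  qed (auto simp: algebra_simps fun_eq_iff)
  moreover have "laurent_sums (opr v e A) x (opr (\<lambda>i S (u::unit). \<mu> i * S u) e (\<lambda>_. s) ()) \<and> vanishing_at x (opr v e A)"
    by (rule opr_rel[of "\<lambda>A S. laurent_sums A x (S ()) \<and> vanishing_at x A"])
      (use assms in \<open>auto intro: laurent_sums_add laurent_sums_scale vanishing_at_add vanishing_at_scale\<close>)
  ultimately show ?thesis by simp
qed

lemma laurent_sums_lvar: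
  assumes "laurent_sums A x s" "vanishing_at x A"
  shows "laurent_sums (lvar (length x) i A) x (ev x i * s) \<and> vanishing_at x (lvar (length x) i A)"
proof (cases "i < length x")
  case True
  then show ?thesis using assms vanishing_at_shift[OF assms(2), of i]
    by (auto simp: lvar_def ev_def vanishing_at_def intro!: laurent_sums_shift)
qed (simp add: lvar_def ev_def laurent_sums_0 vanishing_at_def)

lemma vanishing_at_nonzero: "\<forall>y\<in>set x. y \<noteq> 0 \<Longrightarrow> vanishing_at x A"
  unfolding vanishing_at_def by auto

text \<open>The constant series 1: the exponent 0 is the mode \<open>-1\<close>.\<close>

definition unit_array :: "nat \<Rightarrow> int list \<Rightarrow> complex" where
  "unit_array N k = (if k = replicate N (-1) then 1 else 0)"

lemma laurent_sums_unit: "laurent_sums (unit_array (length x)) x 1"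
proof -
  have "mon x (replicate (length x) (-1)) = 1" by (subst mon_nth) auto
  then show ?thesis unfolding laurent_sums_iff
    by (intro has_sum_finite_neutralI[of "{replicate (length x) (-1)}"]) (auto simp: unit_array_def)
qed

section \<open>Uniqueness of Laurent coefficients on circles and tori\<close>

lemma has_sum_finite_sum:
  fixes f :: "'i \<Rightarrow> 'k \<Rightarrow> complex"
  assumes "\<And>i. i \<in> J \<Longrightarrow> (f i has_sum s i) A"
  shows "((\<lambda>k. \<Sum>i\<in>J. f i k) has_sum (\<Sum>i\<in>J. s i)) A"
  using assms by (induction J rule: infinite_finite_induct) (auto intro: has_sum_add)

lemma sum_unit_roots:
  assumes "0 < \<bar>d\<bar>" "\<bar>d\<bar> < int N"
  shows "(\<Sum>j<N. cis (2 * pi * real j / real N) powi d) = 0"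
proof -
  let ?w = "cis (2 * pi * real_of_int d / real N)"
  have pow: "cis (2 * pi * real j / real N) powi d = ?w ^ j" for j
    by (simp only: cis_power_int Complex.DeMoivre) (rule arg_cong[where f = cis], simp)
  have "?w \<noteq> 1"
  proof
    assume "?w = 1"
    then have "cos (2 * pi * real_of_int d / real N) = 1" by (metis cis.sel(1) one_complex.sel(1))
    then obtain n :: int where "2 * pi * real_of_int d / real N = real_of_int n * 2 * pi"
      using cos_one_2pi_int by blast
    then have "real_of_int d = real_of_int n * real N" using assms by (simp add: field_simps)
    then have "d = n * int N" by (metis of_int_eq_iff of_int_mult of_int_of_nat_eq)
    then have "\<bar>n\<bar> * int N < 1 * int N" "n \<noteq> 0" using assms by (auto simp: abs_mult)
    then show False by (simp only: mult_less_cancel_right) auto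
  qed
  moreover have "?w ^ N = 1"
  proof -
    have "real N * (2 * pi * real_of_int d / real N) = 2 * pi * real_of_int d" using assms by simp
    then have "?w ^ N = cis (2 * pi * real_of_int d)" by (simp only: Complex.DeMoivre)
    then show ?thesis by (simp add: cis_multiple_2pi)
  qed
  ultimately show ?thesis by (simp add: pow geometric_sum)
qed

text \<open>Averaging over N-th roots of unity takes the place of a contour integral. A nonzero
  coefficient c(k0) survives the average, the other modes of a large finite set are annihilated, and
  the remaining tail has norm at most half of |c(k0)|, which is contradictory.\<close>

lemma circle_unique:
  fixes b :: "int \<Rightarrow> complex"
  assumes "r > 0" and sums: "\<And>z. cmod z = r \<Longrightarrow> ((\<lambda>k. b k * z powi (- k - 1)) has_sum 0) UNIV"
  shows "b k0 = 0"
proof (rule ccontr)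
  assume "b k0 \<noteq> 0"
  define c where "c k = b k * of_real r powi (- k - 1)" for k
  have "c k0 \<noteq> 0" using \<open>b k0 \<noteq> 0\<close> \<open>r > 0\<close> by (simp add: c_def)
  define \<epsilon> where "\<epsilon> = cmod (c k0)"
  have "\<epsilon> > 0" using \<open>c k0 \<noteq> 0\<close> by (simp add: \<epsilon>_def)
  have hs: "((\<lambda>k. c k * w powi (- k - 1)) has_sum 0) UNIV" if "cmod w = 1" for w
    using sums[of "of_real r * w"] that \<open>r > 0\<close>
    by (simp add: c_def norm_mult power_int_mult_distrib mult.assoc)
  have cs: "(\<lambda>k. cmod (c k)) summable_on UNIV"
    using has_sum_imp_summable[OF hs[of 1]] summable_on_iff_abs_summable_on_complex by auto
  obtain F where F: "finite F" "dist (sum (\<lambda>k. cmod (c k)) F) (\<Sum>\<^sub>\<infinity>k. cmod (c k)) \<le> \<epsilon> / 2"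
    using has_sum_finite_approximation[OF has_sum_infsum[OF cs], of "\<epsilon> / 2"] \<open>\<epsilon> > 0\<close> by auto
  define G where "G = insert k0 F"
  have "finite G" using F by (simp add: G_def)
  have csG: "(\<lambda>k. cmod (c k)) summable_on A" for A using cs by (rule summable_on_subset) auto
  have split: "(\<Sum>\<^sub>\<infinity>k. cmod (c k)) = (\<Sum>k\<in>H. cmod (c k)) + (\<Sum>\<^sub>\<infinity>k\<in>-H. cmod (c k))" if "finite H" for H
    using infsum_Un_disjoint[OF csG[of H] csG[of "-H"]] that by (simp add: Compl_partition)
  have tail: "(\<Sum>\<^sub>\<infinity>k\<in>-G. cmod (c k)) \<le> \<epsilon> / 2"
  proof -
    have "(\<Sum>\<^sub>\<infinity>k\<in>-F. cmod (c k)) \<le> \<epsilon> / 2" using F(2) split[OF F(1)] by (simp add: dist_real_def)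
    moreover have "(\<Sum>\<^sub>\<infinity>k\<in>-G. cmod (c k)) \<le> (\<Sum>\<^sub>\<infinity>k\<in>-F. cmod (c k))"
      by (rule infsum_mono_neutral) (auto simp: G_def csG)
    ultimately show ?thesis by simp
  qed
  \<comment> \<open>\<open>N\<close> exceeds all distances from \<open>k0\<close> within
    \<open>G\<close>, so that no mode of \<open>G\<close> other than \<open>k0\<close> is congruent
    to \<open>k0\<close> modulo \<open>N\<close>.\<close>
  define N where "N = nat (Max ((\<lambda>k. \<bar>k - k0\<bar>) ` G)) + 1"
  have N: "\<bar>k - k0\<bar> < int N" if "k \<in> G" for k
  proof -
    have "\<bar>k - k0\<bar> \<le> Max ((\<lambda>k. \<bar>k - k0\<bar>) ` G)" using \<open>finite G\<close> that by (intro Max_ge) auto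
    then show ?thesis unfolding N_def by linarith
  qed
  define w where "w j = cis (2 * pi * real j / real N)" for j
  define S where "S k = (\<Sum>j<N. w j powi (k0 - k))" for k
  have w: "cmod (w j) = 1" "w j \<noteq> 0" for j by (auto simp: w_def)
  have "((\<lambda>k. \<Sum>j<N. w j powi (k0 + 1) * (c k * w j powi (- k - 1))) has_sum (\<Sum>j<N. w j powi (k0 + 1) * 0)) UNIV"
    by (intro has_sum_finite_sum has_sum_cmult_right hs w)
  moreover have "(\<Sum>j<N. w j powi (k0 + 1) * (c k * w j powi (- k - 1))) = c k * S k" for k
  proof -
    have "w j powi (k0 + 1) * w j powi (- k - 1) = w j powi (k0 - k)" for j
      using power_int_add[of "w j" "k0 + 1" "- k - 1"] w(2)[of j] by simp
    then show ?thesis by (simp add: S_def sum_distrib_left mult.left_commute)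
  qed
  ultimately have hS: "((\<lambda>k. c k * S k) has_sum 0) UNIV" by simp
  have S0: "S k0 = of_nat N" by (simp add: S_def)
  have SG: "S k = 0" if "k \<in> G" "k \<noteq> k0" for k
    using sum_unit_roots[of "k0 - k" N] N[OF that(1)] that(2) by (simp add: S_def w_def abs_minus_commute)
  have Sle: "cmod (S k) \<le> real N" for k
  proof -
    have "cmod (S k) \<le> (\<Sum>j<N. cmod (w j powi (k0 - k)))" unfolding S_def by (rule norm_sum)
    then show ?thesis by (simp add: norm_power_int w)
  qed
  have hsS: "(\<lambda>k. c k * S k) summable_on A" for A
    using has_sum_imp_summable[OF hS] by (rule summable_on_subset) auto
  have "0 = (\<Sum>k\<in>G. c k * S k) + (\<Sum>\<^sub>\<infinity>k\<in>-G. c k * S k)"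
    using infsum_Un_disjoint[OF hsS[of G] hsS[of "-G"]] \<open>finite G\<close> infsumI[OF hS]
    by (simp add: Compl_partition)
  also have "(\<Sum>k\<in>G. c k * S k) = c k0 * of_nat N"
    using \<open>finite G\<close> SG S0 by (subst sum.remove[of _ k0]) (auto simp: G_def)
  finally have "c k0 * of_nat N = - (\<Sum>\<^sub>\<infinity>k\<in>-G. c k * S k)" by (simp add: eq_neg_iff_add_eq_0)
  then have "\<epsilon> * real N = cmod (\<Sum>\<^sub>\<infinity>k\<in>-G. c k * S k)"
    by (metis \<epsilon>_def norm_minus_cancel norm_mult norm_of_nat)
  also have "\<dots> \<le> (\<Sum>\<^sub>\<infinity>k\<in>-G. cmod (c k * S k))"
    by (rule norm_infsum_bound) (use hsS[of "-G"] in \<open>simp only: summable_on_iff_abs_summable_on_complex\<close>)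
  also have "\<dots> \<le> (\<Sum>\<^sub>\<infinity>k\<in>-G. cmod (c k) * real N)"
    by (rule infsum_mono) (use hsS[of "-G", unfolded summable_on_iff_abs_summable_on_complex] in
        \<open>auto simp: norm_mult Sle mult_left_mono intro!: summable_on_cmult_left csG\<close>)
  also have "\<dots> = (\<Sum>\<^sub>\<infinity>k\<in>-G. cmod (c k)) * real N"
    by (rule infsum_cmult_left) (rule csG)
  also have "\<dots> \<le> \<epsilon> / 2 * real N" using tail by (intro mult_right_mono) auto
  finally show False using \<open>\<epsilon> > 0\<close> by (simp add: N_def)
qed

lemma bij_Cons: "bij_betw (\<lambda>(l, k). l # k) (UNIV \<times> {k. length k = N}) {k. length k = Suc N}"
  by (rule bij_betwI[where g = "\<lambda>k. (hd k, tl k)"]) (auto simp: length_Suc_conv)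

text \<open>Summing first over the remaining variables gives a Laurent series in the first one, with
  coefficients \<open>B l\<close>; the circle case kills these, and the induction hypothesis applies
  to each of them.\<close>

lemma torus_unique:
  assumes "\<forall>r\<in>set rs. r > 0" and "\<And>x. map cmod x = rs \<Longrightarrow> laurent_sums a x 0"
    and "length k = length rs"
  shows "a k = 0"
  using assms
proof (induction rs arbitrary: a k)
  case Nil
  then have "laurent_sums a [] 0" "k = []" by auto
  moreover have "(a has_sum a []) {[]}" by (intro has_sum_finiteI) auto
  ultimately show ?case using has_sum_unique by (fastforce simp: laurent_sums_iff)
next
  case (Cons r rs)
  obtain l k' where k: "k = l # k'" "length k' = length rs" using Cons.prems(3) by (cases k) auto
  have "laurent_sums (\<lambda>k'. a (l # k')) x 0" if x: "map cmod x = rs" for x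
  proof -
    define I where "I = {k :: int list. length k = length x}"
    define B where "B l = (\<Sum>\<^sub>\<infinity>k\<in>I. a (l # k) * mon x k)" for l
    have hs: "((\<lambda>(l, k). a (l # k) * (z powi (- l - 1) * mon x k)) has_sum 0) (UNIV \<times> I)" if "cmod z = r" for z
    proof -
      have "((\<lambda>k. a k * mon (z # x) k) has_sum 0) {k. length k = Suc (length x)}"
        using Cons.prems(2)[of "z # x"] x that by (simp add: laurent_sums_iff)
      then have "((\<lambda>p. (\<lambda>k. a k * mon (z # x) k) ((\<lambda>(l, k). l # k) p)) has_sum 0) (UNIV \<times> I)"
        unfolding I_def
        using has_sum_reindex_bij_betw[OF bij_Cons[of "length x"], of "\<lambda>k. a k * mon (z # x) k"] by blast
      then show ?thesis by (simp add: case_prod_unfold)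
    qed
    have sm: "(\<lambda>k. a (l # k) * mon x k) summable_on I" for l
    proof -
      have "r > 0" using Cons.prems by simp
      have "(\<lambda>k. a (l # k) * (of_real r powi (- l - 1) * mon x k)) summable_on I"
        using has_sum_imp_summable[OF hs[of "of_real r"]] \<open>r > 0\<close> by (intro summable_on_SigmaD1[where x = l and A = UNIV and B = "\<lambda>_. I"]) auto
      then have "(\<lambda>k. inverse (of_real r powi (- l - 1)) * (a (l # k) * (of_real r powi (- l - 1) * mon x k))) summable_on I"
        by (rule summable_on_cmult_right)
      then show ?thesis using \<open>r > 0\<close> by (simp add: field_simps)
    qed
    have "B l = 0"
    proof (rule circle_unique)
      show "r > 0" using Cons.prems by simp
      fix z assume z: "cmod z = r"
      show "((\<lambda>l. B l * z powi (- l - 1)) has_sum 0) UNIV"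
      proof (rule has_sum_SigmaD[OF hs[OF z]])
        fix l
        have "((\<lambda>k. a (l # k) * mon x k * z powi (- l - 1)) has_sum B l * z powi (- l - 1)) I"
          unfolding B_def by (intro has_sum_cmult_left has_sum_infsum sm)
        then show "((\<lambda>y. case (l, y) of (l, k) \<Rightarrow> a (l # k) * (z powi (- l - 1) * mon x k)) has_sum B l * z powi (- l - 1)) I"
          by (simp add: mult_ac)
      qed
    qed
    then show ?thesis using has_sum_infsum[OF sm[of l]] unfolding laurent_sums_iff B_def I_def by simp
  qed
  then have "(\<lambda>k'. a (l # k')) k' = 0"
    using Cons.prems k by (intro Cons.IH) auto
  then show ?case using k by simp
qed

text \<open>Turns convergence into algebra: on the torus D R = e holds pointwise, both sides are
  sums of absolutely convergent Laurent series, and so their coefficients agree.\<close>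

lemma rational_sums_opr:
  assumes "\<forall>r\<in>set rs. r > 0"
    and "\<And>x. map cmod x = rs \<Longrightarrow> laurent_sums a x (R x) \<and> peval (ev x) D * R x = peval (ev x) e"
    and "length k = length rs"
  shows "opr (lvar (length rs)) D a k = opr (lvar (length rs)) e (unit_array (length rs)) k"
proof -
  have "(\<lambda>k. opr (lvar (length rs)) D a k + (-1) * opr (lvar (length rs)) e (unit_array (length rs)) k) k = 0"
  proof (rule torus_unique[OF assms(1) _ assms(3)])
    fix x assume x: "map cmod x = rs"
    then have len: "length rs = length x" by (metis length_map)
    have nz: "\<forall>y\<in>set x. y \<noteq> 0" using assms(1) unfolding x[symmetric] by auto
    show "laurent_sums (\<lambda>k. opr (lvar (length rs)) D a k + (-1) * opr (lvar (length rs)) e (unit_array (length rs)) k) x 0"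
    proof -
      have 1: "laurent_sums (opr (lvar (length x)) D a) x (peval (ev x) D * R x)"
        by (rule laurent_sums_opr)
          (use assms(2)[OF x] in \<open>auto intro: laurent_sums_lvar[THEN conjunct1] laurent_sums_lvar[THEN conjunct2] vanishing_at_nonzero[OF nz]\<close>)
      have 2: "laurent_sums (opr (lvar (length x)) e (unit_array (length x))) x (peval (ev x) e * 1)"
        by (rule laurent_sums_opr)
          (auto intro: laurent_sums_lvar[THEN conjunct1] laurent_sums_lvar[THEN conjunct2] vanishing_at_nonzero[OF nz] laurent_sums_unit)
      show ?thesis
        using laurent_sums_add[OF 1 laurent_sums_scale[OF 2, where c = "-1"]] assms(2)[OF x] by (simp add: len)
    qed
  qed
  then show ?thesis by simp
qed


section \<open>Division by a linear factor with a dominant term\<close>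

subsection \<open>Inverting linear factors\<close>

text \<open>From A = B + U A one gets A = B + U B + U^2 B + ..., a finite sum at each index because
  \<open>U ^^ j\<close> eventually kills \<open>A\<close> there. The estimate is phrased with finite
  partial sums since summability of \<open>A\<close> is what is to be proved; \<open>P\<close>
  carries side conditions that the estimate for \<open>U\<close> requires.\<close>

lemma neumann_bound:
  fixes A B :: "'k \<Rightarrow> complex" and w :: "'k \<Rightarrow> real"
  assumes U: "\<And>C D. U (\<lambda>k. C k - D k) = (\<lambda>k. U C k - U D k)"
    and B: "B = (\<lambda>k. A k - U A k)"
    and vanish: "\<And>k. k \<in> I \<Longrightarrow> \<exists>J. \<forall>j\<ge>J. (U ^^ j) A k = 0"
    and P: "P B" "\<And>C. P C \<Longrightarrow> P (U C)"
    and step: "\<And>C s. P C \<Longrightarrow> (\<And>F. finite F \<Longrightarrow> F \<subseteq> I \<Longrightarrow> (\<Sum>k\<in>F. cmod (C k) * w k) \<le> s) \<Longrightarrow>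
       (\<And>F. finite F \<Longrightarrow> F \<subseteq> I \<Longrightarrow> (\<Sum>k\<in>F. cmod (U C k) * w k) \<le> \<theta> * s)"
    and w: "\<And>k. w k \<ge> 0" and \<theta>: "0 \<le> \<theta>" "\<theta> < 1"
    and s: "\<And>F. finite F \<Longrightarrow> F \<subseteq> I \<Longrightarrow> (\<Sum>k\<in>F. cmod (B k) * w k) \<le> s"
    and F: "finite F" "F \<subseteq> I"
  shows "(\<Sum>k\<in>F. cmod (A k) * w k) \<le> s / (1 - \<theta>)"
proof -
  have s0: "s \<ge> 0" using s[of "{}"] by simp
  have tele: "(\<Sum>j<J. (U ^^ j) B k) = A k - (U ^^ J) A k" for J k
  proof (induction J)
    case (Suc J)
    have "(U ^^ J) B = (\<lambda>k. (U ^^ J) A k - (U ^^ Suc J) A k)"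
    proof (induction J)
      case (Suc J)
      then show ?case by (simp add: U)
    qed (simp add: B)
    then show ?case using Suc by simp
  qed simp
  have PU: "P ((U ^^ j) B)" for j by (induction j) (auto intro: P)
  have bd: "(\<Sum>k\<in>F. cmod ((U ^^ j) B k) * w k) \<le> \<theta> ^ j * s" if "finite F" "F \<subseteq> I" for j F
    using that
  proof (induction j arbitrary: F)
    case (Suc j)
    have "(\<Sum>k\<in>F. cmod (U ((U ^^ j) B) k) * w k) \<le> \<theta> * (\<theta> ^ j * s)"
      by (rule step[OF PU]) (use Suc in auto)
    then show ?case by (simp add: mult.assoc)
  qed (use s in auto)
  from vanish F(2) have "\<forall>k\<in>F. \<exists>J. \<forall>j\<ge>J. (U ^^ j) A k = 0" by blast
  then obtain J where J: "\<forall>k\<in>F. \<forall>j\<ge>J k. (U ^^ j) A k = 0" by metis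
  define M where "M = Max (insert 0 (J ` F))"
  have M: "(U ^^ M) A k = 0" if "k \<in> F" for k
    using J that F(1) by (auto simp: M_def intro: Max_ge)
  have "(\<Sum>k\<in>F. cmod (A k) * w k) = (\<Sum>k\<in>F. cmod (\<Sum>j<M. (U ^^ j) B k) * w k)"
    by (intro sum.cong) (auto simp: tele M)
  also have "\<dots> \<le> (\<Sum>k\<in>F. (\<Sum>j<M. cmod ((U ^^ j) B k)) * w k)"
    by (intro sum_mono mult_right_mono norm_sum w)
  also have "\<dots> = (\<Sum>j<M. \<Sum>k\<in>F. cmod ((U ^^ j) B k) * w k)"
    by (simp add: sum_distrib_right) (rule sum.swap)
  also have "\<dots> \<le> (\<Sum>j<M. \<theta> ^ j * s)" by (intro sum_mono bd F)
  also have "\<dots> = (\<Sum>j<M. \<theta> ^ j) * s" by (simp add: sum_distrib_right)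
  also have "(\<Sum>j<M. \<theta> ^ j) \<le> 1 / (1 - \<theta>)"
  proof -
    have "(\<Sum>j<M. \<theta> ^ j) \<le> (\<Sum>j. \<theta> ^ j)"
      by (rule sum_le_suminf) (use \<theta> in auto)
    then show ?thesis using \<theta> by (simp add: suminf_geometric)
  qed
  finally show ?thesis using s0 by (simp add: mult_right_mono)
qed

text \<open>Multiplication by x_p - c0 - c1 x_q, the common shape, up to sign, of the denominators
  z_i - z_l, z_i - c and \<zeta> + t_i - c.\<close>

definition lin_factor :: "nat \<Rightarrow> nat \<Rightarrow> complex \<Rightarrow> complex \<Rightarrow> (int list \<Rightarrow> complex) \<Rightarrow> int list \<Rightarrow> complex" where
  "lin_factor p q c0 c1 A k = shift p A k - c0 * A k - c1 * shift q A k"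

text \<open>The j-th power of (c0 + c1 x_q) / x_p reads entries whose mode p is lowered by j and
  whose mode q is raised by at most j, and not at all if \<open>c1 = 0\<close>. The condition says
  that these entries are zero for large j.\<close>

definition trunc_factor :: "nat \<Rightarrow> nat \<Rightarrow> complex \<Rightarrow> (int list \<Rightarrow> complex) \<Rightarrow> bool" where
  "trunc_factor p q c1 A \<longleftrightarrow> (\<forall>k. \<exists>J. \<forall>j\<ge>J. \<forall>c\<le>j. (c1 = 0 \<longrightarrow> c = 0) \<longrightarrow>
     A (k[p := k ! p - int j, q := k ! q + int c]) = 0)"

lemma trunc_factor_shift:
  assumes "trunc_factor p q c1 A" "p \<noteq> q"
  shows "trunc_factor p q c1 (shift i A)"
  unfolding trunc_factor_def
proof
  fix k :: "int list"
  show "\<exists>J. \<forall>j\<ge>J. \<forall>c\<le>j. (c1 = 0 \<longrightarrow> c = 0) \<longrightarrow> shift i A (k[p := k ! p - int j, q := k ! q + int c]) = 0"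
  proof (cases "i < length k")
    case False
    then have "shift i A (k[p := k ! p - int j, q := k ! q + int c]) = A (k[p := k ! p - int j, q := k ! q + int c])" for j c
      by (simp add: shift_def False list_update_beyond[of _ i] leI)
    then show ?thesis using assms(1) unfolding trunc_factor_def by simp
  next
    case True
    let ?k = "k[i := k ! i + 1]"
    have "(k[p := k ! p - int j, q := k ! q + int c])[i := k[p := k ! p - int j, q := k ! q + int c] ! i + 1]
       = ?k[p := ?k ! p - int j, q := ?k ! q + int c]" for j c
      using True assms(2)
      by (cases "p < length k"; cases "q < length k"; intro nth_equalityI) (auto simp: nth_list_update not_less)
    then show ?thesis using assms(1) unfolding trunc_factor_def shift_def by simp
  qed
qed

lemma trunc_factor_add:
  assumes "trunc_factor p q c1 A" "trunc_factor p q c1 B"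
  shows "trunc_factor p q c1 (\<lambda>k. A k + B k)"
  unfolding trunc_factor_def
proof
  fix k :: "int list"
  from assms obtain J1 J2 where
    "\<forall>j\<ge>J1. \<forall>c\<le>j. (c1 = 0 \<longrightarrow> c = 0) \<longrightarrow> A (k[p := k ! p - int j, q := k ! q + int c]) = 0"
    "\<forall>j\<ge>J2. \<forall>c\<le>j. (c1 = 0 \<longrightarrow> c = 0) \<longrightarrow> B (k[p := k ! p - int j, q := k ! q + int c]) = 0"
    unfolding trunc_factor_def by blast
  then show "\<exists>J. \<forall>j\<ge>J. \<forall>c\<le>j. (c1 = 0 \<longrightarrow> c = 0) \<longrightarrow>
      A (k[p := k ! p - int j, q := k ! q + int c]) + B (k[p := k ! p - int j, q := k ! q + int c]) = 0"
    by (intro exI[of _ "max J1 J2"]) auto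
qed

lemma trunc_factor_scale: "trunc_factor p q c1 A \<Longrightarrow> trunc_factor p q c1 (\<lambda>k. c * A k)"
  unfolding trunc_factor_def by fastforce

text \<open>Since x_p dominates, multiplication by (c0 + c1 x_q) / x_p contracts the l^1 norm
  weighted by |x^k|, and the factor can be inverted geometrically.\<close>

lemma laurent_sums_invert:
  assumes "p < length x" "q < length x" "p \<noteq> q"
    and less: "cmod c0 + cmod c1 * cmod (x ! q) < cmod (x ! p)"
    and trunc: "trunc_factor p q c1 A" and van: "vanishing_at x A"
    and sums: "laurent_sums (lin_factor p q c0 c1 A) x s"
  shows "laurent_sums A x (s / (x ! p - c0 - c1 * x ! q))"
proof -
  define N where "N = length x"
  define I where "I = {k :: int list. length k = N}"
  define w where "w k = cmod (mon x k)" for k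
  \<comment> \<open>Division by x_p on coefficients. Thus \<open>U\<close> is multiplication by (c0
    + c1 x_q) / x_p, and \<theta> bounds its norm.\<close>
  define dn where "dn C k = C (k[p := k ! p - 1])" for C :: "int list \<Rightarrow> complex" and k :: "int list"
  define U where "U C k = c0 * dn C k + c1 * dn (shift q C) k" for C k
  define B where "B k = A k - U A k" for k
  define \<theta> where "\<theta> = (cmod c0 + cmod c1 * cmod (x ! q)) / cmod (x ! p)"
  have xp: "cmod (x ! p) > 0" using less by (smt (verit) mult_nonneg_nonneg norm_ge_zero)
  have \<theta>: "0 \<le> \<theta>" "\<theta> < 1" using less xp by (auto simp: \<theta>_def)
  have pq: "p < N" "q < N" using assms by (auto simp: N_def)
  have wdn: "w (k[p := k ! p - 1]) = cmod (x ! p) * w k" if "k \<in> I" for k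
    using mon_shift[of p x "k[p := k ! p - 1]"] that pq xp
    by (auto simp: w_def I_def N_def norm_mult)
  have bdn: "(\<Sum>k\<in>F. cmod (dn C k) * w k) \<le> s / cmod (x ! p)"
    if s: "\<And>F. finite F \<Longrightarrow> F \<subseteq> I \<Longrightarrow> (\<Sum>k\<in>F. cmod (C k) * w k) \<le> s" and F: "finite F" "F \<subseteq> I" for C s F
  proof -
    let ?g = "\<lambda>k. k[p := k ! p - (1::int)]"
    have inj: "inj_on ?g I"
      using bij_betw_imp_inj_on[OF bij_shift[OF pq(1), of "-1"]] by (simp add: I_def)
    have "(\<Sum>k\<in>F. cmod (dn C k) * w k) = (\<Sum>k\<in>F. cmod (C (?g k)) * w (?g k) / cmod (x ! p))"
      using F(2) xp by (intro sum.cong) (auto simp: dn_def wdn)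
    also have "\<dots> = (\<Sum>k\<in>F. cmod (C (?g k)) * w (?g k)) / cmod (x ! p)" by (simp add: sum_divide_distrib)
    also have "(\<Sum>k\<in>F. cmod (C (?g k)) * w (?g k)) = (\<Sum>k\<in>?g ` F. cmod (C k) * w k)"
      using inj F(2) by (subst sum.reindex) (auto intro: inj_on_subset)
    also have "\<dots> \<le> s" by (rule s) (use F in \<open>auto simp: I_def\<close>)
    finally show ?thesis using xp by (simp add: divide_right_mono)
  qed
  have bsh: "(\<Sum>k\<in>F. cmod (shift q C k) * w k) \<le> cmod (x ! q) * s"
    if P: "vanishing_at x C" and s: "\<And>F. finite F \<Longrightarrow> F \<subseteq> I \<Longrightarrow> (\<Sum>k\<in>F. cmod (C k) * w k) \<le> s"
      and F: "finite F" "F \<subseteq> I" for C s F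
  proof -
    let ?g = "\<lambda>k. k[q := k ! q + (1::int)]"
    have inj: "inj_on ?g I"
      using bij_betw_imp_inj_on[OF bij_shift[OF pq(2), of "1"]] by (simp add: I_def)
    have "(\<Sum>k\<in>F. cmod (shift q C k) * w k) = (\<Sum>k\<in>F. cmod (x ! q) * (cmod (C (?g k)) * w (?g k)))"
    proof (intro sum.cong refl)
      fix k assume "k \<in> F"
      then have k: "length k = length x" using F(2) by (auto simp: I_def N_def)
      show "cmod (shift q C k) * w k = cmod (x ! q) * (cmod (C (?g k)) * w (?g k))"
      proof (cases "C (?g k) = 0")
        case False
        have "x ! q \<noteq> 0 \<or> k ! q + 1 < 0"
        proof (cases "x ! q = 0")
          case True
          then have "?g k ! q < 0"
            using P[unfolded vanishing_at_def, rule_format, of "?g k" q] False k pq unfolding N_def by simp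
          then show ?thesis using k pq by (simp add: N_def)
        qed simp
        from mon_shift[OF _ k this] pq show ?thesis by (simp add: w_def shift_def norm_mult N_def)
      qed (simp add: shift_def)
    qed
    also have "\<dots> = cmod (x ! q) * (\<Sum>k\<in>?g ` F. cmod (C k) * w k)"
      using inj F(2) by (subst sum.reindex) (auto simp: sum_distrib_left intro: inj_on_subset)
    also have "\<dots> \<le> cmod (x ! q) * s" by (intro mult_left_mono s) (use F in \<open>auto simp: I_def\<close>)
    finally show ?thesis .
  qed
  have van_dn: "vanishing_at x (dn C)" if "vanishing_at x C" for C
    unfolding vanishing_at_def
  proof (intro allI impI)
    fix k :: "int list" and i
    assume k: "length k = length x" "i < length x" "x ! i = 0" "dn C k \<noteq> 0"
    then have "k[p := k ! p - 1] ! i < 0" "i \<noteq> p"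
      using that xp unfolding vanishing_at_def dn_def by auto
    then show "k ! i < 0" by auto
  qed
  have van_U: "vanishing_at x (U C)" if "vanishing_at x C" for C
    using van_dn[OF that] van_dn[OF vanishing_at_shift[OF that, of q]]
    unfolding vanishing_at_def U_def by fastforce
  have U: "U (\<lambda>k. C k - D k) = (\<lambda>k. U C k - U D k)" for C D
    by (simp add: U_def dn_def shift_def fun_eq_iff algebra_simps)
  have van_B: "vanishing_at x B"
    using van van_U[OF van] unfolding vanishing_at_def B_def by fastforce
  have U0: "(U ^^ j) A k = 0"
    if "\<And>c. c \<le> j \<Longrightarrow> (c1 = 0 \<longrightarrow> c = 0) \<Longrightarrow> A (k[p := k ! p - int j, q := k ! q + int c]) = 0" "k \<in> I" for j k
    using that
  proof (induction j arbitrary: k)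
    case 0
    from 0(1)[of 0] show ?case using 0(2) pq by (simp add: I_def)
  next
    case (Suc j)
    let ?k1 = "k[p := k ! p - 1]" let ?k2 = "?k1[q := ?k1 ! q + 1]"
    have len: "length k = N" using Suc.prems by (simp add: I_def)
    have 1: "(U ^^ j) A ?k1 = 0"
    proof (rule Suc.IH)
      fix c assume "c \<le> j" "c1 = 0 \<longrightarrow> c = 0"
      then have "A (k[p := k ! p - int (Suc j), q := k ! q + int c]) = 0" using Suc.prems(1) by auto
      moreover have "k[p := k ! p - int (Suc j), q := k ! q + int c] = ?k1[p := ?k1 ! p - int j, q := ?k1 ! q + int c]"
        using len pq \<open>p \<noteq> q\<close> by (intro nth_equalityI) (auto simp: nth_list_update)
      ultimately show "A (?k1[p := ?k1 ! p - int j, q := ?k1 ! q + int c]) = 0" by simp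
    qed (use len in \<open>simp add: I_def\<close>)
    have 2: "c1 * (U ^^ j) A ?k2 = 0"
    proof (cases "c1 = 0")
      case False
      have "(U ^^ j) A ?k2 = 0"
      proof (rule Suc.IH)
        fix c assume "c \<le> j" "c1 = 0 \<longrightarrow> c = 0"
        then have "A (k[p := k ! p - int (Suc j), q := k ! q + int (Suc c)]) = 0"
          using Suc.prems(1)[of "Suc c"] False by auto
        moreover have "k[p := k ! p - int (Suc j), q := k ! q + int (Suc c)] = ?k2[p := ?k2 ! p - int j, q := ?k2 ! q + int c]"
          using len pq \<open>p \<noteq> q\<close> by (intro nth_equalityI) (auto simp: nth_list_update)
        ultimately show "A (?k2[p := ?k2 ! p - int j, q := ?k2 ! q + int c]) = 0" by simp
      qed (use len in \<open>simp add: I_def\<close>)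
      then show ?thesis by simp
    qed simp
    have "(U ^^ Suc j) A k = c0 * dn ((U ^^ j) A) k + c1 * dn (shift q ((U ^^ j) A)) k"
      unfolding funpow.simps comp_def by (rule U_def)
    then show ?case using 1 2 by (simp add: dn_def shift_def)
  qed
  have sB: "laurent_sums B x (s / x ! p)"
  proof -
    have "((\<lambda>k. (\<lambda>k. x ! p * (B k * mon x k)) (k[p := k ! p + 1])) has_sum s) {k. length k = length x}"
    proof -
      have "x ! p * (B (k[p := k ! p + 1]) * mon x (k[p := k ! p + 1])) = lin_factor p q c0 c1 A k * mon x k"
        if "length k = length x" for k
      proof -
        have "mon x k = x ! p * mon x (k[p := k ! p + 1])"
          using that assms(1) xp by (intro mon_shift) auto
        moreover have "B (k[p := k ! p + 1]) = lin_factor p q c0 c1 A k"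
          using that pq by (simp add: B_def U_def dn_def shift_def lin_factor_def N_def algebra_simps)
        ultimately show ?thesis by simp
      qed
      then show ?thesis using sums unfolding laurent_sums_iff by (subst has_sum_cong) auto
    qed
    then have "((\<lambda>k. x ! p * (B k * mon x k)) has_sum s) {k. length k = length x}"
      unfolding has_sum_reindex_bij_betw[OF bij_shift[OF assms(1)], where f = "\<lambda>k. x ! p * (B k * mon x k)"] .
    then have "((\<lambda>k. inverse (x ! p) * (x ! p * (B k * mon x k))) has_sum inverse (x ! p) * s) {k. length k = length x}"
      by (rule has_sum_cmult_right)
    then show ?thesis unfolding laurent_sums_iff using xp by (simp add: field_simps)
  qed
  then have "(\<lambda>k. B k * mon x k) summable_on I"
    unfolding laurent_sums_iff I_def N_def by (rule has_sum_imp_summable)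
  then have "(\<lambda>k. norm (B k * mon x k)) summable_on I"
    unfolding summable_on_iff_abs_summable_on_complex .
  then have "bdd_above (sum (\<lambda>k. cmod (B k * mon x k)) ` {F. F \<subseteq> I \<and> finite F})"
    unfolding abs_summable_iff_bdd_above .
  then obtain sb where "\<forall>t\<in>sum (\<lambda>k. cmod (B k * mon x k)) ` {F. F \<subseteq> I \<and> finite F}. t \<le> sb"
    unfolding bdd_above_def by blast
  then have sb: "(\<Sum>k\<in>F. cmod (B k) * w k) \<le> sb" if "finite F" "F \<subseteq> I" for F
    using that by (simp add: w_def norm_mult)
  have "(\<Sum>k\<in>F. cmod (A k) * w k) \<le> sb / (1 - \<theta>)" if F: "finite F" "F \<subseteq> I" for F
  proof (rule neumann_bound[where U = U and B = B and P = "vanishing_at x" and I = I])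
    show "\<exists>J. \<forall>j\<ge>J. (U ^^ j) A k = 0" if "k \<in> I" for k
    proof -
      obtain J where "\<forall>j\<ge>J. \<forall>c\<le>j. (c1 = 0 \<longrightarrow> c = 0) \<longrightarrow> A (k[p := k ! p - int j, q := k ! q + int c]) = 0"
        using trunc unfolding trunc_factor_def by blast
      then show ?thesis by (intro exI[of _ J] allI impI U0 that) auto
    qed
    fix C t F assume C: "vanishing_at x C" and t: "\<And>F. finite F \<Longrightarrow> F \<subseteq> I \<Longrightarrow> (\<Sum>k\<in>F. cmod (C k) * w k) \<le> t"
      and F: "finite F" "F \<subseteq> I"
    have "(\<Sum>k\<in>F. cmod (U C k) * w k) \<le> (\<Sum>k\<in>F. cmod c0 * (cmod (dn C k) * w k) + cmod c1 * (cmod (dn (shift q C) k) * w k))"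
    proof (rule sum_mono)
      fix k
      have "cmod (U C k) \<le> cmod c0 * cmod (dn C k) + cmod c1 * cmod (dn (shift q C) k)"
        unfolding U_def by (metis norm_mult norm_triangle_ineq)
      then have "cmod (U C k) * w k \<le> (cmod c0 * cmod (dn C k) + cmod c1 * cmod (dn (shift q C) k)) * w k"
        by (intro mult_right_mono) (auto simp: w_def)
      then show "cmod (U C k) * w k \<le> cmod c0 * (cmod (dn C k) * w k) + cmod c1 * (cmod (dn (shift q C) k) * w k)"
        by (simp add: algebra_simps)
    qed
    also have "\<dots> = cmod c0 * (\<Sum>k\<in>F. cmod (dn C k) * w k) + cmod c1 * (\<Sum>k\<in>F. cmod (dn (shift q C) k) * w k)"
      by (simp add: sum.distrib sum_distrib_left)
    also have "\<dots> \<le> cmod c0 * (t / cmod (x ! p)) + cmod c1 * ((cmod (x ! q) * t) / cmod (x ! p))"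
      by (intro add_mono mult_left_mono bdn bsh t F C) auto
    also have "\<dots> = \<theta> * t" by (simp add: \<theta>_def add_divide_distrib algebra_simps)
    finally show "(\<Sum>k\<in>F. cmod (U C k) * w k) \<le> \<theta> * t" .
  qed (use van_B van_U U sb F \<theta> in \<open>auto simp: w_def B_def fun_eq_iff\<close>)
  then have "(\<lambda>k. norm (A k * mon x k)) summable_on I"
    unfolding abs_summable_iff_bdd_above by (intro bdd_aboveI2[where M = "sb / (1 - \<theta>)"]) (auto simp: norm_mult w_def)
  then have "(\<lambda>k. A k * mon x k) summable_on I" by (rule abs_summable_summable)
  then have sA: "laurent_sums A x (\<Sum>\<^sub>\<infinity>k\<in>I. A k * mon x k)"
    unfolding laurent_sums_iff I_def N_def by (rule has_sum_infsum)
  \<comment> \<open>The value is identified only now: with \<open>A\<close> known to be summable,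
    applying the factor to its sum must reproduce \<open>s\<close>.\<close>
  define S where "S = (\<Sum>\<^sub>\<infinity>k\<in>I. A k * mon x k)"
  have "laurent_sums (\<lambda>k. shift p A k + ((- c0) * A k + (- c1) * shift q A k)) x (x ! p * S + ((- c0) * S + (- c1) * (x ! q * S)))"
    by (intro laurent_sums_add laurent_sums_scale laurent_sums_shift sA[folded S_def])
      (use assms(1,2) van xp in \<open>auto simp: vanishing_at_def\<close>)
  also have "(\<lambda>k. shift p A k + ((- c0) * A k + (- c1) * shift q A k)) = lin_factor p q c0 c1 A"
    by (simp add: lin_factor_def fun_eq_iff)
  finally have "s = x ! p * S + ((- c0) * S + (- c1) * (x ! q * S))"
    by (rule laurent_sums_unique[OF sums])
  then have "s = (x ! p - c0 - c1 * x ! q) * S" by (simp add: algebra_simps)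
  moreover have "x ! p - c0 - c1 * x ! q \<noteq> 0"
  proof
    assume "x ! p - c0 - c1 * x ! q = 0"
    then have "x ! p = c0 + c1 * x ! q" by (simp add: algebra_simps)
    then have "cmod (x ! p) \<le> cmod c0 + cmod c1 * cmod (x ! q)" by (metis norm_mult norm_triangle_ineq)
    then show False using less by simp
  qed
  ultimately have "s / (x ! p - c0 - c1 * x ! q) = S" by simp
  then show ?thesis using sA by (simp add: S_def)
qed

section \<open>Clearing denominators and the identity theorem for rational functions\<close>

section \<open>Rational functions\<close>

primrec psubst :: "(nat \<Rightarrow> pexp) \<Rightarrow> pexp \<Rightarrow> pexp" where
  "psubst \<sigma> (Var i) = \<sigma> i"
| "psubst \<sigma> (Con c) = Con c"
| "psubst \<sigma> (Add p q) = Add (psubst \<sigma> p) (psubst \<sigma> q)"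
| "psubst \<sigma> (Mul p q) = Mul (psubst \<sigma> p) (psubst \<sigma> q)"

lemma peval_psubst: "peval x (psubst \<sigma> e) = peval (\<lambda>i. peval x (\<sigma> i)) e"
  by (induction e) auto

lemma opr_psubst: "opr v (psubst \<sigma> e) = opr (\<lambda>i. opr v (\<sigma> i)) e"
  by (induction e) auto

primrec pprod :: "pexp list \<Rightarrow> pexp" where
  "pprod [] = Con 1"
| "pprod (p # ps) = Mul p (pprod ps)"

lemma peval_pprod: "peval x (pprod ps) = prod_list (map (peval x) ps)"
  by (induction ps) auto

lemma polynomial_fun_pexp:
  assumes "polynomial_fun n P"
  obtains e where "\<And>z. length z = n \<Longrightarrow> P z = peval (ev z) e"
proof -
  from assms obtain S c where S: "finite S" "S \<subseteq> {a :: nat list. length a = n}"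
    "\<And>z. length z = n \<Longrightarrow> P z = (\<Sum>a\<in>S. c a * prod_list (map2 (^) z a))"
    unfolding polynomial_fun_def by blast
  have "\<exists>e. \<forall>z. length z = n \<longrightarrow> (\<Sum>a\<in>T. c a * prod_list (map2 (^) z a)) = peval (ev z) e" if "T \<subseteq> S" for T
    using finite_subset[OF that S(1)] that
  proof (induction T)
    case empty
    then show ?case by (intro exI[of _ "Con 0"]) simp
  next
    case (insert a T)
    then obtain e where e: "\<And>z. length z = n \<Longrightarrow> (\<Sum>a\<in>T. c a * prod_list (map2 (^) z a)) = peval (ev z) e"
      by auto
    let ?m = "pprod (map (\<lambda>i. ppow (Var i) (a ! i)) [0..<n])"
    have "prod_list (map2 (^) z a) = peval (ev z) ?m" if "length z = n" for z
    proof -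
      have "length a = n" using insert S by auto
      then have "prod_list (map2 (^) z a) = (\<Prod>i<n. (z ! i) ^ (a ! i))"
        using that by (simp add: prod.list_conv_set_nth atLeast0LessThan)
      also have "\<dots> = peval (ev z) ?m"
        using that by (simp add: peval_pprod prod.list_conv_set_nth atLeast0LessThan ev_def)
      finally show ?thesis .
    qed
    then show ?case using insert e by (intro exI[of _ "Add (Mul (Con (c a)) ?m) e"]) simp
  qed
  from this[OF order_refl] S(3) that show thesis by metis
qed

lemma powi_nat_diff: "x \<noteq> 0 \<Longrightarrow> x powi a * x ^ nat (- a) = x ^ nat a" for x :: complex
  by (cases "a \<ge> 0") (auto simp: power_int_def power_inverse)

lemma config_nth_neq: "z \<in> config n \<Longrightarrow> i < j \<Longrightarrow> j < n \<Longrightarrow> z ! i - z ! j \<noteq> 0"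
  unfolding config_def by (auto simp: nth_eq_iff_index_eq)

lemma diag_prod_nonzero: "z \<in> config n \<Longrightarrow> diag_prod n p z \<noteq> 0"
proof -
  assume z: "z \<in> config n"
  have "finite {(i, j). i < j \<and> j < n}" by (rule finite_subset[of _ "{..<n} \<times> {..<n}"]) auto
  then show ?thesis
    unfolding diag_prod_def using config_nth_neq[OF z] by (auto simp: power_int_not_zero)
qed

text \<open>The exponents are integers of either sign. Negative ones are moved into the polynomial
  \<open>N\<close>; the rest is a list of linear factors with multiplicity, since the factors will
  be inverted one at a time.\<close>

lemma diag_prod_clear:
  obtains ds N where "\<And>i l. (i, l) \<in> set ds \<Longrightarrow> i < l \<and> l < n"
    and "\<And>z. z \<in> config n \<Longrightarrow> diag_prod n p z * peval (ev z) N = (\<Prod>(i, l)\<leftarrow>ds. z ! i - z ! l)"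
proof -
  define X where "X = {(i, j). i < j \<and> j < n}"
  have fin: "finite X" by (rule finite_subset[of _ "{..<n} \<times> {..<n}"]) (auto simp: X_def)
  have "\<exists>ds N. set ds \<subseteq> X \<and>
     (\<forall>z\<in>config n. (\<Prod>(i, j)\<in>T. (z ! i - z ! j) powi p i j) * peval (ev z) N = (\<Prod>(i, l)\<leftarrow>ds. z ! i - z ! l))"
    if "T \<subseteq> X" for T
    using finite_subset[OF that fin] that
  proof (induction T)
    case empty
    then show ?case by (intro exI[of _ "[]"] exI[of _ "Con 1"]) simp
  next
    case (insert t T)
    then have "\<exists>ds N. set ds \<subseteq> X \<and>
       (\<forall>z\<in>config n. (\<Prod>(i, j)\<in>T. (z ! i - z ! j) powi p i j) * peval (ev z) N = (\<Prod>(i, l)\<leftarrow>ds. z ! i - z ! l))"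
      by simp
    then obtain ds N where IH: "set ds \<subseteq> X"
      "\<forall>z\<in>config n. (\<Prod>(i, j)\<in>T. (z ! i - z ! j) powi p i j) * peval (ev z) N = (\<Prod>(i, l)\<leftarrow>ds. z ! i - z ! l)"
      by blast
    obtain i j where t: "t = (i, j)" "i < j" "j < n" using insert by (auto simp: X_def)
    let ?N = "Mul (ppow (Sub (Var i) (Var j)) (nat (- p i j))) N"
    let ?ds = "replicate (nat (p i j)) (i, j) @ ds"
    have "(\<Prod>(i, j)\<in>insert t T. (z ! i - z ! j) powi p i j) * peval (ev z) ?N = (\<Prod>(i, l)\<leftarrow>?ds. z ! i - z ! l)"
      if z: "z \<in> config n" for z
    proof -
      let ?x = "z ! i - z ! j"
      have "(\<Prod>(i, j)\<in>insert t T. (z ! i - z ! j) powi p i j) * peval (ev z) ?N =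
        (?x powi p i j * ?x ^ nat (- p i j)) * ((\<Prod>(i, j)\<in>T. (z ! i - z ! j) powi p i j) * peval (ev z) N)"
        using insert.hyps t z by (simp add: ev_def config_def mult_ac)
      also have "\<dots> = (\<Prod>(i, l)\<leftarrow>?ds. z ! i - z ! l)"
        using IH(2)[rule_format, OF z] powi_nat_diff[OF config_nth_neq[OF z t(2,3)]] by (simp add: prod_list_replicate)
      finally show ?thesis .
    qed
    then show ?case using IH(1) t by (intro exI[of _ ?ds] exI[of _ ?N]) (auto simp: X_def)
  qed
  from this[OF order_refl] that show thesis
    unfolding diag_prod_def X_def by fast
qed

lemma rational_diag_clear:
  assumes "rational_diag n R"
  obtains ds e where "\<And>i l. (i, l) \<in> set ds \<Longrightarrow> i < l \<and> l < n"
    and "\<And>z. z \<in> config n \<Longrightarrow> (\<Prod>(i, l)\<leftarrow>ds. z ! i - z ! l) * R z = peval (ev z) e"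
proof -
  from assms obtain P p where P: "polynomial_fun n P" "\<And>z. z \<in> config n \<Longrightarrow> R z = P z / diag_prod n p z"
    unfolding rational_diag_def by blast
  obtain e where e: "\<And>z. length z = n \<Longrightarrow> P z = peval (ev z) e" using polynomial_fun_pexp[OF P(1)] by blast
  obtain ds N where ds: "\<And>i l. (i, l) \<in> set ds \<Longrightarrow> i < l \<and> l < n"
    "\<And>z. z \<in> config n \<Longrightarrow> diag_prod n p z * peval (ev z) N = (\<Prod>(i, l)\<leftarrow>ds. z ! i - z ! l)"
    by (rule diag_prod_clear[of n p]) (rule that)
  show thesis
  proof
    fix z assume z: "z \<in> config n"
    show "(\<Prod>(i, l)\<leftarrow>ds. z ! i - z ! l) * R z = peval (ev z) (Mul N e)"
      using diag_prod_nonzero[OF z] e[of z] z by (simp add: ds(2)[OF z, symmetric] P(2) config_def)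
  qed (use ds(1) in blast)
qed

text \<open>One exponent serves all three factors and may be enlarged at will: the axioms give
  unrelated pole orders for different functions, which must later be matched.\<close>

lemma rational_diag0_clear:
  assumes "rational_diag0 2 R"
  obtains N0 where "\<And>N. N \<ge> N0 \<Longrightarrow> \<exists>e. \<forall>z1 z2. z1 \<noteq> 0 \<longrightarrow> z2 \<noteq> 0 \<longrightarrow> z1 \<noteq> z2 \<longrightarrow>
    z1 ^ N * (z2 ^ N * (z1 - z2) ^ N) * R [z1, z2] = peval (ev [z1, z2]) e"
proof -
  from assms obtain P p q where P: "polynomial_fun 2 P"
    "\<And>z. z \<in> config 2 \<Longrightarrow> 0 \<notin> set z \<Longrightarrow> R z = P z / ((\<Prod>i<2. (z ! i) powi q i) * diag_prod 2 p z)"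
    unfolding rational_diag0_def by blast
  obtain e where e: "\<And>z. length z = 2 \<Longrightarrow> P z = peval (ev z) e" using polynomial_fun_pexp[OF P(1)] by blast
  have set2: "{(i, j). i < j \<and> j < 2} = {(0, 1 :: nat)}" by auto
  have pow: "x ^ N = x powi a * x ^ nat (int N - a)" if "x \<noteq> 0" "a \<le> int N" for x :: complex and a N
  proof -
    have "x ^ N = x powi (a + (int N - a))" by simp
    also have "\<dots> = x powi a * x powi (int N - a)" using that by (intro power_int_add) auto
    also have "x powi (int N - a) = x ^ nat (int N - a)" using that by (simp add: power_int_def)
    finally show ?thesis .
  qed
  define N0 where "N0 = nat (max (q 0) (max (q 1) (p 0 1)))"
  show thesis
  proof
    fix N assume "N \<ge> N0"
    then have N: "q 0 \<le> int N" "q 1 \<le> int N" "p 0 1 \<le> int N" unfolding N0_def by auto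
    let ?M = "Mul (ppow (Var 0) (nat (int N - q 0))) (Mul (ppow (Var 1) (nat (int N - q 1))) (ppow (Sub (Var 0) (Var 1)) (nat (int N - p 0 1))))"
    have "z1 ^ N * (z2 ^ N * (z1 - z2) ^ N) * R [z1, z2] = peval (ev [z1, z2]) (Mul ?M e)"
      if z: "z1 \<noteq> 0" "z2 \<noteq> 0" "z1 \<noteq> z2" for z1 z2
    proof -
      have z12: "z1 - z2 \<noteq> 0" using z by simp
      have "R [z1, z2] = peval (ev [z1, z2]) e / (z1 powi q 0 * z2 powi q 1 * (z1 - z2) powi p 0 1)"
        using P(2)[of "[z1, z2]"] z e[of "[z1, z2]"]
        by (simp add: config_def diag_prod_def set2 lessThan_Suc numeral_2_eq_2[symmetric])
          (simp add: numeral_2_eq_2 lessThan_Suc)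
      then show ?thesis
        unfolding pow[OF z(1) N(1)] pow[OF z(2) N(2)] pow[OF z12 N(3)] using z by simp
    qed
    then show "\<exists>e. \<forall>z1 z2. z1 \<noteq> 0 \<longrightarrow> z2 \<noteq> 0 \<longrightarrow> z1 \<noteq> z2 \<longrightarrow>
      z1 ^ N * (z2 ^ N * (z1 - z2) ^ N) * R [z1, z2] = peval (ev [z1, z2]) e" by blast
  qed
qed

lemma peval_line:
  assumes "length z0 = length z"
  shows "\<exists>q. \<forall>t. peval (ev (map2 (\<lambda>a b. a + t * (b - a)) z0 z)) e = poly q t"
proof (induction e)
  case (Var i)
  show ?case using assms
    by (cases "i < length z") (auto simp: ev_def intro: exI[of _ "[:z0 ! i, z ! i - z0 ! i:]"] exI[of _ 0])
next
  case (Con c)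
  show ?case by (rule exI[of _ "[:c:]"]) simp
next
  case (Add p q)
  then obtain p' q' where "\<forall>t. peval (ev (map2 (\<lambda>a b. a + t * (b - a)) z0 z)) p = poly p' t"
    "\<forall>t. peval (ev (map2 (\<lambda>a b. a + t * (b - a)) z0 z)) q = poly q' t" by blast
  then show ?case by (intro exI[of _ "p' + q'"]) simp
next
  case (Mul p q)
  then obtain p' q' where "\<forall>t. peval (ev (map2 (\<lambda>a b. a + t * (b - a)) z0 z)) p = poly p' t"
    "\<forall>t. peval (ev (map2 (\<lambda>a b. a + t * (b - a)) z0 z)) q = poly q' t" by blast
  then show ?case by (intro exI[of _ "p' * q'"]) simp
qed

definition near :: "real \<Rightarrow> complex list \<Rightarrow> complex list set" where
  "near \<epsilon> z0 = {z. length z = length z0 \<and> (\<forall>i<length z0. cmod (z ! i - z0 ! i) < \<epsilon>)}"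

text \<open>Along the segment from \<open>z0\<close> towards \<open>z\<close> the expression is a
  polynomial in t with infinitely many zeros near t = 0, hence it also vanishes at t = 1.\<close>

lemma peval_vanish:
  assumes "\<epsilon> > 0" "\<And>z. z \<in> near \<epsilon> z0 \<Longrightarrow> peval (ev z) e = 0" "length z = length z0"
  shows "peval (ev z) e = 0"
proof -
  define L where "L t = map2 (\<lambda>a b. a + t * (b - a)) z0 z" for t :: complex
  obtain q where q: "\<And>t. peval (ev (L t)) e = poly q t"
    using peval_line[of z0 z e] assms(3) by (auto simp: L_def)
  define M where "M = Max (insert 1 ((\<lambda>i. cmod (z ! i - z0 ! i)) ` {..<length z0}))"
  have M: "cmod (z ! i - z0 ! i) \<le> M" if "i < length z0" for i
    unfolding M_def using that by (intro Max_ge) auto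
  have "M \<ge> 1" unfolding M_def by (intro Max_ge) auto
  have "poly q (of_real t) = 0" if t: "0 < t" "t < \<epsilon> / M" for t
  proof -
    have "L (of_real t) \<in> near \<epsilon> z0"
      unfolding near_def
    proof (intro CollectI conjI allI impI)
      fix i assume i: "i < length z0"
      have "cmod (L (of_real t) ! i - z0 ! i) = t * cmod (z ! i - z0 ! i)"
        using i assms(3) t by (simp add: L_def norm_mult)
      also have "\<dots> \<le> t * M" using M[OF i] t by (intro mult_left_mono) auto
      also have "\<dots> < \<epsilon>" using t \<open>M \<ge> 1\<close> by (simp add: field_simps)
      finally show "cmod (L (of_real t) ! i - z0 ! i) < \<epsilon>" .
    qed (use assms(3) in \<open>simp add: L_def\<close>)
    then show ?thesis using q[symmetric] assms(2) by metis
  qed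
  then have "of_real ` {0<..<\<epsilon> / M} \<subseteq> {t. poly q t = 0}" by auto
  moreover have "infinite (complex_of_real ` {0<..<\<epsilon> / M})"
    using assms(1) \<open>M \<ge> 1\<close> by (subst finite_image_iff) (auto simp: inj_on_def)
  ultimately have "infinite {t. poly q t = 0}" using finite_subset by blast
  then have "q = 0" using poly_roots_finite by blast
  moreover have "L 1 = z" using assms(3) by (auto simp: L_def intro!: nth_equalityI)
  ultimately show ?thesis using q[of 1] by simp
qed

lemma rational_diag_identity:
  assumes R: "rational_diag n R" "rational_diag n R'"
    and "\<epsilon> > 0" "length z0 = n" and eq: "\<And>z. z \<in> near \<epsilon> z0 \<Longrightarrow> z \<in> config n \<Longrightarrow> R z = R' z"
    and z: "z \<in> config n"
  shows "R z = R' z"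
proof -
  obtain ds e where 1: "\<And>i l. (i, l) \<in> set ds \<Longrightarrow> i < l \<and> l < n"
    "\<And>z. z \<in> config n \<Longrightarrow> (\<Prod>(i, l)\<leftarrow>ds. z ! i - z ! l) * R z = peval (ev z) e"
    by (rule rational_diag_clear[OF R(1)]) (rule that)
  obtain ds' e' where 2: "\<And>i l. (i, l) \<in> set ds' \<Longrightarrow> i < l \<and> l < n"
    "\<And>z. z \<in> config n \<Longrightarrow> (\<Prod>(i, l)\<leftarrow>ds'. z ! i - z ! l) * R' z = peval (ev z) e'"
    by (rule rational_diag_clear[OF R(2)]) (rule that)
  have pd: "\<exists>D. \<forall>z. length z = n \<longrightarrow> peval (ev z) D = (\<Prod>(i, l)\<leftarrow>ds. z ! i - z ! l)"
    if "\<And>i l. (i, l) \<in> set ds \<Longrightarrow> i < l \<and> l < n" for ds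
  proof (intro exI[of _ "pprod (map (\<lambda>(i, l). Sub (Var i) (Var l)) ds)"] allI impI)
    fix z :: "complex list" assume "length z = n"
    then show "peval (ev z) (pprod (map (\<lambda>(i, l). Sub (Var i) (Var l)) ds)) = (\<Prod>(i, l)\<leftarrow>ds. z ! i - z ! l)"
      unfolding peval_pprod map_map using that
      by (intro arg_cong[of _ _ prod_list] map_cong) (fastforce simp: ev_def)+
  qed
  obtain D where D: "\<And>z. length z = n \<Longrightarrow> peval (ev z) D = (\<Prod>(i, l)\<leftarrow>ds. z ! i - z ! l)" using pd[OF 1(1)] by blast
  obtain D' where D': "\<And>z. length z = n \<Longrightarrow> peval (ev z) D' = (\<Prod>(i, l)\<leftarrow>ds'. z ! i - z ! l)" using pd[OF 2(1)] by blast
  have nz: "(\<Prod>(i, l)\<leftarrow>ds. z ! i - z ! l) \<noteq> 0"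
    if "\<And>i l. (i, l) \<in> set ds \<Longrightarrow> i < l \<and> l < n" "z \<in> config n" for ds z
    using config_nth_neq[OF that(2)] that(1) by (fastforce simp: prod_list_zero_iff)
  \<comment> \<open>The product of all z_i - z_j with i < j. The hypothesis is silent on the
    diagonals, so the polynomial identity is multiplied by \<open>V\<close>, which vanishes there,
    and \<open>V\<close> is divided out at the end.\<close>
  define V where "V = pprod (map (\<lambda>(i, l). Sub (Var i) (Var l)) (filter (\<lambda>(i, l). i < l) (List.product [0..<n] [0..<n])))"
  have V: "peval (ev z) V = 0" if "z \<notin> config n" "length z = n" for z
  proof -
    from that obtain i j where ij: "i < n" "j < n" "i \<noteq> j" "z ! i = z ! j"
      unfolding config_def distinct_conv_nth by auto
    have "\<exists>a b. a < b \<and> b < n \<and> z ! a = z ! b" using ij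
    proof (cases "i < j")
      case False
      then have "j < i" using ij by simp
      then show ?thesis using ij by metis
    qed blast
    then obtain a b where "a < b" "b < n" "z ! a = z ! b" by blast
    then have "(a, b) \<in> set (filter (\<lambda>(i, l). i < l) (List.product [0..<n] [0..<n]))"
      and "0 = peval (ev z) (case (a, b) of (i, l) \<Rightarrow> Sub (Var i) (Var l))"
      using that by auto
    then show ?thesis unfolding V_def peval_pprod prod_list_zero_iff set_map by blast
  qed
  have "peval (ev z) (Mul V (Sub (Mul D' e) (Mul D e'))) = 0"
  proof (rule peval_vanish[OF assms(3)])
    fix z assume z: "z \<in> near \<epsilon> z0"
    then have len: "length z = n" using assms(4) by (simp add: near_def)
    show "peval (ev z) (Mul V (Sub (Mul D' e) (Mul D e'))) = 0"
    proof (cases "z \<in> config n")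
      case True
      then show ?thesis using eq[OF z True] 1(2)[OF True] 2(2)[OF True] D[OF len] D'[OF len]
        by (metis (no_types, lifting) diff_self mult.left_commute mult_zero_right peval.simps(4) peval_Sub)
    qed (use V len in simp)
  qed (use z assms(4) in \<open>auto simp: config_def\<close>)
  moreover have "peval (ev z) V \<noteq> 0"
    unfolding V_def peval_pprod prod_list_zero_iff using config_nth_neq[OF z] z
    by (fastforce simp: ev_def config_def)
  moreover have len: "length z = n" using z by (simp add: config_def)
  ultimately have "peval (ev z) D' * peval (ev z) e = peval (ev z) D * peval (ev z) e'" by simp
  then show ?thesis
    unfolding D[OF len] D'[OF len] 1(2)[OF z, symmetric] 2(2)[OF z, symmetric]
    using nz[OF 1(1) z] nz[OF 2(1) z] by simp
qed


subsection \<open>Freezing the last variables\<close>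

definition pspec :: "nat \<Rightarrow> complex list \<Rightarrow> pexp \<Rightarrow> pexp" where
  "pspec m y = psubst (\<lambda>i. if i < m then Var i else Con (ev y (i - m)))"

lemma peval_pspec:
  assumes "length x = m" shows "peval (ev x) (pspec m y e) = peval (ev (x @ y)) e"
proof -
  have "(\<lambda>i. peval (ev x) (if i < m then Var i else Con (ev y (i - m)))) = ev (x @ y)"
    using assms by (auto simp: ev_def nth_append fun_eq_iff)
  then show ?thesis by (simp add: pspec_def peval_psubst)
qed

text \<open>\<open>Inl\<close> refers to another free variable, \<open>Inr\<close> to the value of a
  frozen one.\<close>

primrec pfac :: "nat \<times> (nat + complex) \<Rightarrow> pexp" where
  "pfac (i, t) = Sub (Var i) (case t of Inl l \<Rightarrow> Var l | Inr c \<Rightarrow> Con c)"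

definition valid_fac :: "nat \<Rightarrow> complex set \<Rightarrow> nat \<times> (nat + complex) \<Rightarrow> bool" where
  "valid_fac m Y f \<longleftrightarrow> fst f < m \<and> (case snd f of Inl l \<Rightarrow> fst f < l \<and> l < m | Inr c \<Rightarrow> c \<in> Y)"

text \<open>Differences of two frozen variables are nonzero constants and go into the numerator.
  Every factor that is left contains a free variable.\<close>

lemma rational_diag_freeze:
  assumes "rational_diag (m + n) R" "length y = n" "distinct y"
  obtains fs e where "\<And>f. f \<in> set fs \<Longrightarrow> valid_fac m (set y) f"
    and "\<And>x. length x = m \<Longrightarrow> distinct (x @ y) \<Longrightarrow>
      peval (ev x) (pprod (map pfac fs)) * R (x @ y) = peval (ev x) e"
proof -
  obtain ds e where ds: "\<And>i l. (i, l) \<in> set ds \<Longrightarrow> i < l \<and> l < m + n"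
    "\<And>z. z \<in> config (m + n) \<Longrightarrow> (\<Prod>(i, l)\<leftarrow>ds. z ! i - z ! l) * R z = peval (ev z) e"
    by (rule rational_diag_clear[OF assms(1)]) (rule that)
  have "\<exists>fs C. C \<noteq> 0 \<and> (\<forall>f\<in>set fs. valid_fac m (set y) f) \<and>
      (\<forall>x. length x = m \<longrightarrow> (\<Prod>(i, l)\<leftarrow>ds. (x @ y) ! i - (x @ y) ! l) = C * peval (ev x) (pprod (map pfac fs)))"
    using ds(1)
  proof (induction ds)
    case Nil
    show ?case by (intro exI[of _ "[]"] exI[of _ 1]) simp
  next
    case (Cons d ds)
    then obtain fs C where IH: "C \<noteq> 0" "\<forall>f\<in>set fs. valid_fac m (set y) f"
      "\<And>x. length x = m \<Longrightarrow> (\<Prod>(i, l)\<leftarrow>ds. (x @ y) ! i - (x @ y) ! l) = C * peval (ev x) (pprod (map pfac fs))"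
      by (metis list.set_intros(2))
    obtain i l where d: "d = (i, l)" by (cases d)
    have il: "i < l" "l < m + n" using Cons.prems[of i l] d by auto
    consider "l < m" | "i < m" "m \<le> l" | "m \<le> i" by linarith
    then show ?case
    proof cases
      case 1
      then show ?thesis using IH il
        by (intro exI[of _ "(i, Inl l) # fs"] exI[of _ C]) (auto simp: d valid_fac_def nth_append)
    next
      case 2
      then show ?thesis using IH il assms(2)
        by (intro exI[of _ "(i, Inr (y ! (l - m))) # fs"] exI[of _ C])
          (auto simp: d valid_fac_def nth_append)
    next
      case 3
      then have "y ! (i - m) \<noteq> y ! (l - m)" using il assms(2,3) by (simp add: nth_eq_iff_index_eq)
      then show ?thesis using IH il 3
        by (intro exI[of _ fs] exI[of _ "(y ! (i - m) - y ! (l - m)) * C"]) (auto simp: d nth_append)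
    qed
  qed
  then obtain fs C where fs: "C \<noteq> 0" "\<forall>f\<in>set fs. valid_fac m (set y) f"
    "\<And>x. length x = m \<Longrightarrow> (\<Prod>(i, l)\<leftarrow>ds. (x @ y) ! i - (x @ y) ! l) = C * peval (ev x) (pprod (map pfac fs))"
    by blast
  show thesis
  proof
    fix x assume x: "length x = m" "distinct (x @ y)"
    then have "x @ y \<in> config (m + n)" using assms(2) by (simp add: config_def)
    from ds(2)[OF this] show "peval (ev x) (pprod (map pfac fs)) * R (x @ y) = peval (ev x) (Mul (Con (1 / C)) (pspec m y e))"
      using fs(1) x(1) by (simp add: fs(3) peval_pspec field_simps)
  qed (use fs(2) in blast)
qed


section \<open>Replacing the variables z_i by \<zeta> + t_i one at a time\<close>

section \<open>Passing from products to iterates\<close>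

text \<open>
  A family \<open>A\<close> at \<open>(e, \<kappa>)\<close> is a coefficient with modes \<open>e\<close> in the first variables and total mode \<open>\<kappa>\<close>,
  so that the mode in the remaining variable \<open>\<zeta>\<close> is \<open>\<kappa> - sum_list e\<close>. At stage \<open>r\<close> the variable \<open>i\<close>
  stands for \<open>z\<^sub>i\<close> if \<open>i < r\<close>, and otherwise for \<open>\<zeta> + t\<^sub>i\<close>.
\<close>

type_synonym marray = "int list \<times> int \<Rightarrow> complex"

text \<open>Both summands raise \<kappa>, since it counts the modes of all variables: multiplication
  by \<zeta> leaves \<open>e\<close> alone, multiplication by the i-th variable leaves the mode
  \<open>\<kappa> - sum_list e\<close> of \<zeta> alone.\<close>

definition stage_var :: "nat \<Rightarrow> nat \<Rightarrow> nat \<Rightarrow> marray \<Rightarrow> marray" where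
  "stage_var m r i A = (\<lambda>(e, \<kappa>). if i < r then A (e[i := e ! i + 1], \<kappa> + 1)
     else if i < m then A (e, \<kappa> + 1) + A (e[i := e ! i + 1], \<kappa> + 1) else 0)"

text \<open>The constant 1: the m modes in \<open>e\<close> and the mode of \<zeta> are all
  \<open>-1\<close>, which gives the total \<open>- m - 1\<close>.\<close>

definition stage_unit :: "nat \<Rightarrow> marray" where
  "stage_unit m = (\<lambda>(e, \<kappa>). if e = replicate m (-1) \<and> \<kappa> = - int m - 1 then 1 else 0)"

text \<open>With \<kappa> fixed, raising the mode r lowers that of \<zeta>. Such a line is a series
  in z_r / \<zeta> for \<open>A\<close> and in t_r / \<zeta> = z_r / \<zeta> - 1 for
  \<open>B\<close>, the setting of the one-variable pairs.\<close>

definition line_rel :: "((int \<Rightarrow> complex) \<Rightarrow> (int \<Rightarrow> complex) \<Rightarrow> bool) \<Rightarrow> nat \<Rightarrow> nat \<Rightarrow> marray \<Rightarrow> marray \<Rightarrow> bool" where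
  "line_rel \<rho> m r A B \<longleftrightarrow>
     (\<forall>e \<kappa>. length e = m \<longrightarrow> \<rho> (\<lambda>k. A (e[r := k], \<kappa>)) (\<lambda>k. B (e[r := k], \<kappa>)))"

text \<open>Consecutive stages treat only the variable r differently: on the line it is x for one
  and 1 + t for the other. All other variables combine parallel lines in the same way on both
  sides.\<close>

lemma line_rel_opr:
  assumes add: "\<And>\<alpha> \<beta> \<alpha>' \<beta>'. \<rho> \<alpha> \<beta> \<Longrightarrow> \<rho> \<alpha>' \<beta>' \<Longrightarrow> \<rho> (\<lambda>k. \<alpha> k + \<alpha>' k) (\<lambda>k. \<beta> k + \<beta>' k)"
    and scale: "\<And>c \<alpha> \<beta>. \<rho> \<alpha> \<beta> \<Longrightarrow> \<rho> (\<lambda>k. c * \<alpha> k) (\<lambda>k. c * \<beta> k)"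
    and x: "\<And>\<alpha> \<beta>. \<rho> \<alpha> \<beta> \<Longrightarrow> \<rho> (\<lambda>k. \<alpha> (k + 1)) (\<lambda>k. \<beta> k + \<beta> (k + 1))"
    and "r < m" and "line_rel \<rho> m r A B"
  shows "line_rel \<rho> m r (opr (stage_var m (Suc r)) e A) (opr (stage_var m r) e B)"
proof (rule opr_rel[of "line_rel \<rho> m r"])
  fix i A B assume R: "line_rel \<rho> m r A B"
  show "line_rel \<rho> m r (stage_var m (Suc r) i A) (stage_var m r i B)"
    unfolding line_rel_def
  proof (intro allI impI)
    fix e :: "int list" and \<kappa> :: int assume len: "length e = m"
    have R1: "\<rho> (\<lambda>k. A (e[r := k], \<kappa> + 1)) (\<lambda>k. B (e[r := k], \<kappa> + 1))"
      using R len unfolding line_rel_def by blast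
    have R2: "\<rho> (\<lambda>k. A ((e[i := e ! i + 1])[r := k], \<kappa> + 1)) (\<lambda>k. B ((e[i := e ! i + 1])[r := k], \<kappa> + 1))"
      using R len unfolding line_rel_def by simp
    consider "i < r" | "i = r" | "r < i" "i < m" | "m \<le> i" by linarith
    then show "\<rho> (\<lambda>k. stage_var m (Suc r) i A (e[r := k], \<kappa>)) (\<lambda>k. stage_var m r i B (e[r := k], \<kappa>))"
    proof cases
      case 1
      then have "(e[r := k])[i := e[r := k] ! i + 1] = (e[i := e ! i + 1])[r := k]" for k
        by (simp add: list_update_swap)
      then show ?thesis using R2 1 by (simp add: stage_var_def)
    next
      case 2
      then show ?thesis using x[OF R1] len \<open>r < m\<close> by (simp add: stage_var_def)
    next
      case 3
      then have "(e[r := k])[i := e[r := k] ! i + 1] = (e[i := e ! i + 1])[r := k]" for k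
        by (simp add: list_update_swap)
      then show ?thesis using add[OF R1 R2] 3 by (simp add: stage_var_def)
    next
      case 4
      then show ?thesis using scale[OF R1, of 0] \<open>r < m\<close> by (simp add: stage_var_def)
    qed
  qed
qed (use assms in \<open>auto simp: line_rel_def\<close>)

lemma stage_unit_poly_pair:
  assumes "r < m" shows "line_rel poly_pair m r (stage_unit m) (stage_unit m)"
  unfolding line_rel_def
proof (intro allI impI)
  fix e :: "int list" and \<kappa> :: int assume len: "length e = m"
  have iff: "e[r := k] = replicate m (-1) \<longleftrightarrow> e[r := -1] = replicate m (-1) \<and> k = -1" for k
  proof
    assume *: "e[r := k] = replicate m (-1)"
    then have "e[r := k] ! r = -1" using assms by simp
    then have "k = -1" using assms len by simp
    then show "e[r := -1] = replicate m (-1) \<and> k = -1" using * by simp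
  qed auto
  have "stage_unit m (e[r := k], \<kappa>) =
     (if e[r := -1] = replicate m (-1) \<and> \<kappa> = - int m - 1 then 1 else 0) * iota 1 k" for k
    unfolding stage_unit_def prod.case by (subst iff) (auto simp: iota_def)
  then show "poly_pair (\<lambda>k. stage_unit m (e[r := k], \<kappa>)) (\<lambda>k. stage_unit m (e[r := k], \<kappa>))"
    by (simp only: poly_pair_const)
qed

text \<open>Downward induction: if the multiple at stage r + 1 is that of a polynomial, its lines
  determine those at stage r, and re-expanding the polynomial is a solution.\<close>

lemma stage_chain:
  fixes c :: "nat \<Rightarrow> marray"
  assumes rel: "\<And>r. r < m \<Longrightarrow> line_rel assoc_pair m r (c (Suc r)) (c r)"
    and top: "\<And>e \<kappa>. length e = m \<Longrightarrow>
      opr (stage_var m m) D (c m) (e, \<kappa>) = opr (stage_var m m) N (stage_unit m) (e, \<kappa>)"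
    and "length e = m"
  shows "opr (stage_var m 0) D (c 0) (e, \<kappa>) = opr (stage_var m 0) N (stage_unit m) (e, \<kappa>)"
proof -
  have "\<forall>e \<kappa>. length e = m \<longrightarrow> opr (stage_var m r) D (c r) (e, \<kappa>) = opr (stage_var m r) N (stage_unit m) (e, \<kappa>)"
    if "r \<le> m" for r
    using that
  proof (induction r rule: inc_induct)
    case base
    then show ?case using top by blast
  next
    case (step r)
    show ?case
    proof (intro allI impI)
      fix e :: "int list" and \<kappa> :: int assume len: "length e = m"
      let ?A = "opr (stage_var m (Suc r)) D (c (Suc r))" and ?B = "opr (stage_var m r) D (c r)"
      let ?A' = "opr (stage_var m (Suc r)) N (stage_unit m)" and ?B' = "opr (stage_var m r) N (stage_unit m)"
      have "line_rel assoc_pair m r ?A ?B"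
        by (rule line_rel_opr) (use step rel in \<open>auto intro: assoc_pair_add assoc_pair_scale assoc_pair_x\<close>)
      then have 1: "assoc_pair (\<lambda>k. ?A (e[r := k], \<kappa>)) (\<lambda>k. ?B (e[r := k], \<kappa>))"
        using len unfolding line_rel_def by blast
      have "line_rel poly_pair m r ?A' ?B'"
        by (rule line_rel_opr)
          (use step stage_unit_poly_pair in \<open>auto intro: poly_pair_add poly_pair_scale poly_pair_x\<close>)
      then have 2: "poly_pair (\<lambda>k. ?A' (e[r := k], \<kappa>)) (\<lambda>k. ?B' (e[r := k], \<kappa>))"
        using len unfolding line_rel_def by blast
      have "(\<lambda>k. ?A (e[r := k], \<kappa>)) = (\<lambda>k. ?A' (e[r := k], \<kappa>))"
        using step len by simp
      then have "(\<lambda>k. ?B (e[r := k], \<kappa>)) = (\<lambda>k. ?B' (e[r := k], \<kappa>))"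
        using assoc_pair_unique[OF 1] 2 by simp
      from fun_cong[OF this, of "e ! r"] show "?B (e, \<kappa>) = ?B' (e, \<kappa>)" by simp
    qed
  qed
  then show ?thesis using assms(3) by blast
qed

lemma sum_list_update_int: "i < length e \<Longrightarrow> sum_list (e[i := x]) = sum_list e + x - e ! i" for x :: int
  by (induction e arbitrary: i) (auto split: nat.split)

text \<open>Before any replacement \<zeta> does not occur, so its mode
  \<open>\<kappa> - sum_list e\<close> has to be \<open>-1\<close>.\<close>

lemma stage_top:
  assumes "\<And>e \<kappa>. length e = m \<Longrightarrow> A (e, \<kappa>) = (if \<kappa> = sum_list e - 1 then a e else 0)" "length e = m"
  shows "opr (stage_var m m) D A (e, \<kappa>) = (if \<kappa> = sum_list e - 1 then opr (lvar m) D a e else 0)"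
proof -
  have "\<forall>e \<kappa>. length e = m \<longrightarrow> opr (stage_var m m) D A (e, \<kappa>) = (if \<kappa> = sum_list e - 1 then opr (lvar m) D a e else 0)"
  proof (rule opr_rel[of "\<lambda>A a. \<forall>e \<kappa>. length e = m \<longrightarrow> A (e, \<kappa>) = (if \<kappa> = sum_list e - 1 then a e else 0)"])
    fix i A and a :: "int list \<Rightarrow> complex"
    assume *: "\<forall>e \<kappa>. length e = m \<longrightarrow> A (e, \<kappa>) = (if \<kappa> = sum_list e - 1 then a e else 0)"
    show "\<forall>e \<kappa>. length e = m \<longrightarrow> stage_var m m i A (e, \<kappa>) = (if \<kappa> = sum_list e - 1 then lvar m i a e else 0)"
    proof (intro allI impI)
      fix e :: "int list" and \<kappa> :: int assume len: "length e = m"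
      have "sum_list (e[i := e ! i + 1]) = sum_list e + 1" if "i < m"
        using that len by (simp add: sum_list_update_int)
      then show "stage_var m m i A (e, \<kappa>) = (if \<kappa> = sum_list e - 1 then lvar m i a e else 0)"
        using * len by (cases "i < m") (auto simp: stage_var_def lvar_def shift_def)
    qed
  qed (use assms(1) in auto)
  then show ?thesis using assms(2) by blast
qed

section \<open>The two-variable axioms as formal identities\<close>

section \<open>Rational functions of two variables as pairs of expansions\<close>

type_synonym array2 = "int \<times> int \<Rightarrow> complex"

definition X0 :: "array2 \<Rightarrow> array2" where "X0 A = (\<lambda>(p, q). A (p + 1, q))"
definition X1 :: "array2 \<Rightarrow> array2" where "X1 A = (\<lambda>(p, q). A (p, q + 1))"
definition lin2 :: "complex \<Rightarrow> complex \<Rightarrow> array2 \<Rightarrow> array2" where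
  "lin2 c d A = (\<lambda>k. c * X0 A k + d * X1 A k)"
definition unit2 :: array2 where "unit2 = (\<lambda>(p, q). if p = -1 \<and> q = -1 then 1 else 0)"
definition vars2 :: "(array2 \<Rightarrow> array2) \<Rightarrow> (array2 \<Rightarrow> array2) \<Rightarrow> nat \<Rightarrow> array2 \<Rightarrow> array2" where
  "vars2 F G i = (if i = 0 then F else if i = 1 then G else (\<lambda>A k. 0))"
definition to2 :: "(int list \<Rightarrow> complex) \<Rightarrow> array2" where "to2 a = (\<lambda>(p, q). a [p, q])"

definition den :: "nat \<Rightarrow> pexp" where
  "den N = Mul (ppow (Var 0) N) (Mul (ppow (Var 1) N) (ppow (Sub (Var 0) (Var 1)) N))"

lemma lin2_add: "lin2 c d (\<lambda>k. A k + B k) = (\<lambda>k. lin2 c d A k + lin2 c d B k)"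
  by (auto simp: lin2_def X0_def X1_def fun_eq_iff algebra_simps)

lemma lin2_scale: "lin2 c d (\<lambda>k. a * A k) = (\<lambda>k. a * lin2 c d A k)"
  by (auto simp: lin2_def X0_def X1_def fun_eq_iff algebra_simps)

text \<open>
  The variables \<open>z\<^sub>1, z\<^sub>2\<close> act on product families by \<open>X0, X1\<close>, and on iterate families, whose first
  variable is \<open>z\<^sub>1 - z\<^sub>2\<close>, by \<open>X0 + X1, X1\<close>.
\<close>

abbreviation "prod_vars \<equiv> vars2 (lin2 1 0) (lin2 0 1)"
abbreviation "iter_vars \<equiv> vars2 (lin2 1 1) (lin2 0 1)"

lemma to2_unit: "to2 (unit_array 2) = unit2"
  by (auto simp: to2_def unit_array_def unit2_def fun_eq_iff numeral_2_eq_2)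

lemma to2_lvar: "to2 (opr (lvar 2) e A) = opr prod_vars e (to2 A)"
proof (rule opr_rel[of "\<lambda>A B. to2 A = B"])
  fix i :: nat and A and B :: array2 assume "to2 A = B"
  moreover consider "i = 0" | "i = 1" | "i \<ge> 2" by linarith
  ultimately show "to2 (lvar 2 i A) = prod_vars i B"
    by cases (auto simp: to2_def fun_eq_iff lvar_def shift_def vars2_def lin2_def X0_def X1_def)
qed (auto simp: to2_def fun_eq_iff)

definition iter_subst :: "nat \<Rightarrow> pexp" where
  "iter_subst i = (if i = 0 then Add (Var 0) (Var 1) else if i = 1 then Var 1 else Con 0)"

lemma to2_lvar_iter: "to2 (opr (lvar 2) (psubst iter_subst e) A) = opr iter_vars e (to2 A)"
  unfolding opr_psubst
proof (rule opr_rel[of "\<lambda>A B. to2 A = B"])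
  fix i :: nat and A and B :: array2 assume "to2 A = B"
  moreover consider "i = 0" | "i = 1" | "i \<ge> 2" by linarith
  ultimately show "to2 (opr (lvar 2) (iter_subst i) A) = iter_vars i B"
    by cases (auto simp: to2_def fun_eq_iff lvar_def shift_def vars2_def lin2_def X0_def X1_def iter_subst_def)
qed (auto simp: to2_def fun_eq_iff)

lemma peval_iter_subst: "peval (ev [t, z]) (psubst iter_subst e) = peval (ev [z + t, z]) e"
proof -
  have "(\<lambda>i. peval (ev [t, z]) (iter_subst i)) = ev [z + t, z]"
    by (auto simp: fun_eq_iff ev_def iter_subst_def less_Suc_eq nth_Cons split: nat.split)
  then show ?thesis by (simp add: peval_psubst)
qed

lemma peval_den: "peval (ev [z1, z2]) (den N) = z1 ^ N * (z2 ^ N * (z1 - z2) ^ N)"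
  by (simp add: den_def)

lemma map_cmod_2:
  assumes "map cmod x = [r, s]" obtains a b where "x = [a, b]" "cmod a = r" "cmod b = s"
  using assms by (auto simp: map_eq_Cons_conv)

lemma to2_eqI: "(\<And>k. length k = 2 \<Longrightarrow> A k = B k) \<Longrightarrow> to2 A = to2 B"
  by (auto simp: to2_def fun_eq_iff)

lemma prod_expands_formal:
  assumes "prod_expands 2 a R"
    and "\<And>z1 z2. z1 \<noteq> 0 \<Longrightarrow> z2 \<noteq> 0 \<Longrightarrow> z1 \<noteq> z2 \<Longrightarrow>
      z1 ^ N * (z2 ^ N * (z1 - z2) ^ N) * R [z1, z2] = peval (ev [z1, z2]) e"
  shows "opr prod_vars (den N) (to2 a) = opr prod_vars e unit2"
  unfolding to2_lvar[symmetric] to2_unit[symmetric]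
proof (rule to2_eqI)
  fix k :: "int list" assume "length k = 2"
  \<comment> \<open>Radii 2 and 1 give one torus inside |z_1| > |z_2| > 0.\<close>
  have "opr (lvar (length [2, 1 :: real])) (den N) a k
      = opr (lvar (length [2, 1 :: real])) e (unit_array (length [2, 1 :: real])) k"
  proof (rule rational_sums_opr)
    fix x :: "complex list" assume "map cmod x = [2, 1]"
    then obtain z1 z2 where x: "x = [z1, z2]" "cmod z1 = 2" "cmod z2 = 1" by (rule map_cmod_2)
    then have "z1 \<noteq> 0" "z2 \<noteq> 0" "z1 \<noteq> z2" by auto
    from assms(2)[OF this] show "laurent_sums a x (R x) \<and> peval (ev x) (den N) * R x = peval (ev x) e"
      using assms(1) x unfolding prod_expands_def radial_def by (simp add: peval_den)
  qed (use \<open>length k = 2\<close> in auto)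
  then show "opr (lvar 2) (den N) a k = opr (lvar 2) e (unit_array 2) k" by (simp add: numeral_2_eq_2)
qed

lemma iter_expands_formal:
  assumes "iter_expands b R"
    and "\<And>z1 z2. z1 \<noteq> 0 \<Longrightarrow> z2 \<noteq> 0 \<Longrightarrow> z1 \<noteq> z2 \<Longrightarrow>
      z1 ^ N * (z2 ^ N * (z1 - z2) ^ N) * R [z1, z2] = peval (ev [z1, z2]) e"
  shows "opr iter_vars (den N) (to2 b) = opr iter_vars e unit2"
  unfolding to2_lvar_iter[symmetric] to2_unit[symmetric]
proof (rule to2_eqI)
  fix k :: "int list" assume "length k = 2"
  \<comment> \<open>The expansion variables are z_1 - z_2 and z_2, so now the first radius is the
    smaller one.\<close>
  have "opr (lvar (length [1, 2 :: real])) (psubst iter_subst (den N)) b k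
      = opr (lvar (length [1, 2 :: real])) (psubst iter_subst e) (unit_array (length [1, 2 :: real])) k"
  proof (rule rational_sums_opr[where R = "\<lambda>x. R [x ! 1 + x ! 0, x ! 1]"])
    fix x :: "complex list" assume "map cmod x = [1, 2]"
    then obtain t z where x: "x = [t, z]" "cmod t = 1" "cmod z = 2" by (rule map_cmod_2)
    have "z + t \<noteq> 0"
    proof
      assume "z + t = 0"
      then have "z = - t" by (simp add: eq_neg_iff_add_eq_0)
      then show False using x by simp
    qed
    moreover have "z \<noteq> 0" "z + t \<noteq> z" using x by auto
    ultimately have "(z + t) ^ N * (z ^ N * (z + t - z) ^ N) * R [z + t, z] = peval (ev [z + t, z]) e"
      by (rule assms(2))
    moreover have "laurent_sums b [z + t - z, z] (R [z + t, z])"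
      using assms(1) x unfolding iter_expands_def by (metis add_diff_cancel_left' one_less_numeral_iff semiring_norm(76) zero_less_one)
    ultimately show "laurent_sums b x (R [x ! 1 + x ! 0, x ! 1]) \<and>
        peval (ev x) (psubst iter_subst (den N)) * R [x ! 1 + x ! 0, x ! 1] = peval (ev x) (psubst iter_subst e)"
      using x by (simp add: peval_iter_subst peval_den)
  qed (use \<open>length k = 2\<close> in auto)
  then show "opr (lvar 2) (psubst iter_subst (den N)) b k = opr (lvar 2) (psubst iter_subst e) (unit_array 2) k"
    by (simp add: numeral_2_eq_2)
qed

text \<open>All large exponents are demanded, so that finitely many pairs can share a single
  \<open>N\<close>.\<close>

definition common_rational :: "array2 \<Rightarrow> array2 \<Rightarrow> bool" where
  "common_rational A B \<longleftrightarrow> (\<exists>N0. \<forall>N\<ge>N0. \<exists>e.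
     opr prod_vars (den N) A = opr prod_vars e unit2 \<and> opr iter_vars (den N) B = opr iter_vars e unit2)"

lemma common_rational_expands:
  assumes "rational_diag0 2 R" "prod_expands 2 a R" "iter_expands b R"
  shows "common_rational (to2 a) (to2 b)"
proof -
  obtain N0 where N0: "\<And>N. N \<ge> N0 \<Longrightarrow> \<exists>e. \<forall>z1 z2. z1 \<noteq> 0 \<longrightarrow> z2 \<noteq> 0 \<longrightarrow> z1 \<noteq> z2 \<longrightarrow>
    z1 ^ N * (z2 ^ N * (z1 - z2) ^ N) * R [z1, z2] = peval (ev [z1, z2]) e"
    by (rule rational_diag0_clear[OF assms(1)]) (rule that)
  show ?thesis unfolding common_rational_def
  proof (intro exI[of _ N0] allI impI)
    fix N assume "N \<ge> N0"
    from N0[OF this] obtain e where e: "\<And>z1 z2. z1 \<noteq> 0 \<Longrightarrow> z2 \<noteq> 0 \<Longrightarrow> z1 \<noteq> z2 \<Longrightarrow>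
      z1 ^ N * (z2 ^ N * (z1 - z2) ^ N) * R [z1, z2] = peval (ev [z1, z2]) e" by blast
    from prod_expands_formal[OF assms(2) e] iter_expands_formal[OF assms(3) e]
    show "\<exists>e. opr prod_vars (den N) (to2 a) = opr prod_vars e unit2 \<and>
        opr iter_vars (den N) (to2 b) = opr iter_vars e unit2" by blast
  qed
qed

text \<open>The axioms supply separate rational functions for the product and for the iterate. They
  are sums of their series on a common region, so the numerators over the common denominator agree
  on an open set and hence as polynomials.\<close>

lemma common_rational_assoc:
  assumes "prod_rational 2 a" "iter_rational b" "prod_eq_iter a b"
  shows "common_rational (to2 a) (to2 b)"
proof -
  from assms(1) obtain R where R: "rational_diag0 2 R" "prod_expands 2 a R" unfolding prod_rational_def by blast
  from assms(2) obtain R' where R': "rational_diag0 2 R'" "iter_expands b R'" unfolding iter_rational_def by blast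
  obtain N0 where N0: "\<And>N. N \<ge> N0 \<Longrightarrow> \<exists>e. \<forall>z1 z2. z1 \<noteq> 0 \<longrightarrow> z2 \<noteq> 0 \<longrightarrow> z1 \<noteq> z2 \<longrightarrow>
    z1 ^ N * (z2 ^ N * (z1 - z2) ^ N) * R [z1, z2] = peval (ev [z1, z2]) e"
    by (rule rational_diag0_clear[OF R(1)]) (rule that)
  obtain N1 where N1: "\<And>N. N \<ge> N1 \<Longrightarrow> \<exists>e. \<forall>z1 z2. z1 \<noteq> 0 \<longrightarrow> z2 \<noteq> 0 \<longrightarrow> z1 \<noteq> z2 \<longrightarrow>
    z1 ^ N * (z2 ^ N * (z1 - z2) ^ N) * R' [z1, z2] = peval (ev [z1, z2]) e"
    by (rule rational_diag0_clear[OF R'(1)]) (rule that)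
  show ?thesis unfolding common_rational_def
  proof (intro exI[of _ "max N0 N1"] allI impI)
    fix N assume "N \<ge> max N0 N1"
    then have N: "N \<ge> N0" "N \<ge> N1" by auto
    from N0[OF N(1)] obtain e where e: "\<And>z1 z2. z1 \<noteq> 0 \<Longrightarrow> z2 \<noteq> 0 \<Longrightarrow> z1 \<noteq> z2 \<Longrightarrow>
      z1 ^ N * (z2 ^ N * (z1 - z2) ^ N) * R [z1, z2] = peval (ev [z1, z2]) e" by blast
    from N1[OF N(2)] obtain e' where e': "\<And>z1 z2. z1 \<noteq> 0 \<Longrightarrow> z2 \<noteq> 0 \<Longrightarrow> z1 \<noteq> z2 \<Longrightarrow>
      z1 ^ N * (z2 ^ N * (z1 - z2) ^ N) * R' [z1, z2] = peval (ev [z1, z2]) e'" by blast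
    have "peval (ev z) (Sub e e') = 0" if "length z = 2" for z
    \<comment> \<open>At (3, 2) the moduli of z_1, z_2 and z_1 - z_2 are 3, 2 and 1; perturbations
      below 1/4 preserve |z_1| > |z_2| > |z_1 - z_2| > 0.\<close>
    proof (rule peval_vanish[of "1/4" "[3, 2]"])
      fix z :: "complex list" assume z: "z \<in> near (1/4) [3, 2]"
      then obtain z1 z2 where zz: "z = [z1, z2]" by (auto simp: near_def length_Suc_conv numeral_2_eq_2)
      with z have d: "cmod (z1 - 3) < 1/4" "cmod (z2 - 2) < 1/4" by (auto simp: near_def)
      have 1: "cmod z1 > 11/4" using norm_triangle_ineq2[of 3 "3 - z1"] d by (simp add: norm_minus_commute)
      have 2: "cmod z2 > 7/4" using norm_triangle_ineq2[of 2 "2 - z2"] d by (simp add: norm_minus_commute)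
      have 3: "cmod z2 < 9/4" using norm_triangle_ineq[of 2 "z2 - 2"] d by simp
      have "cmod ((z1 - z2) - 1) = cmod ((z1 - 3) - (z2 - 2))" by (simp add: algebra_simps)
      also have "\<dots> < 1/2" using norm_triangle_ineq4[of "z1 - 3" "z2 - 2"] d by simp
      finally have d': "cmod ((z1 - z2) - 1) < 1/2" .
      have 4: "cmod (z1 - z2) < 3/2" using norm_triangle_ineq[of 1 "(z1 - z2) - 1"] d' by simp
      have 5: "cmod (z1 - z2) > 0" using d' by auto
      have reg: "cmod z1 > cmod z2" "cmod z2 > cmod (z1 - z2)" using 1 2 3 4 by auto
      with 5 assms(3) obtain s where s: "laurent_sums a [z1, z2] s" "laurent_sums b [z1 - z2, z2] s"
        unfolding prod_eq_iter_def by blast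
      have "laurent_sums a [z1, z2] (R [z1, z2])"
      proof -
        have "[z1, z2] \<in> radial 2" using reg(1) 2 1 unfolding radial_def
          by (simp only: mem_Collect_eq list.map append.simps sorted_wrt.simps list.set ball_simps) auto
        then show ?thesis using R(2) unfolding prod_expands_def by blast
      qed
      then have "R [z1, z2] = s" using s(1) by (rule laurent_sums_unique)
      moreover have "laurent_sums b [z1 - z2, z2] (R' [z1, z2])"
        using R'(2) reg 5 unfolding iter_expands_def by blast
      then have "R' [z1, z2] = s" using s(2) by (rule laurent_sums_unique)
      moreover have "z1 \<noteq> 0" "z2 \<noteq> 0" "z1 \<noteq> z2" using 1 2 5 by auto
      ultimately show "peval (ev z) (Sub e e') = 0" using e[of z1 z2] e'[of z1 z2] zz by simp
    qed (use that in auto)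
    then have "peval (ev [z1, z2]) e' = peval (ev [z1, z2]) e" for z1 z2 by simp
    then have e'': "\<And>z1 z2. z1 \<noteq> 0 \<Longrightarrow> z2 \<noteq> 0 \<Longrightarrow> z1 \<noteq> z2 \<Longrightarrow>
      z1 ^ N * (z2 ^ N * (z1 - z2) ^ N) * R' [z1, z2] = peval (ev [z1, z2]) e" using e' by simp
    from prod_expands_formal[OF R(2) e] iter_expands_formal[OF R'(2) e'']
    show "\<exists>e. opr prod_vars (den N) (to2 a) = opr prod_vars e unit2 \<and>
        opr iter_vars (den N) (to2 b) = opr iter_vars e unit2" by blast
  qed
qed


section \<open>Reduction from two variables to one by homogeneity\<close>

subsection \<open>Lines of fixed total mode\<close>

text \<open>The homogeneous part of one total degree with the second variable set to 1. For products
  the remaining variable is x = z_1 / z_2, for iterates t = (z_1 - z_2) / z_2 = x - 1.\<close>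

definition line :: "int \<Rightarrow> array2 \<Rightarrow> int \<Rightarrow> complex" where
  "line \<kappa> A k = A (k, \<kappa> - k)"

lemma line_lin2: "line \<kappa> (lin2 c d A) = act [:d, c:] (line (\<kappa> + 1) A)"
  by (auto simp: fun_eq_iff line_def lin2_def X0_def X1_def act_linear algebra_simps)

lemma line_funpow:
  assumes "\<And>A \<kappa>. line \<kappa> (F A) = act f (line (\<kappa> + 1) A)"
  shows "line \<kappa> ((F ^^ n) A) = act (f ^ n) (line (\<kappa> + int n) A)"
proof (induction n arbitrary: \<kappa>)
  case (Suc n)
  show ?case by (simp add: assms Suc act_mult[symmetric] algebra_simps del: act_mult)
qed simp

lemma lin2_diff: "lin2 c d A k - lin2 c' d' A k = lin2 (c - c') (d - d') A k"
  by (simp add: lin2_def algebra_simps)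

lemma line_den:
  "line \<kappa> (opr (vars2 (lin2 c d) (lin2 c' d')) (den N) A) =
     act ([:d, c:] ^ N * ([:d', c':] ^ N * [:d - d', c - c':] ^ N)) (line (\<kappa> + 3 * int N) A)"
proof -
  have sub: "opr (vars2 (lin2 c d) (lin2 c' d')) (Sub (Var 0) (Var 1)) = lin2 (c - c') (d - d')"
    by (simp add: vars2_def fun_eq_iff lin2_diff)
  have "opr (vars2 (lin2 c d) (lin2 c' d')) (den N) A
      = (lin2 c d ^^ N) ((lin2 c' d' ^^ N) ((lin2 (c - c') (d - d') ^^ N) A))"
    by (simp only: den_def opr.simps opr_ppow sub) (simp add: vars2_def)
  then show ?thesis
    by (simp add: line_funpow[OF line_lin2] act_mult algebra_simps)
qed

lemma line_add: "line \<kappa> (\<lambda>k. A k + B k) = (\<lambda>k. line \<kappa> A k + line \<kappa> B k)"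
  by (simp add: line_def fun_eq_iff)

lemma line_scale: "line \<kappa> (\<lambda>k. c * A k) = (\<lambda>k. c * line \<kappa> A k)"
  by (simp add: line_def fun_eq_iff)

lemma line_unit2: "line \<kappa> unit2 = (\<lambda>k. (if \<kappa> = -2 then 1 else 0) * iota 1 k)"
  by (auto simp: line_def unit2_def iota_def fun_eq_iff)

text \<open>The two sets of variables differ by x_0 -> x_0 + x_1, which turns c x_0 + d x_1 into c
  x_0 + (c + d) x_1 and is x = 1 + t on lines.\<close>

lemma line_poly_pair:
  "poly_pair (line \<kappa> (opr (vars2 (lin2 c d) (lin2 c' d')) e unit2))
     (line \<kappa> (opr (vars2 (lin2 c (c + d)) (lin2 c' (c' + d'))) e unit2))"
proof -
  let ?R = "\<lambda>A B. \<forall>\<kappa>. poly_pair (line \<kappa> A) (line \<kappa> B)"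
  have lin: "poly_pair (line \<kappa> (lin2 c d A)) (line \<kappa> (lin2 c (c + d) B))" if "?R A B" for A B c d \<kappa>
    using poly_pair_act[of "line (\<kappa> + 1) A" "line (\<kappa> + 1) B" "[:d, c:]"] that
    by (simp add: line_lin2 pcompose_pCons add.commute)
  have "?R (opr (vars2 (lin2 c d) (lin2 c' d')) e unit2) (opr (vars2 (lin2 c (c + d)) (lin2 c' (c' + d'))) e unit2)"
  proof (rule opr_rel[of ?R])
    fix i A B assume R: "?R A B"
    show "?R (vars2 (lin2 c d) (lin2 c' d') i A) (vars2 (lin2 c (c + d)) (lin2 c' (c' + d')) i B)"
    proof
      fix \<kappa>
      have "poly_pair (\<lambda>_. 0) (\<lambda>_. 0)" using poly_pair_scale[of _ _ 0] R by fastforce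
      then have "poly_pair (line \<kappa> (\<lambda>k. 0)) (line \<kappa> (\<lambda>k. 0))" by (simp add: line_def[abs_def])
      then show "poly_pair (line \<kappa> (vars2 (lin2 c d) (lin2 c' d') i A))
          (line \<kappa> (vars2 (lin2 c (c + d)) (lin2 c' (c' + d')) i B))"
        using lin[OF R] by (auto simp: vars2_def)
    qed
  qed (auto simp: line_add line_scale line_unit2 poly_pair_add poly_pair_scale poly_pair_const)
  then show ?thesis by blast
qed

text \<open>\<open>den\<close> says that on lines the denominator is x^N (x - 1)^N up to a scalar.
  Composing this with 1 + t gives the denominator of the second expansion.\<close>

lemma assoc_pair_line:
  assumes A: "opr (vars2 (lin2 c d) (lin2 c' d')) (den N) A = opr (vars2 (lin2 c d) (lin2 c' d')) e unit2"
    and B: "opr (vars2 (lin2 c (c + d)) (lin2 c' (c' + d'))) (den N) B =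
      opr (vars2 (lin2 c (c + d)) (lin2 c' (c' + d'))) e unit2"
    and den: "[:d, c:] ^ N * ([:d', c':] ^ N * [:d - d', c - c':] ^ N) = smult s ([:0, 1:] ^ N * [:-1, 1:] ^ N)"
      "s \<noteq> 0"
    and bd: "bounded_modes (line \<kappa> B)"
  shows "assoc_pair (line \<kappa> A) (line \<kappa> B)"
proof -
  \<comment> \<open>The denominator is homogeneous of degree 3N, and multiplication by it reads
    coefficients of total mode higher by that amount.\<close>
  let ?\<kappa> = "\<kappa> - 3 * int N"
  obtain L where L: "line ?\<kappa> (opr (vars2 (lin2 c d) (lin2 c' d')) e unit2) = iota L"
    "line ?\<kappa> (opr (vars2 (lin2 c (c + d)) (lin2 c' (c' + d'))) e unit2) = iota (L \<circ>\<^sub>p [:1, 1:])"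
    using line_poly_pair[of ?\<kappa> c d c' d' e] unfolding poly_pair_def by blast
  have den': "[:c + d, c:] ^ N * ([:c' + d', c':] ^ N * [:c + d - (c' + d'), c - c':] ^ N)
      = smult s ([:1, 1:] ^ N * [:0, 1:] ^ N)"
  proof -
    have "[:c + d, c:] ^ N * ([:c' + d', c':] ^ N * [:c + d - (c' + d'), c - c':] ^ N)
      = ([:d, c:] ^ N * ([:d', c':] ^ N * [:d - d', c - c':] ^ N)) \<circ>\<^sub>p [:1, 1:]"
      by (simp add: pcompose_mult pcompose_power pcompose_pCons algebra_simps)
    also have "\<dots> = smult s (([:0, 1:] ^ N * [:-1, 1:] ^ N) \<circ>\<^sub>p [:1, 1:])"
      unfolding den(1) by (rule pcompose_smult)
    finally show ?thesis unfolding pcompose_denominator .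
  qed
  have 1: "act ([:0, 1:] ^ N * [:-1, 1:] ^ N) (line \<kappa> A) = iota (smult (1 / s) L)"
    using L(1) unfolding A[symmetric] line_den den(1) act_smult iota_smult
    using den(2) by (simp add: fun_eq_iff field_simps)
  have 2: "act ([:1, 1:] ^ N * [:0, 1:] ^ N) (line \<kappa> B) = iota (smult (1 / s) L \<circ>\<^sub>p [:1, 1:])"
    using L(2) unfolding B[symmetric] line_den den' act_smult iota_smult pcompose_smult
    using den(2) by (simp add: fun_eq_iff field_simps)
  show ?thesis unfolding assoc_pair_def using bd 1 2 by blast
qed

lemma common_rational_line:
  assumes "common_rational A B" "bounded_modes (line \<kappa> B)"
  shows "assoc_pair (line \<kappa> A) (line \<kappa> B)"
proof -
  from assms(1) obtain N e where Ne: "opr prod_vars (den N) A = opr prod_vars e unit2"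
    "opr iter_vars (den N) B = opr iter_vars e unit2" unfolding common_rational_def by blast
  show ?thesis
    by (rule assoc_pair_line[of 1 0 0 1 N A e B 1]) (use Ne assms(2) in \<open>auto simp: one_pCons[symmetric]\<close>)
qed

text \<open>The variables are z_1 = x_0 - x_1 and z_2 = - x_1, so z_1 - z_2 = x_0, and with x = x_0
  / x_1 the denominator is x (x - 1) up to sign.\<close>

lemma comm_pair_line:
  assumes A: "opr (vars2 (lin2 1 (-1)) (lin2 0 (-1))) (den N) A = opr (vars2 (lin2 1 (-1)) (lin2 0 (-1))) e unit2"
    and B: "opr (vars2 (lin2 1 (-1)) (lin2 0 (-1))) (den N) B = opr (vars2 (lin2 1 (-1)) (lin2 0 (-1))) e unit2"
    and bd: "bounded_modes (line \<kappa> B)"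
  shows "comm_pair (line \<kappa> A) (line \<kappa> B)"
proof -
  have den: "[:-1, 1:] ^ N * ([:-1, 0:] ^ N * [:-1 - -1, 1 - 0:] ^ N) = smult ((-1) ^ N) ([:0, 1::complex:] ^ N * [:-1, 1:] ^ N)"
  proof -
    have "[:-1, 0:] = smult (-1 :: complex) 1" by simp
    then have "[:-1, 0:] ^ N = smult ((-1 :: complex) ^ N) 1" by (metis smult_power power_one)
    then show ?thesis by (simp add: mult.commute)
  qed
  \<comment> \<open>The factor x^N merely shifts modes, hence cancels on arbitrary families; only
    the power of x - 1 remains.\<close>
  have act0: "act ([:0, 1:] ^ N) \<alpha> = (\<lambda>k. \<alpha> (k + int N))" for \<alpha>
    by (induction N arbitrary: \<alpha>) (auto simp: act_pCons fun_eq_iff algebra_simps)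
  have "line (\<kappa> - 3 * int N) (opr (vars2 (lin2 1 (-1)) (lin2 0 (-1))) (den N) A)
      = line (\<kappa> - 3 * int N) (opr (vars2 (lin2 1 (-1)) (lin2 0 (-1))) (den N) B)"
    using A B by simp
  then have "act ([:0, 1:] ^ N) (act ([:-1, 1:] ^ N) (line \<kappa> A)) = act ([:0, 1:] ^ N) (act ([:-1, 1:] ^ N) (line \<kappa> B))"
    unfolding line_den den act_smult by (simp add: act_mult fun_eq_iff)
  then have "act ([:-1, 1:] ^ N) (line \<kappa> A) (k - int N + int N) = act ([:-1, 1:] ^ N) (line \<kappa> B) (k - int N + int N)" for k
    unfolding act0 by (rule fun_cong)
  then have "act ([:-1, 1:] ^ N) (line \<kappa> A) = act ([:-1, 1:] ^ N) (line \<kappa> B)" by (simp add: fun_eq_iff)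
  then show ?thesis using bd unfolding comm_pair_def by blast
qed

section \<open>Formal substitutions that describe the opposite operators\<close>

subsection \<open>Translation, sign changes and exponentials\<close>

text \<open>The bound on the second mode is uniform in the first; it makes each coefficient of a
  translated family a finite sum.\<close>

definition trunc2 :: "array2 \<Rightarrow> bool" where
  "trunc2 G \<longleftrightarrow> (\<exists>n. \<forall>p q. q \<ge> n \<longrightarrow> G (p, q) = 0)"

text \<open>
  The substitution \<open>x\<^sub>0 \<mapsto> x\<^sub>0 + \<epsilon> x\<^sub>1\<close>, expanded in nonnegative powers of \<open>x\<^sub>1\<close>: the exponent belonging
  to the mode \<open>k - l\<close> is \<open>l - k - 1\<close>, and \<open>(l - k - 1) gchoose l = (- 1) ^ l * (k gchoose l)\<close>.
\<close>

definition translate :: "complex \<Rightarrow> array2 \<Rightarrow> array2" where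
  "translate \<epsilon> G = (\<lambda>(k, q). \<Sum>l | G (k - int l, q + int l) \<noteq> 0.
     (- \<epsilon>) ^ l * (of_int k gchoose l) * G (k - int l, q + int l))"

lemma translate_bound:
  assumes "\<And>l. l \<ge> n \<Longrightarrow> G (k - int l, q + int l) = 0"
  shows "translate \<epsilon> G (k, q) = (\<Sum>l<n. (- \<epsilon>) ^ l * (of_int k gchoose l) * G (k - int l, q + int l))"
  unfolding translate_def prod.case using assms
  by (intro sum.mono_neutral_left) (auto simp: not_less[symmetric])

lemma trunc2_bound:
  assumes "trunc2 G"
  obtains n where "\<And>p q l. q \<ge> q0 \<Longrightarrow> l \<ge> n \<Longrightarrow> G (p, q + int l) = 0"
proof -
  from assms obtain n where "\<And>p q. q \<ge> n \<Longrightarrow> G (p, q) = 0" unfolding trunc2_def by blast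
  then show thesis by (intro that[of "nat (n - q0)"]) auto
qed

lemma trunc2_lin2: "trunc2 G \<Longrightarrow> trunc2 (lin2 c d G)"
proof -
  assume "trunc2 G"
  then obtain n where n: "\<And>p q. q \<ge> n \<Longrightarrow> G (p, q) = 0" unfolding trunc2_def by blast
  show ?thesis unfolding trunc2_def lin2_def X0_def X1_def
    by (intro exI[of _ n]) (simp add: n)
qed

lemma trunc2_add:
  assumes "trunc2 G" "trunc2 H" shows "trunc2 (\<lambda>k. G k + H k)"
proof -
  from assms obtain n m where "\<forall>p q. q \<ge> n \<longrightarrow> G (p, q) = 0" "\<forall>p q. q \<ge> m \<longrightarrow> H (p, q) = 0"
    unfolding trunc2_def by blast
  then show ?thesis unfolding trunc2_def by (intro exI[of _ "max n m"]) auto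
qed

lemma trunc2_scale: "trunc2 G \<Longrightarrow> trunc2 (\<lambda>k. c * G k)"
  unfolding trunc2_def by auto

lemma translate_add:
  assumes "trunc2 G" "trunc2 H"
  shows "translate \<epsilon> (\<lambda>k. G k + H k) = (\<lambda>k. translate \<epsilon> G k + translate \<epsilon> H k)"
proof
  fix kq :: "int \<times> int" obtain k q where kq: "kq = (k, q)" by (cases kq)
  obtain n where n: "\<And>p q' l. q' \<ge> q \<Longrightarrow> l \<ge> n \<Longrightarrow> G (p, q' + int l) = 0" using trunc2_bound[OF assms(1)] by blast
  obtain m where m: "\<And>p q' l. q' \<ge> q \<Longrightarrow> l \<ge> m \<Longrightarrow> H (p, q' + int l) = 0" using trunc2_bound[OF assms(2)] by blast
  show "translate \<epsilon> (\<lambda>k. G k + H k) kq = translate \<epsilon> G kq + translate \<epsilon> H kq"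
    unfolding kq by (simp add: translate_bound[of "max n m"] n m sum.distrib algebra_simps)
qed

lemma translate_scale:
  assumes "trunc2 G"
  shows "translate \<epsilon> (\<lambda>k. c * G k) = (\<lambda>k. c * translate \<epsilon> G k)"
proof
  fix kq :: "int \<times> int" obtain k q where kq: "kq = (k, q)" by (cases kq)
  obtain n where n: "\<And>p q' l. q' \<ge> q \<Longrightarrow> l \<ge> n \<Longrightarrow> G (p, q' + int l) = 0" using trunc2_bound[OF assms(1)] by blast
  show "translate \<epsilon> (\<lambda>k. c * G k) kq = c * translate \<epsilon> G kq"
    unfolding kq by (simp add: translate_bound[of n] n sum_distrib_left algebra_simps)
qed

lemma translate_X1:
  assumes "trunc2 G"
  shows "translate \<epsilon> (X1 G) = X1 (translate \<epsilon> G)"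
proof
  fix kq :: "int \<times> int" obtain k q where kq: "kq = (k, q)" by (cases kq)
  obtain n where n: "\<And>p q' l. q' \<ge> q \<Longrightarrow> l \<ge> n \<Longrightarrow> G (p, q' + int l) = 0" using trunc2_bound[OF assms(1)] by blast
  have n': "G (k - int l, q + int l + 1) = 0" if "l \<ge> n" for l
    using n[of "q + 1" l] that by (simp add: algebra_simps)
  have "translate \<epsilon> (X1 G) (k, q) = (\<Sum>l<n. (- \<epsilon>) ^ l * (of_int k gchoose l) * X1 G (k - int l, q + int l))"
    by (rule translate_bound) (simp add: X1_def n')
  moreover have "translate \<epsilon> G (k, q + 1) = (\<Sum>l<n. (- \<epsilon>) ^ l * (of_int k gchoose l) * G (k - int l, q + 1 + int l))"
    by (rule translate_bound) (simp add: n)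
  ultimately show "translate \<epsilon> (X1 G) kq = X1 (translate \<epsilon> G) kq"
    unfolding kq by (simp add: X1_def algebra_simps)
qed

text \<open>Pascal's rule for the generalised binomial coefficients: the old variable x_0 acts after
  translation as x_0 + \<epsilon> x_1.\<close>

lemma translate_X0:
  assumes "trunc2 G" and \<epsilon>: "\<epsilon> * \<epsilon> = 1"
  shows "translate \<epsilon> (X0 G) = (\<lambda>k. X0 (translate \<epsilon> G) k + \<epsilon> * X1 (translate \<epsilon> G) k)"
proof
  fix kq :: "int \<times> int" obtain k q where kq: "kq = (k, q)" by (cases kq)
  obtain n where n: "\<And>p q' l. q' \<ge> q \<Longrightarrow> l \<ge> n \<Longrightarrow> G (p, q' + int l) = 0" using trunc2_bound[OF assms(1)] by blast
  let ?g = "\<lambda>l. G (k + 1 - int l, q + int l)"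
  let ?k = "of_int k :: complex"
  have t1: "translate \<epsilon> (X0 G) (k, q) = (\<Sum>l<Suc n. (- \<epsilon>) ^ l * (?k gchoose l) * ?g l)"
    by (subst translate_bound[of "Suc n"]) (auto simp: X0_def n algebra_simps)
  have t2: "translate \<epsilon> G (k + 1, q) = (\<Sum>l<Suc n. (- \<epsilon>) ^ l * ((?k + 1) gchoose l) * ?g l)"
    by (subst translate_bound[of "Suc n"]) (auto simp: n)
  have t3: "translate \<epsilon> G (k, q + 1) = (\<Sum>l<n. (- \<epsilon>) ^ l * (?k gchoose l) * ?g (Suc l))"
  proof -
    have "translate \<epsilon> G (k, q + 1) = (\<Sum>l<n. (- \<epsilon>) ^ l * (?k gchoose l) * G (k - int l, q + 1 + int l))"
      by (rule translate_bound) (simp add: n)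
    then show ?thesis by (simp add: algebra_simps)
  qed
  have "(\<Sum>l<Suc n. (- \<epsilon>) ^ l * ((?k + 1) gchoose l) * ?g l)
      = ?g 0 + (\<Sum>l<n. (- \<epsilon>) ^ Suc l * ((?k + 1) gchoose Suc l) * ?g (Suc l))"
    by (subst sum.lessThan_Suc_shift) simp
  also have "\<dots> = (?g 0 + (\<Sum>l<n. (- \<epsilon>) ^ Suc l * (?k gchoose Suc l) * ?g (Suc l)))
      + (\<Sum>l<n. (- \<epsilon>) ^ Suc l * (?k gchoose l) * ?g (Suc l))"
    unfolding gbinomial_Suc_Suc by (simp add: sum.distrib sum_subtractf sum_negf algebra_simps)
  also have "?g 0 + (\<Sum>l<n. (- \<epsilon>) ^ Suc l * (?k gchoose Suc l) * ?g (Suc l))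
      = (\<Sum>l<Suc n. (- \<epsilon>) ^ l * (?k gchoose l) * ?g l)"
    by (subst sum.lessThan_Suc_shift) simp
  also have "(\<Sum>l<n. (- \<epsilon>) ^ Suc l * (?k gchoose l) * ?g (Suc l))
      = - \<epsilon> * (\<Sum>l<n. (- \<epsilon>) ^ l * (?k gchoose l) * ?g (Suc l))"
    by (simp add: sum_distrib_left algebra_simps)
  finally have "translate \<epsilon> G (k + 1, q) = translate \<epsilon> (X0 G) (k, q) - \<epsilon> * translate \<epsilon> G (k, q + 1)"
    unfolding t1 t2 t3 by simp
  then show "translate \<epsilon> (X0 G) kq = X0 (translate \<epsilon> G) kq + \<epsilon> * X1 (translate \<epsilon> G) kq"
    unfolding kq X0_def[of "translate \<epsilon> G"] X1_def[of "translate \<epsilon> G"] by simp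
qed

lemma translate_lin2:
  assumes "trunc2 G" "\<epsilon> * \<epsilon> = 1"
  shows "translate \<epsilon> (lin2 c d G) = lin2 c (d + c * \<epsilon>) (translate \<epsilon> G)"
proof -
  have t: "trunc2 (X0 G)" "trunc2 (X1 G)"
    using trunc2_lin2[OF assms(1), of 1 0] trunc2_lin2[OF assms(1), of 0 1] by (simp_all add: lin2_def)
  show ?thesis unfolding lin2_def
    by (simp add: translate_add[OF trunc2_scale trunc2_scale] translate_scale t translate_X0[OF assms] translate_X1[OF assms(1)]
        fun_eq_iff algebra_simps)
qed

lemma translate_unit2: "translate \<epsilon> unit2 = unit2"
proof
  fix kq :: "int \<times> int" obtain k q where kq: "kq = (k, q)" by (cases kq)
  have "translate \<epsilon> unit2 (k, q) = (\<Sum>l<Suc (nat (- 1 - q)). (- \<epsilon>) ^ l * (of_int k gchoose l) * unit2 (k - int l, q + int l))"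
    by (rule translate_bound) (auto simp: unit2_def)
  also have "\<dots> = (\<Sum>l<Suc (nat (- 1 - q)). if l = 0 then unit2 (k, q) else 0)"
  proof (rule sum.cong)
    fix l assume "l \<in> {..<Suc (nat (- 1 - q))}"
    show "(- \<epsilon>) ^ l * (of_int k gchoose l) * unit2 (k - int l, q + int l) = (if l = 0 then unit2 (k, q) else 0)"
    proof (cases "l = 0")
      case False
      \<comment> \<open>The only other entry of \<open>unit2\<close> that could enter has first mode
        -1, and there the coefficient is l - 1 over l, which is zero.\<close>
      have "(of_int k :: complex) gchoose l = 0" if "k = int l - 1"
      proof -
        have "(of_int k :: complex) = of_nat (l - 1)" using that False by simp
        then have "(of_int k :: complex) gchoose l = of_nat ((l - 1) choose l)"
          using binomial_gbinomial[of "l - 1" l, where 'a = complex] by simp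
        then show ?thesis using False by simp
      qed
      moreover have "unit2 (k - int l, q + int l) = 0" if "k \<noteq> int l - 1"
        using that by (simp add: unit2_def)
      ultimately show ?thesis using False by (cases "k = int l - 1") auto
    qed simp
  qed simp
  also have "\<dots> = unit2 (k, q)" by (simp add: sum.delta)
  finally show "translate \<epsilon> unit2 kq = unit2 kq" by (simp add: kq)
qed

lemma trunc2_unit2: "trunc2 unit2"
  unfolding trunc2_def unit2_def by (intro exI[of _ 0]) auto

lemma translate_opr:
  assumes "trunc2 G" "\<epsilon> * \<epsilon> = 1"
  shows "translate \<epsilon> (opr (vars2 (lin2 c d) (lin2 c' d')) e G) =
    opr (vars2 (lin2 c (d + c * \<epsilon>)) (lin2 c' (d' + c' * \<epsilon>))) e (translate \<epsilon> G)"
proof -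
  let ?R = "\<lambda>A B. trunc2 A \<and> translate \<epsilon> A = B"
  have "?R (opr (vars2 (lin2 c d) (lin2 c' d')) e G)
      (opr (vars2 (lin2 c (d + c * \<epsilon>)) (lin2 c' (d' + c' * \<epsilon>))) e (translate \<epsilon> G))"
  proof (rule opr_rel[of ?R])
    fix i A B assume "?R A B"
    moreover have "trunc2 (\<lambda>_. 0)" "translate \<epsilon> (\<lambda>_. 0) = (\<lambda>_. 0)"
      by (auto simp: trunc2_def translate_def fun_eq_iff)
    ultimately show "?R (vars2 (lin2 c d) (lin2 c' d') i A) (vars2 (lin2 c (d + c * \<epsilon>)) (lin2 c' (d' + c' * \<epsilon>)) i B)"
      using assms(2) by (auto simp: vars2_def trunc2_lin2 translate_lin2)
  qed (use assms(1) in \<open>auto simp: trunc2_add trunc2_scale translate_add translate_scale\<close>)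
  then show ?thesis by simp
qed

lemma translate_relation:
  assumes "opr (vars2 (lin2 c d) (lin2 c' d')) D G = opr (vars2 (lin2 c d) (lin2 c' d')) e unit2"
    and "trunc2 G" "\<epsilon> * \<epsilon> = 1"
  shows "opr (vars2 (lin2 c (d + c * \<epsilon>)) (lin2 c' (d' + c' * \<epsilon>))) D (translate \<epsilon> G)
    = opr (vars2 (lin2 c (d + c * \<epsilon>)) (lin2 c' (d' + c' * \<epsilon>))) e unit2"
  using arg_cong[OF assms(1), of "translate \<epsilon>"]
  by (simp add: translate_opr[OF assms(2,3)] translate_opr[OF trunc2_unit2 assms(3)] translate_unit2)

definition swap2 :: "array2 \<Rightarrow> array2" where "swap2 A = (\<lambda>(p, q). A (q, p))"

text \<open>The substitution x_1 -> - x_1.\<close>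

definition twist :: "array2 \<Rightarrow> array2" where "twist A = (\<lambda>(p, q). (-1) powi (- q - 1) * A (p, q))"

lemma swap2_relation:
  assumes "opr (vars2 (lin2 c d) (lin2 c' d')) D G = opr (vars2 (lin2 c d) (lin2 c' d')) e unit2"
  shows "opr (vars2 (lin2 d c) (lin2 d' c')) D (swap2 G) = opr (vars2 (lin2 d c) (lin2 d' c')) e unit2"
proof -
  have *: "swap2 (opr (vars2 (lin2 c d) (lin2 c' d')) p A) = opr (vars2 (lin2 d c) (lin2 d' c')) p (swap2 A)" for p A
    by (rule opr_rel[of "\<lambda>A B. swap2 A = B"])
      (auto simp: swap2_def vars2_def lin2_def X0_def X1_def fun_eq_iff)
  have "swap2 unit2 = unit2" by (auto simp: swap2_def unit2_def fun_eq_iff)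
  then show ?thesis using arg_cong[OF assms, of swap2] unfolding * by simp
qed

lemma twist_relation:
  assumes "opr (vars2 (lin2 c d) (lin2 c' d')) D G = opr (vars2 (lin2 c d) (lin2 c' d')) e unit2"
  shows "opr (vars2 (lin2 c (- d)) (lin2 c' (- d'))) D (twist G) = opr (vars2 (lin2 c (- d)) (lin2 c' (- d'))) e unit2"
proof -
  have s: "(-1 :: complex) powi (- (q + 1) - 1) = - ((-1) powi (- q - 1))" for q
  proof -
    have "(-1 :: complex) powi (- q - 1) = (-1) powi (- (q + 1) - 1 + 1)"
      by (rule arg_cong[where f = "\<lambda>z. (-1) powi z"]) simp
    also have "\<dots> = - ((-1) powi (- (q + 1) - 1))" by (subst power_int_add) auto
    finally show ?thesis by simp
  qed
  have lin: "twist (lin2 c d A) = lin2 c (- d) (twist A)" for c d A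
    by (rule ext) (auto simp only: twist_def lin2_def X0_def X1_def s prod.case split: prod.split, simp add: algebra_simps)
  have *: "twist (opr (vars2 (lin2 c d) (lin2 c' d')) p A) = opr (vars2 (lin2 c (- d)) (lin2 c' (- d'))) p (twist A)" for p A
  proof (rule opr_rel[of "\<lambda>A B. twist A = B"])
    fix i A B assume "twist A = B"
    then show "twist (vars2 (lin2 c d) (lin2 c' d') i A) = vars2 (lin2 c (- d)) (lin2 c' (- d')) i B"
      by (auto simp: vars2_def lin) (simp add: twist_def fun_eq_iff)
  qed (auto simp: twist_def fun_eq_iff algebra_simps)
  have "twist unit2 = unit2" by (auto simp: twist_def unit2_def fun_eq_iff)
  then show ?thesis using arg_cong[OF assms, of twist] unfolding * by simp
qed

text \<open>The effect of \<open>exp(x\<^sub>1 D)\<close>, where \<open>A i\<close> is the family obtained by applying \<open>D\<close> \<open>i\<close> times.\<close>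

definition exp_sum :: "nat \<Rightarrow> (nat \<Rightarrow> array2) \<Rightarrow> array2" where
  "exp_sum n A = (\<lambda>k. \<Sum>i<n. 1 / fact i * (X1 ^^ i) (A i) k)"

lemma X1_funpow: "(X1 ^^ i) A (p, q) = A (p, q + int i)"
  by (induction i arbitrary: q) (auto simp: X1_def algebra_simps)

text \<open>The variable x_1 is itself a polynomial \<open>X\<close> in the acting variables, so
  x_1^i / i! can be absorbed into the i-th numerator, while one denominator serves all
  terms.\<close>

lemma exp_sum_relation:
  assumes lin: "lin2 0 1 = opr (vars2 (lin2 c d) (lin2 c' d')) X"
    and rel: "\<And>i. i < n \<Longrightarrow> opr (vars2 (lin2 c d) (lin2 c' d')) D (A i) = opr (vars2 (lin2 c d) (lin2 c' d')) (e i) unit2"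
  shows "opr (vars2 (lin2 c d) (lin2 c' d')) D (exp_sum n A)
    = opr (vars2 (lin2 c d) (lin2 c' d')) (foldr (\<lambda>i. Add (Mul (Con (1 / fact i)) (Mul (ppow X i) (e i)))) [0..<n] (Con 0)) unit2"
proof -
  let ?v = "vars2 (lin2 c d) (lin2 c' d')"
  have add: "?v i (\<lambda>k. A k + B k) = (\<lambda>k. ?v i A k + ?v i B k)" for i A B
    by (auto simp: vars2_def lin2_add)
  have scale: "?v i (\<lambda>k. a * A k) = (\<lambda>k. a * ?v i A k)" for i a A
    by (auto simp: vars2_def lin2_scale)
  have X1: "X1 = lin2 0 1" by (simp add: lin2_def fun_eq_iff)
  have pow: "opr ?v D ((X1 ^^ i) B) = (X1 ^^ i) (opr ?v D B)" for i B
  proof (rule opr_comm)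
    show "(X1 ^^ i) (\<lambda>k. A k + B k) = (\<lambda>k. (X1 ^^ i) A k + (X1 ^^ i) B k)" for A B
      by (auto simp: fun_eq_iff X1_funpow)
    show "(X1 ^^ i) (\<lambda>k. a * A k) = (\<lambda>k. a * (X1 ^^ i) A k)" for a A
      by (auto simp: fun_eq_iff X1_funpow)
    show "?v j ((X1 ^^ i) A) = (X1 ^^ i) (?v j A)" for j A
    proof
      fix k :: "int \<times> int" obtain p q where k: "k = (p, q)" by (cases k)
      have sh: "A (p, q + 1 + int i) = A (p, q + int i + 1)" by (simp add: algebra_simps)
      show "?v j ((X1 ^^ i) A) k = (X1 ^^ i) (?v j A) k"
        unfolding k X1_funpow vars2_def lin2_def X0_def
        by (simp add: X1_def[of "(X1 ^^ i) A"] X1_def[of A] X1_funpow sh)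
    qed
  qed
  have "opr ?v D (exp_sum n A) = (\<lambda>k. \<Sum>i<n. 1 / fact i * (X1 ^^ i) (opr ?v (e i) unit2) k)"
    unfolding exp_sum_def
    by (simp only: opr_sum[of ?v, OF add scale] opr_scale[of ?v, OF scale] pow)
      (auto simp: rel intro!: ext sum.cong)
  also have "\<dots> = opr ?v (foldr (\<lambda>i. Add (Mul (Con (1 / fact i)) (Mul (ppow X i) (e i)))) [0..<n] (Con 0)) unit2"
  proof -
    have "opr ?v (foldr (\<lambda>i. Add (Mul (Con (1 / fact i)) (Mul (ppow X i) (e i)))) xs (Con 0)) unit2
        = (\<lambda>k. \<Sum>i\<leftarrow>xs. 1 / fact i * (X1 ^^ i) (opr ?v (e i) unit2) k)" for xs
      by (induction xs) (simp_all add: X1 lin)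
    then show ?thesis by (simp add: sum_list_distinct_conv_sum_set atLeast0LessThan)
  qed
  finally show ?thesis .
qed

lemma common_rational_family:
  fixes n :: nat
  assumes "\<And>i. i < n \<Longrightarrow> common_rational (A i) (B i)"
  obtains N e where "\<And>i. i < n \<Longrightarrow> opr prod_vars (den N) (A i) = opr prod_vars (e i) unit2"
    and "\<And>i. i < n \<Longrightarrow> opr iter_vars (den N) (B i) = opr iter_vars (e i) unit2"
proof -
  from assms obtain N0 where N0: "\<And>i N. i < n \<Longrightarrow> N \<ge> N0 i \<Longrightarrow>
    \<exists>e. opr prod_vars (den N) (A i) = opr prod_vars e unit2 \<and> opr iter_vars (den N) (B i) = opr iter_vars e unit2"
    unfolding common_rational_def by metis
  define N where "N = Max (insert 0 (N0 ` {..<n}))"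
  have "N \<ge> N0 i" if "i < n" for i unfolding N_def using that by (intro Max_ge finite.insertI finite_imageI finite_lessThan) auto
  with N0 have "\<forall>i. \<exists>e. i < n \<longrightarrow> opr prod_vars (den N) (A i) = opr prod_vars e unit2 \<and>
      opr iter_vars (den N) (B i) = opr iter_vars e unit2" by blast
  then obtain e where "\<forall>i. i < n \<longrightarrow> opr prod_vars (den N) (A i) = opr prod_vars (e i) unit2 \<and>
      opr iter_vars (den N) (B i) = opr iter_vars (e i) unit2" by metis
  then show thesis by (intro that[of N e]) auto
qed

text \<open>With Y_S(v, x_1) w = exp(x_1 D) Y^R(w, - x_1) v, moving exp(x_1 D) to the left past
  Y^L(u, x_0) replaces x_0 by x_0 - x_1. Both orders thus expand the compatibility function at z_1 =
  x_0 - x_1, z_2 = - x_1. In the iterate \<open>H\<close> the difference z_1 - z_2 is x_0 already;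
  the product \<open>G\<close> has to be translated first.\<close>

lemma comm_pair_exp:
  assumes "\<And>i. i < n \<Longrightarrow> common_rational (G i) (H i)" "\<And>i. i < n \<Longrightarrow> trunc2 (G i)"
    and bd: "bounded_modes (line \<kappa> (exp_sum n (\<lambda>i. twist (H i))))"
  shows "comm_pair (line \<kappa> (exp_sum n (\<lambda>i. twist (translate 1 (G i))))) (line \<kappa> (exp_sum n (\<lambda>i. twist (H i))))"
proof -
  obtain N e where G: "\<And>i. i < n \<Longrightarrow> opr prod_vars (den N) (G i) = opr prod_vars (e i) unit2"
    and H: "\<And>i. i < n \<Longrightarrow> opr iter_vars (den N) (H i) = opr iter_vars (e i) unit2"
    by (rule common_rational_family[of n G H, OF assms(1)]) (auto intro: that)
  let ?v = "vars2 (lin2 1 (-1)) (lin2 0 (-1))"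
  have G': "opr ?v (den N) (twist (translate 1 (G i))) = opr ?v (e i) unit2" if "i < n" for i
    using twist_relation[OF translate_relation[OF G[OF that] assms(2)[OF that], of 1]] by simp
  have H': "opr ?v (den N) (twist (H i)) = opr ?v (e i) unit2" if "i < n" for i
    using twist_relation[OF H[OF that]] by simp
  have lin: "lin2 0 1 = opr ?v (Mul (Con (-1)) (Var 1))"
    by (simp add: vars2_def lin2_def fun_eq_iff)
  show ?thesis
    by (rule comm_pair_line[OF exp_sum_relation[OF lin G'] exp_sum_relation[OF lin H'] bd])
qed

text \<open>In both families z_1 = - x_1, while z_2 is x_0 - x_1 for the product of opposite
  operators and x_0 for their iterate. The chain of swaps, signs and a translation writes the
  coefficients of the iterate of Y^R, given in powers of z_1 - z_2 = - x_0 and z_2, in the variables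
  x_0, x_1.\<close>

lemma assoc_pair_exp:
  assumes "\<And>i. i < n \<Longrightarrow> common_rational (H i) (G i)" "\<And>i. i < n \<Longrightarrow> trunc2 (swap2 (G i))"
    and bd: "bounded_modes (line \<kappa> (exp_sum n (\<lambda>i. twist (swap2 (H i)))))"
  shows "assoc_pair (line \<kappa> (exp_sum n (\<lambda>i. twist (swap2 (twist (translate (-1) (swap2 (G i))))))))
    (line \<kappa> (exp_sum n (\<lambda>i. twist (swap2 (H i)))))"
proof -
  obtain N e where H: "\<And>i. i < n \<Longrightarrow> opr prod_vars (den N) (H i) = opr prod_vars (e i) unit2"
    and G: "\<And>i. i < n \<Longrightarrow> opr iter_vars (den N) (G i) = opr iter_vars (e i) unit2"
    by (rule common_rational_family[of n H G, OF assms(1)]) (auto intro: that)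
  let ?v = "vars2 (lin2 0 (-1)) (lin2 1 (-1))" and ?w = "vars2 (lin2 0 (-1)) (lin2 1 0)"
  have G': "opr ?v (den N) (twist (swap2 (twist (translate (-1) (swap2 (G i)))))) = opr ?v (e i) unit2"
    if "i < n" for i
    using twist_relation[OF swap2_relation[OF twist_relation[OF
      translate_relation[OF swap2_relation[OF G[OF that]] assms(2)[OF that], of "-1"]]]] by simp
  have H': "opr ?w (den N) (twist (swap2 (H i))) = opr ?w (e i) unit2" if "i < n" for i
    using twist_relation[OF swap2_relation[OF H[OF that]]] by simp
  have lin: "lin2 0 1 = opr ?v (Mul (Con (-1)) (Var 0))" "lin2 0 1 = opr ?w (Mul (Con (-1)) (Var 0))"
    by (simp_all add: vars2_def lin2_def fun_eq_iff)
  have "[:-1, 0:] ^ N * ([:-1, 1:] ^ N * [:-1 - -1, 0 - 1:] ^ N) = smult (1 :: complex) ([:0, 1:] ^ N * [:-1, 1:] ^ N)"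
  proof -
    have "[:-1, 0:] * [:0, -1:] = [:0, 1 :: complex:]" by simp
    then have "[:-1, 0:] ^ N * [:0, -1:] ^ N = [:0, 1 :: complex:] ^ N" by (metis power_mult_distrib)
    then show ?thesis by (simp add: mult_ac)
  qed
  from assoc_pair_line[OF exp_sum_relation[OF lin(1) G'] _ this _ bd]
  show ?thesis using exp_sum_relation[OF lin(2) H'] by simp
qed

section \<open>Homogeneous components, the graded dual and operators on the completion\<close>

section \<open>Graded spaces\<close>

lemma linearI_iff:
  assumes "vector_space s1" "vector_space s2" "\<And>x y. f (x + y) = f x + f y" "\<And>c x. f (s1 c x) = s2 c (f x)"
  shows "Vector_Spaces.linear s1 s2 f"
  using assms unfolding Vector_Spaces.linear_iff by blast

lemma linear_addD: "Vector_Spaces.linear s1 s2 f \<Longrightarrow> f (x + y) = f x + f y"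
  unfolding Vector_Spaces.linear_iff by blast

lemma linear_scaleD: "Vector_Spaces.linear s1 s2 f \<Longrightarrow> f (s1 c x) = s2 c (f x)"
  unfolding Vector_Spaces.linear_iff by blast

lemma linear_zeroD: "Vector_Spaces.linear s1 s2 f \<Longrightarrow> f 0 = 0"
  using linear_addD[of s1 s2 f 0 0] by simp

lemma linear_sumD: "Vector_Spaces.linear s1 s2 f \<Longrightarrow> f (\<Sum>i\<in>I. g i) = (\<Sum>i\<in>I. f (g i))"
  by (induction I rule: infinite_finite_induct) (auto simp: linear_addD linear_zeroD)

lemma linear_compD:
  "Vector_Spaces.linear s1 s2 f \<Longrightarrow> Vector_Spaces.linear s2 s3 g \<Longrightarrow> Vector_Spaces.linear s1 s3 (\<lambda>x. g (f x))"
  unfolding Vector_Spaces.linear_iff by auto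

lemma vector_space_complex: "vector_space ((*) :: complex \<Rightarrow> complex \<Rightarrow> complex)"
  by unfold_locales (auto simp: algebra_simps)

context graded_space
begin

abbreviation cpt :: "'i \<Rightarrow> 'a \<Rightarrow> 'a" where "cpt \<equiv> component G"

lemma G_closed: "0 \<in> G i" "x \<in> G i \<Longrightarrow> y \<in> G i \<Longrightarrow> x + y \<in> G i" "x \<in> G i \<Longrightarrow> scale c x \<in> G i"
  using subspace_G[of i] by (auto simp: subspace_def)

lemma comp_decomp: "is_decomp G x (\<lambda>i. cpt i x)"
  using theI'[OF direct_sum[of x]] by (simp add: component_def)

lemma comp_in: "cpt i x \<in> G i" and comp_finite: "finite {i. cpt i x \<noteq> 0}"
  using comp_decomp[of x] by (auto simp: is_decomp_def)

lemma comp_eqI: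
  assumes "\<And>i. c i \<in> G i" "finite S" "\<And>i. i \<notin> S \<Longrightarrow> c i = 0" "x = (\<Sum>i\<in>S. c i)"
  shows "cpt i x = c i"
proof -
  have fin: "finite {i. c i \<noteq> 0}" by (rule finite_subset[OF _ assms(2)]) (use assms(3) in auto)
  have "x = (\<Sum>i | c i \<noteq> 0. c i)"
    unfolding assms(4) by (rule sum.mono_neutral_right) (use assms in auto)
  then have "is_decomp G x c" using assms(1) fin by (simp add: is_decomp_def)
  then have "(\<lambda>i. cpt i x) = c" using comp_decomp direct_sum[of x] by (auto elim!: ex1E)
  then show ?thesis by (rule fun_cong)
qed

lemma comp_sum: "finite S \<Longrightarrow> {i. cpt i x \<noteq> 0} \<subseteq> S \<Longrightarrow> (\<Sum>i\<in>S. cpt i x) = x"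
proof -
  assume S: "finite S" "{i. cpt i x \<noteq> 0} \<subseteq> S"
  then have "(\<Sum>i\<in>S. cpt i x) = (\<Sum>i | cpt i x \<noteq> 0. cpt i x)" by (intro sum.mono_neutral_right) auto
  then show ?thesis using comp_decomp[of x] by (simp add: is_decomp_def)
qed

lemma comp_sum_self: "(\<Sum>i | cpt i x \<noteq> 0. cpt i x) = x"
  by (rule comp_sum) (auto simp: comp_finite)

lemma comp_ext:
  assumes "\<And>i. cpt i x = cpt i y" shows "x = y"
proof -
  have "(\<Sum>i | cpt i x \<noteq> 0. cpt i x) = (\<Sum>i | cpt i y \<noteq> 0. cpt i y)" by (simp only: assms)
  then show ?thesis by (simp only: comp_sum_self)
qed

lemma comp_hom: "x \<in> G j \<Longrightarrow> cpt i x = (if i = j then x else 0)"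
  by (rule comp_eqI[of _ "{j}"]) (auto simp: G_closed)

lemma comp_add: "cpt i (x + y) = cpt i x + cpt i y"
proof (rule comp_eqI)
  let ?S = "{i. cpt i x \<noteq> 0} \<union> {i. cpt i y \<noteq> 0}"
  show "finite ?S" by (simp add: comp_finite)
  then show "x + y = (\<Sum>i\<in>?S. cpt i x + cpt i y)"
    using comp_sum[of ?S x] comp_sum[of ?S y] by (simp add: sum.distrib)
qed (auto intro: G_closed comp_in)

lemma comp_scale: "cpt i (scale c x) = scale c (cpt i x)"
proof (rule comp_eqI)
  let ?S = "{i. cpt i x \<noteq> 0}"
  show "finite ?S" by (simp add: comp_finite)
  show "scale c x = (\<Sum>i\<in>?S. scale c (cpt i x))"
    using comp_sum_self[of x] by (simp add: scale_sum_right[symmetric])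
qed (auto intro: G_closed comp_in)

lemma comp_linear: "Vector_Spaces.linear scale scale (cpt i)"
  by (intro linearI_iff comp_add comp_scale) unfold_locales

lemma comp_0: "cpt i 0 = 0"
  using comp_linear by (rule linear_zeroD)

lemma hom_iff: "x \<in> G j \<longleftrightarrow> (\<forall>i. i \<noteq> j \<longrightarrow> cpt i x = 0)"
proof
  assume *: "\<forall>i. i \<noteq> j \<longrightarrow> cpt i x = 0"
  then have "{i. cpt i x \<noteq> 0} \<subseteq> {j}" by auto
  then have "x = cpt j x" using comp_sum[of "{j}" x] by simp
  then show "x \<in> G j" using comp_in by metis
qed (auto simp: comp_hom)

lemma comp_induct [consumes 0, case_names add hom]:
  assumes "\<And>x y. P x \<Longrightarrow> P y \<Longrightarrow> P (x + y)" and hom: "\<And>i x. x \<in> G i \<Longrightarrow> P x"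
  shows "P x"
proof -
  have "P (\<Sum>i\<in>S. cpt i x)" if "finite S" for S
    using that
  proof induction
    case empty
    show ?case using hom[OF G_closed(1)] by simp
  next
    case (insert i S)
    then show ?case using assms(1)[OF hom[OF comp_in]] by simp
  qed
  from this[OF comp_finite[of x]] show ?thesis by (simp only: comp_sum_self)
qed

lemma comp_grading_op: "cpt j (grading_op scale G wt x) = scale (wt j) (cpt j x)"
proof (rule comp_eqI)
  show "finite {i. cpt i x \<noteq> 0}" by (rule comp_finite)
  show "grading_op scale G wt x = (\<Sum>i | cpt i x \<noteq> 0. scale (wt i) (cpt i x))"
    by (simp add: grading_op_def)
qed (auto intro: G_closed comp_in)

lemma grading_op_hom: "x \<in> G j \<Longrightarrow> grading_op scale G wt x = scale (wt j) x"
proof -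
  assume x: "x \<in> G j"
  have "cpt i (grading_op scale G wt x) = cpt i (scale (wt j) x)" for i
    by (simp add: comp_grading_op comp_scale comp_hom[OF x])
  then show ?thesis by (rule comp_ext)
qed

lemma grading_op_eigen:
  assumes "grading_op scale G wt x = scale c x" "\<And>i. wt i = c \<Longrightarrow> i = j"
  shows "x \<in> G j"
  unfolding hom_iff
proof (intro allI impI)
  fix i assume "i \<noteq> j"
  have "scale (wt i) (cpt i x) = scale c (cpt i x)"
    using comp_grading_op[of i wt x] unfolding assms(1) comp_scale by (rule sym)
  then have "scale (wt i - c) (cpt i x) = 0"
    unfolding scale_left_diff_distrib by (rule right_minus_eq[THEN iffD2])
  moreover have "wt i \<noteq> c" using assms(2)[of i] \<open>i \<noteq> j\<close> by blast
  ultimately show "cpt i x = 0" by simp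
qed


subsection \<open>The graded dual\<close>

abbreviation dual :: "('a \<Rightarrow> complex) set" where "dual \<equiv> graded_dual scale G"

definition supp :: "('a \<Rightarrow> complex) \<Rightarrow> 'i set" where "supp \<psi> = {i. \<exists>x\<in>G i. \<psi> x \<noteq> 0}"

lemma dual_linear: "\<psi> \<in> dual \<Longrightarrow> Vector_Spaces.linear scale (*) \<psi>"
  and dual_supp: "\<psi> \<in> dual \<Longrightarrow> finite (supp \<psi>)"
  by (auto simp: graded_dual_def supp_def)

lemma not_supp: "i \<notin> supp \<psi> \<Longrightarrow> x \<in> G i \<Longrightarrow> \<psi> x = 0"
  by (auto simp: supp_def)

lemma dual_sum: "\<psi> \<in> dual \<Longrightarrow> \<psi> x = (\<Sum>i\<in>supp \<psi>. \<psi> (cpt i x))"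
proof -
  assume \<psi>: "\<psi> \<in> dual"
  have "\<psi> x = \<psi> (\<Sum>i | cpt i x \<noteq> 0. cpt i x)" by (simp only: comp_sum_self)
  also have "\<dots> = (\<Sum>i | cpt i x \<noteq> 0. \<psi> (cpt i x))" by (rule linear_sumD[OF dual_linear[OF \<psi>]])
  also have "\<dots> = (\<Sum>i\<in>{i. cpt i x \<noteq> 0} \<union> supp \<psi>. \<psi> (cpt i x))"
    by (rule sum.mono_neutral_left) (auto simp: comp_finite dual_supp[OF \<psi>] linear_zeroD[OF dual_linear[OF \<psi>]])
  also have "\<dots> = (\<Sum>i\<in>supp \<psi>. \<psi> (cpt i x))"
    by (rule sum.mono_neutral_right) (auto simp: comp_finite dual_supp[OF \<psi>] intro!: not_supp comp_in)
  finally show ?thesis .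
qed

lemma pairing_supp: "pairing G \<psi> w = (\<Sum>i\<in>supp \<psi>. \<psi> (w i))"
  by (simp add: pairing_def supp_def)

text \<open>A functional equal to 1 on a nonzero difference of homogeneous components, composed with
  the projection onto that degree, has a single degree as support and so lies in the graded
  dual.\<close>

lemma dual_separates:
  assumes "w \<in> completion G" "w' \<in> completion G" "\<And>\<psi>. \<psi> \<in> dual \<Longrightarrow> pairing G \<psi> w = pairing G \<psi> w'"
  shows "w = w'"
proof
  fix i
  show "w i = w' i"
  proof (rule ccontr)
    assume "w i \<noteq> w' i"
    define x where "x = w i - w' i"
    have x: "x \<noteq> 0" "x \<in> G i"
      using \<open>w i \<noteq> w' i\<close> assms(1,2) subspace_G[of i] by (auto simp: x_def completion_def intro: subspace_diff)
    interpret p: vector_space_pair scale "(*) :: complex \<Rightarrow> complex \<Rightarrow> complex"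
      by (intro vector_space_pair.intro vector_space_complex) unfold_locales
    obtain f where f: "Vector_Spaces.linear scale (*) f" "f x = (1 :: complex)"
      using p.linear_independent_extend[of "{x}" "\<lambda>_. 1"] x(1) by auto
    define \<psi> where "\<psi> y = f (cpt i y)" for y
    have lin: "Vector_Spaces.linear scale (*) \<psi>"
      unfolding \<psi>_def by (rule linear_compD[OF comp_linear f(1)])
    have z: "\<psi> y = 0" if "y \<in> G j" "j \<noteq> i" for y j
      using that linear_zeroD[OF f(1)] by (auto simp: \<psi>_def comp_hom)
    have "\<psi> x = 1" using x(2) f(2) by (simp add: \<psi>_def comp_hom)
    have supp: "supp \<psi> = {i}"
    proof
      show "supp \<psi> \<subseteq> {i}" using z by (auto simp: supp_def)
      show "{i} \<subseteq> supp \<psi>" using x(2) \<open>\<psi> x = 1\<close> by (auto simp: supp_def intro!: bexI[of _ x])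
    qed
    then have "\<psi> \<in> dual" using lin by (simp add: graded_dual_def supp_def)
    from assms(3)[OF this] have "\<psi> (w i) = \<psi> (w' i)" by (simp add: pairing_supp supp)
    then have "\<psi> x = 0" using linear_addD[OF lin, of x "w' i"] by (simp add: x_def)
    then show False using \<open>\<psi> x = 1\<close> by simp
  qed
qed

end


subsection \<open>Operators of finitely many degrees on the completion\<close>

lemma modes_Cons: "modes Y (u # us) (l # k) x = Y u l (modes Y us k x)"
  by (simp add: modes_def)

lemma modes_Nil: "modes Y [] k x = x"
  by (simp add: modes_def)

locale graded_group = graded_space scale G
  for scale :: "complex \<Rightarrow> 'a::ab_group_add \<Rightarrow> 'a" and G :: "'i::ab_group_add \<Rightarrow> 'a set"
begin

text \<open>\<Delta> is a finite set of degree shifts. Naming it fixes in advance which components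
  of a completion element can contribute to a given degree.\<close>

definition spread :: "'i set \<Rightarrow> ('a \<Rightarrow> 'a) \<Rightarrow> bool" where
  "spread \<Delta> T \<longleftrightarrow> finite \<Delta> \<and> Vector_Spaces.linear scale scale T \<and>
     (\<forall>j x i. x \<in> G j \<longrightarrow> cpt i (T x) \<noteq> 0 \<longrightarrow> i - j \<in> \<Delta>)"

lemma spread_linear: "spread \<Delta> T \<Longrightarrow> Vector_Spaces.linear scale scale T"
  by (simp add: spread_def)

lemma spread_comp_0: "spread \<Delta> T \<Longrightarrow> x \<in> G j \<Longrightarrow> i - j \<notin> \<Delta> \<Longrightarrow> cpt i (T x) = 0"
  unfolding spread_def by blast

lemma spread_id: "spread {0} (\<lambda>x. x)"
  unfolding spread_def by (auto simp: comp_hom split: if_splits intro!: linearI_iff) unfold_locales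

lemma spread_compose:
  assumes S: "spread \<Delta> S" and T: "spread \<Delta>' T"
  shows "spread ((\<lambda>(a, b). a + b) ` (\<Delta> \<times> \<Delta>')) (\<lambda>x. S (T x))"
  unfolding spread_def
proof (intro conjI allI impI)
  show "finite ((\<lambda>(a, b). a + b) ` (\<Delta> \<times> \<Delta>'))" using assms by (auto simp: spread_def)
  show "Vector_Spaces.linear scale scale (\<lambda>x. S (T x))"
    using assms by (auto simp: spread_def intro: linear_compD)
  fix j x i assume x: "x \<in> G j" and "cpt i (S (T x)) \<noteq> 0"
  have "cpt i (S (T x)) = cpt i (S (\<Sum>l | cpt l (T x) \<noteq> 0. cpt l (T x)))" by (simp only: comp_sum_self)
  also have "\<dots> = (\<Sum>l | cpt l (T x) \<noteq> 0. cpt i (S (cpt l (T x))))"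
    by (simp only: linear_sumD[OF spread_linear[OF S]] linear_sumD[OF comp_linear])
  finally obtain l where l: "cpt l (T x) \<noteq> 0" "cpt i (S (cpt l (T x))) \<noteq> 0"
    using \<open>cpt i (S (T x)) \<noteq> 0\<close> by (metis (mono_tags, lifting) mem_Collect_eq sum.neutral)
  have "l - j \<in> \<Delta>'" using T x l(1) unfolding spread_def by blast
  moreover have "i - l \<in> \<Delta>" using S l(2) comp_in unfolding spread_def by blast
  ultimately have "(i - l) + (l - j) \<in> (\<lambda>(a, b). a + b) ` (\<Delta> \<times> \<Delta>')" by (intro image_eqI[of _ _ "(i - l, l - j)"]) auto
  then show "i - j \<in> (\<lambda>(a, b). a + b) ` (\<Delta> \<times> \<Delta>')" by simp
qed

lemma spread_mono: "spread \<Delta> T \<Longrightarrow> \<Delta> \<subseteq> \<Delta>' \<Longrightarrow> finite \<Delta>' \<Longrightarrow> spread \<Delta>' T"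
  unfolding spread_def by blast

lemma hat_sum:
  assumes "spread \<Delta> T" "w \<in> completion G" "finite J" "\<And>\<delta>. \<delta> \<in> \<Delta> \<Longrightarrow> i - \<delta> \<in> J"
  shows "hat G T w i = (\<Sum>j\<in>J. cpt i (T (w j)))"
  unfolding hat_def
proof (rule sum.mono_neutral_left)
  show "{j. cpt i (T (w j)) \<noteq> 0} \<subseteq> J"
  proof
    fix j assume "j \<in> {j. cpt i (T (w j)) \<noteq> 0}"
    moreover have "w j \<in> G j" using assms(2) by (simp add: completion_def)
    ultimately have "i - j \<in> \<Delta>" using assms(1) unfolding spread_def by blast
    from assms(4)[OF this] show "j \<in> J" by simp
  qed
qed (use assms in auto)

lemma pairing_hat:
  assumes \<psi>: "\<psi> \<in> dual" and T: "spread \<Delta> T" and w: "w \<in> completion G"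
    and J: "finite J" "\<And>i \<delta>. i \<in> supp \<psi> \<Longrightarrow> \<delta> \<in> \<Delta> \<Longrightarrow> i - \<delta> \<in> J"
  shows "pairing G \<psi> (hat G T w) = (\<Sum>j\<in>J. \<psi> (T (w j)))"
proof -
  have "pairing G \<psi> (hat G T w) = (\<Sum>i\<in>supp \<psi>. \<Sum>j\<in>J. \<psi> (cpt i (T (w j))))"
    unfolding pairing_supp
    by (intro sum.cong refl) (simp add: hat_sum[OF T w J(1) J(2)] linear_sumD[OF dual_linear[OF \<psi>]])
  also have "\<dots> = (\<Sum>j\<in>J. \<Sum>i\<in>supp \<psi>. \<psi> (cpt i (T (w j))))" by (rule sum.swap)
  also have "\<dots> = (\<Sum>j\<in>J. \<psi> (T (w j)))" by (simp only: dual_sum[OF \<psi>, symmetric])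
  finally show ?thesis .
qed

text \<open>Series compose operators on the completion, whereas the axioms speak of W. Each
  component is a finite double sum, and enlarging the ranges of the intermediate and initial degrees
  makes both sides the same sum.\<close>

lemma hat_compose:
  assumes S: "spread \<Delta> S" and T: "spread \<Delta>' T" and w: "w \<in> completion G"
  shows "hat G S (hat G T w) = hat G (\<lambda>x. S (T x)) w"
proof
  fix i
  define L where "L = (\<lambda>\<delta>. i - \<delta>) ` \<Delta>"
  define J where "J = (\<lambda>(l, \<delta>). l - \<delta>) ` (L \<times> \<Delta>')"
  have fin: "finite L" "finite J" using S T by (auto simp: L_def J_def spread_def)
  have cl: "hat G T w \<in> completion G"
    unfolding completion_def
  proof (intro CollectI allI)
    fix i show "hat G T w i \<in> G i" unfolding hat_def
      by (rule subspace_sum[OF subspace_G]) (rule comp_in)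
  qed
  have "hat G S (hat G T w) i = (\<Sum>l\<in>L. cpt i (S (hat G T w l)))"
    by (rule hat_sum[OF S cl fin(1)]) (auto simp: L_def)
  also have "\<dots> = (\<Sum>l\<in>L. cpt i (S (\<Sum>j\<in>J. cpt l (T (w j)))))"
  proof (intro sum.cong refl)
    fix l assume "l \<in> L"
    then have "hat G T w l = (\<Sum>j\<in>J. cpt l (T (w j)))"
      by (intro hat_sum[OF T w fin(2)]) (force simp: J_def)
    then show "cpt i (S (hat G T w l)) = cpt i (S (\<Sum>j\<in>J. cpt l (T (w j))))" by simp
  qed
  also have "\<dots> = (\<Sum>j\<in>J. \<Sum>l\<in>L. cpt i (S (cpt l (T (w j)))))"
    by (simp only: linear_sumD[OF spread_linear[OF S]] linear_sumD[OF comp_linear]) (rule sum.swap)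
  also have "\<dots> = (\<Sum>j\<in>J. cpt i (S (T (w j))))"
  proof (intro sum.cong refl)
    fix j
    let ?x = "T (w j)" and ?U = "{l. cpt l (T (w j)) \<noteq> 0} \<union> L"
    have "(\<Sum>l\<in>L. cpt i (S (cpt l ?x))) = (\<Sum>l\<in>?U. cpt i (S (cpt l ?x)))"
    proof (rule sum.mono_neutral_left)
      show "\<forall>l\<in>?U - L. cpt i (S (cpt l ?x)) = 0"
      proof
        fix l assume "l \<in> ?U - L"
        then have "i - l \<notin> \<Delta>" by (auto simp: L_def image_iff)
        then show "cpt i (S (cpt l ?x)) = 0" using spread_comp_0[OF S comp_in] by blast
      qed
    qed (auto simp: comp_finite fin)
    also have "\<dots> = cpt i (S (\<Sum>l\<in>?U. cpt l ?x))"
      by (simp only: linear_sumD[OF spread_linear[OF S]] linear_sumD[OF comp_linear])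
    also have "(\<Sum>l\<in>?U. cpt l ?x) = ?x" by (rule comp_sum) (auto simp: comp_finite fin)
    finally show "(\<Sum>l\<in>L. cpt i (S (cpt l ?x))) = cpt i (S ?x)" .
  qed
  also have "\<dots> = hat G (\<lambda>x. S (T x)) w i"
  proof (rule hat_sum[OF spread_compose[OF S T] w fin(2), symmetric])
    fix \<delta> assume "\<delta> \<in> (\<lambda>(a, b). a + b) ` (\<Delta> \<times> \<Delta>')"
    then obtain a b where ab: "a \<in> \<Delta>" "b \<in> \<Delta>'" "\<delta> = a + b" by auto
    then have "(i - a) - b \<in> J" unfolding J_def L_def by (intro image_eqI[of _ _ "(i - a, b)"]) auto
    then show "i - \<delta> \<in> J" using ab by (simp add: diff_diff_eq)
  qed
  finally show "hat G S (hat G T w) i = hat G (\<lambda>x. S (T x)) w i" .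
qed

lemma hat_id:
  assumes "w \<in> completion G" shows "hat G (\<lambda>x. x) w = w"
proof
  fix i
  have "w i \<in> G i" using assms by (simp add: completion_def)
  then show "hat G (\<lambda>x. x) w i = w i"
    using hat_sum[OF spread_id assms, of "{i}" i] by (simp add: comp_hom)
qed

lemma spread_modes:
  assumes "\<And>A l. A \<in> set As \<Longrightarrow> \<exists>\<Delta>. spread \<Delta> (A l)" "length k = length As"
  shows "\<exists>\<Delta>. spread \<Delta> (modes (\<lambda>A l. A l) As k)"
  using assms(2,1)
proof (induction k As rule: list_induct2)
  case Nil
  show ?case using spread_id by (auto simp: modes_def)
next
  case (Cons l k A As)
  then obtain \<Delta> \<Delta>' where "spread \<Delta> (A l)" "spread \<Delta>' (modes (\<lambda>A l. A l) As k)" by force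
  from spread_compose[OF this] show ?case by (auto simp: modes_Cons[abs_def])
qed

lemma modes_hat:
  assumes "\<And>A l. A \<in> set As \<Longrightarrow> \<exists>\<Delta>. spread \<Delta> (A l)" "length k = length As" "w \<in> completion G"
  shows "modes (\<lambda>A l. hat G (A l)) As k w = hat G (modes (\<lambda>A l. A l) As k) w"
  using assms(2,1)
proof (induction k As rule: list_induct2)
  case Nil
  show ?case using hat_id[OF assms(3)] by (simp add: modes_def)
next
  case (Cons l k A As)
  obtain \<Delta> where 1: "spread \<Delta> (A l)" using Cons.prems by force
  obtain \<Delta>' where 2: "spread \<Delta>' (modes (\<lambda>A l. A l) As k)"
    using spread_modes[OF _ Cons.hyps] Cons.prems by force
  show ?case using hat_compose[OF 1 2 assms(3)] Cons by (simp add: modes_Cons[abs_def])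
qed

text \<open>Lets outer modes and powers of D be absorbed into the functional, so that the axioms can
  be quoted for the operators that remain.\<close>

lemma dual_compose:
  assumes \<psi>: "\<psi> \<in> dual" and T: "spread \<Delta> T"
  shows "(\<lambda>x. \<psi> (T x)) \<in> dual"
proof -
  have "{j. \<exists>x\<in>G j. \<psi> (T x) \<noteq> 0} \<subseteq> (\<lambda>(i, \<delta>). i - \<delta>) ` (supp \<psi> \<times> \<Delta>)"
  proof
    fix j assume "j \<in> {j. \<exists>x\<in>G j. \<psi> (T x) \<noteq> 0}"
    then obtain x where x: "x \<in> G j" "\<psi> (T x) \<noteq> 0" by blast
    then obtain i where i: "i \<in> supp \<psi>" "\<psi> (cpt i (T x)) \<noteq> 0"
      using dual_sum[OF \<psi>, of "T x"] by (metis sum.neutral)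
    then have "cpt i (T x) \<noteq> 0" using linear_zeroD[OF dual_linear[OF \<psi>]] by auto
    then have "i - j \<in> \<Delta>" using T x(1) unfolding spread_def by blast
    then show "j \<in> (\<lambda>(i, \<delta>). i - \<delta>) ` (supp \<psi> \<times> \<Delta>)" using i(1) by (intro image_eqI[of _ _ "(i, i - j)"]) auto
  qed
  moreover have "finite ((\<lambda>(i, \<delta>). i - \<delta>) ` (supp \<psi> \<times> \<Delta>))" using dual_supp[OF \<psi>] T by (auto simp: spread_def)
  ultimately have "finite {j. \<exists>x\<in>G j. \<psi> (T x) \<noteq> 0}" by (rule finite_subset)
  then show ?thesis unfolding graded_dual_def
    using linear_compD[OF spread_linear[OF T] dual_linear[OF \<psi>]] by blast
qed

end

section \<open>Weights, truncation and the pair relations of vertex operators\<close>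

section \<open>Vertex operators\<close>

definition sgn_mode :: "int \<Rightarrow> complex" where "sgn_mode k = (-1) powi (- k - 1)"

lemma sgn_mode_add: "sgn_mode (k + int l) = (-1) ^ l * sgn_mode k"
proof (induction l)
  case (Suc l)
  have "sgn_mode (k + int l) = (-1) powi (- (k + int (Suc l)) - 1 + 1)"
    unfolding sgn_mode_def by (rule arg_cong[where f = "\<lambda>z. (-1) powi z"]) simp
  also have "\<dots> = - sgn_mode (k + int (Suc l))"
    unfolding sgn_mode_def by (subst power_int_add) auto
  finally show ?case using Suc by (simp add: minus_equation_iff[of "sgn_mode _"])
qed simp

lemma twist_sgn: "twist A (p, q) = sgn_mode q * A (p, q)"
  by (simp add: twist_def sgn_mode_def)

text \<open>Applied to \<open>f i j k = \<psi> (D\<^sup>i Y\<^sub>k D\<^sup>j w)\<close>, where \<open>Y\<^sub>k D = D Y\<^sub>k + k Y\<^sub>k\<^sub>-\<^sub>1\<close>.\<close>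

lemma derivation_expansion:
  fixes f :: "nat \<Rightarrow> nat \<Rightarrow> int \<Rightarrow> complex"
  assumes "\<And>i j k. f i (Suc j) k = f (Suc i) j k + of_int k * f i j (k - 1)"
  shows "f i j k / fact j = (\<Sum>l\<le>j. (of_int k gchoose l) * f (i + (j - l)) 0 (k - int l) / fact (j - l))"
proof (induction j arbitrary: i k)
  case 0
  show ?case by simp
next
  case (Suc j)
  let ?g = "\<lambda>l. f (i + (Suc j - l)) 0 (k - int l)" and ?k = "of_int k :: complex"
  let ?t = "\<lambda>l. (?k gchoose l) * ?g l / fact (Suc j - l)"
  have abs: "of_nat (Suc l) * (?k gchoose Suc l) = ?k * ((?k - 1) gchoose l)" for l
    by (rule gbinomial_absorption)
  have A: "f (Suc i) j k / fact j = (\<Sum>l\<le>j. of_nat (Suc j - l) * ?t l)"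
    unfolding Suc.IH
  proof (intro sum.cong refl)
    fix l assume "l \<in> {..j}"
    then have "Suc j - l = Suc (j - l)" by auto
    then show "(?k gchoose l) * f (Suc i + (j - l)) 0 (k - int l) / fact (j - l) = of_nat (Suc j - l) * ?t l"
      by (simp del: of_nat_Suc)
  qed
  have B: "?k * f i j (k - 1) / fact j = (\<Sum>l\<le>j. of_nat (Suc l) * ?t (Suc l))"
  proof -
    have "?k * f i j (k - 1) / fact j = ?k * (f i j (k - 1) / fact j)" by simp
    also have "\<dots> = (\<Sum>l\<le>j. ?k * (((?k - 1) gchoose l) * f (i + (j - l)) 0 (k - 1 - int l) / fact (j - l)))"
      unfolding Suc.IH by (simp add: sum_distrib_left)
    also have "\<dots> = (\<Sum>l\<le>j. of_nat (Suc l) * ?t (Suc l))"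
    proof (intro sum.cong refl)
      fix l
      have "?k * (((?k - 1) gchoose l) * f (i + (j - l)) 0 (k - 1 - int l) / fact (j - l))
        = (?k * ((?k - 1) gchoose l)) * (f (i + (j - l)) 0 (k - 1 - int l) / fact (j - l))" by simp
      also have "\<dots> = of_nat (Suc l) * ?t (Suc l)" unfolding abs[symmetric] by (simp add: diff_diff_eq)
      finally show "?k * (((?k - 1) gchoose l) * f (i + (j - l)) 0 (k - 1 - int l) / fact (j - l))
        = of_nat (Suc l) * ?t (Suc l)" .
    qed
    finally show ?thesis .
  qed
  \<comment> \<open>The step is proved after multiplication by j + 1, which splits as (j + 1 - l) +
    l on the l-th term; the two pieces match the two terms of the recursion.\<close>
  have "of_nat (Suc j) * (f i (Suc j) k / fact (Suc j)) = f (Suc i) j k / fact j + ?k * f i j (k - 1) / fact j"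
  proof -
    have "of_nat (Suc j) * (y / fact (Suc j)) = y / fact j" for y :: complex
      unfolding fact_Suc by (simp add: field_simps del: of_nat_Suc)
    then show ?thesis by (simp only: assms add_divide_distrib distrib_left)
  qed
  also have "\<dots> = (\<Sum>l\<le>Suc j. of_nat (Suc j - l) * ?t l) + (\<Sum>l\<le>Suc j. of_nat l * ?t l)"
  proof -
    have "(\<Sum>l\<le>Suc j. of_nat (Suc j - l) * ?t l) = (\<Sum>l\<le>j. of_nat (Suc j - l) * ?t l)"
      by (subst sum.atMost_Suc) simp
    moreover have "(\<Sum>l\<le>Suc j. of_nat l * ?t l) = (\<Sum>l\<le>j. of_nat (Suc l) * ?t (Suc l))"
      by (subst sum.atMost_Suc_shift) (simp del: of_nat_Suc)
    ultimately show ?thesis by (simp only: A B)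
  qed
  also have "\<dots> = (\<Sum>l\<le>Suc j. of_nat (Suc j) * ?t l)"
    unfolding sum.distrib[symmetric]
  proof (intro sum.cong refl)
    fix l assume "l \<in> {..Suc j}"
    then have "of_nat (Suc j) = (of_nat (Suc j - l) + of_nat l :: complex)"
      by (simp only: of_nat_add[symmetric]) simp
    then show "of_nat (Suc j - l) * ?t l + of_nat l * ?t l = of_nat (Suc j) * ?t l"
      by (simp only: distrib_right)
  qed
  also have "\<dots> = of_nat (Suc j) * (\<Sum>l\<le>Suc j. ?t l)" by (rule sum_distrib_left[symmetric])
  finally have eq: "of_nat (Suc j) * (f i (Suc j) k / fact (Suc j)) = of_nat (Suc j) * (\<Sum>l\<le>Suc j. ?t l)" .
  have nz: "of_nat (Suc j) \<noteq> (0 :: complex)" by (simp del: of_nat_Suc)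
  show ?case by (rule mult_left_cancel[OF nz, THEN iffD1, OF eq])
qed

context mosva
begin

lemma YV_add: "YV (u + u') k v = YV u k v + YV u' k v" "YV u k (v + v') = YV u k v + YV u k v'"
  using linear_addD[OF YV_linear_left] linear_addD[OF YV_linear_right] by auto

lemma YV_weight:
  assumes "u \<in> VG a" "v \<in> VG b" shows "YV u k v \<in> VG (a + b - k - 1)"
proof (rule V.grading_op_eigen)
  have "grading_op sV VG of_int (YV u k v) = YV u k (sV (of_int b) v) + (sV (of_int (- k - 1)) (YV u k v) + YV (sV (of_int a) u) k v)"
    using YV_d_commutator[of u k v] V.grading_op_hom[OF assms(1)] V.grading_op_hom[OF assms(2)]
    by (metis add.commute diff_add_cancel)
  also have "\<dots> = sV (of_int (a + b - k - 1)) (YV u k v)"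
    unfolding linear_scaleD[OF YV_linear_right] linear_scaleD[OF YV_linear_left] V.scale_left_distrib[symmetric]
    by (simp add: algebra_simps)
  finally show "grading_op sV VG of_int (YV u k v) = sV (of_int (a + b - k - 1)) (YV u k v)" .
qed (use of_int_eq_iff in blast)

lemma YV_trunc: "\<exists>n. \<forall>k\<ge>n. YV u k v = 0"
proof -
  obtain N where N: "\<And>n. n < N \<Longrightarrow> VG n = {0}" using V_lower_bounded by blast
  show ?thesis
  proof (induction u rule: V.comp_induct)
    case (add u u')
    then obtain n m where "\<forall>k\<ge>n. YV u k v = 0" "\<forall>k\<ge>m. YV u' k v = 0" by blast
    then show ?case by (intro exI[of _ "max n m"]) (auto simp: YV_add)
  next
    case (hom a u)
    note u = hom
    show ?case
    proof (induction v rule: V.comp_induct)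
      case (add v v')
      then obtain n m where "\<forall>k\<ge>n. YV u k v = 0" "\<forall>k\<ge>m. YV u k v' = 0" by blast
      then show ?case by (intro exI[of _ "max n m"]) (auto simp: YV_add)
    next
      case (hom b v)
      have "YV u k v = 0" if "k \<ge> a + b - N" for k
        using YV_weight[OF u hom, of k] N[of "a + b - k - 1"] that by auto
      then show ?case by blast
    qed
  qed
qed

text \<open>The commutator with d at mode -1 gives Y(d 1)_{-1} 1 = 0, and creation turns this into d
  1 = 0.\<close>

lemma vac_weight: "vac \<in> VG 0"
proof (rule V.grading_op_eigen)
  have "YV (grading_op sV VG of_int vac) (- 1) vac = 0"
    using YV_d_commutator[of vac "- 1" vac] by (simp add: YV_identity)
  then show "grading_op sV VG of_int vac = sV 0 vac" by (simp add: YV_creation)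
qed simp

definition wts :: "'v \<Rightarrow> int set" where "wts u = {n. component VG n u \<noteq> 0}"

lemma finite_wts: "finite (wts u)"
  by (simp add: wts_def V.comp_finite)

lemma wts_sum: "(\<Sum>n\<in>wts u. component VG n u) = u"
  unfolding wts_def by (rule V.comp_sum_self)

lemma YV_wts:
  assumes "c \<in> wts (YV u k v)" shows "\<exists>a\<in>wts u. \<exists>b\<in>wts v. c = a + b - k - 1"
proof (rule ccontr)
  assume *: "\<not> ?thesis"
  have "YV u k v = YV (\<Sum>a\<in>wts u. component VG a u) k (\<Sum>b\<in>wts v. component VG b v)"
    by (simp only: wts_sum)
  also have "\<dots> = (\<Sum>b\<in>wts v. \<Sum>a\<in>wts u. YV (component VG a u) k (component VG b v))"
    by (simp only: linear_sumD[OF YV_linear_right] linear_sumD[OF YV_linear_left])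
  finally have "component VG c (YV u k v) = (\<Sum>b\<in>wts v. \<Sum>a\<in>wts u. component VG c (YV (component VG a u) k (component VG b v)))"
    by (simp only: linear_sumD[OF V.comp_linear])
  also have "\<dots> = 0"
  proof (intro sum.neutral ballI)
    fix b a assume "b \<in> wts v" "a \<in> wts u"
    then have "c \<noteq> a + b - k - 1" using * by blast
    then show "component VG c (YV (component VG a u) k (component VG b v)) = 0"
      using V.comp_hom[OF YV_weight[OF V.comp_in V.comp_in]] by simp
  qed
  finally show False using assms by (simp add: wts_def)
qed

text \<open>Each mode l changes the weight by a weight of its vector minus l + 1, so after adding
  back the sum of the modes one finite set serves all of them simultaneously.\<close>

lemma modes_vac_wts:
  "\<exists>N. finite N \<and> (\<forall>k. length k = length us \<longrightarrow>
     (\<forall>c\<in>wts (modes YV us k vac). c + sum_list k \<in> N))"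
proof (induction us)
  case Nil
  show ?case
    by (intro exI[of _ "{0}"]) (auto simp: modes_def wts_def V.comp_hom[OF vac_weight] split: if_splits)
next
  case (Cons u us)
  then obtain N where N: "finite N" "\<And>k c. length k = length us \<Longrightarrow> c \<in> wts (modes YV us k vac) \<Longrightarrow> c + sum_list k \<in> N"
    by blast
  show ?case
  proof (intro exI conjI allI impI ballI)
    show "finite ((\<lambda>(a, b). a + b - 1) ` (wts u \<times> N))" using N(1) finite_wts by blast
    fix k :: "int list" and c assume k: "length k = length (u # us)" and c: "c \<in> wts (modes YV (u # us) k vac)"
    obtain l k' where kk: "k = l # k'" using k by (cases k) auto
    from c obtain a b where ab: "a \<in> wts u" "b \<in> wts (modes YV us k' vac)" "c = a + b - l - 1"
      unfolding kk modes_def by (auto dest: YV_wts)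
    have "b + sum_list k' \<in> N" using N(2) ab(2) k kk by auto
    then show "c + sum_list k \<in> (\<lambda>(a, b). a + b - 1) ` (wts u \<times> N)"
      using ab kk by (intro image_eqI[of _ _ "(a, b + sum_list k')"]) auto
  qed
qed

end

sublocale mosva_bimodule \<subseteq> W: graded_group sW WG ..

context mosva_bimodule
begin

abbreviation "YS \<equiv> skew sW DW YR"

text \<open>The properties shared by Y^L and the opposite operator from which truncation and
  finiteness of the degree shifts follow.\<close>

definition vertex_map :: "('v \<Rightarrow> int \<Rightarrow> 'w \<Rightarrow> 'w) \<Rightarrow> bool" where
  "vertex_map Y \<longleftrightarrow> (\<forall>u k. Vector_Spaces.linear sW sW (Y u k)) \<and>
     (\<forall>k w. Vector_Spaces.linear sV sW (\<lambda>u. Y u k w)) \<and>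
     (\<forall>a b u w k. u \<in> VG a \<longrightarrow> w \<in> WG b \<longrightarrow> Y u k w \<in> WG (b + of_int (a - k - 1)))"

lemma vertex_mapD:
  assumes "vertex_map Y"
  shows "Vector_Spaces.linear sW sW (Y u k)" "Vector_Spaces.linear sV sW (\<lambda>u. Y u k w)"
    "u \<in> VG a \<Longrightarrow> w \<in> WG b \<Longrightarrow> Y u k w \<in> WG (b + of_int (a - k - 1))"
  using assms unfolding vertex_map_def by blast+

lemma weight_trunc:
  assumes "\<And>k. x k \<in> WG (b + of_int (a - k - 1))"
  shows "\<exists>n. \<forall>k\<ge>n. x k = 0"
proof -
  obtain N where N: "\<And>m. Re m < N \<Longrightarrow> WG m = {0}" using W_lower_bounded by blast
  have "x k = 0" if "k \<ge> \<lceil>Re b + of_int a - N\<rceil>" for k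
  proof -
    have "Re b + of_int a - N \<le> of_int k" using that by linarith
    then have "Re (b + of_int (a - k - 1)) < N" by simp
    from N[OF this] assms[of k] show ?thesis by simp
  qed
  then show ?thesis by blast
qed

lemma vertex_map_trunc:
  assumes "vertex_map Y" shows "\<exists>n. \<forall>k\<ge>n. Y u k w = 0"
proof (induction u rule: V.comp_induct)
  case (add u u')
  then obtain n m where "\<forall>k\<ge>n. Y u k w = 0" "\<forall>k\<ge>m. Y u' k w = 0" by blast
  then show ?case
    by (intro exI[of _ "max n m"]) (auto simp: linear_addD[OF vertex_mapD(2)[OF assms]])
next
  case (hom a u)
  note u = hom
  show ?case
  proof (induction w rule: W.comp_induct)
    case (add w w')
    then obtain n m where "\<forall>k\<ge>n. Y u k w = 0" "\<forall>k\<ge>m. Y u k w' = 0" by blast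
    then show ?case
      by (intro exI[of _ "max n m"]) (auto simp: linear_addD[OF vertex_mapD(1)[OF assms]])
  next
    case (hom b w)
    then show ?case by (intro weight_trunc[of _ b a] vertex_mapD(3)[OF assms] u)
  qed
qed

lemma vertex_map_spread:
  assumes "vertex_map Y"
  shows "W.spread ((\<lambda>a. of_int (a - k - 1)) ` wts u) (Y u k)"
  unfolding W.spread_def
proof (intro conjI allI impI)
  show "finite ((\<lambda>a. of_int (a - k - 1)) ` wts u)" using finite_wts by blast
  show "Vector_Spaces.linear sW sW (Y u k)" by (rule vertex_mapD(1)[OF assms])
  fix j x i assume x: "x \<in> WG j" and nz: "component WG i (Y u k x) \<noteq> 0"
  show "i - j \<in> (\<lambda>a. of_int (a - k - 1)) ` wts u"
  proof (rule ccontr)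
    assume *: "i - j \<notin> (\<lambda>a. of_int (a - k - 1)) ` wts u"
    have "Y u k x = Y (\<Sum>a\<in>wts u. component VG a u) k x" by (simp only: wts_sum)
    then have "component WG i (Y u k x) = (\<Sum>a\<in>wts u. component WG i (Y (component VG a u) k x))"
      by (simp only: linear_sumD[OF vertex_mapD(2)[OF assms]] linear_sumD[OF W.comp_linear])
    also have "\<dots> = 0"
    proof (intro sum.neutral ballI)
      fix a assume "a \<in> wts u"
      then have "i - j \<noteq> of_int (a - k - 1)" using * by blast
      then have "i \<noteq> j + of_int (a - k - 1)" by (metis add_diff_cancel_left')
      then show "component WG i (Y (component VG a u) k x) = 0"
        using W.comp_hom[OF vertex_mapD(3)[OF assms V.comp_in x]] by simp
    qed
    finally show False using nz by simp
  qed
qed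

lemma YL_vertex_map: "vertex_map YL"
  unfolding vertex_map_def
proof (intro conjI allI impI YL_linear_left YL_linear_right)
  fix a b u w k assume uw: "u \<in> VG a" "w \<in> WG b"
  show "YL u k w \<in> WG (b + of_int (a - k - 1))"
  proof (rule W.grading_op_eigen[where wt = "\<lambda>m. m"])
    have "grading_op sW WG (\<lambda>m. m) (YL u k w) = YL u k (sW b w) + (YL (sV (of_int a) u) k w + sW (of_int (- k - 1)) (YL u k w))"
      using YL_d_commutator[of u k w] V.grading_op_hom[OF uw(1), of of_int] W.grading_op_hom[OF uw(2), of "\<lambda>m. m"]
      by (metis add.commute diff_add_cancel)
    also have "\<dots> = sW (b + of_int (a - k - 1)) (YL u k w)"
      unfolding linear_scaleD[OF YL_linear_right] linear_scaleD[OF YL_linear_left] W.scale_left_distrib[symmetric]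
      by (simp add: algebra_simps)
    finally show "grading_op sW WG (\<lambda>m. m) (YL u k w) = sW (b + of_int (a - k - 1)) (YL u k w)" .
  qed
qed

lemma YR_weight:
  assumes "w \<in> WG b" "v \<in> VG a" shows "YR w k v \<in> WG (b + of_int (a - k - 1))"
proof (rule W.grading_op_eigen[where wt = "\<lambda>m. m"])
  have "grading_op sW WG (\<lambda>m. m) (YR w k v) = YR w k (sV (of_int a) v) + (YR (sW b w) k v + sW (of_int (- k - 1)) (YR w k v))"
    using YR_d_commutator[of w k v] V.grading_op_hom[OF assms(2), of of_int] W.grading_op_hom[OF assms(1), of "\<lambda>m. m"]
    by (metis add.commute diff_add_cancel)
  also have "\<dots> = sW (b + of_int (a - k - 1)) (YR w k v)"
    unfolding linear_scaleD[OF YR_linear_right] linear_scaleD[OF YR_linear_left] W.scale_left_distrib[symmetric]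
    by (simp add: algebra_simps)
  finally show "grading_op sW WG (\<lambda>m. m) (YR w k v) = sW (b + of_int (a - k - 1)) (YR w k v)" .
qed

lemma YR_trunc: "\<exists>n. \<forall>k\<ge>n. YR w k v = 0"
proof (induction v rule: V.comp_induct)
  case (add v v')
  then obtain n m where "\<forall>k\<ge>n. YR w k v = 0" "\<forall>k\<ge>m. YR w k v' = 0" by blast
  then show ?case by (intro exI[of _ "max n m"]) (auto simp: linear_addD[OF YR_linear_right])
next
  case (hom a v)
  note v = hom
  show ?case
  proof (induction w rule: W.comp_induct)
    case (add w w')
    then obtain n m where "\<forall>k\<ge>n. YR w k v = 0" "\<forall>k\<ge>m. YR w' k v = 0" by blast
    then show ?case by (intro exI[of _ "max n m"]) (auto simp: linear_addD[OF YR_linear_left])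
  next
    case (hom b w)
    then show ?case by (intro weight_trunc[of _ b a] YR_weight v)
  qed
qed

lemma DW_pow_linear: "Vector_Spaces.linear sW sW (DW ^^ i)"
proof (induction i)
  case 0
  show ?case by (rule linearI_iff) (auto intro: W.vector_space_axioms)
next
  case (Suc i)
  from linear_compD[OF this DW_linear] show ?case by (simp add: o_def)
qed

lemma DW_pow_weight: "w \<in> WG m \<Longrightarrow> (DW ^^ i) w \<in> WG (m + of_nat i)"
proof (induction i)
  case (Suc i)
  from DW_weight[OF Suc.IH[OF Suc.prems]] show ?case by (simp add: algebra_simps)
qed simp

lemma dual_DW_pow: "\<psi> \<in> graded_dual sW WG \<Longrightarrow> (\<lambda>x. \<psi> ((DW ^^ i) x)) \<in> graded_dual sW WG"
proof (rule W.dual_compose)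
  show "W.spread {of_nat i} (DW ^^ i)"
    unfolding W.spread_def using DW_pow_linear W.comp_hom[OF DW_pow_weight]
    by (auto split: if_splits)
qed

text \<open>D raises weights by one, the real parts of weights are bounded below, and \<psi> sees
  finitely many degrees; hence one exponent works for all vectors.\<close>

lemma dual_DW_nilpotent:
  assumes \<psi>: "\<psi> \<in> graded_dual sW WG"
  obtains n where "\<And>i x. i \<ge> n \<Longrightarrow> \<psi> ((DW ^^ i) x) = 0"
proof -
  obtain N where N: "\<And>m. Re m < N \<Longrightarrow> WG m = {0}" using W_lower_bounded by blast
  define M where "M = Max (insert 0 (Re ` W.supp \<psi>))"
  have M: "Re s \<le> M" if "s \<in> W.supp \<psi>" for s
    unfolding M_def using W.dual_supp[OF \<psi>] that by (intro Max_ge) auto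
  define n where "n = nat \<lceil>M - N\<rceil> + 1"
  have "\<psi> ((DW ^^ i) x) = 0" if "i \<ge> n" for i x
  proof (induction x rule: W.comp_induct)
    case (add x y)
    then show ?case using linear_addD[OF linear_compD[OF DW_pow_linear[of i] W.dual_linear[OF \<psi>]]] by simp
  next
    case (hom m x)
    show ?case
    proof (cases "x = 0")
      case True
      then show ?thesis using linear_zeroD[OF linear_compD[OF DW_pow_linear[of i] W.dual_linear[OF \<psi>]]] by simp
    next
      case False
      then have "Re m \<ge> N" using hom N[of m] by force
      then have "Re (m + of_nat i) > M" using that unfolding n_def by simp linarith
      then have "m + of_nat i \<notin> W.supp \<psi>" using M by force
      then show ?thesis using W.not_supp DW_pow_weight[OF hom] by blast
    qed
  qed
  then show thesis by (rule that)
qed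

lemma YS_bound:
  assumes "\<And>i. i \<ge> n \<Longrightarrow> YR w (k + int i) v = 0"
  shows "YS v k w = (\<Sum>i<n. sW (sgn_mode (k + int i) / fact i) ((DW ^^ i) (YR w (k + int i) v)))"
  unfolding skew_def sgn_mode_def using assms
  by (intro sum.mono_neutral_left) (auto simp: not_less[symmetric] linear_zeroD[OF DW_pow_linear])

lemma YR_trunc_nat:
  obtains n where "\<And>i. i \<ge> n \<Longrightarrow> YR w (k + int i) v = 0"
proof -
  obtain m where "\<And>l. l \<ge> m \<Longrightarrow> YR w l v = 0" using YR_trunc by blast
  then show thesis by (intro that[of "nat (m - k)"]) auto
qed

lemma YS_vertex_map: "vertex_map YS"
  unfolding vertex_map_def
proof (intro conjI allI impI)
  fix u k
  show "Vector_Spaces.linear sW sW (YS u k)"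
  proof (rule linearI_iff)
    fix w w'
    obtain n where n: "\<And>i. i \<ge> n \<Longrightarrow> YR w (k + int i) u = 0" by (rule YR_trunc_nat) (rule that)
    obtain m where m: "\<And>i. i \<ge> m \<Longrightarrow> YR w' (k + int i) u = 0" by (rule YR_trunc_nat) (rule that)
    show "YS u k (w + w') = YS u k w + YS u k w'"
      by (simp add: YS_bound[of "max n m"] n m linear_addD[OF YR_linear_left] linear_addD[OF DW_pow_linear]
          W.scale_right_distrib sum.distrib)
  next
    fix c w
    obtain n where n: "\<And>i. i \<ge> n \<Longrightarrow> YR w (k + int i) u = 0" by (rule YR_trunc_nat) (rule that)
    show "YS u k (sW c w) = sW c (YS u k w)"
      by (simp add: YS_bound[of n] n linear_scaleD[OF YR_linear_left] linear_scaleD[OF DW_pow_linear]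
          W.scale_sum_right mult.commute)
  qed (auto intro: W.vector_space_axioms)
next
  fix k w
  show "Vector_Spaces.linear sV sW (\<lambda>u. YS u k w)"
  proof (rule linearI_iff)
    fix u u'
    obtain n where n: "\<And>i. i \<ge> n \<Longrightarrow> YR w (k + int i) u = 0" by (rule YR_trunc_nat) (rule that)
    obtain m where m: "\<And>i. i \<ge> m \<Longrightarrow> YR w (k + int i) u' = 0" by (rule YR_trunc_nat) (rule that)
    show "YS (u + u') k w = YS u k w + YS u' k w"
      by (simp add: YS_bound[of "max n m"] n m linear_addD[OF YR_linear_right] linear_addD[OF DW_pow_linear]
          W.scale_right_distrib sum.distrib)
  next
    fix c u
    obtain n where n: "\<And>i. i \<ge> n \<Longrightarrow> YR w (k + int i) u = 0" by (rule YR_trunc_nat) (rule that)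
    show "YS (sV c u) k w = sW c (YS u k w)"
      by (simp add: YS_bound[of n] n linear_scaleD[OF YR_linear_right] linear_scaleD[OF DW_pow_linear]
          W.scale_sum_right mult.commute)
  qed (auto intro: W.vector_space_axioms V.vector_space_axioms)
next
  fix a b u w k assume uw: "u \<in> VG a" "w \<in> WG b"
  show "YS u k w \<in> WG (b + of_int (a - k - 1))"
    unfolding skew_def
  proof (intro W.subspace_sum[OF W.subspace_G] W.G_closed(3))
    fix i
    show "(DW ^^ i) (YR w (k + int i) u) \<in> WG (b + of_int (a - k - 1))"
      using DW_pow_weight[OF YR_weight[OF uw(2,1)], of i "k + int i"] by (simp add: algebra_simps)
  qed
qed

text \<open>The modes of Y^R(w, x) 1 = exp(x D) w: because D 1 = 0, the commutator with D is a
  recursion in the mode.\<close>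

lemma YR_vac: "YR w (- 1 - int s) vac = sW (1 / fact s) ((DW ^^ s) w)"
proof (induction s)
  case 0
  show ?case by (simp add: YR_creation)
next
  case (Suc s)
  have "D_op YV vac vac = 0" by (simp add: D_op_def YV_identity)
  moreover have "(of_int (- (- 1 - int s)) :: complex) = of_nat (Suc s)" "- 1 - int s - 1 = - 1 - int (Suc s)" by simp_all
  ultimately have "DW (YR w (- 1 - int s) vac) = sW (of_nat (Suc s)) (YR w (- 1 - int (Suc s)) vac)"
    using YR_D_commutator[of w "- 1 - int s" vac] by (simp only: linear_zeroD[OF YR_linear_right] diff_zero)
  then have "sW (1 / of_nat (Suc s)) (DW (YR w (- 1 - int s) vac)) = YR w (- 1 - int (Suc s)) vac"
    by (simp del: of_nat_Suc)
  then show ?case using Suc by (simp add: linear_scaleD[OF DW_linear] mult.commute del: of_nat_Suc)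
qed

text \<open>This is exp(x D) exp(- x D) = 1; the coefficient of the n-th power is (1 - 1)^n / n!
  times D^n.\<close>

lemma YS_identity: "YS vac k w = (if k = - 1 then w else 0)"
proof (cases "k \<ge> 0")
  case True
  then show ?thesis using YS_bound[of 0 w k vac] by (simp add: YR_creation)
next
  case False
  define n where "n = nat (- 1 - k)"
  have k: "k = - 1 - int n" using False by (simp add: n_def)
  have "YS vac k w = (\<Sum>i<Suc n. sW (sgn_mode (k + int i) / fact i) ((DW ^^ i) (YR w (k + int i) vac)))"
    by (rule YS_bound) (simp add: k YR_creation)
  also have "\<dots> = (\<Sum>i<Suc n. sW ((-1) ^ (n - i) * of_nat (n choose i) / fact n) ((DW ^^ n) w))"
  proof (intro sum.cong refl)
    fix i assume "i \<in> {..<Suc n}"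
    then have i: "i \<le> n" by simp
    have ki: "k + int i = - 1 - int (n - i)" using i by (simp add: k of_nat_diff)
    have s: "sgn_mode (k + int i) = (-1) ^ (n - i)" unfolding ki by (simp add: sgn_mode_def)
    have "(DW ^^ i) (YR w (k + int i) vac) = sW (1 / fact (n - i)) ((DW ^^ i) ((DW ^^ (n - i)) w))"
      unfolding ki YR_vac by (rule linear_scaleD[OF DW_pow_linear])
    also have "(DW ^^ i) ((DW ^^ (n - i)) w) = (DW ^^ n) w"
      using i by (metis comp_apply funpow_add le_add_diff_inverse)
    finally show "sW (sgn_mode (k + int i) / fact i) ((DW ^^ i) (YR w (k + int i) vac))
      = sW ((-1) ^ (n - i) * of_nat (n choose i) / fact n) ((DW ^^ n) w)"
      using i by (simp add: s binomial_fact field_simps)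
  qed
  also have "\<dots> = sW (\<Sum>i<Suc n. (-1) ^ (n - i) * of_nat (n choose i) / fact n) ((DW ^^ n) w)"
    by (rule W.scale_sum_left[symmetric])
  also have "(\<Sum>i<Suc n. (-1) ^ (n - i) * of_nat (n choose i) / fact n) = ((1 + (-1)) ^ n / fact n :: complex)"
    unfolding binomial_ring lessThan_Suc_atMost sum_divide_distrib by (intro sum.cong) auto
  also have "sW ((1 + (-1)) ^ n / fact n) ((DW ^^ n) w) = (if k = - 1 then w else 0)"
    by (cases "n = 0") (auto simp: k)
  finally show ?thesis .
qed

lemma dual_YS:
  assumes \<psi>: "\<psi> \<in> graded_dual sW WG" and n: "\<And>i x. i \<ge> n \<Longrightarrow> \<psi> ((DW ^^ i) x) = 0"
  shows "\<psi> (YS v k w) = (\<Sum>i<n. 1 / fact i * (sgn_mode (k + int i) * \<psi> ((DW ^^ i) (YR w (k + int i) v))))"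
proof -
  obtain m where m: "\<And>i. i \<ge> m \<Longrightarrow> YR w (k + int i) v = 0" by (rule YR_trunc_nat) (rule that)
  have "\<psi> (YS v k w) = (\<Sum>i<max m n. 1 / fact i * (sgn_mode (k + int i) * \<psi> ((DW ^^ i) (YR w (k + int i) v))))"
    by (subst YS_bound[of "max m n"])
      (auto simp: m linear_sumD[OF W.dual_linear[OF \<psi>]] linear_scaleD[OF W.dual_linear[OF \<psi>]])
  also have "\<dots> = (\<Sum>i<n. 1 / fact i * (sgn_mode (k + int i) * \<psi> ((DW ^^ i) (YR w (k + int i) v))))"
    by (intro sum.mono_neutral_right) (auto simp: n)
  finally show ?thesis .
qed


subsection \<open>Associativity and commutativity of pairs of vertex operators\<close>

lemma YL_pair:
  assumes \<psi>: "\<psi> \<in> graded_dual sW WG"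
  shows "assoc_pair (\<lambda>k. \<psi> (YL u k (YL v (\<kappa> - k) w))) (\<lambda>k. \<psi> (YL (YV u k v) (\<kappa> - k) w))"
proof -
  let ?a = "\<lambda>k. \<psi> (modes YL [u, v] k w)" and ?b = "\<lambda>k. \<psi> (YL (YV u (k ! 0) v) (k ! 1) w)"
  have cr: "common_rational (to2 ?a) (to2 ?b)"
    by (rule common_rational_assoc)
      (use YL_rationality_product[OF \<psi>, of "[u, v]" w] YL_rationality_iterate[OF \<psi>] YL_associativity[OF \<psi>]
        in \<open>auto simp: numeral_2_eq_2\<close>)
  have a: "line \<kappa> (to2 ?a) = (\<lambda>k. \<psi> (YL u k (YL v (\<kappa> - k) w)))"
    by (simp add: line_def to2_def modes_def fun_eq_iff)
  have b: "line \<kappa> (to2 ?b) = (\<lambda>k. \<psi> (YL (YV u k v) (\<kappa> - k) w))"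
    by (simp add: line_def to2_def fun_eq_iff)
  obtain n where "\<And>k. k \<ge> n \<Longrightarrow> YV u k v = 0" using YV_trunc by blast
  then have "bounded_modes (line \<kappa> (to2 ?b))"
    unfolding b by (intro bounded_modesI[of n]) (simp add: linear_zeroD[OF YL_linear_left] linear_zeroD[OF W.dual_linear[OF \<psi>]])
  from common_rational_line[OF cr this] show ?thesis unfolding a b .
qed

lemma exp_sum_twist:
  "exp_sum n (\<lambda>i. twist (A i)) (p, q) = (\<Sum>i<n. 1 / fact i * (sgn_mode (q + int i) * A i (p, q + int i)))"
  by (simp add: exp_sum_def X1_funpow twist_sgn)

text \<open>The product side is brought to the form required by the exponential lemma by commuting
  powers of D to the left past Y^L, where they meet \<psi> and only finitely many survive.\<close>

lemma LR_pair:
  assumes \<psi>: "\<psi> \<in> graded_dual sW WG"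
  shows "comm_pair (\<lambda>k. \<psi> (YL u k (YS v (\<kappa> - k) w))) (\<lambda>k. \<psi> (YS v (\<kappa> - k) (YL u k w)))"
proof -
  obtain n where n: "\<And>i x. i \<ge> n \<Longrightarrow> \<psi> ((DW ^^ i) x) = 0" by (rule dual_DW_nilpotent[OF \<psi>]) (rule that)
  define G where "G i = to2 (\<lambda>k. \<psi> ((DW ^^ i) (YL u (k ! 0) (YR w (k ! 1) v))))" for i
  define H where "H i = to2 (\<lambda>k. \<psi> ((DW ^^ i) (YR (YL u (k ! 0) w) (k ! 1) v)))" for i
  have cr: "common_rational (G i) (H i)" for i
    unfolding G_def H_def using LR_compatibility[OF dual_DW_pow[OF \<psi>, of i], of u w v]
    by (auto intro: common_rational_expands)
  obtain n0 where n0: "\<And>k. k \<ge> n0 \<Longrightarrow> YR w k v = 0" using YR_trunc by blast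
  have tr: "trunc2 (G i)" for i
    unfolding trunc2_def G_def to2_def
    by (intro exI[of _ n0]) (simp add: n0 linear_zeroD[OF vertex_mapD(1)[OF YL_vertex_map]]
      linear_zeroD[OF DW_pow_linear] linear_zeroD[OF W.dual_linear[OF \<psi>]])
  have H: "line \<kappa> (exp_sum n (\<lambda>i. twist (H i))) = (\<lambda>k. \<psi> (YS v (\<kappa> - k) (YL u k w)))"
    by (rule ext) (simp add: line_def exp_sum_twist H_def to2_def dual_YS[OF \<psi> n])
  have G: "line \<kappa> (exp_sum n (\<lambda>i. twist (translate 1 (G i)))) = (\<lambda>k. \<psi> (YL u k (YS v (\<kappa> - k) w)))"
  proof
    fix k
    let ?q = "\<kappa> - k"
    obtain m0 where m0: "\<And>i. i \<ge> m0 \<Longrightarrow> YR w (?q + int i) v = 0" by (rule YR_trunc_nat) (rule that)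
    \<comment> \<open>\<open>m0\<close> cuts off the modes of Y^R and \<open>n\<close> the powers of
      D seen by \<psi>; a square of side \<open>m\<close> contains all nonzero terms.\<close>
    define m where "m = max n m0"
    have m: "YR w (?q + int i) v = 0" if "i \<ge> m" for i using m0 that by (simp add: m_def)
    let ?t = "\<lambda>i l. (of_int k gchoose l) * \<psi> ((DW ^^ i) (YL u (k - int l) (YR w (?q + int (i + l)) v))) / fact i"
    have t0: "?t i l = 0" if "i + l \<ge> m" for i l
      by (simp only: m[OF that] linear_zeroD[OF YL_linear_right] linear_zeroD[OF DW_pow_linear]
          linear_zeroD[OF W.dual_linear[OF \<psi>]]) simp
    have step: "\<psi> (YL u k ((DW ^^ j) x)) / fact j =
        (\<Sum>l\<le>j. (of_int k gchoose l) * \<psi> ((DW ^^ (j - l)) (YL u (k - int l) x)) / fact (j - l))" for j x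
    proof -
      define f where "f i j k = \<psi> ((DW ^^ i) (YL u k ((DW ^^ j) x)))" for i j k
      have "f i (Suc j) k = f (Suc i) j k + of_int k * f i j (k - 1)" for i j k
      proof -
        let ?y = "(DW ^^ j) x"
        have "YL u k (DW ?y) = DW (YL u k ?y) + sW (of_int k) (YL u (k - 1) ?y)"
          using YL_D_commutator[of u k ?y] by (simp add: algebra_simps)
        then show ?thesis
          by (simp add: f_def linear_addD[OF DW_pow_linear] linear_scaleD[OF DW_pow_linear]
              linear_addD[OF W.dual_linear[OF \<psi>]] linear_scaleD[OF W.dual_linear[OF \<psi>]] funpow_swap1)
      qed
      from derivation_expansion[of f, OF this, of 0 j k] show ?thesis by (simp add: f_def)
    qed
    have "\<psi> (YL u k (YS v ?q w)) = (\<Sum>j<m. sgn_mode (?q + int j) * (\<psi> (YL u k ((DW ^^ j) (YR w (?q + int j) v))) / fact j))"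
      by (subst YS_bound[of m])
        (auto simp: m linear_sumD[OF YL_linear_right] linear_scaleD[OF YL_linear_right]
          linear_sumD[OF W.dual_linear[OF \<psi>]] linear_scaleD[OF W.dual_linear[OF \<psi>]])
    also have "\<dots> = (\<Sum>j<m. \<Sum>l\<le>j. sgn_mode (?q + int (l + (j - l))) * ?t (j - l) l)"
      unfolding step sum_distrib_left by (intro sum.cong) auto
    \<comment> \<open>Of the j = l + i powers of D, l have been spent on lowering the mode of Y^L
      and i stand outside.\<close>
    also have "\<dots> = (\<Sum>(l, i)\<in>{(l, i). l + i < m}. sgn_mode (?q + int (l + i)) * ?t i l)"
      by (rule sum.triangle_reindex[symmetric])
    also have "\<dots> = (\<Sum>(l, i)\<in>{..<m} \<times> {..<m}. sgn_mode (?q + int (l + i)) * ?t i l)"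
    proof (rule sum.mono_neutral_left)
      show "\<forall>p\<in>{..<m} \<times> {..<m} - {(l, i). l + i < m}. (case p of (l, i) \<Rightarrow> sgn_mode (?q + int (l + i)) * ?t i l) = 0"
      proof
        fix p assume p: "p \<in> {..<m} \<times> {..<m} - {(l, i). l + i < m}"
        obtain l i where "p = (l, i)" by (cases p)
        moreover from this p have "i + l \<ge> m" by auto
        ultimately show "(case p of (l, i) \<Rightarrow> sgn_mode (?q + int (l + i)) * ?t i l) = 0"
          using t0[of i l] by (simp only: prod.case mult_zero_right)
      qed
    qed auto
    also have "\<dots> = (\<Sum>i<m. \<Sum>l<m. sgn_mode (?q + int (l + i)) * ?t i l)"
      by (simp only: sum.cartesian_product[symmetric]) (rule sum.swap)
    also have "\<dots> = (\<Sum>i<n. \<Sum>l<m. sgn_mode (?q + int (l + i)) * ?t i l)"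
      by (intro sum.mono_neutral_right) (auto simp: m_def n)
    also have "\<dots> = (\<Sum>i<n. 1 / fact i * (sgn_mode (?q + int i) * translate 1 (G i) (k, ?q + int i)))"
    proof (intro sum.cong refl)
      fix i
      have "translate 1 (G i) (k, ?q + int i) = (\<Sum>l<m. (- 1) ^ l * (of_int k gchoose l) * G i (k - int l, ?q + int i + int l))"
      proof (rule translate_bound)
        fix l assume "l \<ge> m"
        then have y: "YR w (?q + int i + int l) v = 0" using m[of "i + l"] by (simp add: add.assoc)
        show "G i (k - int l, ?q + int i + int l) = 0"
          by (simp add: G_def to2_def y linear_zeroD[OF YL_linear_right] linear_zeroD[OF DW_pow_linear]
            linear_zeroD[OF W.dual_linear[OF \<psi>]])
      qed
      then show "(\<Sum>l<m. sgn_mode (?q + int (l + i)) * ?t i l)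
          = 1 / fact i * (sgn_mode (?q + int i) * translate 1 (G i) (k, ?q + int i))"
      proof (simp only: sum_distrib_left, intro sum.cong refl)
        fix l
        have s: "sgn_mode (?q + int (l + i)) = (- 1) ^ l * sgn_mode (?q + int i)"
          using sgn_mode_add[of "?q + int i" l] by (simp add: algebra_simps)
        have g: "G i (k - int l, ?q + int i + int l) = \<psi> ((DW ^^ i) (YL u (k - int l) (YR w (?q + int (i + l)) v)))"
          by (simp add: G_def to2_def add.assoc)
        show "sgn_mode (?q + int (l + i)) * ?t i l = 1 / fact i * (sgn_mode (?q + int i) *
          ((- 1) ^ l * (of_int k gchoose l) * G i (k - int l, ?q + int i + int l)))"
          unfolding s g by simp
      qed
    qed
    finally show "line \<kappa> (exp_sum n (\<lambda>i. twist (translate 1 (G i)))) k = \<psi> (YL u k (YS v ?q w))"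
      by (simp add: line_def exp_sum_twist)
  qed
  obtain n1 where "\<And>k. k \<ge> n1 \<Longrightarrow> YL u k w = 0" using vertex_map_trunc[OF YL_vertex_map] by blast
  then have "bounded_modes (line \<kappa> (exp_sum n (\<lambda>i. twist (H i))))"
    unfolding H by (intro bounded_modesI[of n1])
      (simp add: linear_zeroD[OF vertex_mapD(1)[OF YS_vertex_map]] linear_zeroD[OF W.dual_linear[OF \<psi>]])
  from comm_pair_exp[OF cr tr this] show ?thesis unfolding G H .
qed

text \<open>Coefficient form of Y^R(D^l w, x) = (d/dx)^l Y^R(w, x); the factorial times the binomial
  coefficient is a falling factorial.\<close>

lemma YR_DW_pow: "YR ((DW ^^ l) w) q v = sW ((- 1) ^ l * fact l * (of_int q gchoose l)) (YR w (q - int l) v)"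
proof (induction l arbitrary: q)
  case (Suc l)
  have "YR ((DW ^^ Suc l) w) q v = sW (of_int (- q)) (YR ((DW ^^ l) w) (q - 1) v)"
    by (simp add: YR_D_derivative)
  also have "\<dots> = sW (of_int (- q) * ((- 1) ^ l * fact l * (of_int (q - 1) gchoose l))) (YR w (q - 1 - int l) v)"
    unfolding Suc by (rule W.scale_scale)
  also have "of_int (- q) * ((- 1) ^ l * fact l * (of_int (q - 1) gchoose l))
      = (- 1) ^ Suc l * fact (Suc l) * (of_int q gchoose Suc l :: complex)"
  proof -
    have "of_nat (Suc l) * (of_int q gchoose Suc l :: complex) = of_int q * ((of_int q - 1) gchoose l)"
      by (rule gbinomial_absorption)
    moreover have "of_int (- q) * ((- 1) ^ l * fact l * (of_int (q - 1) gchoose l))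
      = (- 1) ^ Suc l * fact l * (of_int q * ((of_int q - 1) gchoose l) :: complex)" by simp
    ultimately show ?thesis by (simp add: mult_ac del: of_nat_Suc)
  qed
  also have "q - 1 - int l = q - int (Suc l)" by simp
  finally show ?case .
qed simp

text \<open>Passing to opposite operators exchanges the sides of right associativity: their product
  is exp(x_1 D) applied to an iterate of Y^R, and their iterate is exp(x_1 D) applied to a product
  of Y^R and Y_V.\<close>

lemma YS_pair:
  assumes \<psi>: "\<psi> \<in> graded_dual sW WG"
  shows "assoc_pair (\<lambda>k. \<psi> (YS v (\<kappa> - k) (YS u k w))) (\<lambda>k. \<psi> (YS (YV u k v) (\<kappa> - k) w))"
proof -
  obtain n where n: "\<And>i x. i \<ge> n \<Longrightarrow> \<psi> ((DW ^^ i) x) = 0" by (rule dual_DW_nilpotent[OF \<psi>]) (rule that)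
  define H where "H i = to2 (\<lambda>k. \<psi> ((DW ^^ i) (YR w (k ! 0) (YV u (k ! 1) v))))" for i
  define G where "G i = to2 (\<lambda>k. \<psi> ((DW ^^ i) (YR (YR w (k ! 0) u) (k ! 1) v)))" for i
  have H': "H i = to2 (\<lambda>k. \<psi> ((DW ^^ i) (YR w (hd k) (modes YV [u] (tl k) v))))" for i
    by (simp add: H_def to2_def modes_def fun_eq_iff)
  have cr: "common_rational (H i) (G i)" for i
  proof -
    have "prod_eq_iter (\<lambda>k. \<psi> ((DW ^^ i) (YR w (hd k) (modes YV [u] (tl k) v)))) (\<lambda>k. \<psi> ((DW ^^ i) (YR (YR w (k ! 0) u) (k ! 1) v)))"
    proof -
      have "laurent_sums (\<lambda>k. \<psi> ((DW ^^ i) (YR w (hd k) (modes YV [u] (tl k) v)))) [z1, z2] s \<longleftrightarrow>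
          laurent_sums (\<lambda>k. \<psi> ((DW ^^ i) (YR w (k ! 0) (YV u (k ! 1) v)))) [z1, z2] s" for z1 z2 s
        by (rule laurent_sums_cong) (auto simp: modes_def length_Suc_conv)
      then show ?thesis using YR_associativity[OF dual_DW_pow[OF \<psi>, of i], of w u v]
        unfolding prod_eq_iter_def by simp
    qed
    then show ?thesis unfolding H' G_def
      using YR_rationality_product[OF dual_DW_pow[OF \<psi>, of i], of "[u]" w v]
        YR_rationality_iterate[OF dual_DW_pow[OF \<psi>, of i], of w u v]
      by (intro common_rational_assoc) (auto simp: numeral_2_eq_2)
  qed
  obtain n0 where n0: "\<And>k. k \<ge> n0 \<Longrightarrow> YR w k u = 0" using YR_trunc by blast
  have tr: "trunc2 (swap2 (G i))" for i
    unfolding trunc2_def G_def to2_def swap2_def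
    by (intro exI[of _ n0]) (simp add: n0 linear_zeroD[OF YR_linear_left]
      linear_zeroD[OF DW_pow_linear] linear_zeroD[OF W.dual_linear[OF \<psi>]])
  have H: "line \<kappa> (exp_sum n (\<lambda>i. twist (swap2 (H i)))) = (\<lambda>k. \<psi> (YS (YV u k v) (\<kappa> - k) w))"
    by (rule ext) (simp add: line_def exp_sum_twist H_def to2_def swap2_def dual_YS[OF \<psi> n])
  have G: "line \<kappa> (exp_sum n (\<lambda>i. twist (swap2 (twist (translate (-1) (swap2 (G i))))))) = (\<lambda>k. \<psi> (YS v (\<kappa> - k) (YS u k w)))"
  proof
    fix k
    obtain m where m: "\<And>i. i \<ge> m \<Longrightarrow> YR w (k + int i) u = 0" by (rule YR_trunc_nat) (rule that)
    \<comment> \<open>Coefficient form of Y^R(exp(x_0 D) w', z) = Y^R(w', z + x_0) for w' = Y^R(w, -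
      x_0) u. The inner variable is - x_0, hence the translation by -1.\<close>
    have inner: "\<psi> ((DW ^^ i) (YR (YS u k w) q v)) = sgn_mode k * translate (-1) (swap2 (G i)) (q, k)" for i q
    proof -
      have "translate (-1) (swap2 (G i)) (q, k) = (\<Sum>l<m. (- (-1)) ^ l * (of_int q gchoose l) * swap2 (G i) (q - int l, k + int l))"
        by (rule translate_bound) (simp add: swap2_def G_def to2_def m linear_zeroD[OF YR_linear_left]
          linear_zeroD[OF DW_pow_linear] linear_zeroD[OF W.dual_linear[OF \<psi>]])
      moreover have "\<psi> ((DW ^^ i) (YR (YS u k w) q v)) =
          (\<Sum>l<m. sgn_mode (k + int l) / fact l * \<psi> ((DW ^^ i) (YR ((DW ^^ l) (YR w (k + int l) u)) q v)))"
        by (subst YS_bound[of m])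
          (auto simp: m linear_sumD[OF YR_linear_left] linear_scaleD[OF YR_linear_left] linear_sumD[OF DW_pow_linear]
            linear_scaleD[OF DW_pow_linear] linear_sumD[OF W.dual_linear[OF \<psi>]] linear_scaleD[OF W.dual_linear[OF \<psi>]])
      moreover have "sgn_mode (k + int l) / fact l * \<psi> ((DW ^^ i) (YR ((DW ^^ l) (YR w (k + int l) u)) q v))
          = sgn_mode k * ((- (-1)) ^ l * (of_int q gchoose l) * swap2 (G i) (q - int l, k + int l))" for l
      proof -
        have "((-1) ^ l * (-1) ^ l :: complex) = 1" by (simp flip: power_mult_distrib)
        then show ?thesis
          by (simp add: YR_DW_pow sgn_mode_add linear_scaleD[OF DW_pow_linear] linear_scaleD[OF W.dual_linear[OF \<psi>]]
              swap2_def G_def to2_def)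
      qed
      ultimately show ?thesis by (simp add: sum_distrib_left)
    qed
    show "line \<kappa> (exp_sum n (\<lambda>i. twist (swap2 (twist (translate (-1) (swap2 (G i))))))) k = \<psi> (YS v (\<kappa> - k) (YS u k w))"
      by (simp add: line_def exp_sum_twist dual_YS[OF \<psi> n] inner swap2_def[of "twist _"] twist_sgn)
  qed
  obtain n1 where "\<And>k. k \<ge> n1 \<Longrightarrow> YV u k v = 0" using YV_trunc by blast
  then have "bounded_modes (line \<kappa> (exp_sum n (\<lambda>i. twist (swap2 (H i)))))"
    unfolding H by (intro bounded_modesI[of n1])
      (simp add: linear_zeroD[OF vertex_mapD(2)[OF YS_vertex_map]] linear_zeroD[OF W.dual_linear[OF \<psi>]])
  from assoc_pair_exp[OF cr tr this] show ?thesis unfolding G H .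
qed

end

section \<open>From formal identities back to convergence\<close>

section \<open>Convergence of iterates\<close>

lemma laurent_sums_rev:
  "laurent_sums (\<lambda>k. a (rev k)) (rev x) s \<longleftrightarrow> laurent_sums a x s"
proof -
  have m: "mon (rev x) k = mon x (rev k)" if "length k = length x" for k
  proof -
    have "map2 (\<lambda>y l. y powi (- l - 1)) (rev x) (rev (rev k)) = rev (map2 (\<lambda>y l. y powi (- l - 1)) x (rev k))"
      using that by (simp only: zip_rev[symmetric] rev_map length_rev)
    then show ?thesis unfolding mon_def by (simp add: prod_list.rev)
  qed
  have bij: "bij_betw rev {k. length k = length x} {k :: int list. length k = length x}"
    by (rule bij_betwI[where g = rev]) auto
  have "laurent_sums (\<lambda>k. a (rev k)) (rev x) s \<longleftrightarrow>
      ((\<lambda>k. (\<lambda>k. a k * mon x k) (rev k)) has_sum s) {k. length k = length x}"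
    unfolding laurent_sums_iff length_rev by (intro has_sum_cong) (simp add: m)
  also have "\<dots> \<longleftrightarrow> laurent_sums a x s"
    unfolding laurent_sums_iff using has_sum_reindex_bij_betw[OF bij, of "\<lambda>k. a k * mon x k" s] by blast
  finally show ?thesis .
qed

text \<open>The outermost factor is divided out first. What remains is a polynomial multiple of
  \<open>A\<close>, and truncation and vanishing conditions of \<open>A\<close> pass to polynomial
  multiples.\<close>

lemma invert_factors:
  assumes fs: "\<And>f. f \<in> set fs \<Longrightarrow> \<exists>\<sigma> p q c0 c1. \<sigma> \<noteq> 0 \<and>
      (\<forall>A. opr v (pfac f) A = (\<lambda>k. \<sigma> * lin_factor p q c0 c1 A k)) \<and>
      peval \<mu> (pfac f) = \<sigma> * (x ! p - c0 - c1 * x ! q) \<and>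
      p < length x \<and> q < length x \<and> p \<noteq> q \<and>
      cmod c0 + cmod c1 * cmod (x ! q) < cmod (x ! p) \<and> trunc_factor p q c1 A"
    and v: "\<And>i p q c B. p \<noteq> q \<Longrightarrow> trunc_factor p q c B \<Longrightarrow> trunc_factor p q c (v i B)"
      "\<And>i B. vanishing_at x B \<Longrightarrow> vanishing_at x (v i B)"
    and van: "vanishing_at x A"
    and sums: "laurent_sums (opr v (pprod (map pfac fs)) A) x s"
  shows "laurent_sums A x (s / peval \<mu> (pprod (map pfac fs)))"
  using fs sums
proof (induction fs arbitrary: s)
  case Nil
  then show ?case by simp
next
  case (Cons f fs)
  let ?B = "opr v (pprod (map pfac fs)) A"
  obtain \<sigma> p q c0 c1 where f: "\<sigma> \<noteq> 0" "\<And>A. opr v (pfac f) A = (\<lambda>k. \<sigma> * lin_factor p q c0 c1 A k)"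
    "peval \<mu> (pfac f) = \<sigma> * (x ! p - c0 - c1 * x ! q)" "p < length x" "q < length x" "p \<noteq> q"
    "cmod c0 + cmod c1 * cmod (x ! q) < cmod (x ! p)" "trunc_factor p q c1 A"
    using Cons.prems(1)[of f] by (metis list.set_intros(1))
  have tr: "trunc_factor p q c1 ?B"
    by (rule opr_pred[of "trunc_factor p q c1"]) (use v(1) f(6,8) in \<open>auto intro: trunc_factor_add trunc_factor_scale\<close>)
  have va: "vanishing_at x ?B"
    by (rule opr_pred[of "vanishing_at x"]) (use v(2) van in \<open>auto intro: vanishing_at_add vanishing_at_scale\<close>)
  have "laurent_sums (\<lambda>k. \<sigma> * lin_factor p q c0 c1 ?B k) x s"
    using Cons.prems(2) f(2) by simp
  from laurent_sums_scale[OF this, of "1 / \<sigma>"] have "laurent_sums (lin_factor p q c0 c1 ?B) x (s / \<sigma>)"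
    using f(1) by simp
  from laurent_sums_invert[OF f(4-7) tr va this]
  have "laurent_sums ?B x (s / peval \<mu> (pfac f))" by (simp add: f(3))
  from Cons.IH[OF _ this] Cons.prems(1)
  have "laurent_sums A x (s / peval \<mu> (pfac f) / peval \<mu> (pprod (map pfac fs)))" by (meson list.set_intros(2))
  then show ?case by (simp add: mult.commute)
qed

text \<open>Returns to one mode per variable, the last one for \<zeta>, so the total mode is
  \<open>sum_list k\<close>. Lists of other lengths get 0, which makes identities of families
  equalities of functions.\<close>

definition flat :: "nat \<Rightarrow> marray \<Rightarrow> int list \<Rightarrow> complex" where
  "flat m A k = (if length k = Suc m then A (butlast k, sum_list k) else 0)"

definition iterate_var :: "nat \<Rightarrow> nat \<Rightarrow> (int list \<Rightarrow> complex) \<Rightarrow> int list \<Rightarrow> complex" where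
  "iterate_var m i A = (if i < m then (\<lambda>k. shift m A k + shift i A k) else (\<lambda>_. 0))"

lemma flat_add: "flat m (\<lambda>k. A k + B k) = (\<lambda>k. flat m A k + flat m B k)"
  and flat_scale: "flat m (\<lambda>k. c * A k) = (\<lambda>k. c * flat m A k)"
  by (simp_all add: flat_def fun_eq_iff)

lemma flat_opr: "flat m (opr (stage_var m 0) e A) = opr (iterate_var m) e (flat m A)"
proof (rule opr_rel[of "\<lambda>A B. flat m A = B"])
  fix i A B assume B: "flat m A = B"
  have "flat m (stage_var m 0 i A) k = iterate_var m i B k" for k
  proof (cases "length k = Suc m \<and> i < m")
    case True
    then have *: "sum_list (k[m := k ! m + 1]) = sum_list k + 1" "sum_list (k[i := k ! i + 1]) = sum_list k + 1"
      "butlast (k[m := k ! m + 1]) = butlast k" "butlast (k[i := k ! i + 1]) = (butlast k)[i := butlast k ! i + 1]"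
      by (auto simp: sum_list_update_int butlast_list_update nth_butlast)
    show ?thesis using True unfolding B[symmetric]
      by (simp add: flat_def stage_var_def iterate_var_def shift_def *)
  qed (auto simp: flat_def stage_var_def iterate_var_def shift_def B[symmetric])
  then show "flat m (stage_var m 0 i A) = iterate_var m i B" by blast
qed (auto simp: flat_add flat_scale)

lemma flat_unit: "flat m (stage_unit m) = unit_array (Suc m)"
proof
  fix k :: "int list"
  have "k = replicate (Suc m) (-1) \<longleftrightarrow> length k = Suc m \<and> butlast k = replicate m (-1) \<and> sum_list k = - int m - 1"
  proof
    assume *: "length k = Suc m \<and> butlast k = replicate m (-1) \<and> sum_list k = - int m - 1"
    then have k: "k = butlast k @ [last k]" by (metis append_butlast_last_id list.size(3) nat.simps(3))
    have "sum_list k = sum_list (butlast k) + last k" by (subst k) simp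
    then have "last k = -1" using * by (simp add: sum_list_replicate)
    then have "k = replicate m (-1) @ [-1]" using * k by simp
    then show "k = replicate (Suc m) (-1)" by (simp add: replicate_append_same)
  next
    assume k: "k = replicate (Suc m) (-1)"
    show "length k = Suc m \<and> butlast k = replicate m (-1) \<and> sum_list k = - int m - 1"
      unfolding k by (simp add: sum_list_replicate butlast_conv_take del: replicate_Suc)
  qed
  then show "flat m (stage_unit m) k = unit_array (Suc m) k"
    by (auto simp: flat_def stage_unit_def unit_array_def)
qed

text \<open>\<open>low\<close>, \<open>trunc\<close> and \<open>last\<close> are the finiteness
  facts behind the inversion: total modes are bounded below, the i-th mode is bounded above once the
  later ones are fixed, and the m-th mode is negative. The last one is what permits z_m =
  \<zeta>.\<close>

lemma iterate_core:
  fixes c :: "nat \<Rightarrow> marray"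
  assumes R: "rational_diag (m + n) R" and y: "length y = n" "distinct y"
    and rs: "length rs = m" "\<forall>r\<in>set rs. r > 0"
    and a: "\<And>x. map cmod x = rs \<Longrightarrow> distinct (x @ y) \<and> laurent_sums a x (R (x @ y))"
    and rel: "\<And>r. r < m \<Longrightarrow> line_rel assoc_pair m r (c (Suc r)) (c r)"
    and top: "\<And>e \<kappa>. length e = m \<Longrightarrow> c m (e, \<kappa>) = (if \<kappa> = sum_list e - 1 then a e else 0)"
    and low: "\<And>e \<kappa>. length e = m \<Longrightarrow> \<kappa> < K0 \<Longrightarrow> c 0 (e, \<kappa>) = 0"
    and trunc: "\<And>i e. i < m \<Longrightarrow> length e = m \<Longrightarrow> \<exists>n0. \<forall>e' \<kappa>. length e' = m \<longrightarrow>
      (\<forall>j. i < j \<longrightarrow> j < m \<longrightarrow> e' ! j = e ! j) \<longrightarrow> e' ! i \<ge> n0 \<longrightarrow> c 0 (e', \<kappa>) = 0"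
    and last: "\<And>e \<kappa>. length e = m \<Longrightarrow> e ! (m - 1) \<ge> 0 \<Longrightarrow> c 0 (e, \<kappa>) = 0"
    and m: "m \<ge> 1" and X: "length X = m" "distinct (X @ y)"
    and \<zeta>: "cmod \<zeta> > cmod (hd X - \<zeta>)" "\<forall>t\<in>set y. cmod \<zeta> > cmod (hd X - \<zeta>) + cmod t"
    and sorted: "sorted_wrt (>) (map (\<lambda>t. cmod (t - \<zeta>)) X)"
  shows "laurent_sums (\<lambda>k. c 0 (butlast k, sum_list k)) (map (\<lambda>t. t - \<zeta>) X @ [\<zeta>]) (R (X @ y))"
proof -
  obtain fs e where fs: "\<And>f. f \<in> set fs \<Longrightarrow> valid_fac m (set y) f"
    and e: "\<And>x. length x = m \<Longrightarrow> distinct (x @ y) \<Longrightarrow>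
      peval (ev x) (pprod (map pfac fs)) * R (x @ y) = peval (ev x) e"
    by (rule rational_diag_freeze[OF R y]) (rule that)
  let ?D = "pprod (map pfac fs)"
  have topD: "opr (lvar m) ?D a k = opr (lvar m) e (unit_array m) k" if "length k = m" for k
  proof -
    have "opr (lvar (length rs)) ?D a k = opr (lvar (length rs)) e (unit_array (length rs)) k"
    proof (rule rational_sums_opr[OF rs(2), of a "\<lambda>x. R (x @ y)"])
      fix x assume x: "map cmod x = rs"
      then have "length x = m" using rs(1) by (metis length_map)
      then show "laurent_sums a x (R (x @ y)) \<and> peval (ev x) ?D * R (x @ y) = peval (ev x) e"
        using a[OF x] e by blast
    qed (use that rs in simp)
    then show ?thesis by (simp add: rs(1))
  qed
  have su: "stage_unit m (k, \<kappa>) = (if \<kappa> = sum_list k - 1 then unit_array m k else 0)" if "length k = m" for k \<kappa>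
    by (auto simp: stage_unit_def unit_array_def sum_list_replicate)
  have bot: "opr (stage_var m 0) ?D (c 0) (k, \<kappa>) = opr (stage_var m 0) e (stage_unit m) (k, \<kappa>)"
    if "length k = m" for k \<kappa>
  proof (rule stage_chain[of m c, OF rel _ that])
    fix k :: "int list" and \<kappa> assume k: "length k = m"
    have "opr (stage_var m m) ?D (c m) (k, \<kappa>) = (if \<kappa> = sum_list k - 1 then opr (lvar m) ?D a k else 0)"
      by (rule stage_top[OF top k])
    moreover have "opr (stage_var m m) e (stage_unit m) (k, \<kappa>) = (if \<kappa> = sum_list k - 1 then opr (lvar m) e (unit_array m) k else 0)"
      by (rule stage_top[OF su k])
    ultimately show "opr (stage_var m m) ?D (c m) (k, \<kappa>) = opr (stage_var m m) e (stage_unit m) (k, \<kappa>)"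
      using topD[OF k] by simp
  qed
  define b where "b = flat m (c 0)"
  define x where "x = map (\<lambda>t. t - \<zeta>) X @ [\<zeta>]"
  have len: "length x = Suc m" using X by (simp add: x_def)
  have xm: "x ! m = \<zeta>" using X by (simp add: x_def nth_append)
  have xi: "x ! i = X ! i - \<zeta>" if "i < m" for i using that X by (simp add: x_def nth_append)
  have dec: "cmod (x ! l) < cmod (x ! i)" if "i < l" "l < m" for i l
    using sorted_wrt_nth_less[OF sorted, of i l] that X by (simp add: xi)
  have hd: "cmod (x ! i) \<le> cmod (hd X - \<zeta>)" if "i < m" for i
  proof (cases "i = 0")
    case True
    then show ?thesis using that X m by (cases X) (auto simp: xi)
  next
    case False
    then have "cmod (x ! i) < cmod (x ! 0)" using dec[of 0 i] that by simp
    moreover have "x ! 0 = hd X - \<zeta>" using X m by (cases X) (auto simp: xi)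
    ultimately show ?thesis by simp
  qed
  have \<zeta>0: "\<zeta> \<noteq> 0" using \<zeta>(1) by auto
  have eqD: "opr (iterate_var m) ?D b = opr (iterate_var m) e (unit_array (Suc m))"
    unfolding b_def flat_opr[symmetric] flat_unit[symmetric]
    by (auto simp: flat_def bot fun_eq_iff)
  have van_var: "vanishing_at x (iterate_var m i B)" if "vanishing_at x B" for i B
  proof (cases "i < m")
    case True
    then show ?thesis using vanishing_at_add[OF vanishing_at_shift[OF that, of m] vanishing_at_shift[OF that, of i]]
      by (simp add: iterate_var_def)
  qed (simp add: iterate_var_def vanishing_at_def)
  have rhs: "laurent_sums (opr (iterate_var m) e (unit_array (Suc m))) x (peval (ev X) e * 1)"
  proof (rule laurent_sums_opr)
    fix i A s assume A: "laurent_sums A x s" "vanishing_at x A"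
    show "laurent_sums (iterate_var m i A) x (ev X i * s) \<and> vanishing_at x (iterate_var m i A)"
    proof (cases "i < m")
      case True
      have "laurent_sums (\<lambda>k. shift m A k + shift i A k) x (x ! m * s + x ! i * s)"
        using A True len by (intro laurent_sums_add laurent_sums_shift) (auto simp: vanishing_at_def)
      moreover have "x ! m * s + x ! i * s = ev X i * s" using True X by (simp add: xm xi algebra_simps)
      ultimately show ?thesis using van_var[OF A(2), of i] True by (simp add: iterate_var_def)
    qed (use X in \<open>simp add: iterate_var_def ev_def laurent_sums_0 vanishing_at_def\<close>)
  next
    show "laurent_sums (unit_array (Suc m)) x 1" using laurent_sums_unit[of x] len by simp
    show "vanishing_at x (unit_array (Suc m))"
      using len by (auto simp: vanishing_at_def unit_array_def nth_Cons split: nat.split if_splits)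
  qed
  \<comment> \<open>The strict decrease of the moduli leaves z_m - \<zeta> as the only coordinate
    that can vanish.\<close>
  have van: "vanishing_at x b"
    unfolding vanishing_at_def
  proof (intro allI impI)
    fix k :: "int list" and i assume k: "length k = length x" "i < length x" "x ! i = 0" "b k \<noteq> 0"
    have "i \<noteq> m" using k(3) xm \<zeta>0 by auto
    then have "i < m" using k len by simp
    moreover have "\<not> i < m - 1" using dec[of i "m - 1"] k(3) by auto
    ultimately have i: "i = m - 1" by simp
    have "c 0 (butlast k, sum_list k) \<noteq> 0" using k len by (simp add: b_def flat_def)
    then have "butlast k ! (m - 1) < 0" using last[of "butlast k" "sum_list k"] k len by force
    then show "k ! i < 0" using k len i \<open>i < m\<close> by (simp add: nth_butlast)
  qed
  \<comment> \<open>The dominant variable p is \<zeta> or a t with smaller index than the dominated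
    one. Lowering its mode therefore leaves the t-modes after q unchanged, and \<open>trunc\<close>
    applies.\<close>
  have trunc_b: "trunc_factor p q c1 b"
    if pq: "q < m" "p < q \<or> p = m" for p q and c1 :: complex
    unfolding trunc_factor_def
  proof
    fix k :: "int list"
    show "\<exists>J. \<forall>j\<ge>J. \<forall>c\<le>j. (c1 = 0 \<longrightarrow> c = 0) \<longrightarrow> b (k[p := k ! p - int j, q := k ! q + int c]) = 0"
    proof (cases "length k = Suc m")
      case False
      then show ?thesis by (simp add: b_def flat_def)
    next
      case True
      have pl: "p < length k" "q < length k" "p \<noteq> q" using pq True by auto
      obtain n0 where n0: "\<And>e' \<kappa>. length e' = m \<Longrightarrow> (\<forall>j. q < j \<longrightarrow> j < m \<longrightarrow> e' ! j = butlast k ! j) \<Longrightarrow>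
          e' ! q \<ge> n0 \<Longrightarrow> c 0 (e', \<kappa>) = 0"
        using trunc[OF pq(1), of "butlast k"] True by auto
      \<comment> \<open>Either the mode q has reached its bound \<open>n0\<close>, or it was raised
        by less than \<open>n0 - k ! q\<close> and lowering mode p by j has pushed the total below
        \<open>K0\<close>.\<close>
      define J where "J = nat (sum_list k + (n0 - k ! q) - K0) + nat (sum_list k - K0) + 1"
      show ?thesis
      proof (intro exI[of _ J] allI impI)
        fix j c' assume j: "j \<ge> J" and c': "c' \<le> j"
        let ?k = "k[p := k ! p - int j, q := k ! q + int c']"
        have sum: "sum_list ?k = sum_list k - int j + int c'"
          using pl by (simp add: sum_list_update_int)
        have bk: "butlast ?k ! q = k ! q + int c'" "\<forall>l. q < l \<longrightarrow> l < m \<longrightarrow> butlast ?k ! l = butlast k ! l"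
          using True pl pq by (auto simp: nth_butlast nth_list_update)
        show "b ?k = 0"
        proof (cases "k ! q + int c' \<ge> n0")
          case True': True
          have "c 0 (butlast ?k, sum_list ?k) = 0"
            by (rule n0) (use True True' bk in auto)
          then show ?thesis by (simp add: b_def flat_def)
        next
          case False
          then have "sum_list ?k < K0" using j unfolding sum J_def by linarith
          then have "c 0 (butlast ?k, sum_list ?k) = 0" using True by (intro low) auto
          then show ?thesis by (simp add: b_def flat_def)
        qed
      qed
    qed
  qed
  have "laurent_sums b x (peval (ev X) e / peval (ev X) ?D)"
  proof (rule invert_factors[where v = "iterate_var m"])
    fix f assume "f \<in> set fs"
    then have f: "valid_fac m (set y) f" by (rule fs)
    obtain i t where ft: "f = (i, t)" by (cases f)
    show "\<exists>\<sigma> p q c0 c1. \<sigma> \<noteq> 0 \<and>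
      (\<forall>A. opr (iterate_var m) (pfac f) A = (\<lambda>k. \<sigma> * lin_factor p q c0 c1 A k)) \<and>
      peval (ev X) (pfac f) = \<sigma> * (x ! p - c0 - c1 * x ! q) \<and>
      p < length x \<and> q < length x \<and> p \<noteq> q \<and>
      cmod c0 + cmod c1 * cmod (x ! q) < cmod (x ! p) \<and> trunc_factor p q c1 b"
    proof (cases t)
      case (Inl l)
      then have il: "i < l" "l < m" using f ft by (auto simp: valid_fac_def)
      show ?thesis
        by (intro exI[of _ 1] exI[of _ i] exI[of _ l] exI[of _ 0] exI[of _ 1])
          (use il dec[OF il] X len in \<open>auto simp: ft Inl iterate_var_def lin_factor_def fun_eq_iff xi intro!: trunc_b\<close>)
    next
      case (Inr t')
      then have it: "i < m" "t' \<in> set y" using f ft by (auto simp: valid_fac_def)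
      \<comment> \<open>The sum in |\<zeta>| > |z_1 - \<zeta>| + |z_i| is needed here: \<zeta> must
        dominate both other terms of \<zeta> + t_i - t'.\<close>
      have "cmod t' + cmod (x ! i) < cmod (x ! m)" using hd[OF it(1)] \<zeta>(2) it(2) unfolding xm by fastforce
      then show ?thesis
        by (intro exI[of _ 1] exI[of _ m] exI[of _ i] exI[of _ t'] exI[of _ "-1"])
          (use it X len in \<open>auto simp: ft Inr iterate_var_def lin_factor_def fun_eq_iff xi xm intro!: trunc_b\<close>)
    qed
  next
    fix i p q and c :: complex and B assume B: "p \<noteq> q" "trunc_factor p q c B"
    show "trunc_factor p q c (iterate_var m i B)"
    proof (cases "i < m")
      case True
      then show ?thesis using trunc_factor_add[OF trunc_factor_shift[OF B(2,1), of m] trunc_factor_shift[OF B(2,1), of i]]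
        by (simp add: iterate_var_def)
    qed (simp add: iterate_var_def trunc_factor_def)
  qed (use van van_var rhs eqD in simp_all)
  moreover have "peval (ev X) ?D \<noteq> 0"
    unfolding peval_pprod prod_list_zero_iff
  proof
    assume "0 \<in> set (map (peval (ev X)) (map pfac fs))"
    then obtain i t where it: "(i, t) \<in> set fs" "peval (ev X) (pfac (i, t)) = 0" by force
    have v: "valid_fac m (set y) (i, t)" by (rule fs[OF it(1)])
    show False
    proof (cases t)
      case (Inl l)
      then show False using v it(2) X by (simp add: valid_fac_def nth_eq_iff_index_eq)
    next
      case (Inr c)
      then have "X ! i \<in> set y" using v it(2) X by (simp add: valid_fac_def)
      moreover have "X ! i \<in> set X" using v X Inr by (simp add: valid_fac_def)
      ultimately show False using X(2) by auto
    qed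
  qed
  ultimately have "laurent_sums b x (R (X @ y))" by (simp add: e[OF X, symmetric])
  then show ?thesis
    unfolding x_def by (rule laurent_sums_cong[THEN iffD1, rotated]) (use X in \<open>simp add: b_def flat_def\<close>)
qed


section \<open>Commuting two operators\<close>

text \<open>The denominator of F makes \<open>a\<close> polynomial on each line, so the unknown
  power of x - 1 cancels and the same multiple of \<open>b\<close> is that polynomial. Then
  \<open>b\<close> is recovered in the opposite region, where z_2 is dominant.\<close>

lemma commute_core:
  fixes a b :: "int list \<Rightarrow> complex"
  assumes R: "rational_diag (2 + n) R" and y: "length y = n" "distinct y"
    and rs: "length rs = 2" "\<forall>r\<in>set rs. r > 0"
    and a: "\<And>x. map cmod x = rs \<Longrightarrow> distinct (x @ y) \<and> laurent_sums a x (R (x @ y))"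
    and pair: "\<And>\<kappa>. comm_pair (line \<kappa> (to2 a)) (line \<kappa> (to2 b))"
    and low: "\<And>k. length k = 2 \<Longrightarrow> sum_list k < K0 \<Longrightarrow> b k = 0"
    and trunc: "\<And>K. \<exists>n0. \<forall>k. length k = 2 \<longrightarrow> k ! 0 \<ge> n0 \<longrightarrow> sum_list k \<le> K \<longrightarrow> b k = 0"
    and X: "length X = 2" "distinct (X @ y)"
    and less: "cmod (X ! 0) < cmod (X ! 1)" "\<forall>t\<in>set y. cmod t < cmod (X ! 0)" "X ! 0 \<noteq> 0"
  shows "laurent_sums b X (R (X @ y))"
proof -
  obtain fs e where fs: "\<And>f. f \<in> set fs \<Longrightarrow> valid_fac 2 (set y) f"
    and e: "\<And>x. length x = 2 \<Longrightarrow> distinct (x @ y) \<Longrightarrow>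
      peval (ev x) (pprod (map pfac fs)) * R (x @ y) = peval (ev x) e"
    by (rule rational_diag_freeze[OF R y]) (rule that)
  let ?D = "pprod (map pfac fs)"
  have "opr (lvar 2) ?D a k = opr (lvar 2) e (unit_array 2) k" if "length k = 2" for k
  proof -
    have "opr (lvar (length rs)) ?D a k = opr (lvar (length rs)) e (unit_array (length rs)) k"
    proof (rule rational_sums_opr[OF rs(2), of a "\<lambda>x. R (x @ y)"])
      fix x assume x: "map cmod x = rs"
      then have "length x = 2" using rs(1) by (metis length_map)
      then show "laurent_sums a x (R (x @ y)) \<and> peval (ev x) ?D * R (x @ y) = peval (ev x) e"
        using a[OF x] e by blast
    qed (use that rs in simp)
    then show ?thesis by (simp add: rs(1))
  qed
  then have "to2 (opr (lvar 2) ?D a) = to2 (opr (lvar 2) e (unit_array 2))" by (rule to2_eqI)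
  then have A: "opr prod_vars ?D (to2 a) = opr prod_vars e unit2" unfolding to2_lvar to2_unit .
  have "\<forall>\<kappa>. comm_pair (line \<kappa> (opr prod_vars ?D (to2 a))) (line \<kappa> (opr prod_vars ?D (to2 b)))"
  proof (rule opr_rel[of "\<lambda>A B. \<forall>\<kappa>. comm_pair (line \<kappa> A) (line \<kappa> B)"])
    fix i A B assume AB: "\<forall>\<kappa>. comm_pair (line \<kappa> A) (line \<kappa> B)"
    have z: "comm_pair (line \<kappa> (\<lambda>k. 0)) (line \<kappa> (\<lambda>k. 0))" for \<kappa>
      using comm_pair_zero by (simp add: line_def[abs_def])
    show "\<forall>\<kappa>. comm_pair (line \<kappa> (prod_vars i A)) (line \<kappa> (prod_vars i B))"
      using AB z by (auto simp: vars2_def line_lin2 intro: comm_pair_act)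
  qed (use pair in \<open>auto simp: line_add line_scale comm_pair_add comm_pair_scale\<close>)
  then have cp: "comm_pair (line \<kappa> (opr prod_vars e unit2)) (line \<kappa> (opr prod_vars ?D (to2 b)))" for \<kappa>
    unfolding A by blast
  have lines: "line \<kappa> (opr prod_vars e unit2) = line \<kappa> (opr prod_vars ?D (to2 b))" for \<kappa>
  proof (rule comm_pair_unique[OF cp])
    show "bounded_modes (line \<kappa> (opr prod_vars e unit2))"
      using line_poly_pair[of \<kappa> 1 0 0 1 e] by (auto simp: poly_pair_def bounded_modes_iota)
  qed
  have "opr prod_vars e unit2 (p, q) = opr prod_vars ?D (to2 b) (p, q)" for p q
  proof -
    have "line (p + q) (opr prod_vars e unit2) p = line (p + q) (opr prod_vars ?D (to2 b)) p" by (simp only: lines)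
    then show ?thesis by (simp add: line_def)
  qed
  then have t2: "to2 (opr (lvar 2) ?D b) = to2 (opr (lvar 2) e (unit_array 2))"
    unfolding to2_lvar to2_unit by auto
  have B: "opr (lvar 2) ?D b k = opr (lvar 2) e (unit_array 2) k" if "length k = 2" for k
  proof -
    obtain p q where k: "k = [p, q]" using \<open>length k = 2\<close> by (auto simp: length_Suc_conv numeral_2_eq_2)
    have "to2 (opr (lvar 2) ?D b) (p, q) = to2 (opr (lvar 2) e (unit_array 2)) (p, q)" by (simp only: t2)
    then show ?thesis by (simp add: to2_def k)
  qed
  \<comment> \<open>The truncation condition quantifies over lists of every length, whereas
    \<open>b\<close> is controlled only on length two.\<close>
  define b' where "b' k = (if length k = 2 then b k else 0)" for k
  have lvar2: "lvar 2 i A k = lvar 2 i B k" if "\<And>k. length k = 2 \<Longrightarrow> A k = B k" "length k = 2" for i A B k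
    using that by (simp add: lvar_def shift_def)
  have "\<forall>k. length k = 2 \<longrightarrow> opr (lvar 2) ?D b' k = opr (lvar 2) ?D b k"
    by (rule opr_rel[of "\<lambda>A B. \<forall>k. length k = 2 \<longrightarrow> A k = B k"]) (auto simp: b'_def intro!: lvar2)
  then have B': "opr (lvar 2) ?D b' k = opr (lvar 2) e (unit_array 2) k" if "length k = 2" for k
    using B that by simp
  have nz: "\<forall>t\<in>set X. t \<noteq> 0"
    using X less by (auto simp: length_Suc_conv numeral_2_eq_2)
  have "laurent_sums (opr (lvar (length X)) e (unit_array (length X))) X (peval (ev X) e * 1)"
    by (rule laurent_sums_opr) (auto intro: laurent_sums_lvar[THEN conjunct1] laurent_sums_lvar[THEN conjunct2]
        vanishing_at_nonzero[OF nz] laurent_sums_unit)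
  then have rhs: "laurent_sums (opr (lvar 2) ?D b') X (peval (ev X) e)"
    using laurent_sums_cong[of X "opr (lvar 2) ?D b'" "opr (lvar 2) e (unit_array 2)"] B' X by simp
  have tr0: "trunc_factor p q 0 b'" if "p < 2" "p \<noteq> q" for p q
    unfolding trunc_factor_def
  proof
    fix k :: "int list"
    show "\<exists>J. \<forall>j\<ge>J. \<forall>c\<le>j. ((0::complex) = 0 \<longrightarrow> c = 0) \<longrightarrow> b' (k[p := k ! p - int j, q := k ! q + int c]) = 0"
    proof (cases "length k = 2")
      case True
      show ?thesis
      proof (intro exI[of _ "nat (sum_list k - K0) + 1"] allI impI)
        fix j c :: nat assume j: "j \<ge> nat (sum_list k - K0) + 1" and "(0::complex) = 0 \<longrightarrow> c = 0"
        then have c: "c = 0" by simp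
        show "b' (k[p := k ! p - int j, q := k ! q + int c]) = 0"
        proof -
          have "k[p := k ! p - int j, q := k ! q + int c] = k[p := k ! p - int j]"
            using c that(2) by (metis add.right_neutral list_update_id list_update_swap of_nat_0)
          moreover have "sum_list (k[p := k ! p - int j]) < K0"
            using j True that by (simp add: sum_list_update_int)
          ultimately show ?thesis using low[of "k[p := k ! p - int j]"] True by (simp add: b'_def)
        qed
      qed
    qed (simp add: b'_def)
  qed
  have tr1: "trunc_factor 1 0 1 b'"
    unfolding trunc_factor_def
  proof
    fix k :: "int list"
    show "\<exists>J. \<forall>j\<ge>J. \<forall>c\<le>j. ((1::complex) = 0 \<longrightarrow> c = 0) \<longrightarrow> b' (k[1 := k ! 1 - int j, 0 := k ! 0 + int c]) = 0"
    proof (cases "length k = 2")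
      case True
      obtain n0 where n0: "\<And>k'. length k' = 2 \<Longrightarrow> k' ! 0 \<ge> n0 \<Longrightarrow> sum_list k' \<le> sum_list k \<Longrightarrow> b k' = 0"
        using trunc[of "sum_list k"] by blast
      define J where "J = nat (sum_list k + (n0 - k ! 0) - K0) + nat (sum_list k - K0) + 1"
      show ?thesis
      proof (intro exI[of _ J] allI impI)
        fix j c :: nat assume j: "j \<ge> J" and c: "c \<le> j"
        let ?k = "k[1 := k ! 1 - int j, 0 := k ! 0 + int c]"
        have sum: "sum_list ?k = sum_list k - int j + int c"
          using True by (simp add: sum_list_update_int)
        show "b' ?k = 0"
        proof (cases "k ! 0 + int c \<ge> n0")
          case True': True
          have "b ?k = 0" by (rule n0) (use True True' sum c in auto)
          then show ?thesis by (simp add: b'_def)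
        next
          case False
          then have "sum_list ?k < K0" using j unfolding sum J_def by linarith
          then show ?thesis using low[of ?k] True by (simp add: b'_def)
        qed
      qed
    qed (simp add: b'_def)
  qed
  have "laurent_sums b' X (peval (ev X) e / peval (ev X) ?D)"
  proof (rule invert_factors[where v = "lvar 2"])
    fix f assume "f \<in> set fs"
    then have f: "valid_fac 2 (set y) f" by (rule fs)
    obtain i t where ft: "f = (i, t)" by (cases f)
    show "\<exists>\<sigma> p q c0 c1. \<sigma> \<noteq> 0 \<and>
      (\<forall>A. opr (lvar 2) (pfac f) A = (\<lambda>k. \<sigma> * lin_factor p q c0 c1 A k)) \<and>
      peval (ev X) (pfac f) = \<sigma> * (X ! p - c0 - c1 * X ! q) \<and>
      p < length X \<and> q < length X \<and> p \<noteq> q \<and>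
      cmod c0 + cmod c1 * cmod (X ! q) < cmod (X ! p) \<and> trunc_factor p q c1 b'"
    proof (cases t)
      case (Inl l)
      then have il: "i = 0" "l = 1" using f ft by (auto simp: valid_fac_def)
      \<comment> \<open>Since |z_2| > |z_1|, the factor z_1 - z_2 is inverted as -(z_2 - z_1),
        whence the scalar -1.\<close>
      show ?thesis
        by (intro exI[of _ "-1"] exI[of _ 1] exI[of _ 0] exI[of _ 0] exI[of _ 1])
          (use il X less tr1 in \<open>auto simp: ft Inl lvar_def lin_factor_def fun_eq_iff\<close>)
    next
      case (Inr t')
      then have it: "i < 2" "t' \<in> set y" using f ft by (auto simp: valid_fac_def)
      have "cmod t' < cmod (X ! i)" using less it by (cases "i = 0") (auto simp: less_2_cases_iff)
      moreover obtain q where "q < (2 :: nat)" "i \<noteq> q" using that[of 0] that[of 1] by (cases "i = 0") auto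
      ultimately show ?thesis
        by (intro exI[of _ 1] exI[of _ i] exI[of _ q] exI[of _ t'] exI[of _ 0])
          (use it X tr0 in \<open>auto simp: ft Inr lvar_def lin_factor_def fun_eq_iff\<close>)
    qed
  next
    fix i p q and c :: complex and B assume B: "p \<noteq> q" "trunc_factor p q c B"
    show "trunc_factor p q c (lvar 2 i B)"
      using trunc_factor_shift[OF B(2,1), of i] by (auto simp: lvar_def trunc_factor_def)
  qed (use rhs in \<open>auto intro: vanishing_at_nonzero[OF nz]\<close>)
  moreover have "peval (ev X) ?D \<noteq> 0"
    unfolding peval_pprod prod_list_zero_iff
  proof
    assume "0 \<in> set (map (peval (ev X)) (map pfac fs))"
    then obtain i t where it: "(i, t) \<in> set fs" "peval (ev X) (pfac (i, t)) = 0" by force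
    have v: "valid_fac 2 (set y) (i, t)" by (rule fs[OF it(1)])
    show False
    proof (cases t)
      case (Inl l)
      then show False using v it(2) X by (simp add: valid_fac_def nth_eq_iff_index_eq)
    next
      case (Inr c)
      then have "X ! i \<in> set y" using v it(2) X by (simp add: valid_fac_def)
      moreover have "X ! i \<in> set X" using v X Inr by (simp add: valid_fac_def)
      ultimately show False using X(2) by auto
    qed
  qed
  ultimately have "laurent_sums b' X (R (X @ y))" by (simp add: e[OF X, symmetric])
  then show ?thesis
    by (rule laurent_sums_cong[THEN iffD1, rotated]) (use X in \<open>simp add: b'_def\<close>)
qed

section \<open>Families interpolating between product and iterate\<close>

section \<open>Assembling the families of coefficients\<close>

lemma modes_map: "modes (\<lambda>A l. A l) (map Y us) k x = modes Y us k x"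
proof (induction us arbitrary: k)
  case (Cons u us)
  then show ?case by (cases k) (auto simp: modes_def)
qed (simp add: modes_def)

lemma modes_append:
  "length k = length us \<Longrightarrow> modes Y (us @ us') (k @ k') x = modes Y us k (modes Y us' k' x)"
  by (simp add: modes_def)

lemma wtilde_completion: "f \<in> wtilde s G n \<Longrightarrow> y \<in> config n \<Longrightarrow> f y \<in> completion G"
  unfolding wtilde_def by blast

lemma wtilde_rational: "f \<in> wtilde s G n \<Longrightarrow> \<psi> \<in> graded_dual s G \<Longrightarrow> rational_diag n (\<lambda>z. pairing G \<psi> (f z))"
  unfolding wtilde_def by blast

text \<open>Uniqueness of coefficients needs a full torus inside the region; strictly decreasing
  radii above all |t| achieve this whatever the arguments are.\<close>

lemma torus_radii:
  fixes y :: "complex list"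
  obtains rs where "length rs = m" "\<And>r. r \<in> set rs \<Longrightarrow> r > 0"
    "\<And>x. map cmod x = rs \<Longrightarrow> distinct x \<and> set x \<inter> set y = {} \<and>
      (\<forall>t\<in>set y. sorted_wrt (>) (map cmod (x @ [t])))"
proof -
  define R where "R = Max (insert 0 (cmod ` set y))"
  have R: "cmod t \<le> R" if "t \<in> set y" for t unfolding R_def using that by (intro Max_ge) auto
  have "R \<ge> 0" unfolding R_def by (intro Max_ge) auto
  define rs where "rs = map (\<lambda>i. R + real (m - i)) [0..<m]"
  show thesis
  proof
    show "length rs = m" by (simp add: rs_def)
    show "r > 0" if "r \<in> set rs" for r using that \<open>R \<ge> 0\<close> by (auto simp: rs_def)
    fix x assume x: "map cmod x = rs"
    then have len: "length x = m" by (metis length_map length_upt minus_nat.diff_0 rs_def)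
    have nth: "cmod (x ! i) = R + real (m - i)" if "i < m" for i
      using that len x by (metis add_0 length_upt minus_nat.diff_0 nth_map nth_upt rs_def)
    have sorted: "sorted_wrt (>) (map cmod x)"
      by (auto simp: sorted_wrt_iff_nth_less len nth)
    have "distinct x"
      unfolding distinct_conv_nth len using nth
      by (metis add_left_cancel diff_diff_cancel less_imp_le of_nat_eq_iff)
    moreover have gt: "cmod t < cmod s" if "t \<in> set y" "s \<in> set x" for s t
      using that R[OF that(1)] nth by (force simp: in_set_conv_nth len)
    moreover have "set x \<inter> set y = {}" using gt by fastforce
    ultimately show "distinct x \<and> set x \<inter> set y = {} \<and> (\<forall>t\<in>set y. sorted_wrt (>) (map cmod (x @ [t])))"
      using sorted by (auto simp: sorted_wrt_append)
  qed
qed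

lemma sum_list_split: "length e = m \<Longrightarrow> sum_list e = sum_list (take r e) + sum_list (drop r e)" for e :: "int list"
  by (metis append_take_drop_id sum_list.append)

context mosva_bimodule
begin

definition spr :: "int set \<Rightarrow> int \<Rightarrow> complex set" where
  "spr N \<kappa> = (\<lambda>a. of_int (a - \<kappa> - 1)) ` N"

text \<open>The degrees from which an operator with shifts in \<open>spr N \<kappa>\<close> can
  reach the support of \<psi>. They depend on \<kappa> and not on the individual modes, so along a
  line the pairings are sums over one finite set and pair relations can be added up.\<close>

definition idx :: "('w \<Rightarrow> complex) \<Rightarrow> int set \<Rightarrow> int \<Rightarrow> complex set" where
  "idx \<psi> N \<kappa> = (\<lambda>(i, a). i - of_int (a - \<kappa> - 1)) ` (W.supp \<psi> \<times> N)"

lemma pairing_idx: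
  assumes "\<psi> \<in> graded_dual sW WG" "W.spread (spr N \<kappa>) T" "finite N" "w \<in> completion WG"
  shows "pairing WG \<psi> (hat WG T w) = (\<Sum>j\<in>idx \<psi> N \<kappa>. \<psi> (T (w j)))"
proof (rule W.pairing_hat[OF assms(1,2,4)])
  show "finite (idx \<psi> N \<kappa>)" using W.dual_supp[OF assms(1)] assms(3) by (simp add: idx_def)
  fix i \<delta> assume "i \<in> W.supp \<psi>" "\<delta> \<in> spr N \<kappa>"
  then show "i - \<delta> \<in> idx \<psi> N \<kappa>" by (force simp: spr_def idx_def)
qed

lemma pairing_hat_zero: "\<psi> \<in> graded_dual sW WG \<Longrightarrow> pairing WG \<psi> (hat WG (\<lambda>_. 0) w) = 0"
  by (simp add: W.pairing_supp hat_def W.comp_0 linear_zeroD[OF W.dual_linear])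

text \<open>Decreasing \<kappa> lowers the degrees in \<open>idx\<close> by the same amount, and
  below the lower bound of the grading the components of \<open>w\<close> are zero.\<close>

lemma low_degree:
  assumes \<psi>: "\<psi> \<in> graded_dual sW WG" and N: "finite N" and w: "w \<in> completion WG"
  shows "\<exists>K0. \<forall>\<kappa> < K0. \<forall>j \<in> idx \<psi> N \<kappa>. w j = 0"
proof -
  obtain B where B: "\<And>m. Re m < B \<Longrightarrow> WG m = {0}" using W_lower_bounded by blast
  define M where "M = Max (insert 0 (Re ` W.supp \<psi>))"
  have M: "Re s \<le> M" if "s \<in> W.supp \<psi>" for s
    unfolding M_def using W.dual_supp[OF \<psi>] that by (intro Max_ge) auto
  define A where "A = Min (insert 0 N)"
  have A: "A \<le> a" if "a \<in> N" for a unfolding A_def using N that by (intro Min_le) auto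
  have "w j = 0" if "\<kappa> < \<lfloor>B - M + of_int A - 1\<rfloor>" "j \<in> idx \<psi> N \<kappa>" for \<kappa> j
  proof -
    from that(2) obtain i a where ia: "i \<in> W.supp \<psi>" "a \<in> N" "j = i - of_int (a - \<kappa> - 1)" by (auto simp: idx_def)
    have "of_int \<kappa> < B - M + of_int A - 1" using that(1) by linarith
    moreover have "real_of_int A \<le> of_int a" using A[OF ia(2)] by simp
    ultimately have "Re j < B" using M[OF ia(1)] by (simp add: ia(3))
    then show ?thesis using B w by (force simp: completion_def)
  qed
  then show ?thesis by blast
qed

text \<open>Only the sum of the modes enters the degree shift, so the finite set of weight
  contributions can be chosen once for all modes.\<close>

lemma modes_spread:
  assumes "vertex_map Y"
  shows "\<exists>N. finite N \<and> (\<forall>k. length k = length us \<longrightarrow>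
    W.spread ((\<lambda>a. of_int (a - sum_list k)) ` N) (modes Y us k))"
proof (induction us)
  case Nil
  show ?case using W.spread_id by (intro exI[of _ "{0}"]) (simp add: modes_def)
next
  case (Cons u us)
  then obtain N where N: "finite N" "\<And>k. length k = length us \<Longrightarrow>
    W.spread ((\<lambda>a. of_int (a - sum_list k)) ` N) (modes Y us k)" by blast
  show ?case
  proof (intro exI conjI allI impI)
    let ?N = "(\<lambda>(a, b). a + b - 1) ` (wts u \<times> N)"
    show fin: "finite ?N" using N(1) finite_wts by blast
    fix k :: "int list" assume "length k = length (u # us)"
    then obtain l k' where k: "k = l # k'" "length k' = length us" by (cases k) auto
    have "W.spread ((\<lambda>(a, b). a + b) ` ((\<lambda>a. of_int (a - l - 1)) ` wts u \<times> (\<lambda>a. of_int (a - sum_list k')) ` N))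
        (modes Y (u # us) k)"
      using W.spread_compose[OF vertex_map_spread[OF assms] N(2)[OF k(2)]]
      by (simp add: k modes_Cons[abs_def])
    then show "W.spread ((\<lambda>a. of_int (a - sum_list k)) ` ?N) (modes Y (u # us) k)"
    proof (rule W.spread_mono)
      show "(\<lambda>(a, b). a + b) ` ((\<lambda>a. of_int (a - l - 1)) ` wts u \<times> (\<lambda>a. of_int (a - sum_list k')) ` N)
        \<subseteq> (\<lambda>a. complex_of_int (a - sum_list k)) ` ?N"
      proof
        fix z assume "z \<in> (\<lambda>(a, b). a + b) ` ((\<lambda>a. complex_of_int (a - l - 1)) ` wts u \<times> (\<lambda>a. of_int (a - sum_list k')) ` N)"
        then obtain a b where ab: "a \<in> wts u" "b \<in> N" "z = of_int (a - l - 1) + of_int (b - sum_list k')" by auto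
        then show "z \<in> (\<lambda>a. complex_of_int (a - sum_list k)) ` ?N"
          by (intro image_eqI[of _ _ "a + b - 1"]) (auto simp: k)
      qed
    qed (use fin in blast)
  qed
qed

lemma modes_vac_spread:
  assumes "vertex_map Y"
  shows "\<exists>N. finite N \<and> (\<forall>k l. length k = length us \<longrightarrow>
    W.spread ((\<lambda>a. of_int (a - sum_list k - l - 1)) ` N) (Y (modes YV us k vac) l))"
proof -
  obtain N where N: "finite N" "\<And>k c. length k = length us \<Longrightarrow> c \<in> wts (modes YV us k vac) \<Longrightarrow> c + sum_list k \<in> N"
    using modes_vac_wts[of us] by blast
  show ?thesis
  proof (intro exI[of _ N] conjI allI impI N(1))
    fix k :: "int list" and l assume k: "length k = length us"
    show "W.spread ((\<lambda>a. of_int (a - sum_list k - l - 1)) ` N) (Y (modes YV us k vac) l)"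
    proof (rule W.spread_mono[OF vertex_map_spread[OF assms]])
      show "(\<lambda>a. of_int (a - l - 1)) ` wts (modes YV us k vac) \<subseteq> (\<lambda>a. complex_of_int (a - sum_list k - l - 1)) ` N"
      proof
        fix z assume "z \<in> (\<lambda>a. complex_of_int (a - l - 1)) ` wts (modes YV us k vac)"
        then obtain a where "a \<in> wts (modes YV us k vac)" "z = of_int (a - l - 1)" by blast
        then show "z \<in> (\<lambda>a. complex_of_int (a - sum_list k - l - 1)) ` N"
          using N(2)[OF k, of a] by (intro image_eqI[of _ _ "a + sum_list k"]) auto
      qed
    qed (use N(1) in blast)
  qed
qed

lemma modes_YV_zero:
  assumes "length us = length e" "i < length us" "YV (us ! i) (e ! i) (modes YV (drop (Suc i) us) (drop (Suc i) e) vac) = 0"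
  shows "modes YV us e vac = 0"
proof -
  have z: "modes YV us' k 0 = 0" for us' k
    unfolding modes_def by (induction us' arbitrary: k)
      (auto split: list.split simp: linear_zeroD[OF YV_linear_right] zip_Cons1)
  have "modes YV us e vac = modes YV (take i us @ us ! i # drop (Suc i) us) (take i e @ e ! i # drop (Suc i) e) vac"
    using assms(1,2) by (simp add: id_take_nth_drop[symmetric])
  also have "\<dots> = modes YV (take i us) (take i e) (YV (us ! i) (e ! i) (modes YV (drop (Suc i) us) (drop (Suc i) e) vac))"
    using assms(1,2) by (subst modes_append) (auto simp: modes_def)
  finally show ?thesis by (simp add: assms(3) z)
qed

text \<open>Stated for an abstract family \<open>T r\<close> that is the product at r = m and the
  iterate at r = 0, so that left and opposite operators share the argument.\<close>

lemma iterate_converges: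
  fixes T :: "nat \<Rightarrow> int list \<Rightarrow> int \<Rightarrow> 'w \<Rightarrow> 'w" and A :: "int list \<Rightarrow> 'w \<Rightarrow> 'w"
  assumes Y: "vertex_map Y" and m: "length us = m" "m \<ge> 1" and n: "n \<ge> 1"
    and f: "f \<in> wtilde sW WG n" and F: "F \<in> wtilde sW WG (m + n)"
    and spread: "\<And>r. r \<le> m \<Longrightarrow> \<exists>N. finite N \<and> (\<forall>e \<kappa>. length e = m \<longrightarrow> W.spread (spr N \<kappa>) (T r e \<kappa>))"
    and pair: "\<And>\<psi> r e \<kappa> w. \<psi> \<in> graded_dual sW WG \<Longrightarrow> r < m \<Longrightarrow> length e = m \<Longrightarrow>
      assoc_pair (\<lambda>k. \<psi> (T (Suc r) (e[r := k]) \<kappa> w)) (\<lambda>k. \<psi> (T r (e[r := k]) \<kappa> w))"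
    and bot: "\<And>e \<kappa>. length e = m \<Longrightarrow> T 0 e \<kappa> = Y (modes YV us e vac) (\<kappa> - sum_list e)"
    and top: "\<And>e \<kappa>. length e = m \<Longrightarrow> T m e \<kappa> = (if \<kappa> = sum_list e - 1 then A e else (\<lambda>_. 0))"
    and torus: "\<And>y. length y = n \<Longrightarrow> distinct y \<Longrightarrow> \<exists>rs. length rs = m \<and> (\<forall>r\<in>set rs. r > 0) \<and>
      (\<forall>x. map cmod x = rs \<longrightarrow> distinct (x @ y) \<and>
        (\<forall>\<psi>\<in>graded_dual sW WG. laurent_sums (\<lambda>e. pairing WG \<psi> (hat WG (A e) (f y))) x (pairing WG \<psi> (F (x @ y)))))"
  shows "converges_to_rational sW WG (m + n) (iterate_series WG n YV vac Y us f) F"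
  unfolding converges_to_rational_def
proof (intro conjI F ballI, clarify)
  fix z x and c :: "int list \<Rightarrow> complex \<Rightarrow> 'w" and \<psi>
  assume \<psi>: "\<psi> \<in> graded_dual sW WG" and "(z, x, c) \<in> iterate_series WG n YV vac Y us f"
  then obtain X y \<zeta> where z: "z = X @ y" and x: "x = map (\<lambda>t. t - \<zeta>) X @ [\<zeta>]"
    and c: "c = (\<lambda>k. hat WG (Y (modes YV us (butlast k) vac) (last k)) (f y))"
    and X: "length X = m" "length y = n" "distinct (X @ y)"
    and reg: "\<forall>t\<in>set y. cmod \<zeta> > cmod (hd X - \<zeta>) + cmod t" "sorted_wrt (>) (map (\<lambda>t. cmod (t - \<zeta>)) X)"
    unfolding iterate_series_def using m(1) by auto
  have dy: "distinct y" using X(3) by simp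
  define w where "w = f y"
  have w: "w \<in> completion WG"
    unfolding w_def using wtilde_completion[OF f] X(2) dy by (simp add: config_def)
  obtain N0 where N0: "\<And>r. r \<le> m \<Longrightarrow> finite (N0 r) \<and> (\<forall>e \<kappa>. length e = m \<longrightarrow> W.spread (spr (N0 r) \<kappa>) (T r e \<kappa>))"
    using spread by metis
  \<comment> \<open>One set for all stages, so that both members of a pair are sums over the same
    \<open>idx\<close>.\<close>
  define N where "N = (\<Union>r\<le>m. N0 r)"
  have finN: "finite N" using N0 by (auto simp: N_def)
  have sp: "W.spread (spr N \<kappa>) (T r e \<kappa>)" if "r \<le> m" "length e = m" for r e \<kappa>
  proof (rule W.spread_mono)
    show "W.spread (spr (N0 r) \<kappa>) (T r e \<kappa>)" using N0 that by blast
    show "spr (N0 r) \<kappa> \<subseteq> spr N \<kappa>" using that(1) by (auto simp: spr_def N_def)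
    show "finite (spr N \<kappa>)" using finN by (simp add: spr_def)
  qed
  define cc where "cc r = (\<lambda>(e, \<kappa>). pairing WG \<psi> (hat WG (T r e \<kappa>) w))" for r
  have cc: "cc r (e, \<kappa>) = (\<Sum>j\<in>idx \<psi> N \<kappa>. \<psi> (T r e \<kappa> (w j)))" if "r \<le> m" "length e = m" for r e \<kappa>
    using pairing_idx[OF \<psi> sp[OF that] finN w] by (simp add: cc_def)
  obtain K0 where K0: "\<And>\<kappa> j. \<kappa> < K0 \<Longrightarrow> j \<in> idx \<psi> N \<kappa> \<Longrightarrow> w j = 0" using low_degree[OF \<psi> finN w] by blast
  obtain rs where rs: "length rs = m" "\<forall>r\<in>set rs. r > 0"
    "\<And>x. map cmod x = rs \<Longrightarrow> distinct (x @ y) \<and>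
        laurent_sums (\<lambda>e. pairing WG \<psi> (hat WG (A e) w)) x (pairing WG \<psi> (F (x @ y)))"
    using torus[OF X(2) dy] \<psi> unfolding w_def by metis
  have zero: "cc 0 (e, \<kappa>) = 0" if "length e = m" "modes YV us e vac = 0" for e \<kappa>
  proof -
    have "T 0 e \<kappa> = (\<lambda>_. 0)" using bot[OF that(1)] that(2) linear_zeroD[OF vertex_mapD(2)[OF Y]] by auto
    then show ?thesis using pairing_hat_zero[OF \<psi>] by (simp add: cc_def)
  qed
  have "laurent_sums (\<lambda>k. cc 0 (butlast k, sum_list k)) (map (\<lambda>t. t - \<zeta>) X @ [\<zeta>]) (pairing WG \<psi> (F (X @ y)))"
  proof (rule iterate_core[where R = "\<lambda>z. pairing WG \<psi> (F z)" and rs = rs and ?K0.0 = K0])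
    show "rational_diag (m + n) (\<lambda>z. pairing WG \<psi> (F z))" by (rule wtilde_rational[OF F \<psi>])
    fix r assume r: "r < m"
    show "line_rel assoc_pair m r (cc (Suc r)) (cc r)"
      unfolding line_rel_def
    proof (intro allI impI)
      fix e :: "int list" and \<kappa> :: int assume e: "length e = m"
      have "assoc_pair (\<lambda>k. \<Sum>j\<in>idx \<psi> N \<kappa>. \<psi> (T (Suc r) (e[r := k]) \<kappa> (w j))) (\<lambda>k. \<Sum>j\<in>idx \<psi> N \<kappa>. \<psi> (T r (e[r := k]) \<kappa> (w j)))"
        by (intro assoc_pair_sum pair[OF \<psi> r e])
      then show "assoc_pair (\<lambda>k. cc (Suc r) (e[r := k], \<kappa>)) (\<lambda>k. cc r (e[r := k], \<kappa>))"
        using r e by (simp add: cc)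
    qed
  next
    fix e :: "int list" and \<kappa> assume "length e = m"
    then show "cc m (e, \<kappa>) = (if \<kappa> = sum_list e - 1 then pairing WG \<psi> (hat WG (A e) w) else 0)"
      using pairing_hat_zero[OF \<psi>] by (simp add: cc_def top)
  next
    fix e :: "int list" and \<kappa> assume e: "length e = m" "\<kappa> < K0"
    then show "cc 0 (e, \<kappa>) = 0"
      by (simp add: cc K0 linear_zeroD[OF W.spread_linear[OF sp]] linear_zeroD[OF W.dual_linear[OF \<psi>]])
  next
    fix i and e :: "int list" assume i: "i < m" "length e = m"
    \<comment> \<open>The vector acted on by mode i depends on the later modes only, which explains
      the form of the truncation hypothesis.\<close>
    obtain n0 where n0: "\<forall>k\<ge>n0. YV (us ! i) k (modes YV (drop (Suc i) us) (drop (Suc i) e) vac) = 0"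
      using YV_trunc by blast
    show "\<exists>n0. \<forall>e' \<kappa>. length e' = m \<longrightarrow> (\<forall>j. i < j \<longrightarrow> j < m \<longrightarrow> e' ! j = e ! j) \<longrightarrow> e' ! i \<ge> n0 \<longrightarrow> cc 0 (e', \<kappa>) = 0"
    proof (intro exI[of _ n0] allI impI)
      fix e' :: "int list" and \<kappa> assume e': "length e' = m" "\<forall>j. i < j \<longrightarrow> j < m \<longrightarrow> e' ! j = e ! j" "e' ! i \<ge> n0"
      have "drop (Suc i) e' = drop (Suc i) e" using i e' by (intro nth_equalityI) auto
      then have "modes YV us e' vac = 0" using i e' n0 m by (intro modes_YV_zero[of us e' i]) auto
      then show "cc 0 (e', \<kappa>) = 0" using e' by (intro zero)
    qed
  next
    fix e :: "int list" and \<kappa> assume e: "length e = m" "e ! (m - 1) \<ge> 0"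
    have "modes YV us e vac = 0"
      using e m by (intro modes_YV_zero[of us e "m - 1"]) (auto simp: modes_def YV_creation)
    then show "cc 0 (e, \<kappa>) = 0" using e by (intro zero)
  next
    have "set y \<noteq> {}" using X(2) n by auto
    then show "cmod \<zeta> > cmod (hd X - \<zeta>)" using reg(1) by (smt (verit) ex_in_conv norm_ge_zero)
  qed (use X dy rs m reg in auto)
  then have "laurent_sums (\<lambda>k. pairing WG \<psi> (c k)) (map (\<lambda>t. t - \<zeta>) X @ [\<zeta>]) (pairing WG \<psi> (F (X @ y)))"
  proof (rule laurent_sums_cong[THEN iffD1, rotated])
    fix k :: "int list" assume "length k = length (map (\<lambda>t. t - \<zeta>) X @ [\<zeta>])"
    then have k: "length k = Suc m" using X by simp
    then have "k = butlast k @ [last k]" by (metis append_butlast_last_id list.size(3) nat.simps(3))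
    then have "sum_list k - sum_list (butlast k) = last k" by (metis add_diff_cancel_left' sum_list.Cons sum_list.Nil sum_list.append add.right_neutral)
    then show "cc 0 (butlast k, sum_list k) = pairing WG \<psi> (c k)"
      using k by (simp add: cc_def bot c w_def)
  qed
  then show "laurent_sums (\<lambda>k. pairing WG \<psi> (c k)) x (pairing WG \<psi> (F z))" by (simp add: x z)
qed

lemma spread_sum_spr:
  assumes S: "W.spread ((\<lambda>a. of_int (a - p)) ` M) S" and T: "W.spread ((\<lambda>a. of_int (a - q)) ` N) T"
    and "p + q = \<kappa> + 1" "finite M" "finite N"
  shows "W.spread (spr ((\<lambda>(a, b). a + b) ` (M \<times> N)) \<kappa>) (\<lambda>x. S (T x))"
proof (rule W.spread_mono[OF W.spread_compose[OF S T]])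
  show "(\<lambda>(a, b). a + b) ` ((\<lambda>a. of_int (a - p)) ` M \<times> (\<lambda>a. of_int (a - q)) ` N) \<subseteq> spr ((\<lambda>(a, b). a + b) ` (M \<times> N)) \<kappa>"
  proof
    fix z assume "z \<in> (\<lambda>(a, b). a + b) ` ((\<lambda>a. complex_of_int (a - p)) ` M \<times> (\<lambda>a. of_int (a - q)) ` N)"
    then obtain a b where ab: "a \<in> M" "b \<in> N" "z = of_int (a - p) + of_int (b - q)" by auto
    have "a - p + (b - q) = a + b - \<kappa> - 1" using assms(3) by simp
    then have "z = of_int (a + b - \<kappa> - 1)" using ab(3) by (metis of_int_add)
    then show "z \<in> spr ((\<lambda>(a, b). a + b) ` (M \<times> N)) \<kappa>"
      unfolding spr_def using ab by (intro image_eqI[of _ _ "a + b"]) auto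
  qed
qed (use assms(4,5) in \<open>simp add: spr_def\<close>)

text \<open>The first \<open>r\<close> vectors act as a product, the others are gathered at \<zeta>,
  whose mode is what the total \<kappa> leaves over.\<close>

definition TL :: "'v list \<Rightarrow> nat \<Rightarrow> int list \<Rightarrow> int \<Rightarrow> 'w \<Rightarrow> 'w" where
  "TL us r e \<kappa> w = modes YL (take r us) (take r e) (YL (modes YV (drop r us) (drop r e) vac) (\<kappa> - sum_list e) w)"

text \<open>For opposite operators the vectors not yet gathered act first and in reversed order,
  with the gathered state outermost.\<close>

definition TS :: "'v list \<Rightarrow> nat \<Rightarrow> int list \<Rightarrow> int \<Rightarrow> 'w \<Rightarrow> 'w" where
  "TS us r e \<kappa> w = YS (modes YV (drop r us) (drop r e) vac) (\<kappa> - sum_list e) (modes YS (rev (take r us)) (rev (take r e)) w)"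

lemma TL_spread:
  assumes "length us = m" "r \<le> m"
  shows "\<exists>N. finite N \<and> (\<forall>e \<kappa>. length e = m \<longrightarrow> W.spread (spr N \<kappa>) (TL us r e \<kappa>))"
proof -
  obtain M where M: "finite M" "\<And>k. length k = length (take r us) \<Longrightarrow>
    W.spread ((\<lambda>a. of_int (a - sum_list k)) ` M) (modes YL (take r us) k)"
    using modes_spread[OF YL_vertex_map] by blast
  obtain N where N: "finite N" "\<And>k l. length k = length (drop r us) \<Longrightarrow>
    W.spread ((\<lambda>a. of_int (a - sum_list k - l - 1)) ` N) (YL (modes YV (drop r us) k vac) l)"
    using modes_vac_spread[OF YL_vertex_map] by blast
  show ?thesis
  proof (intro exI conjI allI impI)
    show "finite ((\<lambda>(a, b). a + b) ` (M \<times> N))" using M(1) N(1) by blast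
    fix e :: "int list" and \<kappa> assume e: "length e = m"
    let ?q = "sum_list (drop r e) + (\<kappa> - sum_list e) + 1"
    have "W.spread ((\<lambda>a. of_int (a - sum_list (take r e))) ` M) (modes YL (take r us) (take r e))"
      using M(2) assms e by simp
    moreover have "W.spread ((\<lambda>a. of_int (a - ?q)) ` N) (YL (modes YV (drop r us) (drop r e) vac) (\<kappa> - sum_list e))"
      using N(2)[of "drop r e" "\<kappa> - sum_list e"] assms e by (simp add: diff_diff_eq algebra_simps)
    ultimately show "W.spread (spr ((\<lambda>(a, b). a + b) ` (M \<times> N)) \<kappa>) (TL us r e \<kappa>)"
      unfolding TL_def[abs_def]
      by (rule spread_sum_spr) (use M(1) N(1) sum_list_split[OF e, of r] in auto)
  qed
qed

lemma TS_spread: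
  assumes "length us = m" "r \<le> m"
  shows "\<exists>N. finite N \<and> (\<forall>e \<kappa>. length e = m \<longrightarrow> W.spread (spr N \<kappa>) (TS us r e \<kappa>))"
proof -
  obtain M where M: "finite M" "\<And>k. length k = length (rev (take r us)) \<Longrightarrow>
    W.spread ((\<lambda>a. of_int (a - sum_list k)) ` M) (modes YS (rev (take r us)) k)"
    using modes_spread[OF YS_vertex_map] by blast
  obtain N where N: "finite N" "\<And>k l. length k = length (drop r us) \<Longrightarrow>
    W.spread ((\<lambda>a. of_int (a - sum_list k - l - 1)) ` N) (YS (modes YV (drop r us) k vac) l)"
    using modes_vac_spread[OF YS_vertex_map] by blast
  show ?thesis
  proof (intro exI conjI allI impI)
    show "finite ((\<lambda>(a, b). a + b) ` (N \<times> M))" using M(1) N(1) by blast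
    fix e :: "int list" and \<kappa> assume e: "length e = m"
    let ?q = "sum_list (drop r e) + (\<kappa> - sum_list e) + 1"
    have "W.spread ((\<lambda>a. of_int (a - ?q)) ` N) (YS (modes YV (drop r us) (drop r e) vac) (\<kappa> - sum_list e))"
      using N(2)[of "drop r e" "\<kappa> - sum_list e"] assms e by (simp add: diff_diff_eq algebra_simps)
    moreover have "W.spread ((\<lambda>a. of_int (a - sum_list (rev (take r e)))) ` M) (modes YS (rev (take r us)) (rev (take r e)))"
      using M(2)[of "rev (take r e)"] assms e by simp
    ultimately show "W.spread (spr ((\<lambda>(a, b). a + b) ` (N \<times> M)) \<kappa>) (TS us r e \<kappa>)"
      unfolding TS_def[abs_def]
      by (rule spread_sum_spr) (use M(1) N(1) sum_list_split[OF e, of r] in auto)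
  qed
qed

lemma T_lists:
  assumes "length us = m" "r < m" "length e = m"
  shows "take (Suc r) us = take r us @ [us ! r]" "take (Suc r) (e[r := k]) = take r e @ [k]"
    "drop (Suc r) (e[r := k]) = drop (Suc r) e" "drop r us = us ! r # drop (Suc r) us"
    "drop r (e[r := k]) = k # drop (Suc r) e" "take r (e[r := k]) = take r e"
    "\<kappa> - sum_list (e[r := k]) = (\<kappa> - sum_list e + e ! r) - (k :: int)"
  using assms by (auto simp: take_Suc_conv_app_nth Cons_nth_drop_Suc[symmetric] sum_list_update_int drop_update_cancel)

text \<open>The outer modes are absorbed into the functional; what remains is associativity for the
  r-th vector and the state made of the later ones.\<close>

lemma TL_pair:
  assumes \<psi>: "\<psi> \<in> graded_dual sW WG" and r: "length us = m" "r < m" "length e = m"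
  shows "assoc_pair (\<lambda>k. \<psi> (TL us (Suc r) (e[r := k]) \<kappa> w)) (\<lambda>k. \<psi> (TL us r (e[r := k]) \<kappa> w))"
proof -
  obtain N where N: "\<And>k. length k = length (take r us) \<Longrightarrow>
      W.spread ((\<lambda>a. of_int (a - sum_list k)) ` N) (modes YL (take r us) k)"
    using modes_spread[OF YL_vertex_map, of "take r us"] by blast
  have "length (take r e) = length (take r us)" using r by simp
  from W.dual_compose[OF \<psi> N[OF this]]
  have \<psi>': "(\<lambda>x. \<psi> (modes YL (take r us) (take r e) x)) \<in> graded_dual sW WG" .
  show ?thesis
    unfolding TL_def T_lists[OF r] using r
    by (subst modes_append) (use YL_pair[OF \<psi>'] in \<open>auto simp: modes_Cons modes_Nil\<close>)
qed

lemma TS_pair: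
  assumes \<psi>: "\<psi> \<in> graded_dual sW WG" and r: "length us = m" "r < m" "length e = m"
  shows "assoc_pair (\<lambda>k. \<psi> (TS us (Suc r) (e[r := k]) \<kappa> w)) (\<lambda>k. \<psi> (TS us r (e[r := k]) \<kappa> w))"
  unfolding TS_def T_lists[OF r] using YS_pair[OF \<psi>] by (simp add: modes_Cons)

lemma left_iterate:
  assumes m: "length us = m" "m \<ge> 1" and n: "n \<ge> 1" and f: "f \<in> wtilde sW WG n"
    and conv: "converges_to_rational sW WG (m + n) (product_series WG n (\<lambda>z. z) (map YL us) f) F"
  shows "converges_to_rational sW WG (m + n) (iterate_series WG n YV vac YL us f) F"
proof (rule iterate_converges[where T = "TL us" and A = "\<lambda>e. modes YL us e"])
  show "F \<in> wtilde sW WG (m + n)" using conv by (simp add: converges_to_rational_def)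
  fix e :: "int list" and \<kappa> assume e: "length e = m"
  show "TL us 0 e \<kappa> = YL (modes YV us e vac) (\<kappa> - sum_list e)"
    by (simp add: TL_def[abs_def] modes_Nil)
  \<comment> \<open>At the top stage the state at \<zeta> is \<open>vac\<close>, which has only the
    mode \<open>-1\<close>. For every other mode the product is applied to the zero vector.\<close>
  obtain \<Delta> where "W.spread \<Delta> (modes YL us e)" using modes_spread[OF YL_vertex_map, of us] e m by auto
  then have "modes YL us e 0 = 0" using W.spread_linear linear_zeroD by blast
  then show "TL us m e \<kappa> = (if \<kappa> = sum_list e - 1 then modes YL us e else (\<lambda>_. 0))"
    using e m by (auto simp: TL_def[abs_def] modes_Nil YL_identity fun_eq_iff modes_def[of YV "[]"])
next
  fix y :: "complex list" assume y: "length y = n" "distinct y"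
  obtain rs where rs: "length rs = m" "\<And>r. r \<in> set rs \<Longrightarrow> r > 0"
    "\<And>x. map cmod x = rs \<Longrightarrow> distinct x \<and> set x \<inter> set y = {} \<and> (\<forall>t\<in>set y. sorted_wrt (>) (map cmod (x @ [t])))"
    by (rule torus_radii[of m y]) (rule that)
  show "\<exists>rs. length rs = m \<and> (\<forall>r\<in>set rs. r > 0) \<and> (\<forall>x. map cmod x = rs \<longrightarrow> distinct (x @ y) \<and>
      (\<forall>\<psi>\<in>graded_dual sW WG. laurent_sums (\<lambda>e. pairing WG \<psi> (hat WG (modes YL us e) (f y))) x (pairing WG \<psi> (F (x @ y)))))"
  proof (intro exI[of _ rs] conjI ballI allI impI rs(1,2))
    fix x assume x: "map cmod x = rs"
    then have len: "length x = m" using rs(1) by (metis length_map)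
    show d: "distinct (x @ y)" using rs(3)[OF x] y by auto
    fix \<psi> assume \<psi>: "\<psi> \<in> graded_dual sW WG"
    have "(x @ y, x, \<lambda>k. modes (\<lambda>A l. hat WG (A l)) (map YL us) k (f y)) \<in> product_series WG n (\<lambda>z. z) (map YL us) f"
      unfolding product_series_def using len m y d rs(3)[OF x] by auto
    with conv \<psi> have "laurent_sums (\<lambda>k. pairing WG \<psi> (modes (\<lambda>A l. hat WG (A l)) (map YL us) k (f y))) x (pairing WG \<psi> (F (x @ y)))"
      unfolding converges_to_rational_def by fastforce
    then show "laurent_sums (\<lambda>e. pairing WG \<psi> (hat WG (modes YL us e) (f y))) x (pairing WG \<psi> (F (x @ y)))"
    proof (rule laurent_sums_cong[THEN iffD1, rotated])
      fix k :: "int list" assume k: "length k = length x"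
      have "modes (\<lambda>A l. hat WG (A l)) (map YL us) k (f y) = hat WG (modes (\<lambda>A l. A l) (map YL us) k) (f y)"
        by (rule W.modes_hat) (use vertex_map_spread[OF YL_vertex_map] k len m y wtilde_completion[OF f]
            in \<open>auto simp: config_def\<close>)
      then show "pairing WG \<psi> (modes (\<lambda>A l. hat WG (A l)) (map YL us) k (f y)) = pairing WG \<psi> (hat WG (modes YL us k) (f y))"
        by (simp add: modes_map[abs_def])
    qed
  qed
qed (use assms YL_vertex_map TL_spread TL_pair in auto)

lemma right_iterate:
  assumes m: "length us = m" "m \<ge> 1" and n: "n \<ge> 1" and f: "f \<in> wtilde sW WG n"
    and conv: "converges_to_rational sW WG (m + n) (product_series WG n rev (map YS (rev us)) f) F"
  shows "converges_to_rational sW WG (m + n) (iterate_series WG n YV vac YS us f) F"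
proof (rule iterate_converges[where T = "TS us" and A = "\<lambda>e. modes YS (rev us) (rev e)"])
  show "F \<in> wtilde sW WG (m + n)" using conv by (simp add: converges_to_rational_def)
  fix e :: "int list" and \<kappa> assume e: "length e = m"
  show "TS us 0 e \<kappa> = YS (modes YV us e vac) (\<kappa> - sum_list e)"
    by (simp add: TS_def[abs_def] modes_Nil)
  show "TS us m e \<kappa> = (if \<kappa> = sum_list e - 1 then modes YS (rev us) (rev e) else (\<lambda>_. 0))"
    using e m by (auto simp: TS_def[abs_def] YS_identity fun_eq_iff modes_def[of YV "[]"])
next
  fix y :: "complex list" assume y: "length y = n" "distinct y"
  obtain rs where rs: "length rs = m" "\<And>r. r \<in> set rs \<Longrightarrow> r > 0"
    "\<And>x. map cmod x = rs \<Longrightarrow> distinct x \<and> set x \<inter> set y = {} \<and> (\<forall>t\<in>set y. sorted_wrt (>) (map cmod (x @ [t])))"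
    by (rule torus_radii[of m y]) (rule that)
  show "\<exists>rs. length rs = m \<and> (\<forall>r\<in>set rs. r > 0) \<and> (\<forall>x. map cmod x = rs \<longrightarrow> distinct (x @ y) \<and>
      (\<forall>\<psi>\<in>graded_dual sW WG. laurent_sums (\<lambda>e. pairing WG \<psi> (hat WG (modes YS (rev us) (rev e)) (f y))) x (pairing WG \<psi> (F (x @ y)))))"
  \<comment> \<open>The outermost opposite operator carries z_m, so in the order z_1, ..., z_m the
    radii increase.\<close>
  proof (intro exI[of _ "rev rs"] conjI ballI allI impI)
    fix x assume "map cmod x = rev rs"
    then have x: "map cmod (rev x) = rs" by (simp add: rev_map[symmetric])
    then have len: "length x = m" using rs(1) by (metis length_map length_rev)
    show d: "distinct (x @ y)" using rs(3)[OF x] y by auto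
    fix \<psi> assume \<psi>: "\<psi> \<in> graded_dual sW WG"
    have "(rev (rev x) @ y, rev x, \<lambda>k. modes (\<lambda>A l. hat WG (A l)) (map YS (rev us)) k (f y)) \<in> product_series WG n rev (map YS (rev us)) f"
      unfolding product_series_def using len m y d rs(3)[OF x] by auto
    with conv \<psi> have "laurent_sums (\<lambda>k. pairing WG \<psi> (modes (\<lambda>A l. hat WG (A l)) (map YS (rev us)) k (f y))) (rev x) (pairing WG \<psi> (F (x @ y)))"
      unfolding converges_to_rational_def by fastforce
    then have "laurent_sums (\<lambda>k. (\<lambda>e. pairing WG \<psi> (hat WG (modes YS (rev us) (rev e)) (f y))) (rev k)) (rev x) (pairing WG \<psi> (F (x @ y)))"
    proof (rule laurent_sums_cong[THEN iffD1, rotated])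
      fix k :: "int list" assume k: "length k = length (rev x)"
      have "modes (\<lambda>A l. hat WG (A l)) (map YS (rev us)) k (f y) = hat WG (modes (\<lambda>A l. A l) (map YS (rev us)) k) (f y)"
        by (rule W.modes_hat) (use vertex_map_spread[OF YS_vertex_map] k len m y wtilde_completion[OF f]
            in \<open>auto simp: config_def\<close>)
      then show "pairing WG \<psi> (modes (\<lambda>A l. hat WG (A l)) (map YS (rev us)) k (f y)) =
          pairing WG \<psi> (hat WG (modes YS (rev us) (rev (rev k))) (f y))"
        by (simp add: modes_map[abs_def])
    qed
    then show "laurent_sums (\<lambda>e. pairing WG \<psi> (hat WG (modes YS (rev us) (rev e)) (f y))) x (pairing WG \<psi> (F (x @ y)))"
      unfolding laurent_sums_rev[of "\<lambda>e. pairing WG \<psi> (hat WG (modes YS (rev us) (rev e)) (f y))" x] .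
  qed (use rs in auto)
qed (use assms YS_vertex_map TS_spread TS_pair in auto)

end

section \<open>Exchange of a left operator and an opposite operator\<close>

context mosva_bimodule
begin

lemma LR_commute:
  assumes n: "n \<ge> 1" and f: "f \<in> wtilde sW WG n"
    and conv: "converges_to_rational sW WG (n + 2) (product_series WG n (\<lambda>z. z) [YL u1, YS u2] f) F"
  shows "converges_to_rational sW WG (n + 2) (product_series WG n rev [YS u2, YL u1] f) F"
  unfolding converges_to_rational_def
proof (intro conjI ballI, goal_cases)
  case 1
  show ?case using conv by (simp add: converges_to_rational_def)
next
  case (2 p)
  obtain z x' c where p: "p = (z, x', c)" by (cases p)
  with 2 obtain y where z: "z = rev x' @ y" and c: "c = (\<lambda>k. modes (\<lambda>A l. hat WG (A l)) [YS u2, YL u1] k (f y))"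
    and x': "length x' = 2" "length y = n" "distinct (x' @ y)" "\<forall>t\<in>set y. sorted_wrt (>) (map cmod (x' @ [t]))"
    unfolding product_series_def by auto
  have F: "F \<in> wtilde sW WG (2 + n)" using conv by (simp add: converges_to_rational_def add.commute)
  define w where "w = f y"
  have w: "w \<in> completion WG"
    unfolding w_def using wtilde_completion[OF f] x' by (simp add: config_def)
  define N where "N = (\<lambda>(a, b). a + b) ` (wts u1 \<times> wts u2) \<union> (\<lambda>(a, b). a + b) ` (wts u2 \<times> wts u1)"
  have finN: "finite N" using finite_wts by (simp add: N_def)
  have sL: "W.spread ((\<lambda>a. of_int (a - (k + 1))) ` wts u) (YL u k)" for u k
    using vertex_map_spread[OF YL_vertex_map, of k u] by (simp add: diff_diff_eq)
  have sS: "W.spread ((\<lambda>a. of_int (a - (k + 1))) ` wts u) (YS u k)" for u k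
    using vertex_map_spread[OF YS_vertex_map, of k u] by (simp add: diff_diff_eq)
  have mono: "W.spread (spr N \<kappa>) T" if "W.spread (spr M \<kappa>) T" "M \<subseteq> N" for M \<kappa> T
    using that finN by (intro W.spread_mono[OF that(1)]) (auto simp: spr_def)
  \<comment> \<open>The shifts add up as (a - k - 1) + (b - l - 1) = (a + b) - (k + l + 1) - 1, so
    two modes have total k + l + 1 in the sense of \<open>spr\<close>. The same offset appears in
    \<open>idx\<close> and in the bound \<open>K0 - 1\<close>.\<close>
  have sLS: "W.spread (spr N (k + l + 1)) (\<lambda>x. YL u1 k (YS u2 l x))" for k l
    by (rule mono[OF spread_sum_spr[OF sL sS _ finite_wts finite_wts]]) (auto simp: N_def)
  have sSL: "W.spread (spr N (k + l + 1)) (\<lambda>x. YS u2 l (YL u1 k x))" for k l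
    by (rule mono[OF spread_sum_spr[OF sS sL _ finite_wts finite_wts]]) (auto simp: N_def)
  have hats: "modes (\<lambda>A l. hat WG (A l)) [A, B] [k, l] w = hat WG (\<lambda>x. A k (B l x)) w"
    if "\<And>k. \<exists>\<Delta>. W.spread \<Delta> (A k)" "\<And>k. \<exists>\<Delta>. W.spread \<Delta> (B k)" for A B k l
  proof -
    have "modes (\<lambda>A l. hat WG (A l)) [A, B] [k, l] w = hat WG (modes (\<lambda>A l. A l) [A, B] [k, l]) w"
      by (rule W.modes_hat) (use that w in auto)
    also have "modes (\<lambda>A l. A l) [A, B] [k, l] = (\<lambda>x. A k (B l x))"
      by (simp add: modes_def fun_eq_iff)
    finally show ?thesis .
  qed
  have "laurent_sums (\<lambda>k. pairing WG \<psi> (c k)) x' (pairing WG \<psi> (F z))" if \<psi>: "\<psi> \<in> graded_dual sW WG" for \<psi>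
  proof -
    define a where "a k = pairing WG \<psi> (hat WG (\<lambda>x. YL u1 (k ! 0) (YS u2 (k ! 1) x)) w)" for k
    \<comment> \<open>Both families list the mode of Y^L first, so that their lines can be compared;
      the series to be summed lists them the other way round and is reversed at the end.\<close>
    define b where "b k = pairing WG \<psi> (hat WG (\<lambda>x. YS u2 (k ! 1) (YL u1 (k ! 0) x)) w)" for k
    obtain K0 where K0: "\<And>\<kappa> j. \<kappa> < K0 \<Longrightarrow> j \<in> idx \<psi> N \<kappa> \<Longrightarrow> w j = 0"
      using low_degree[OF \<psi> finN w] by blast
    have b: "b k = (\<Sum>j\<in>idx \<psi> N (sum_list k + 1). \<psi> (YS u2 (k ! 1) (YL u1 (k ! 0) (w j))))" if "length k = 2" for k
      using pairing_idx[OF \<psi> sSL finN w, of "k ! 1" "k ! 0"] that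
      by (auto simp: b_def length_Suc_conv numeral_2_eq_2)
    have zero: "\<psi> (YS u2 q 0) = 0" "YL u1 q 0 = 0" for q
      using linear_zeroD[OF vertex_mapD(1)[OF YS_vertex_map]] linear_zeroD[OF vertex_mapD(1)[OF YL_vertex_map]]
        linear_zeroD[OF W.dual_linear[OF \<psi>]] by simp_all
    have low: "b k = 0" if "length k = 2" "sum_list k < K0 - 1" for k
      unfolding b[OF that(1)] by (rule sum.neutral) (use K0[of "sum_list k + 1"] that in \<open>simp add: zero\<close>)
    obtain rs where rs: "length rs = 2" "\<And>r. r \<in> set rs \<Longrightarrow> r > 0"
      "\<And>x. map cmod x = rs \<Longrightarrow> distinct x \<and> set x \<inter> set y = {} \<and> (\<forall>t\<in>set y. sorted_wrt (>) (map cmod (x @ [t])))"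
      by (rule torus_radii[of 2 y]) (rule that)
    have "laurent_sums b (rev x') (pairing WG \<psi> (F (rev x' @ y)))"
    proof (rule commute_core[where a = a and rs = rs and R = "\<lambda>z. pairing WG \<psi> (F z)" and ?K0.0 = "K0 - 1"])
      show "rational_diag (2 + n) (\<lambda>z. pairing WG \<psi> (F z))" by (rule wtilde_rational[OF F \<psi>])
    next
      fix x assume x: "map cmod x = rs"
      then have len: "length x = 2" using rs(1) by (metis length_map)
      have d: "distinct (x @ y)" using rs(3)[OF x] x'(3) by auto
      have "(x @ y, x, \<lambda>k. modes (\<lambda>A l. hat WG (A l)) [YL u1, YS u2] k (f y)) \<in> product_series WG n (\<lambda>z. z) [YL u1, YS u2] f"
        unfolding product_series_def using len x' d rs(3)[OF x] by auto
      with conv \<psi> have "laurent_sums (\<lambda>k. pairing WG \<psi> (modes (\<lambda>A l. hat WG (A l)) [YL u1, YS u2] k (f y))) x (pairing WG \<psi> (F (x @ y)))"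
        unfolding converges_to_rational_def by fastforce
      then have "laurent_sums a x (pairing WG \<psi> (F (x @ y)))"
      proof (rule laurent_sums_cong[THEN iffD1, rotated])
        fix k :: "int list" assume "length k = length x"
        then obtain p q where k: "k = [p, q]" using len by (auto simp: length_Suc_conv numeral_2_eq_2)
        show "pairing WG \<psi> (modes (\<lambda>A l. hat WG (A l)) [YL u1, YS u2] k (f y)) = a k"
          unfolding k a_def w_def[symmetric] using hats[of "YL u1" "YS u2" p q] sL sS by (metis nth_Cons_0 nth_Cons_Suc One_nat_def)
      qed
      then show "distinct (x @ y) \<and> laurent_sums a x (pairing WG \<psi> (F (x @ y)))" using d by blast
    next
      fix \<kappa>
      have "comm_pair (\<lambda>k. \<Sum>j\<in>idx \<psi> N (\<kappa> + 1). \<psi> (YL u1 k (YS u2 (\<kappa> - k) (w j))))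
          (\<lambda>k. \<Sum>j\<in>idx \<psi> N (\<kappa> + 1). \<psi> (YS u2 (\<kappa> - k) (YL u1 k (w j))))"
        by (intro comm_pair_sum LR_pair[OF \<psi>])
      moreover have "line \<kappa> (to2 a) = (\<lambda>k. \<Sum>j\<in>idx \<psi> N (\<kappa> + 1). \<psi> (YL u1 k (YS u2 (\<kappa> - k) (w j))))"
      proof
        fix k
        show "line \<kappa> (to2 a) k = (\<Sum>j\<in>idx \<psi> N (\<kappa> + 1). \<psi> (YL u1 k (YS u2 (\<kappa> - k) (w j))))"
          using pairing_idx[OF \<psi> sLS[of k "\<kappa> - k"] finN w] by (simp add: line_def to2_def a_def)
      qed
      moreover have "line \<kappa> (to2 b) = (\<lambda>k. \<Sum>j\<in>idx \<psi> N (\<kappa> + 1). \<psi> (YS u2 (\<kappa> - k) (YL u1 k (w j))))"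
        by (rule ext) (simp add: line_def to2_def b)
      ultimately show "comm_pair (line \<kappa> (to2 a)) (line \<kappa> (to2 b))" by simp
    next
      fix k :: "int list" assume "length k = 2" "sum_list k < K0 - 1"
      then show "b k = 0" by (rule low)
    next
      fix K
      \<comment> \<open>Below \<open>K0\<close> the relevant components vanish, so total modes up to
        \<open>K\<close> involve finitely many components and their truncation bounds have a
        maximum.\<close>
      define J where "J = (\<Union>\<kappa>\<in>{K0..K + 1}. idx \<psi> N \<kappa>)"
      have finJ: "finite J" using finN W.dual_supp[OF \<psi>] by (simp add: J_def idx_def)
      have "\<forall>j. \<exists>n. \<forall>k\<ge>n. YL u1 k (w j) = 0" using vertex_map_trunc[OF YL_vertex_map] by blast
      then obtain n1 where n1: "\<And>j k. k \<ge> n1 j \<Longrightarrow> YL u1 k (w j) = 0" by metis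
      define n0 where "n0 = Max (insert 0 (n1 ` J))"
      have n0: "n1 j \<le> n0" if "j \<in> J" for j unfolding n0_def using finJ that by (intro Max_ge) auto
      show "\<exists>n0. \<forall>k. length k = 2 \<longrightarrow> k ! 0 \<ge> n0 \<longrightarrow> sum_list k \<le> K \<longrightarrow> b k = 0"
      proof (intro exI[of _ n0] allI impI)
        fix k :: "int list" assume k: "length k = 2" "k ! 0 \<ge> n0" "sum_list k \<le> K"
        show "b k = 0"
        proof (cases "sum_list k < K0 - 1")
          case False
          have "\<psi> (YS u2 (k ! 1) (YL u1 (k ! 0) (w j))) = 0" if "j \<in> idx \<psi> N (sum_list k + 1)" for j
          proof -
            have "j \<in> J" unfolding J_def using that False k(3) by (intro UN_I[of "sum_list k + 1"]) auto
            then have "YL u1 (k ! 0) (w j) = 0" using n0[of j] k(2) by (intro n1) simp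
            then show ?thesis by (simp add: zero)
          qed
          then show ?thesis unfolding b[OF k(1)] by (intro sum.neutral) blast
        qed (rule low[OF k(1)])
      qed
    next
      have "y \<noteq> []" using x'(2) n by auto
      then obtain t where t: "t \<in> set y" by (cases y) auto
      obtain s1 s2 where s: "x' = [s1, s2]" using x'(1) by (auto simp: length_Suc_conv numeral_2_eq_2)
      show "cmod (rev x' ! 0) < cmod (rev x' ! 1)" using x'(4) t by (auto simp: s)
      show "\<forall>t\<in>set y. cmod t < cmod (rev x' ! 0)" using x'(4) by (auto simp: s)
      then have "cmod t < cmod (rev x' ! 0)" using t by blast
      then show "rev x' ! 0 \<noteq> 0" by auto
    qed (use x' rs in auto)
    then have "laurent_sums (\<lambda>k. b (rev k)) (rev (rev x')) (pairing WG \<psi> (F z))"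
      unfolding laurent_sums_rev z .
    then have "laurent_sums (\<lambda>k. b (rev k)) x' (pairing WG \<psi> (F z))" by simp
    then show ?thesis
    proof (rule laurent_sums_cong[THEN iffD1, rotated])
      fix k :: "int list" assume "length k = length x'"
      then obtain p q where k: "k = [p, q]" using x'(1) by (auto simp: length_Suc_conv numeral_2_eq_2)
      show "b (rev k) = pairing WG \<psi> (c k)"
      proof -
        have "modes (\<lambda>A l. hat WG (A l)) [YS u2, YL u1] [p, q] w = hat WG (\<lambda>x. YS u2 p (YL u1 q x)) w"
          by (rule hats) (use sL sS in blast)+
        then show ?thesis by (simp add: k b_def c w_def)
      qed
    qed
  qed
  then show ?case by (auto simp: p)
qed

end


section \<open>The rational function determined by a series\<close>

section \<open>Uniqueness of the sums\<close>

lemma set_drop_nth: "t \<in> set (drop m z) \<Longrightarrow> \<exists>j. m + j < length z \<and> t = z ! (m + j)"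
  by (auto simp: in_set_conv_nth less_diff_conv add.commute intro: exI[of _ "_ :: nat"])

context graded_space
begin

text \<open>Near \<open>z0\<close> both functions are sums of the same series. Their pairings are
  rational, hence agree everywhere, and the graded dual separates points of the completion.\<close>

lemma converges_unique:
  assumes "\<epsilon> > 0" "length z0 = N"
    and region: "\<And>z. z \<in> near \<epsilon> z0 \<Longrightarrow> z \<in> config N \<Longrightarrow> \<exists>x c. (z, x, c) \<in> S"
    and F: "converges_to_rational scale G N S F" and F': "converges_to_rational scale G N S F'"
  shows "F = F'"
proof (rule PiE_ext[where k = "config N" and s = "\<lambda>_. completion G"])
  have w: "F \<in> wtilde scale G N" "F' \<in> wtilde scale G N"
    using F F' by (auto simp: converges_to_rational_def)
  then show "F \<in> config N \<rightarrow>\<^sub>E completion G" "F' \<in> config N \<rightarrow>\<^sub>E completion G" by (auto simp: wtilde_def)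
  fix z assume z: "z \<in> config N"
  show "F z = F' z"
  proof (rule dual_separates)
    fix \<psi> assume \<psi>: "\<psi> \<in> dual"
    show "pairing G \<psi> (F z) = pairing G \<psi> (F' z)"
    proof (rule rational_diag_identity[OF wtilde_rational[OF w(1) \<psi>] wtilde_rational[OF w(2) \<psi>] assms(1,2) _ z])
      fix z assume "z \<in> near \<epsilon> z0" "z \<in> config N"
      then obtain x c where "(z, x, c) \<in> S" using region by blast
      then have "laurent_sums (\<lambda>k. pairing G \<psi> (c k)) x (pairing G \<psi> (F z))"
        "laurent_sums (\<lambda>k. pairing G \<psi> (c k)) x (pairing G \<psi> (F' z))"
        using F F' \<psi> unfolding converges_to_rational_def by fastforce+
      then show "pairing G \<psi> (F z) = pairing G \<psi> (F' z)" by (rule laurent_sums_unique)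
    qed
  qed (intro wtilde_completion[OF w(1) z] wtilde_completion[OF w(2) z])+
qed

text \<open>The part of the region that the identity theorem requires; it gives the definite
  description in \<open>E\<close> a well-defined value whenever the series converges.\<close>

definition determining :: "nat \<Rightarrow> ('i, 'a) wseries \<Rightarrow> bool" where
  "determining N S \<longleftrightarrow> (\<exists>\<epsilon> z0. \<epsilon> > 0 \<and> length z0 = N \<and>
     (\<forall>z\<in>near \<epsilon> z0 \<inter> config N. \<exists>x c. (z, x, c) \<in> S))"

lemma E_eq:
  assumes "determining N S" "converges_to_rational scale G N S F"
  shows "E scale G N S = F"
  unfolding E_def
proof (rule the_equality)
  show "converges_to_rational scale G N S F" by (rule assms(2))
  fix F' assume "converges_to_rational scale G N S F'"
  then show "F' = F" using assms converges_unique unfolding determining_def by blast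
qed

lemma E_transfer:
  assumes "determining N S" "determining N T"
    and "\<And>F. converges_to_rational scale G N S F \<Longrightarrow> converges_to_rational scale G N T F"
  shows "(\<exists>F. converges_to_rational scale G N S F) \<longrightarrow>
    (\<forall>F. converges_to_rational scale G N S F \<longrightarrow> converges_to_rational scale G N T F) \<and>
    E scale G N S \<in> wtilde scale G N \<and> E scale G N S = E scale G N T"
proof
  assume "\<exists>F. converges_to_rational scale G N S F"
  then obtain F where F: "converges_to_rational scale G N S F" by blast
  have "E scale G N S = F" "E scale G N T = F"
    using E_eq[OF assms(1) F] E_eq[OF assms(2) assms(3)[OF F]] by auto
  then show "(\<forall>F. converges_to_rational scale G N S F \<longrightarrow> converges_to_rational scale G N T F) \<and>
    E scale G N S \<in> wtilde scale G N \<and> E scale G N S = E scale G N T"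
    using assms(3) F by (auto simp: converges_to_rational_def)
qed

lemma near_cmod:
  assumes "z \<in> near (1/4) (map (\<lambda>i. of_real (\<rho> i)) [0..<N])" "i < N" "\<rho> i \<ge> 0"
  shows "\<bar>cmod (z ! i) - \<rho> i\<bar> < 1/4"
proof -
  have "cmod (z ! i - of_real (\<rho> i)) < 1/4" using assms(1,2) by (auto simp: near_def)
  moreover have "\<bar>cmod (z ! i) - cmod (of_real (\<rho> i))\<bar> \<le> cmod (z ! i - of_real (\<rho> i))"
    by (rule norm_triangle_ineq3)
  ultimately show ?thesis using assms(3) by simp
qed

lemma product_seriesI:
  assumes "length x = length As" "length y = n" "distinct (x @ y)"
    "\<And>t. t \<in> set y \<Longrightarrow> sorted_wrt (>) (map cmod (x @ [t]))"
  shows "(ord x @ y, x, \<lambda>k. modes (\<lambda>A l. hat G (A l)) As k (f y)) \<in> product_series G n ord As f"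
  unfolding product_series_def using assms by blast

lemma iterate_seriesI:
  assumes "length x = length us" "length y = n" "distinct (x @ y)"
    "\<And>t. t \<in> set y \<Longrightarrow> cmod \<zeta> > cmod (hd x - \<zeta>) + cmod t"
    "sorted_wrt (>) (map (\<lambda>t. cmod (t - \<zeta>)) x)"
  shows "(x @ y, map (\<lambda>t. t - \<zeta>) x @ [\<zeta>], \<lambda>k. hat G (YW (modes YV us (butlast k) vac) (last k)) (f y))
    \<in> iterate_series G n YV vac YW us f"
  unfolding iterate_series_def using assms by blast

lemma determining_product:
  assumes "length As = m"
  shows "determining (m + n) (product_series G n (\<lambda>z. z) As f)"
proof -
  \<comment> \<open>Centres on the positive axis with consecutive distances 1; perturbations below
    1/4 keep their moduli in strict order.\<close>
  define \<rho> where "\<rho> i = real (m + n - i)" for i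
  show ?thesis unfolding determining_def
  proof (rule exI[of _ "1/4"], rule exI[of _ "map (\<lambda>i. of_real (\<rho> i)) [0..<m + n]"], intro conjI ballI)
    fix z assume z: "z \<in> near (1/4) (map (\<lambda>i. of_real (\<rho> i)) [0..<m + n]) \<inter> config (m + n)"
    have \<rho>0: "\<rho> i \<ge> 0" for i by (auto simp: \<rho>_def)
    have h: "\<bar>cmod (z ! i) - \<rho> i\<bar> < 1/4" if "i < m + n" for i
      by (rule near_cmod[OF _ that \<rho>0]) (use z in blast)
    have lt: "cmod (z ! j) < cmod (z ! i)" if "i < j" "j < m + n" for i j
    proof -
      have "\<rho> j + 1 \<le> \<rho> i" using that by (auto simp: \<rho>_def)
      moreover have "i < m + n" "j < m + n" using that by auto
      ultimately show ?thesis using h[of i] h[of j] by linarith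
    qed
    have len: "length z = m + n" using z by (simp add: config_def)
    have "sorted_wrt (>) (map cmod (take m z @ [t]))" if t: "t \<in> set (drop m z)" for t
    proof -
      obtain j where "j < n" "t = z ! (m + j)" using set_drop_nth[OF t] len by auto
      then show ?thesis using lt len by (auto simp: sorted_wrt_iff_nth_less nth_append)
    qed
    then have "(take m z @ drop m z, take m z, \<lambda>k. modes (\<lambda>A l. hat G (A l)) As k (f (drop m z))) \<in> product_series G n (\<lambda>z. z) As f"
      using assms len z by (intro product_seriesI) (simp_all add: config_def)
    then show "\<exists>x c. (z, x, c) \<in> product_series G n (\<lambda>z. z) As f" by auto
  qed simp_all
qed

lemma determining_product_rev:
  assumes "length As = m"
  shows "determining (m + n) (product_series G n rev As f)"
proof -
  \<comment> \<open>The first m moduli increase from n + 1, as the reversed order demands, and stay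
    above the others, which are at most n.\<close>
  define \<rho> where "\<rho> i = (if i < m then real (n + 1 + i) else real (m + n - i))" for i
  show ?thesis unfolding determining_def
  proof (rule exI[of _ "1/4"], rule exI[of _ "map (\<lambda>i. of_real (\<rho> i)) [0..<m + n]"], intro conjI ballI)
    fix z assume z: "z \<in> near (1/4) (map (\<lambda>i. of_real (\<rho> i)) [0..<m + n]) \<inter> config (m + n)"
    have \<rho>0: "\<rho> i \<ge> 0" for i by (auto simp: \<rho>_def)
    have h: "\<bar>cmod (z ! i) - \<rho> i\<bar> < 1/4" if "i < m + n" for i
      by (rule near_cmod[OF _ that \<rho>0]) (use z in blast)
    have lt: "cmod (z ! i) < cmod (z ! j)" if "i < j \<and> j < m \<or> j < m \<and> m \<le> i \<and> i < m + n" for i j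
    proof -
      have "\<rho> i + 1 \<le> \<rho> j" using that by (auto simp: \<rho>_def)
      moreover have "i < m + n" "j < m + n" using that by auto
      ultimately show ?thesis using h[of i] h[of j] by linarith
    qed
    have len: "length z = m + n" using z by (simp add: config_def)
    have "sorted_wrt (>) (map cmod (rev (take m z) @ [t]))" if t: "t \<in> set (drop m z)" for t
    proof -
      obtain j where j: "j < n" "t = z ! (m + j)" using set_drop_nth[OF t] len by auto
      show ?thesis unfolding sorted_wrt_iff_nth_less
      proof (intro allI impI)
        fix a b assume ab: "a < b" "b < length (map cmod (rev (take m z) @ [t]))"
        then have b: "b \<le> m" using len by simp
        have "map cmod (rev (take m z) @ [t]) ! a = cmod (z ! (m - 1 - a))"
          using ab b len by (simp add: nth_append rev_nth)
        moreover have "map cmod (rev (take m z) @ [t]) ! b = cmod (if b < m then z ! (m - 1 - b) else z ! (m + j))"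
          using b len j by (simp add: nth_append rev_nth)
        ultimately show "map cmod (rev (take m z) @ [t]) ! a > map cmod (rev (take m z) @ [t]) ! b"
          using ab b j by (auto intro!: lt)
      qed
    qed
    then have "(rev (rev (take m z)) @ drop m z, rev (take m z), \<lambda>k. modes (\<lambda>A l. hat G (A l)) As k (f (drop m z))) \<in> product_series G n rev As f"
      using assms len z
      by (intro product_seriesI) (simp_all add: config_def set_take_disj_set_drop_if_distinct)
    then show "\<exists>x c. (z, x, c) \<in> product_series G n rev As f" by auto
  qed simp_all
qed

lemma determining_iterate:
  assumes "length us = m" "m \<ge> 1"
  shows "determining (m + n) (iterate_series G n YV vac YW us f)"
proof -
  \<comment> \<open>\<zeta> is fixed at \<open>Z\<close> and z_i lies near
    \<open>Z + (m - i)\<close>, so |z_i - \<zeta>| is near m - i. The largest of these plus a frozen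
    modulus is below m + n + 1/2, which is less than \<open>Z\<close>.\<close>
  define Z where "Z = real (m + n + 2)"
  define \<rho> where "\<rho> i = (if i < m then Z + real (m - i) else real (m + n - i))" for i
  show ?thesis unfolding determining_def
  proof (rule exI[of _ "1/4"], rule exI[of _ "map (\<lambda>i. of_real (\<rho> i)) [0..<m + n]"], intro conjI ballI)
    fix z assume z: "z \<in> near (1/4) (map (\<lambda>i. of_real (\<rho> i)) [0..<m + n]) \<inter> config (m + n)"
    have len: "length z = m + n" using z by (simp add: config_def)
    have t: "\<bar>cmod (z ! i - of_real Z) - real (m - i)\<bar> < 1/4" if "i < m" for i
    proof -
      have "cmod (z ! i - of_real (\<rho> i)) < 1/4" using z that by (auto simp: near_def)
      moreover have "z ! i - of_real (\<rho> i) = (z ! i - of_real Z) - of_real (real (m - i))"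
        using that by (simp add: \<rho>_def)
      moreover have "\<bar>cmod (z ! i - of_real Z) - cmod (of_real (real (m - i)))\<bar> \<le> cmod ((z ! i - of_real Z) - of_real (real (m - i)))"
        by (rule norm_triangle_ineq3)
      ultimately show ?thesis by simp
    qed
    have y: "cmod s < real n + 1/4" if s: "s \<in> set (drop m z)" for s
    proof -
      obtain j where "j < n" "s = z ! (m + j)" using set_drop_nth[OF s] len by auto
      moreover from this have "\<rho> (m + j) \<ge> 0" "\<rho> (m + j) \<le> real n" by (auto simp: \<rho>_def)
      moreover from calculation have "\<bar>cmod s - \<rho> (m + j)\<bar> < 1/4"
        using near_cmod[of z \<rho> "m + n" "m + j"] z by auto
      ultimately show ?thesis by linarith
    qed
    have hd: "hd (take m z) = z ! 0" using assms(2) len by (cases z) auto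
    have 1: "\<forall>s\<in>set (drop m z). cmod (of_real Z) > cmod (hd (take m z) - of_real Z) + cmod s"
    proof
      fix s assume "s \<in> set (drop m z)"
      from y[OF this] have "cmod s < real n + 1/4" .
      moreover have "cmod (z ! 0 - of_real Z) < real m + 1/4"
      proof -
        have "0 < m" using assms(2) by simp
        from t[OF this] show ?thesis unfolding diff_zero by linarith
      qed
      ultimately have "cmod (z ! 0 - of_real Z) + cmod s < Z" by (simp add: Z_def)
      moreover have "cmod (of_real Z) = Z" unfolding norm_of_real by (simp add: Z_def)
      ultimately show "cmod (of_real Z) > cmod (hd (take m z) - of_real Z) + cmod s" unfolding hd by simp
    qed
    have 2: "sorted_wrt (>) (map (\<lambda>t. cmod (t - of_real Z)) (take m z))"
      unfolding sorted_wrt_iff_nth_less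
    proof (intro allI impI)
      fix i j assume ij: "i < j" "j < length (map (\<lambda>t. cmod (t - of_real Z)) (take m z))"
      then have "i < m" "j < m" using len by auto
      moreover have "real (m - j) + 1 \<le> real (m - i)" using ij len by auto
      ultimately have "cmod (z ! j - of_real Z) < cmod (z ! i - of_real Z)" using t[of i] t[of j] by linarith
      then show "map (\<lambda>t. cmod (t - of_real Z)) (take m z) ! i > map (\<lambda>t. cmod (t - of_real Z)) (take m z) ! j"
        using ij len by simp
    qed
    have "(take m z @ drop m z, map (\<lambda>t. t - of_real Z) (take m z) @ [of_real Z],
        \<lambda>k. hat G (YW (modes YV us (butlast k) vac) (last k)) (f (drop m z))) \<in> iterate_series G n YV vac YW us f"
      using assms len z 1 2 by (intro iterate_seriesI) (simp_all add: config_def)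
    then show "\<exists>x c. (z, x, c) \<in> iterate_series G n YV vac YW us f" by auto
  qed simp_all
qed

end

theorem theorem3p20:
  fixes sV :: "complex \<Rightarrow> 'v::ab_group_add \<Rightarrow> 'v" and VG :: "int \<Rightarrow> 'v set"
    and YV :: "'v \<Rightarrow> int \<Rightarrow> 'v \<Rightarrow> 'v" and vac :: 'v
    and sW :: "complex \<Rightarrow> 'w::ab_group_add \<Rightarrow> 'w" and WG :: "complex \<Rightarrow> 'w set"
    and DW :: "'w \<Rightarrow> 'w" and YL :: "'v \<Rightarrow> int \<Rightarrow> 'w \<Rightarrow> 'w" and YR :: "'w \<Rightarrow> int \<Rightarrow> 'v \<Rightarrow> 'w"
    and m n :: nat
  assumes "mosva sV VG YV vac"
    and "mosva_bimodule sV VG YV vac sW WG DW YL YR"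
    and "mosva_pole_order_condition sV VG YV"
    and "bimodule_pole_order_condition YV sW WG YL YR"
    and "m \<ge> 1" and "n \<ge> 1"
  shows
    "(\<forall>u1 u2. \<forall>f\<in>wtilde sW WG n.
        let S = product_series WG n (\<lambda>z. z) [YL u1, skew sW DW YR u2] f;
            T = product_series WG n rev [skew sW DW YR u2, YL u1] f
        in (\<exists>F. converges_to_rational sW WG (n + 2) S F) \<longrightarrow>
             (\<forall>F. converges_to_rational sW WG (n + 2) S F \<longrightarrow>
                converges_to_rational sW WG (n + 2) T F) \<and>
             E sW WG (n + 2) S \<in> wtilde sW WG (n + 2) \<and>
             E sW WG (n + 2) S = E sW WG (n + 2) T) \<and>
     (\<forall>us. \<forall>f\<in>wtilde sW WG n. length us = m \<longrightarrow>
        (let S = product_series WG n (\<lambda>z. z) (map YL us) f;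
             T = iterate_series WG n YV vac YL us f
         in (\<exists>F. converges_to_rational sW WG (m + n) S F) \<longrightarrow>
              (\<forall>F. converges_to_rational sW WG (m + n) S F \<longrightarrow>
                 converges_to_rational sW WG (m + n) T F) \<and>
              E sW WG (m + n) S \<in> wtilde sW WG (m + n) \<and>
              E sW WG (m + n) S = E sW WG (m + n) T)) \<and>
     (\<forall>us. \<forall>f\<in>wtilde sW WG n. length us = m \<longrightarrow>
        (let S = product_series WG n rev (map (skew sW DW YR) (rev us)) f;
             T = iterate_series WG n YV vac (skew sW DW YR) us f
         in (\<exists>F. converges_to_rational sW WG (m + n) S F) \<longrightarrow>
              (\<forall>F. converges_to_rational sW WG (m + n) S F \<longrightarrow>
                 converges_to_rational sW WG (m + n) T F) \<and>
              E sW WG (m + n) S \<in> wtilde sW WG (m + n) \<and>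
              E sW WG (m + n) S = E sW WG (m + n) T))"
proof -
  interpret B: mosva_bimodule sV VG YV vac sW WG DW YL YR by (rule assms(2))
  have two: "2 + n = n + 2" by simp
  show ?thesis
    unfolding Let_def
    by (intro conjI allI ballI impI[of "length _ = _"] B.W.E_transfer
        B.W.determining_product[of _ 2 n, unfolded two]
        B.W.determining_product_rev[of _ 2 n, unfolded two]
        B.W.determining_product B.W.determining_product_rev B.W.determining_iterate
        B.LR_commute B.left_iterate B.right_iterate assms) auto
qed

end
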